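(* The only noble polyhedra whose symmetry group is prismatic are the stephanoids and the disphenoids. Other than the stephanoids and disphenoids, there are only finitely many noble polyhedra up to canonical equivalence.
   Context: **Polyhedra.** An abstract polyhedron is a poset $P$ with a minimum and a maximum element (the improper elements; all others are proper), such that every maximal chain has exactly $5$ elements (rank 3; in general rank = number of elements in a maximal chain minus 2), every section $\{h: f\le h\le g\}$ of rank 1 has exactly 4 elements, and every other section is connected (any two proper elements of the section are joined by a sequence of proper elements with consecutive ones comparable). Elements of rank 0, 1, 2 are vertices, edges, faces; a face is an abstract polygon. A realization is a map from the vertices to $\mathbb{R}^3$. "Polyhedron" means an abstract polyhedron with a realization that is nondegenerate: it is finite; the realization is injective and no two edges and no two faces have the same vertex set; the vertices of each face are coplanar (their plane is the face plane); two faces sharing an edge never have the same face plane. A symmetry of $\mathcal P$ is a poset automorphism whose induced vertex permutation extends to an isometry of $\mathbb{R}^3$; these form the symmetry group $\Gamma(\mathcal P)$, viewed as a finite group of isometries. $\mathcal P$ is noble if $\Gamma(\mathcal P)$ is transitive on vertices and on faces. The vertices then lie on a sphere, whose centre is placed at the origin. **Groups (orbifold notation).** The prismatic groups, for positive integers $n$, are: $nn$ (rotations about an axis, order $n$); $*nn$ ($nn$ with $n$ mirrors through the axis); $n*$ ($nn$ with the mirror perpendicular to the axis); $n\times$ (cyclic of order $2n$, generated by a rotary reflection through angle $\pi/n$); $22n$ ($nn$ with $n$ perpendicular half-turn axes, order $2n$); $*22n$ ($*nn$ with the perpendicular mirror, order $4n$; the symmetry group of a right regular $n$-prism); $2{*}n$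 ($*nn$ with the rotary reflection through $\pi/n$, order $4n$; the symmetry group of a regular $n$-antiprism). The nonprismatic finite groups are $332,*332,3{*}2,432,*432,532,*532$ (rotational tetrahedral, full tetrahedral, pyritohedral, rotational octahedral, full octahedral, rotational icosahedral, full icosahedral). **Disphenoids.** A disphenoid is a noble tetrahedron with four congruent non-equilateral triangular faces (tetragonal if the faces are isosceles, rhombic if scalene). **Stephanoids.** For a planar polygon $F$ and a group $G$, $G(F)=\{g(F):g\in G\}$; it is called a polyhedron if it is the set of faces of a polyhedron. Let $a_1,\dots,a_n$ (counterclockwise) and $b_1,\dots,b_n$, with $b_i$ directly below $a_i$, be the vertices of a right regular $n$-prism of arbitrary height. For positive integers $n,p,q$ with $2p-n<2q<p<n$, $\operatorname{PC}(n,p,q)$ is $G(F)$ for $G=*22n$ (symmetry group of the prism) and $F$ the quadrilateral $a_1,b_{1+q},a_{1+p},b_{1+p-q}$ in this cyclic order. Let $a_1,\dots,a_{2n}$ be the vertices of a regular $n$-antiprism of arbitrary height listed counterclockwise about the axis (alternating between the two bases). For positive integers $n,p,q$ with $q$ odd and $2p-n<q<p<n$, $\operatorname{AC}(n,p,q)$ is $G(F)$ for $G=2{*}n$ and $F$ the quadrilateral $a_1,a_{1+q},a_{1+2p},a_{1+2p-q}$ (indices modulo $n$, respectively $2n$). A stephanoid is a prismatic noble polyhedron of the form $\operatorname{PC}(n,p,q)$ or $\operatorname{AC}(n,p,q)$. **Orbit types and canonical equivalence.** Let $G$ be one of the reflection groups $*332$, $*432$, $*532$, generated by three reflections $r_1,r_2,r_3$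 whose mirrors bound a fundamental domain: for $*332$, mirrors $x=y$, $x=-y$, $y=z$; for $*432$, mirrors $x=0$, $x=y$, $y=z$; for $*532$, mirrors $x=0$, $y=0$, $\phi x+y-\phi^{-1}z=0$ with $\phi=(1+\sqrt5)/2$. Let $u_i$ be the vector in the closed fundamental domain lying on the two mirrors other than that of $r_i$, at distance 1 from the mirror of $r_i$. For $N$ one of the nonprismatic groups, taken as a normal subgroup of $G$ ($332,*332$ in $*332$; $3{*}2,432,*432$ in $*432$; $532,*532$ in $*532$), let $V_N(a,b,c)$ be the $N$-orbit of the generating point $au_1+bu_2+cu_3$. The (nonprismatic) orbit types are the families $V_N(a,b,1)$, $V_N(0,a,1)$, $V_N(a,0,1)$, $V_N(a,1,0)$, $V_N(0,0,1)$, $V_N(0,1,0)$, $V_N(1,0,0)$, with $a,b$ ranging over the positive reals, identical families being identified. For members $V,U$ of one orbit type with generating points $p_V,p_U$, the canonical mapping $f:V\to U$ is the unique map with $f(g(p_V))=g(p_U)$ for all $g$ in a point group acting transitively on all members of the type. Two noble polyhedra are identified up to the canonical mapping (canonically equivalent) if, after similarities, their vertex sets are members of a common orbit type and the canonical mapping between the vertex sets carries the vertices, edges and faces of one onto those of the other; canonical equivalence is the equivalence relation generated by this. *)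

theory Defs
  imports
    "HOL-Analysis.Analysis"
    "HOL-Algebra.Bij"
    "HOL-Algebra.Generated_Groups"
begin

section \<open>Abstract polyhedra\<close>

text \<open>
  A poset is given by its reflexive order relation \<open>r\<close>; its elements are those of \<open>Field r\<close>.
  Rank \<open>k\<close> is a relation, so that nothing is presupposed about maximal chains having equal length.
\<close>

definition has_rank :: "'a rel \<Rightarrow> int \<Rightarrow> bool" where
  "has_rank r k \<longleftrightarrow>
     (\<forall>C. pred_on.maxchain (Field r) (\<lambda>x y. (x, y) \<in> r) C \<longrightarrow> finite C \<and> int (card C) = k + 2)"

definition interval_of :: "'a rel \<Rightarrow> 'a \<Rightarrow> 'a \<Rightarrow> 'a rel" where
  "interval_of r f g = Restr r (above r f \<inter> under r g)"

definition connected_interval :: "'a rel \<Rightarrow> 'a \<Rightarrow> 'a \<Rightarrow> bool" where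
  "connected_interval r f g \<longleftrightarrow>
     (let X = Field (interval_of r f g) - {f, g}
      in \<forall>x\<in>X. \<forall>y\<in>X. (x, y) \<in> (Restr (r \<union> r\<inverse>) X)\<^sup>*)"

definition abstract_polyhedron :: "'a rel \<Rightarrow> bool" where
  "abstract_polyhedron r \<longleftrightarrow>
     Partial_order r \<and>
     (\<exists>l\<in>Field r. \<forall>x\<in>Field r. (l, x) \<in> r) \<and>
     (\<exists>m\<in>Field r. \<forall>x\<in>Field r. (x, m) \<in> r) \<and>
     has_rank r 3 \<and>
     (\<forall>(f, g)\<in>r.
        if has_rank (interval_of r f g) 1
        then card (Field (interval_of r f g)) = 4
        else connected_interval r f g)"

text \<open>The rank of an element \<open>x\<close> is the rank of the section from the minimum to \<open>x\<close>.\<close>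

definition elements_of_rank :: "'a rel \<Rightarrow> int \<Rightarrow> 'a set" where
  "elements_of_rank r k = {x \<in> Field r. has_rank (Restr r (under r x)) k}"

abbreviation vertices :: "'a rel \<Rightarrow> 'a set" where "vertices r \<equiv> elements_of_rank r 0"
abbreviation edges :: "'a rel \<Rightarrow> 'a set" where "edges r \<equiv> elements_of_rank r 1"
abbreviation faces :: "'a rel \<Rightarrow> 'a set" where "faces r \<equiv> elements_of_rank r 2"

definition vertex_set :: "'a rel \<Rightarrow> 'a \<Rightarrow> 'a set" where
  "vertex_set r x = {v \<in> vertices r. (v, x) \<in> r}"

section \<open>Realizations, symmetries and noble polyhedra\<close>

text \<open>Only the values of \<open>pos\<close> at the vertices are meaningful.\<close>

datatype 'a realized = Realized (incidence: "'a rel") (pos: "'a \<Rightarrow> real^3")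

definition points_of :: "'a realized \<Rightarrow> 'a \<Rightarrow> (real^3) set" where
  "points_of P x = pos P ` vertex_set (incidence P) x"

text \<open>
  The face plane is the affine hull of the vertices of the face; for this to be a plane the
  vertices are required to be coplanar but not collinear.
\<close>

definition nondegenerate :: "'a realized \<Rightarrow> bool" where
  "nondegenerate P \<longleftrightarrow>
     (let r = incidence P in
      finite (Field r) \<and>
      inj_on (pos P) (vertices r) \<and>
      inj_on (vertex_set r) (edges r) \<and>
      inj_on (vertex_set r) (faces r) \<and>
      (\<forall>f\<in>faces r. aff_dim (points_of P f) = 2) \<and>
      (\<forall>f\<in>faces r. \<forall>g\<in>faces r. \<forall>e\<in>edges r.
         f \<noteq> g \<and> (e, f) \<in> r \<and> (e, g) \<in> r \<longrightarrow>
         affine hull (points_of P f) \<noteq> affine hull (points_of P g)))"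

definition is_polyhedron :: "'a realized \<Rightarrow> bool" where
  "is_polyhedron P \<longleftrightarrow> abstract_polyhedron (incidence P) \<and> nondegenerate P"

definition isometry :: "(real^3 \<Rightarrow> real^3) \<Rightarrow> bool" where
  "isometry h \<longleftrightarrow> (\<forall>x y. dist (h x) (h y) = dist x y)"

definition similarity :: "(real^3 \<Rightarrow> real^3) \<Rightarrow> bool" where
  "similarity h \<longleftrightarrow> (\<exists>c>0. \<forall>x y. dist (h x) (h y) = c * dist x y)"

definition poset_automorphism :: "'a rel \<Rightarrow> ('a \<Rightarrow> 'a) \<Rightarrow> bool" where
  "poset_automorphism r \<phi> \<longleftrightarrow>
     bij_betw \<phi> (Field r) (Field r) \<and>
     (\<forall>x\<in>Field r. \<forall>y\<in>Field r. (\<phi> x, \<phi> y) \<in> r \<longleftrightarrow> (x, y) \<in> r)"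

definition induced_by :: "'a realized \<Rightarrow> ('a \<Rightarrow> 'a) \<Rightarrow> (real^3 \<Rightarrow> real^3) \<Rightarrow> bool" where
  "induced_by P \<phi> h \<longleftrightarrow> isometry h \<and> (\<forall>v\<in>vertices (incidence P). pos P (\<phi> v) = h (pos P v))"

definition symmetry :: "'a realized \<Rightarrow> ('a \<Rightarrow> 'a) \<Rightarrow> bool" where
  "symmetry P \<phi> \<longleftrightarrow> poset_automorphism (incidence P) \<phi> \<and> (\<exists>h. induced_by P \<phi> h)"

definition symmetry_group :: "'a realized \<Rightarrow> (real^3 \<Rightarrow> real^3) set" where
  "symmetry_group P = {h. \<exists>\<phi>. poset_automorphism (incidence P) \<phi> \<and> induced_by P \<phi> h}"

definition noble :: "'a realized \<Rightarrow> bool" where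
  "noble P \<longleftrightarrow>
     is_polyhedron P \<and>
     (\<forall>v\<in>vertices (incidence P). \<forall>w\<in>vertices (incidence P). \<exists>\<phi>. symmetry P \<phi> \<and> \<phi> v = w) \<and>
     (\<forall>f\<in>faces (incidence P). \<forall>g\<in>faces (incidence P). \<exists>\<phi>. symmetry P \<phi> \<and> \<phi> f = g)"

text \<open>
  The geometric vertices, edges and faces. An edge is the set of its endpoints; a face is a
  (possibly self-intersecting) polygon, recorded as the set of its edges, because the vertex
  set alone does not determine the order in which the vertices are joined.
\<close>

definition geom_vertices :: "'a realized \<Rightarrow> (real^3) set" where
  "geom_vertices P = pos P ` vertices (incidence P)"

definition geom_edges :: "'a realized \<Rightarrow> (real^3) set set" where
  "geom_edges P = points_of P ` edges (incidence P)"

definition geom_faces :: "'a realized \<Rightarrow> (real^3) set set set" where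
  "geom_faces P =
     (\<lambda>f. points_of P ` {e \<in> edges (incidence P). (e, f) \<in> incidence P}) ` faces (incidence P)"

section \<open>Prismatic groups\<close>

definition generated_by :: "(real^3 \<Rightarrow> real^3) set \<Rightarrow> (real^3 \<Rightarrow> real^3) set" where
  "generated_by S = generate (BijGroup UNIV) S"

definition rot_z :: "real \<Rightarrow> real^3 \<Rightarrow> real^3" where
  "rot_z t v = vector [cos t * v$1 - sin t * v$2, sin t * v$1 + cos t * v$2, v$3]"

definition axial_mirror :: "real^3 \<Rightarrow> real^3" where
  "axial_mirror v = vector [v$1, - v$2, v$3]"

definition perp_mirror :: "real^3 \<Rightarrow> real^3" where
  "perp_mirror v = vector [v$1, v$2, - v$3]"

definition perp_half_turn :: "real^3 \<Rightarrow> real^3" where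
  "perp_half_turn v = vector [v$1, - v$2, - v$3]"

text \<open>
  The orbifold symbols \<open>nn\<close>, \<open>*nn\<close>, \<open>n*\<close>, \<open>n\<times>\<close>, \<open>22n\<close>, \<open>*22n\<close>, \<open>2*n\<close>, in this order; the
  main axis is the third coordinate axis.
\<close>

definition grp_nn :: "nat \<Rightarrow> (real^3 \<Rightarrow> real^3) set" where
  "grp_nn n = generated_by {rot_z (2 * pi / real n)}"

definition grp_star_nn :: "nat \<Rightarrow> (real^3 \<Rightarrow> real^3) set" where
  "grp_star_nn n = generated_by {rot_z (2 * pi / real n), axial_mirror}"

definition grp_n_star :: "nat \<Rightarrow> (real^3 \<Rightarrow> real^3) set" where
  "grp_n_star n = generated_by {rot_z (2 * pi / real n), perp_mirror}"

definition grp_n_cross :: "nat \<Rightarrow> (real^3 \<Rightarrow> real^3) set" where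
  "grp_n_cross n = generated_by {perp_mirror \<circ> rot_z (pi / real n)}"

definition grp_22n :: "nat \<Rightarrow> (real^3 \<Rightarrow> real^3) set" where
  "grp_22n n = generated_by {rot_z (2 * pi / real n), perp_half_turn}"

definition grp_star_22n :: "nat \<Rightarrow> (real^3 \<Rightarrow> real^3) set" where
  "grp_star_22n n = generated_by {rot_z (2 * pi / real n), axial_mirror, perp_mirror}"

definition grp_2_star_n :: "nat \<Rightarrow> (real^3 \<Rightarrow> real^3) set" where
  "grp_2_star_n n =
     generated_by {rot_z (2 * pi / real n), axial_mirror, perp_mirror \<circ> rot_z (pi / real n)}"

text \<open>
  A symmetry group is prismatic if some isometry \<open>s\<close> (which moves the centre to the origin)
  conjugates it to one of the groups above; \<^term>\<open>s \<circ> h = g \<circ> s\<close> says \<open>h = s\<^sup>-\<^sup>1 g s\<close>.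
\<close>

definition prismatic :: "'a realized \<Rightarrow> bool" where
  "prismatic P \<longleftrightarrow>
     (\<exists>n\<ge>1. \<exists>G \<in> {grp_nn n, grp_star_nn n, grp_n_star n, grp_n_cross n,
                    grp_22n n, grp_star_22n n, grp_2_star_n n}.
      \<exists>s. isometry s \<and> symmetry_group P = {h. \<exists>g\<in>G. s \<circ> h = g \<circ> s})"

section \<open>Disphenoids and stephanoids\<close>

definition equilateral :: "(real^3) set \<Rightarrow> bool" where
  "equilateral T \<longleftrightarrow> (\<exists>d. \<forall>x\<in>T. \<forall>y\<in>T. x \<noteq> y \<longrightarrow> dist x y = d)"

definition disphenoid :: "'a realized \<Rightarrow> bool" where
  "disphenoid P \<longleftrightarrow>
     (let F = faces (incidence P) in
      noble P \<and>
      card (vertices (incidence P)) = 4 \<and> card F = 4 \<and>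
      (\<forall>f\<in>F. card (points_of P f) = 3 \<and> \<not> equilateral (points_of P f)) \<and>
      (\<forall>f\<in>F. \<forall>g\<in>F. \<exists>h. isometry h \<and> h ` points_of P f = points_of P g))"

definition polygon :: "(real^3) list \<Rightarrow> (real^3) set set" where
  "polygon xs = {{xs ! i, xs ! ((i + 1) mod length xs)} |i. i < length xs}"

definition polygon_orbit ::
  "(real^3 \<Rightarrow> real^3) set \<Rightarrow> (real^3) set set \<Rightarrow> (real^3) set set set" where
  "polygon_orbit G F = (\<lambda>g. (`) g ` F) ` G"

text \<open>
  Vertices of a right regular \<open>n\<close>-prism of circumradius \<open>\<rho>\<close> and height \<open>2 * h\<close>, and of a regular
  \<open>n\<close>-antiprism likewise. The periodicity of sine and cosine takes care of the indices being
  read modulo \<open>n\<close> and \<open>2 * n\<close> respectively.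
\<close>

definition prism_a :: "nat \<Rightarrow> real \<Rightarrow> real \<Rightarrow> nat \<Rightarrow> real^3" where
  "prism_a n \<rho> h i = vector [\<rho> * cos (2 * pi * real i / real n), \<rho> * sin (2 * pi * real i / real n), h]"

definition prism_b :: "nat \<Rightarrow> real \<Rightarrow> real \<Rightarrow> nat \<Rightarrow> real^3" where
  "prism_b n \<rho> h i = perp_mirror (prism_a n \<rho> h i)"

definition antiprism_a :: "nat \<Rightarrow> real \<Rightarrow> real \<Rightarrow> nat \<Rightarrow> real^3" where
  "antiprism_a n \<rho> h i =
     vector [\<rho> * cos (pi * real i / real n), \<rho> * sin (pi * real i / real n), (-1) ^ i * h]"

definition PC :: "nat \<Rightarrow> nat \<Rightarrow> nat \<Rightarrow> real \<Rightarrow> real \<Rightarrow> (real^3) set set set" where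
  "PC n p q \<rho> h =
     polygon_orbit (grp_star_22n n)
       (polygon [prism_a n \<rho> h 1, prism_b n \<rho> h (1 + q),
                 prism_a n \<rho> h (1 + p), prism_b n \<rho> h (1 + p - q)])"

definition AC :: "nat \<Rightarrow> nat \<Rightarrow> nat \<Rightarrow> real \<Rightarrow> real \<Rightarrow> (real^3) set set set" where
  "AC n p q \<rho> h =
     polygon_orbit (grp_2_star_n n)
       (polygon [antiprism_a n \<rho> h 1, antiprism_a n \<rho> h (1 + q),
                 antiprism_a n \<rho> h (1 + 2 * p), antiprism_a n \<rho> h (1 + 2 * p - q)])"

definition PC_params :: "nat \<Rightarrow> nat \<Rightarrow> nat \<Rightarrow> bool" where
  "PC_params n p q \<longleftrightarrow>
     0 < n \<and> 0 < p \<and> 0 < q \<and>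
     2 * int p - int n < 2 * int q \<and> 2 * q < p \<and> p < n"

definition AC_params :: "nat \<Rightarrow> nat \<Rightarrow> nat \<Rightarrow> bool" where
  "AC_params n p q \<longleftrightarrow>
     0 < n \<and> 0 < p \<and> 0 < q \<and> odd q \<and>
     2 * int p - int n < int q \<and> q < p \<and> p < n"

text \<open>The isometry \<open>s\<close> allows the prism or antiprism to be placed anywhere in space.\<close>

definition stephanoid :: "'a realized \<Rightarrow> bool" where
  "stephanoid P \<longleftrightarrow>
     noble P \<and> prismatic P \<and>
     (\<exists>n p q \<rho> h s. \<rho> > 0 \<and> h > 0 \<and> isometry s \<and>
        (PC_params n p q \<and> geom_faces P = (`) ((`) s) ` PC n p q \<rho> h \<or>
         AC_params n p q \<and> geom_faces P = (`) ((`) s) ` AC n p q \<rho> h))"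

section \<open>Orbit types and canonical equivalence\<close>

text \<open>
  The \<open>i\<close>-th row of \<open>M\<close> is a normal vector of the mirror of the \<open>i\<close>-th reflection, with its
  sign chosen so that the closed fundamental domain is \<open>{x. \<forall>i. 0 \<le> M$i \<bullet> x}\<close>.
\<close>

definition reflection :: "real^3 \<Rightarrow> real^3 \<Rightarrow> real^3" where
  "reflection n x = x - (2 * (n \<bullet> x) / (n \<bullet> n)) *\<^sub>R n"

definition mirror :: "real^3^3 \<Rightarrow> 3 \<Rightarrow> (real^3) set" where
  "mirror M i = {x. M$i \<bullet> x = 0}"

definition fundamental_domain :: "real^3^3 \<Rightarrow> (real^3) set" where
  "fundamental_domain M = {x. \<forall>i. 0 \<le> M$i \<bullet> x}"

definition reflection_group :: "real^3^3 \<Rightarrow> (real^3 \<Rightarrow> real^3) set" where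
  "reflection_group M = generated_by (range (\<lambda>i. reflection (M$i)))"

definition rotation_subgroup :: "real^3^3 \<Rightarrow> (real^3 \<Rightarrow> real^3) set" where
  "rotation_subgroup M = {g \<in> reflection_group M. det (matrix g) = 1}"

text \<open>
  The mirrors for \<open>*332\<close> (\<open>x = y\<close>, \<open>x = -y\<close>, \<open>y = z\<close>), for \<open>*432\<close> (\<open>x = 0\<close>, \<open>x = y\<close>, \<open>y = z\<close>)
  and for \<open>*532\<close> (\<open>x = 0\<close>, \<open>y = 0\<close>, \<open>\<phi> x + y - z / \<phi> = 0\<close>). The fundamental domains are
  \<open>\<bar>x\<bar> \<le> y \<le> z\<close>, \<open>0 \<le> x \<le> y \<le> z\<close> and \<open>0 \<le> x \<and> 0 \<le> y \<and> \<phi> x + y \<le> z / \<phi>\<close>; in each case the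
  only other chamber bounded by the same three mirrors is the opposite one.
\<close>

definition golden :: real where
  "golden = (1 + sqrt 5) / 2"

definition mirrors_332 :: "real^3^3" where
  "mirrors_332 = vector [vector [-1, 1, 0], vector [1, 1, 0], vector [0, -1, 1]]"

definition mirrors_432 :: "real^3^3" where
  "mirrors_432 = vector [vector [1, 0, 0], vector [-1, 1, 0], vector [0, -1, 1]]"

definition mirrors_532 :: "real^3^3" where
  "mirrors_532 = vector [vector [1, 0, 0], vector [0, 1, 0], vector [- golden, -1, 1 / golden]]"

text \<open>\<open>3*2\<close> is generated by \<open>332\<close> and the central inversion.\<close>

definition pyritohedral_group :: "(real^3 \<Rightarrow> real^3) set" where
  "pyritohedral_group =
     rotation_subgroup mirrors_332 \<union> (\<lambda>g x. - g x) ` rotation_subgroup mirrors_332"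

text \<open>Each nonprismatic group \<open>N\<close>, paired with the mirrors of the reflection group containing it.\<close>

definition nonprismatic_groups :: "((real^3^3) \<times> (real^3 \<Rightarrow> real^3) set) set" where
  "nonprismatic_groups =
     {(mirrors_332, rotation_subgroup mirrors_332),
      (mirrors_332, reflection_group mirrors_332),
      (mirrors_432, pyritohedral_group),
      (mirrors_432, rotation_subgroup mirrors_432),
      (mirrors_432, reflection_group mirrors_432),
      (mirrors_532, rotation_subgroup mirrors_532),
      (mirrors_532, reflection_group mirrors_532)}"

definition basis_vec :: "real^3^3 \<Rightarrow> 3 \<Rightarrow> real^3" where
  "basis_vec M i =
     (THE v. v \<in> fundamental_domain M \<and> (\<forall>j. j \<noteq> i \<longrightarrow> v \<in> mirror M j) \<and>
             infdist v (mirror M i) = 1)"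

definition generating_point :: "real^3^3 \<Rightarrow> real^3 \<Rightarrow> real^3" where
  "generating_point M c = (\<Sum>i\<in>UNIV. c$i *\<^sub>R basis_vec M i)"

definition vertex_orbit :: "real^3^3 \<Rightarrow> (real^3 \<Rightarrow> real^3) set \<Rightarrow> real^3 \<Rightarrow> (real^3) set" where
  "vertex_orbit M N c = (\<lambda>g. g (generating_point M c)) ` N"

definition coefficient_families :: "(real^3) set set" where
  "coefficient_families =
     {{vector [a, b, 1] |a b. 0 < a \<and> 0 < b},
      {vector [0, a, 1] |a. 0 < a},
      {vector [a, 0, 1] |a. 0 < a},
      {vector [a, 1, 0] |a. 0 < a},
      {vector [0, 0, 1]},
      {vector [0, 1, 0]},
      {vector [1, 0, 0]}}"

definition orbit_types :: "(real^3) set set set" where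
  "orbit_types =
     {vertex_orbit M N ` C |M N C. (M, N) \<in> nonprismatic_groups \<and> C \<in> coefficient_families}"

text \<open>
  Since a family may arise from several groups \<open>N\<close>, the group transitive on its members is
  quantified existentially. The map is pinned down only on \<open>V\<close>.
\<close>

definition canonical_mapping ::
  "(real^3) set set \<Rightarrow> (real^3) set \<Rightarrow> (real^3) set \<Rightarrow> (real^3 \<Rightarrow> real^3) \<Rightarrow> bool" where
  "canonical_mapping T V U f \<longleftrightarrow>
     (\<exists>M N C. (M, N) \<in> nonprismatic_groups \<and> C \<in> coefficient_families \<and>
        T = vertex_orbit M N ` C \<and>
        (\<exists>c\<in>C. \<exists>d\<in>C. V = vertex_orbit M N c \<and> U = vertex_orbit M N d \<and>
           (\<forall>g\<in>N. f (g (generating_point M c)) = g (generating_point M d))))"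

definition transform :: "(real^3 \<Rightarrow> real^3) \<Rightarrow> 'a realized \<Rightarrow> 'a realized" where
  "transform s P = Realized (incidence P) (s \<circ> pos P)"

definition canonically_related :: "'a realized \<Rightarrow> 'a realized \<Rightarrow> bool" where
  "canonically_related P Q \<longleftrightarrow>
     noble P \<and> noble Q \<and>
     (\<exists>s t T f. similarity s \<and> similarity t \<and> T \<in> orbit_types \<and>
        (let P' = transform s P; Q' = transform t Q in
         geom_vertices P' \<in> T \<and> geom_vertices Q' \<in> T \<and>
         canonical_mapping T (geom_vertices P') (geom_vertices Q') f \<and>
         f ` geom_vertices P' = geom_vertices Q' \<and>
         (`) f ` geom_edges P' = geom_edges Q' \<and>
         (`) ((`) f) ` geom_faces P' = geom_faces Q'))"

definition canonical_equivalence :: "('a realized \<times> 'a realized) set" where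
  "canonical_equivalence = {(P, Q). equivclp canonically_related P Q}"

end

theory Submission
  imports Defs "HOL-Algebra.Multiplicative_Group"
begin

text \<open>
  The symmetries of a noble polyhedron \<open>P\<close> permute its finitely many vertices, so they fix the
  centroid; after a translation the symmetry group \<open>\<Gamma>\<close> is a finite group of orthogonal maps.
  Counting the poles of its rotations in two ways (\<open>pole_count\<close>, \<open>orbit_sizes\<close>) leaves few
  possibilities: either \<open>\<Gamma>\<close> preserves a line, or an orbit of poles is a regular tetrahedron,
  octahedron or icosahedron, whose coordinates identify \<open>\<Gamma>\<close> with one of the seven nonprismatic
  groups (\<open>axial_or_nonprismatic\<close>). The two halves of the theorem deal with these two cases.

  \<^emph>\<open>An axis.\<close> In cylindrical coordinates a symmetry multiplies the height by \<open>a = \<plusminus>1\<close> and takes the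
  angle \<open>t\<close> to \<open>b * t + \<tau>\<close> with \<open>b = \<plusminus>1\<close>. By transitivity the vertices lie on two circles of equal
  radius at heights \<open>\<plusminus>h\<close>. A face plane meets these in two parallel chords, so a face is a triangle
  or a quadrilateral, and all faces have the same chords up to symmetry. Since the two faces at an edge
  lie in different planes, an edge within one circle must be a diameter
  (\<open>triangle_base_diameter\<close>, \<open>horizontal_edge_diameter\<close>). For triangles this makes \<open>P\<close> a
  tetrahedron with two opposite edges perpendicular to the axis, which is a disphenoid: were it regular,
  it would have a symmetry moving the axis (\<open>not_equilateral\<close>). For quadrilaterals it leaves only faces
  whose edges all join the two circles. With half-angles \<open>\<alpha> > \<gamma>\<close> of the chords, the face behind an edge
  arises from the given one by exchanging the circles and turning through \<open>\<plusminus>\<alpha> \<plusminus> \<gamma>\<close>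
  (\<open>neighbour\<close>). As \<open>P\<close> is finite and connected, the angles occurring are multiples of \<open>\<pi> / n\<close>
  for some \<open>n\<close>, and all faces are determined by one of them; depending on a parity they are those of
  a stephanoid on a prism or on an antiprism (\<open>quad_stephanoid\<close>).

  \<^emph>\<open>No axis.\<close> Some image of a vertex under the reflection group containing \<open>\<Gamma>\<close> lies in the fundamental
  domain, and after scaling it is a generating point, so the vertex set is a member of an orbit type
  (\<open>normal_form_exists\<close>). Pulled back to the finite group \<open>\<Gamma>\<close>, the edges and faces become sets
  of subsets of \<open>\<Gamma>\<close>, for which there are finitely many possibilities; polyhedra with the same
  data correspond under the canonical mapping (\<open>same_code_related\<close>).

  A disphenoid is never of the second kind: each nonprismatic group has an element of order three, which
  would rotate one of the four faces, making it equilateral (\<open>disphenoid_no_order_3\<close>).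
\<close>

type_synonym space_map = "real^3 \<Rightarrow> real^3"
abbreviation orth :: "('a::real_inner \<Rightarrow> 'a) \<Rightarrow> bool" where "orth \<equiv> orthogonal_transformation"
lemmas orth_linear = orthogonal_transformation_linear
lemmas orth_inj = orthogonal_transformation_inj
lemmas orth_def = orthogonal_transformation_def
lemmas orth_bij = orthogonal_transformation_bij
lemmas orth_compose = orthogonal_transformation_compose
abbreviation "prismatic_groups n \<equiv> {grp_nn n, grp_star_nn n, grp_n_star n, grp_n_cross n, grp_22n n, grp_star_22n n, grp_2_star_n n}"
abbreviation "coxeter_mirrors \<equiv> {mirrors_332, mirrors_432, mirrors_532}"
abbreviation ginv :: "('a \<Rightarrow> 'b) \<Rightarrow> 'b \<Rightarrow> 'a" where "ginv \<equiv> inv_into UNIV"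

section \<open>Rank and incidence in abstract polyhedra\<close>

definition chain_in :: "'a rel \<Rightarrow> 'a set \<Rightarrow> 'a set \<Rightarrow> bool" where
  "chain_in r A C \<longleftrightarrow> C \<subseteq> A \<and> (\<forall>x\<in>C. \<forall>y\<in>C. (x, y) \<in> r \<or> (y, x) \<in> r)"

definition maxchain_in :: "'a rel \<Rightarrow> 'a set \<Rightarrow> 'a set \<Rightarrow> bool" where
  "maxchain_in r A C \<longleftrightarrow> chain_in r A C \<and> (\<forall>x\<in>A. chain_in r A (insert x C) \<longrightarrow> x \<in> C)"

lemma maxchain_iff:
  assumes "Refl r" "A \<subseteq> Field r"
  shows "pred_on.maxchain (Field (Restr r A)) (\<lambda>x y. (x, y) \<in> Restr r A) C \<longleftrightarrow> maxchain_in r A C"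
proof -
  have F: "Field (Restr r A) = A" using assms by (auto simp: Field_def refl_on_def)
  have ch: "pred_on.chain A (\<lambda>x y. (x, y) \<in> Restr r A) D \<longleftrightarrow> chain_in r A D" for D
    unfolding pred_on.chain_def chain_in_def using assms unfolding refl_on_def by blast
  have sub: "chain_in r A D" if "chain_in r A E" "D \<subseteq> E" for D E
    using that unfolding chain_in_def by blast
  show ?thesis unfolding pred_on.maxchain_def F ch maxchain_in_def
  proof (intro conj_cong refl iffI ballI impI)
    fix x assume "\<nexists>S. chain_in r A S \<and> C \<subset> S" "x \<in> A" "chain_in r A (insert x C)"
    thus "x \<in> C" by blast
  next
    assume *: "\<forall>x\<in>A. chain_in r A (insert x C) \<longrightarrow> x \<in> C"
    show "\<nexists>S. chain_in r A S \<and> C \<subset> S"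
    proof
      assume "\<exists>S. chain_in r A S \<and> C \<subset> S"
      then obtain S x where S: "chain_in r A S" "C \<subset> S" "x \<in> S" "x \<notin> C" by blast
      hence "chain_in r A (insert x C)" "x \<in> A"
        using sub[OF S(1), of "insert x C"] by (auto simp: chain_in_def)
      with * S show False by blast
    qed
  qed
qed

lemma has_rank_iff:
  assumes "Refl r" "A \<subseteq> Field r"
  shows "has_rank (Restr r A) k \<longleftrightarrow> (\<forall>C. maxchain_in r A C \<longrightarrow> finite C \<and> int (card C) = k + 2)"
  unfolding has_rank_def maxchain_iff[OF assms] ..

lemma maxchain_exists:
  assumes "finite A" shows "\<exists>C. maxchain_in r A C"
proof -
  have "finite {C. chain_in r A C}"
    by (rule finite_subset[of _ "Pow A"]) (auto simp: chain_in_def assms)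
  moreover have "{} \<in> {C. chain_in r A C}" by (auto simp: chain_in_def)
  ultimately obtain C where C: "chain_in r A C" "\<forall>D. chain_in r A D \<and> C \<subseteq> D \<longrightarrow> C = D"
    using finite_has_maximal[of "{C. chain_in r A C}"] by (metis empty_iff mem_Collect_eq)
  thus ?thesis unfolding maxchain_in_def by (metis insertI1 subset_insertI)
qed

locale polyhedral_poset =
  fixes r :: "'a rel"
  assumes polyhedron: "abstract_polyhedron r" and fin: "finite (Field r)"
begin

lemma refl: "Refl r" and trans: "trans r" and antisym: "antisym r"
  using polyhedron unfolding abstract_polyhedron_def partial_order_on_def preorder_on_def by auto

lemma r_refl: "x \<in> Field r \<Longrightarrow> (x, x) \<in> r" using refl by (auto simp: refl_on_def)
lemma r_trans: "(x, y) \<in> r \<Longrightarrow> (y, z) \<in> r \<Longrightarrow> (x, z) \<in> r" using trans by (auto simp: trans_def)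
lemma r_antisym: "(x, y) \<in> r \<Longrightarrow> (y, x) \<in> r \<Longrightarrow> x = y" using antisym by (auto simp: antisym_def)
lemma r_Field: "(x, y) \<in> r \<Longrightarrow> x \<in> Field r \<and> y \<in> Field r" by (auto simp: Field_def)

definition bottom :: 'a where "bottom = (SOME l. l \<in> Field r \<and> (\<forall>x\<in>Field r. (l, x) \<in> r))"
definition top :: 'a where "top = (SOME l. l \<in> Field r \<and> (\<forall>x\<in>Field r. (x, l) \<in> r))"

lemma bottom: "bottom \<in> Field r" "x \<in> Field r \<Longrightarrow> (bottom, x) \<in> r"
proof -
  have "\<exists>l. l \<in> Field r \<and> (\<forall>x\<in>Field r. (l, x) \<in> r)"
    using polyhedron unfolding abstract_polyhedron_def by blast
  from someI_ex[OF this] show "bottom \<in> Field r" "x \<in> Field r \<Longrightarrow> (bottom, x) \<in> r"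
    unfolding bottom_def by auto
qed

lemma top: "top \<in> Field r" "x \<in> Field r \<Longrightarrow> (x, top) \<in> r"
proof -
  have "\<exists>l. l \<in> Field r \<and> (\<forall>x\<in>Field r. (x, l) \<in> r)"
    using polyhedron unfolding abstract_polyhedron_def by blast
  from someI_ex[OF this] show "top \<in> Field r" "x \<in> Field r \<Longrightarrow> (x, top) \<in> r" unfolding top_def by auto
qed

definition sect :: "'a \<Rightarrow> 'a \<Rightarrow> 'a set" where "sect a b = {x. (a, x) \<in> r \<and> (x, b) \<in> r}"

lemma sect_Field: "sect a b \<subseteq> Field r" by (auto simp: sect_def Field_def)
lemma sect_finite: "finite (sect a b)" using fin sect_Field finite_subset by blast
lemma sect_all: "sect bottom top = Field r" using bottom top sect_Field[of bottom top] by (auto simp: sect_def)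
lemma sect_under: "under r x = sect bottom x"
  using bottom by (auto simp: sect_def under_def Field_def)
lemma interval_of_sect: "interval_of r a b = Restr r (sect a b)"
  unfolding interval_of_def sect_def above_def under_def by (auto simp: Collect_conj_eq)

text \<open>
  An element comparable with all of \<open>C \<union> D\<close> is comparable with \<open>x\<close>,
  hence lies in one of the two sections, where maximality applies.
\<close>
lemma maxchain_glue:
  assumes C: "maxchain_in r (sect a x) C" and D: "maxchain_in r (sect x b) D"
    and ax: "(a, x) \<in> r" and xb: "(x, b) \<in> r"
  shows "maxchain_in r (sect a b) (C \<union> D) \<and> C \<inter> D = {x}"
proof -
  have xF: "(x, x) \<in> r" using ax r_refl r_Field by blast
  have Cx: "\<And>y. y \<in> C \<Longrightarrow> (a, y) \<in> r \<and> (y, x) \<in> r"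
    using C unfolding maxchain_in_def chain_in_def sect_def by blast
  have Dx: "\<And>y. y \<in> D \<Longrightarrow> (x, y) \<in> r \<and> (y, b) \<in> r"
    using D unfolding maxchain_in_def chain_in_def sect_def by blast
  have Cc: "\<And>y z. y \<in> C \<Longrightarrow> z \<in> C \<Longrightarrow> (y, z) \<in> r \<or> (z, y) \<in> r"
    using C unfolding maxchain_in_def chain_in_def by blast
  have Dc: "\<And>y z. y \<in> D \<Longrightarrow> z \<in> D \<Longrightarrow> (y, z) \<in> r \<or> (z, y) \<in> r"
    using D unfolding maxchain_in_def chain_in_def by blast
  have Cm: "y \<in> C" if "(a, y) \<in> r" "(y, x) \<in> r" "\<And>z. z \<in> C \<Longrightarrow> (y, z) \<in> r \<or> (z, y) \<in> r" for y
  proof -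
    have "(y, y) \<in> r" using that r_refl r_Field by blast
    hence "chain_in r (sect a x) (insert y C)"
      using that Cx Cc unfolding chain_in_def sect_def by blast
    thus ?thesis using C that unfolding maxchain_in_def sect_def by blast
  qed
  have Dm: "y \<in> D" if "(x, y) \<in> r" "(y, b) \<in> r" "\<And>z. z \<in> D \<Longrightarrow> (y, z) \<in> r \<or> (z, y) \<in> r" for y
  proof -
    have "(y, y) \<in> r" using that r_refl r_Field by blast
    hence "chain_in r (sect x b) (insert y D)"
      using that Dx Dc unfolding chain_in_def sect_def by blast
    thus ?thesis using D that unfolding maxchain_in_def sect_def by blast
  qed
  have xC: "x \<in> C" using Cm ax xF Cx by blast
  have xD: "x \<in> D" using Dm xb xF Dx by blast
  have ch: "chain_in r (sect a b) (C \<union> D)" unfolding chain_in_def sect_def using Cx Dx Cc Dc ax xb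
    by (smt (verit, best) Un_iff mem_Collect_eq r_trans subsetI)
  have "y \<in> C \<union> D" if y: "y \<in> sect a b" "chain_in r (sect a b) (insert y (C \<union> D))" for y
  proof -
    have cmp: "\<And>z. z \<in> C \<union> D \<Longrightarrow> (y, z) \<in> r \<or> (z, y) \<in> r" using y unfolding chain_in_def by blast
    from cmp[of x] xC consider "(y, x) \<in> r" | "(x, y) \<in> r" by blast
    thus ?thesis
    proof cases
      case 1 thus ?thesis using Cm[of y] cmp y by (auto simp: sect_def)
    next
      case 2 thus ?thesis using Dm[of y] cmp y by (auto simp: sect_def)
    qed
  qed
  moreover have "C \<inter> D = {x}" using xC xD Cx Dx r_antisym by blast
  ultimately show ?thesis using ch unfolding maxchain_in_def by blast
qed

definition len :: "'a \<Rightarrow> 'a \<Rightarrow> nat" where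
  "len a b = card (SOME C. maxchain_in r (sect a b) C) - 1"

lemma maxchain_sect_finite: "maxchain_in r (sect a b) C \<Longrightarrow> finite C"
  using sect_finite finite_subset unfolding maxchain_in_def chain_in_def by blast

lemma maxchain_total_card: "maxchain_in r (Field r) C \<Longrightarrow> card C = 5"
proof -
  assume C: "maxchain_in r (Field r) C"
  have "has_rank (Restr r (Field r)) 3"
    using polyhedron unfolding abstract_polyhedron_def by (simp add: Restr_Field)
  thus ?thesis using C has_rank_iff[OF refl order_refl] by fastforce
qed

lemma card_glue:
  assumes "maxchain_in r (sect a x) C" "maxchain_in r (sect x b) D" "(a, x) \<in> r" "(x, b) \<in> r"
  shows "card (C \<union> D) + 1 = card C + card D"
  using card_Un_Int[of C D] maxchain_glue[OF assms] maxchain_sect_finite assms(1,2) by force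

text \<open>
  All maximal chains of a section have the same length, because completing them by fixed maximal
  chains below and above yields maximal chains of the whole poset, which have five elements.
\<close>
lemma maxchain_card_unique:
  assumes ab: "(a, b) \<in> r" and C: "maxchain_in r (sect a b) C" and D: "maxchain_in r (sect a b) D"
  shows "card C = card D"
proof -
  have F: "(bottom, a) \<in> r" "(b, top) \<in> r" "(bottom, b) \<in> r" using ab bottom top r_Field by blast+
  obtain L where L: "maxchain_in r (sect bottom a) L" using maxchain_exists sect_finite by blast
  obtain U where U: "maxchain_in r (sect b top) U" using maxchain_exists sect_finite by blast
  have "card E + card L + card U = 7" if E: "maxchain_in r (sect a b) E" for E
  proof -
    note g1 = maxchain_glue[OF L E F(1) ab, THEN conjunct1]
    note g2 = maxchain_glue[OF g1 U F(3) F(2), THEN conjunct1]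
    show ?thesis using card_glue[OF L E F(1) ab] card_glue[OF g1 U F(3) F(2)]
        maxchain_total_card[of "L \<union> E \<union> U"] g2 unfolding sect_all by linarith
  qed
  from this[OF C] this[OF D] show ?thesis by linarith
qed

lemma maxchain_contains:
  assumes "maxchain_in r (sect a b) C" "(a, b) \<in> r" shows "a \<in> C" "b \<in> C"
proof -
  have aa: "(a, a) \<in> r" "(b, b) \<in> r" using assms r_refl r_Field by blast+
  have "chain_in r (sect a b) (insert a C)" "chain_in r (sect a b) (insert b C)"
    using assms aa unfolding maxchain_in_def chain_in_def sect_def by blast+
  thus "a \<in> C" "b \<in> C" using assms aa unfolding maxchain_in_def sect_def by auto
qed

lemma maxchain_card:
  assumes "(a, b) \<in> r" "maxchain_in r (sect a b) C" shows "card C = Suc (len a b)"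
proof -
  have D: "maxchain_in r (sect a b) (SOME C. maxchain_in r (sect a b) C)"
    using someI_ex[OF maxchain_exists[OF sect_finite]] .
  have "card C > 0" using maxchain_contains[OF assms(2,1)] maxchain_sect_finite[OF assms(2)]
    by (auto simp: card_gt_0_iff)
  thus ?thesis using maxchain_card_unique[OF assms(1) assms(2) D] unfolding len_def by simp
qed

lemma len_add: assumes "(a, x) \<in> r" "(x, b) \<in> r" shows "len a b = len a x + len x b"
proof -
  obtain C where C: "maxchain_in r (sect a x) C" using maxchain_exists sect_finite by blast
  obtain D where D: "maxchain_in r (sect x b) D" using maxchain_exists sect_finite by blast
  have ab: "(a, b) \<in> r" using assms r_trans by blast
  show ?thesis
    using card_glue[OF C D assms] maxchain_card[OF assms(1) C] maxchain_card[OF assms(2) D]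
      maxchain_card[OF ab maxchain_glue[OF C D assms, THEN conjunct1]] by simp
qed

lemma len_0: assumes "(a, b) \<in> r" "len a b = 0" shows "a = b"
proof -
  obtain C where C: "maxchain_in r (sect a b) C" using maxchain_exists sect_finite by blast
  have "card C = 1" using maxchain_card[OF assms(1) C] assms by simp
  thus ?thesis using maxchain_contains[OF C assms(1)] by (auto simp: card_1_singleton_iff)
qed

lemma len_top: "len bottom top = 4"
proof -
  obtain C where C: "maxchain_in r (sect bottom top) C" using maxchain_exists sect_finite by blast
  thus ?thesis using maxchain_card[OF _ C] maxchain_total_card[of C] bottom top sect_all by simp
qed

lemma has_rank_sect:
  assumes "(a, b) \<in> r" shows "has_rank (Restr r (sect a b)) k \<longleftrightarrow> int (len a b) = k + 1"
proof -
  obtain C where C: "maxchain_in r (sect a b) C" using maxchain_exists sect_finite by blast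
  show ?thesis unfolding has_rank_iff[OF refl sect_Field]
    using maxchain_card[OF assms] C maxchain_sect_finite by fastforce
qed

definition rk :: "'a \<Rightarrow> nat" where "rk x = len bottom x"

lemma rk_len: "(a, b) \<in> r \<Longrightarrow> rk b = rk a + len a b"
  unfolding rk_def using len_add bottom r_Field by metis

lemma rk_mono: "(a, b) \<in> r \<Longrightarrow> rk a \<le> rk b" using rk_len by simp
lemma rk_strict: "(a, b) \<in> r \<Longrightarrow> a \<noteq> b \<Longrightarrow> rk a < rk b" using rk_len len_0 by fastforce
lemma rk_top: "rk top = 4" unfolding rk_def by (rule len_top)
lemma rk_bottom: "rk bottom = 0" using rk_len[OF bottom(2)[OF bottom(1)]] unfolding rk_def by simp
lemma rk_le: "x \<in> Field r \<Longrightarrow> rk x \<le> 4" using rk_mono top rk_top by metis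
lemma rk_eq_0: "x \<in> Field r \<Longrightarrow> rk x = 0 \<longleftrightarrow> x = bottom"
  using rk_strict[OF bottom(2)] rk_bottom by fastforce
lemma rk_eq_4: "x \<in> Field r \<Longrightarrow> rk x = 4 \<longleftrightarrow> x = top" using rk_strict[OF top(2)] rk_top by fastforce

lemma elements_of_rank_iff: "x \<in> elements_of_rank r k \<longleftrightarrow> x \<in> Field r \<and> int (rk x) = k + 1"
  unfolding elements_of_rank_def rk_def sect_under using has_rank_sect bottom by auto

lemma vertices_iff: "x \<in> vertices r \<longleftrightarrow> x \<in> Field r \<and> rk x = 1" by (auto simp: elements_of_rank_iff)
lemma edges_iff: "x \<in> edges r \<longleftrightarrow> x \<in> Field r \<and> rk x = 2" by (auto simp: elements_of_rank_iff)
lemma faces_iff: "x \<in> faces r \<longleftrightarrow> x \<in> Field r \<and> rk x = 3" by (auto simp: elements_of_rank_iff)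

text \<open>
  A maximal chain of the section has an element strictly between the ends; continue in the part that
  contains rank \<open>k\<close>.
\<close>
lemma ex_between:
  assumes "(a, b) \<in> r" "rk a < k" "k < rk b"
  shows "\<exists>x. (a, x) \<in> r \<and> (x, b) \<in> r \<and> rk x = k" using assms
proof (induction "rk b - rk a" arbitrary: a b rule: less_induct)
  case less
  obtain C where C: "maxchain_in r (sect a b) C" using maxchain_exists sect_finite by blast
  have "card C \<ge> 3" using maxchain_card[OF less.prems(1) C] rk_len[OF less.prems(1)] less.prems by linarith
  moreover have "card {a, b} \<le> 2" by (simp add: card_insert_if)
  ultimately have "\<not> C \<subseteq> {a, b}" using card_mono[of "{a,b}" C] by auto
  then obtain x where x: "x \<in> C" "x \<noteq> a" "x \<noteq> b" by blast
  hence ax: "(a, x) \<in> r" "(x, b) \<in> r" using C by (auto simp: maxchain_in_def chain_in_def sect_def)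
  hence lt: "rk a < rk x" "rk x < rk b" using rk_strict x by auto
  consider "rk x = k" | "rk x < k" | "k < rk x" by linarith
  thus ?case
  proof cases
    case 2 then obtain y where "(x, y) \<in> r" "(y, b) \<in> r" "rk y = k"
      using less.hyps[of b x] ax lt less.prems by force
    thus ?thesis using ax r_trans by blast
  next
    case 3 then obtain y where "(a, y) \<in> r" "(y, x) \<in> r" "rk y = k"
      using less.hyps[of x a] ax lt less.prems by force
    thus ?thesis using ax r_trans by blast
  qed (use ax in blast)
qed

text \<open>
  The section from \<open>a\<close> to \<open>b\<close> has rank one, so two of its four elements are
  proper. Applied to the bottom element, to a vertex and to an edge this yields the three counts that
  follow.
\<close>
lemma diamond:
  assumes ab: "(a, b) \<in> r" and rk: "rk b = rk a + 2"
  shows "card {x. (a, x) \<in> r \<and> (x, b) \<in> r \<and> rk x = rk a + 1} = 2"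
proof -
  have len: "len a b = 2" using rk_len[OF ab] rk by simp
  have F: "Field (Restr r (sect a b)) = sect a b"
    using sect_Field[of a b] refl unfolding Field_def refl_on_def by blast
  have "card (sect a b) = 4"
    using polyhedron ab len unfolding abstract_polyhedron_def interval_of_sect
    by (auto simp: has_rank_sect F split: if_splits dest!: bspec[of r])
  moreover have "sect a b = insert a (insert b {x. (a, x) \<in> r \<and> (x, b) \<in> r \<and> rk x = rk a + 1})"
  proof (intro equalityI subsetI)
    fix x assume x: "x \<in> sect a b"
    hence "x = a \<or> x = b \<or> rk a < rk x \<and> rk x < rk b" using rk_strict by (auto simp: sect_def)
    thus "x \<in> insert a (insert b {x. (a, x) \<in> r \<and> (x, b) \<in> r \<and> rk x = rk a + 1})"
      using x rk by (auto simp: sect_def)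
  qed (use ab r_refl r_Field in \<open>auto simp: sect_def\<close>)
  moreover have "a \<noteq> b" using rk by auto
  moreover have "finite {x. (a, x) \<in> r \<and> (x, b) \<in> r \<and> rk x = rk a + 1}"
    using sect_finite[of a b] by (rule finite_subset[rotated]) (auto simp: sect_def)
  ultimately show ?thesis using rk by (auto simp: card_insert_if)
qed

lemma edge_vertices_card: "e \<in> edges r \<Longrightarrow> card (vertex_set r e) = 2"
proof -
  assume e: "e \<in> edges r"
  have "vertex_set r e = {x. (bottom, x) \<in> r \<and> (x, e) \<in> r \<and> rk x = rk bottom + 1}"
    unfolding vertex_set_def using vertices_iff bottom rk_bottom r_Field by auto
  thus ?thesis using diamond[of bottom e] e bottom rk_bottom edges_iff by simp
qed

lemma edge_faces_card: "e \<in> edges r \<Longrightarrow> card {f \<in> faces r. (e, f) \<in> r} = 2"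
proof -
  assume e: "e \<in> edges r"
  have "{f \<in> faces r. (e, f) \<in> r} = {x. (e, x) \<in> r \<and> (x, top) \<in> r \<and> rk x = rk e + 1}"
    using faces_iff top rk_top r_Field e edges_iff by auto
  thus ?thesis using diamond[of e top] e top rk_top edges_iff by simp
qed

lemma vertex_face_edges_card:
  assumes "v \<in> vertices r" "f \<in> faces r" "(v, f) \<in> r"
  shows "card {e \<in> edges r. (v, e) \<in> r \<and> (e, f) \<in> r} = 2"
proof -
  have "{e \<in> edges r. (v, e) \<in> r \<and> (e, f) \<in> r} = {x. (v, x) \<in> r \<and> (x, f) \<in> r \<and> rk x = rk v + 1}"
    using assms edges_iff vertices_iff r_Field by auto
  thus ?thesis using diamond[of v f] assms vertices_iff faces_iff by simp
qed

lemma ex_face_above: assumes "x \<in> Field r" "rk x \<le> 3" shows "\<exists>f\<in>faces r. (x, f) \<in> r"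
proof (cases "rk x = 3")
  case True thus ?thesis using assms r_refl faces_iff by blast
next
  case False thus ?thesis using ex_between[of x top 3] assms top rk_top faces_iff r_Field by force
qed

lemma ex_edge_above: assumes "v \<in> vertices r" "f \<in> faces r" "(v, f) \<in> r"
  shows "\<exists>e\<in>edges r. (v, e) \<in> r \<and> (e, f) \<in> r"
  using ex_between[of v f 2] assms faces_iff vertices_iff edges_iff r_Field by force

lemma ex_edge_below: assumes "f \<in> faces r" shows "\<exists>e\<in>edges r. (e, f) \<in> r"
  using ex_between[of bottom f 2] assms faces_iff edges_iff r_Field bottom rk_bottom by force

lemma faces_nonempty: "faces r \<noteq> {}" using ex_face_above[OF bottom(1)] rk_bottom by auto

lemma sect_connected:
  assumes "(a, b) \<in> r" "rk b \<noteq> rk a + 2" "x \<in> sect a b - {a, b}" "y \<in> sect a b - {a, b}"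
  shows "(x, y) \<in> (Restr (r \<union> r\<inverse>) (sect a b - {a, b}))\<^sup>*"
proof -
  have F: "Field (Restr r (sect a b)) = sect a b"
    using sect_Field[of a b] refl unfolding Field_def refl_on_def by blast
  have "\<not> has_rank (interval_of r a b) 1" unfolding interval_of_sect
    using has_rank_sect[OF assms(1)] rk_len[OF assms(1)] assms(2) by auto
  hence "connected_interval r a b"
    using polyhedron assms(1) unfolding abstract_polyhedron_def by fastforce
  thus ?thesis using assms unfolding connected_interval_def interval_of_sect F by (auto simp: Let_def)
qed

text \<open>
  Any two faces are joined by a sequence of faces in which consecutive ones share an edge.  For an
  element \<open>x\<close>, consider whether all faces above \<open>x\<close> belong to a set \<open>S\<close> closed under passing across
  an edge. This property spreads along comparable elements: first within the section above a
  vertex, which is connected, then within the whole poset.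
\<close>
lemma faces_connected:
  assumes S: "S \<subseteq> faces r" "f0 \<in> S"
    and cl: "\<And>f g e. f \<in> S \<Longrightarrow> g \<in> faces r \<Longrightarrow> e \<in> edges r \<Longrightarrow> (e, f) \<in> r \<Longrightarrow> (e, g) \<in> r \<Longrightarrow> g \<in> S"
  shows "S = faces r"
proof -
  define Q where "Q x \<longleftrightarrow> (\<forall>f\<in>faces r. (x, f) \<in> r \<longrightarrow> f \<in> S)" for x
  have up: "Q y" if "Q x" "(x, y) \<in> r" for x y using that r_trans unfolding Q_def by blast
  have face: "Q f \<longleftrightarrow> f \<in> S" if "f \<in> faces r" for f
  proof
    show "Q f \<Longrightarrow> f \<in> S" using that r_refl faces_iff unfolding Q_def by blast
    assume "f \<in> S"
    moreover have "g = f" if "g \<in> faces r" "(f, g) \<in> r" for g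
      using rk_strict that \<open>f \<in> faces r\<close> faces_iff by fastforce
    ultimately show "Q f" unfolding Q_def by blast
  qed
  have edge: "Q e" if "e \<in> edges r" "(e, f) \<in> r" "f \<in> S" for e f
    using that cl unfolding Q_def by blast
  have edge_down: "Q e" if "e \<in> edges r" "(e, y) \<in> r" "y \<noteq> top" "Q y" for e y
  proof -
    have "y \<in> Field r" using that r_Field by blast
    hence "rk y \<le> 3" using rk_le rk_eq_4 that by force
    then obtain f where "f \<in> faces r" "(y, f) \<in> r" using ex_face_above \<open>y \<in> Field r\<close> by blast
    thus ?thesis using edge[OF that(1), of f] that r_trans unfolding Q_def by blast
  qed
  have spread: "Q y" if b: "b \<in> Field r" "rk b < 2"
    and xy: "x \<in> sect b top - {b, top}" "y \<in> sect b top - {b, top}" and Qx: "Q x"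
    and down: "\<And>c d. (b, c) \<in> r \<Longrightarrow> b \<noteq> c \<Longrightarrow> (c, d) \<in> r \<Longrightarrow> c \<noteq> d \<Longrightarrow> d \<noteq> top \<Longrightarrow> Q d \<Longrightarrow> Q c" for b x y
  proof -
    have "(x, y) \<in> (Restr (r \<union> r\<inverse>) (sect b top - {b, top}))\<^sup>*"
      using sect_connected[OF top(2)[OF b(1)] _ xy] b(2) rk_top by simp
    thus ?thesis
    proof (induction rule: rtrancl_induct)
      case base show ?case by (rule Qx)
    next
      case (step c d)
      hence cd: "c \<in> sect b top - {b, top}" "d \<in> sect b top - {b, top}" "(c, d) \<in> r \<or> (d, c) \<in> r" by auto
      show ?case
      proof (cases "(c, d) \<in> r")
        case True thus ?thesis using up step by blast
      next
        case False
        hence "(d, c) \<in> r" "d \<noteq> c" using cd r_refl r_Field by blast+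
        thus ?thesis using down[of d c] cd step.IH by (auto simp: sect_def)
      qed
    qed
  qed
  have between: "rk b < rk c \<and> rk c < rk d \<and> rk d < 4"
    if "(b, c) \<in> r" "b \<noteq> c" "(c, d) \<in> r" "c \<noteq> d" "d \<noteq> top" for b c d
    using rk_strict[OF that(1,2)] rk_strict[OF that(3,4)] rk_strict[of d top] that top r_Field rk_top by auto
  have vert_down: "Q v" if v: "v \<in> vertices r" "(v, y) \<in> r" "y \<noteq> top" "y \<noteq> v" "Q y" for v y
    unfolding Q_def
  proof (intro ballI impI)
    fix f assume f: "f \<in> faces r" "(v, f) \<in> r"
    have "Q f"
    proof (rule spread[of v y f])
      show "y \<in> sect v top - {v, top}" using v top r_Field by (auto simp: sect_def)
      show "f \<in> sect v top - {v, top}" using f top faces_iff v vertices_iff rk_top by (auto simp: sect_def)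
      fix c d assume c: "(v, c) \<in> r" "v \<noteq> c" "(c, d) \<in> r" "c \<noteq> d" "d \<noteq> top" "Q d"
      hence "c \<in> edges r" using between[OF c(1-5)] v vertices_iff edges_iff r_Field by force
      thus "Q c" using edge_down c by blast
    qed (use v vertices_iff in auto)
    thus "f \<in> S" using face f by blast
  qed
  have "f \<in> S" if f: "f \<in> faces r" for f
  proof -
    have X: "g \<in> sect bottom top - {bottom, top}" if "g \<in> faces r" for g
      using that faces_iff sect_all rk_bottom rk_top by auto
    have "Q f"
    proof (rule spread[OF bottom(1) _ X X[OF f]])
      show "f0 \<in> faces r" "Q f0" using S face by auto
      fix c d assume c: "(bottom, c) \<in> r" "bottom \<noteq> c" "(c, d) \<in> r" "c \<noteq> d" "d \<noteq> top" "Q d"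
      hence "c \<in> edges r \<or> c \<in> vertices r" using between[OF c(1-5)] vertices_iff edges_iff r_Field by force
      thus "Q c" using edge_down vert_down c by blast
    qed (simp add: rk_bottom)
    thus ?thesis using face f by blast
  qed
  thus ?thesis using S by blast
qed

end

text \<open>
  Below an element of rank \<open>k > 0\<close> there is one of rank \<open>k - 1\<close>, so an order-preserving injection
  does not lower the rank; the inverse of an automorphism is another such map.
\<close>
lemma (in polyhedral_poset) rk_increase:
  assumes "\<phi> ` Field r \<subseteq> Field r" "inj_on \<phi> (Field r)" "\<And>x y. (x, y) \<in> r \<Longrightarrow> (\<phi> x, \<phi> y) \<in> r" "x \<in> Field r"
  shows "rk x \<le> rk (\<phi> x)" using assms(4)
proof (induction "rk x" arbitrary: x)
  case (Suc k)
  then obtain y where y: "(y, x) \<in> r" "rk y = k"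
    using ex_between[of bottom x k] bottom rk_bottom by (cases "k = 0") auto
  hence "\<phi> y \<noteq> \<phi> x" using Suc.hyps(2) r_Field inj_onD[OF assms(2)] by fastforce
  hence "rk (\<phi> y) < rk (\<phi> x)" using rk_strict assms(3)[OF y(1)] by blast
  thus ?case using Suc.hyps(1)[of y] y r_Field Suc.hyps(2) by fastforce
qed simp

lemma poset_automorphism_rank:
  assumes pp: "polyhedral_poset r" and \<phi>: "poset_automorphism r \<phi>" and x: "x \<in> Field r"
  shows "polyhedral_poset.rk r (\<phi> x) = polyhedral_poset.rk r x"
proof -
  interpret polyhedral_poset r by (rule pp)
  have bij: "bij_betw \<phi> (Field r) (Field r)"
    and iff: "\<And>x y. x \<in> Field r \<Longrightarrow> y \<in> Field r \<Longrightarrow> (\<phi> x, \<phi> y) \<in> r \<longleftrightarrow> (x, y) \<in> r"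
    using \<phi> unfolding poset_automorphism_def by auto
  let ?\<psi> = "inv_into (Field r) \<phi>"
  have inv: "\<phi> (?\<psi> y) = y" "?\<psi> y \<in> Field r" if "y \<in> Field r" for y
    using bij that by (auto simp: bij_betw_def f_inv_into_f inv_into_into)
  have "rk x \<le> rk (\<phi> x)" using bij iff r_Field x by (intro rk_increase) (auto simp: bij_betw_def)
  moreover have "rk (\<phi> x) \<le> rk (?\<psi> (\<phi> x))"
  proof (rule rk_increase)
    show "(?\<psi> a, ?\<psi> b) \<in> r" if "(a, b) \<in> r" for a b
      using iff[of "?\<psi> a" "?\<psi> b"] inv r_Field[OF that] that by auto
    show "inj_on ?\<psi> (Field r)" using bij_betw_inv_into[OF bij] by (simp add: bij_betw_def)
    show "?\<psi> ` Field r \<subseteq> Field r" using inv by auto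
    show "\<phi> x \<in> Field r" using bij x by (auto simp: bij_betw_def)
  qed
  moreover have "?\<psi> (\<phi> x) = x" using bij x by (simp add: bij_betw_def)
  ultimately show ?thesis by simp
qed

section \<open>Isometries of space\<close>

lemma isometry_affine:
  assumes "isometry h"
  obtains L a where "orth L" "\<And>x. h x = L x + a"
proof
  show "orth (\<lambda>x. h x - h 0)"
    using assms unfolding orthogonal_transformation_isometry isometry_def by (simp add: dist_norm)
qed auto

lemma orthogonal_transformation_is_isometry: "orth L \<Longrightarrow> isometry L"
  unfolding isometry_def orthogonal_transformation_isometry by simp

lemma isometry_inj: "isometry h \<Longrightarrow> inj h" unfolding isometry_def inj_def by (metis dist_eq_0_iff)

lemma isometry_surj: "isometry h \<Longrightarrow> surj h"
proof -
  assume "isometry h"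
  then obtain L a where L: "orth L" "\<And>x. h x = L x + a" using isometry_affine by blast
  have "h (ginv L (y - a)) = y" for y
    using L orthogonal_transformation_surj[OF L(1)] by (simp add: surj_f_inv_f)
  thus ?thesis by (rule surjI)
qed

lemma isometry_bij: "isometry h \<Longrightarrow> bij h" by (simp add: bij_def isometry_inj isometry_surj)

lemma isometry_comp: "isometry g \<Longrightarrow> isometry h \<Longrightarrow> isometry (g \<circ> h)" by (simp add: isometry_def)

lemma isometry_inv: "isometry h \<Longrightarrow> isometry (ginv h)" unfolding isometry_def
  by (metis isometry_def isometry_surj surj_f_inv_f)

lemma isometry_id: "isometry id" by (simp add: isometry_def)

lemma isometry_translation: "isometry (\<lambda>x. x - a)" by (simp add: isometry_def dist_norm)

lemma isometry_fixing_0: "isometry h \<Longrightarrow> h 0 = 0 \<Longrightarrow> orth h"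
  unfolding isometry_def orthogonal_transformation_isometry by simp

lemma isometry_affine_hull:
  assumes "isometry h" shows "affine hull (h ` S) = h ` (affine hull S)"
proof -
  obtain L a where L: "orth L" "\<And>x. h x = L x + a" using isometry_affine assms by blast
  have "h ` T = (\<lambda>x. a + x) ` (L ` T)" for T using L(2) by (auto simp: image_iff add.commute)
  thus ?thesis using affine_hull_translation[of a "L ` S"] affine_hull_linear_image[of L S]
      orth_linear[OF L(1)] linear_conv_bounded_linear by metis
qed

lemma isometry_aff_dim:
  assumes "isometry h" shows "aff_dim (h ` S) = aff_dim S"
proof -
  obtain L a where L: "orth L" "\<And>x. h x = L x + a" using isometry_affine assms by blast
  have "h ` S = (\<lambda>x. a + x) ` (L ` S)" using L(2) by (auto simp: image_iff add.commute)
  thus ?thesis using aff_dim_translation_eq[of a "L ` S"] aff_dim_injective_linear_image[of L S]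
      orth_linear[OF L(1)] orth_inj[OF L(1)] by metis
qed

lemma isometry_sum:
  assumes "isometry h" "finite V" "h ` V = V" "V \<noteq> {}"
  shows "h ((1 / real (card V)) *\<^sub>R \<Sum>V) = (1 / real (card V)) *\<^sub>R \<Sum>V"
proof -
  obtain L a where L: "orth L" "\<And>x. h x = L x + a" using isometry_affine assms by blast
  have lin: "linear L" using orth_linear L by blast
  have card: "real (card V) \<noteq> 0" using assms by simp
  have "\<Sum>V = \<Sum>(h ` V)" using assms by simp
  also have "\<dots> = (\<Sum>x\<in>V. L x + a)"
    using sum.reindex[of h V "\<lambda>x. x"] isometry_inj[OF assms(1)] L(2) by (simp add: inj_on_subset o_def)
  also have "\<dots> = L (\<Sum>V) + real (card V) *\<^sub>R a"
    using linear_sum[OF lin, of "\<lambda>x. x" V] by (simp add: sum.distrib scaleR_conv_of_real sum_constant_scaleR)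
  finally have eq: "\<Sum>V = L (\<Sum>V) + real (card V) *\<^sub>R a" .
  have "(1 / real (card V)) *\<^sub>R \<Sum>V = (1 / real (card V)) *\<^sub>R (L (\<Sum>V) + real (card V) *\<^sub>R a)"
    by (rule arg_cong[OF eq])
  hence "(1 / real (card V)) *\<^sub>R L (\<Sum>V) + a = (1 / real (card V)) *\<^sub>R \<Sum>V"
    using card by (simp add: scaleR_add_right)
  thus ?thesis unfolding L(2) linear_scale[OF lin] .
qed

lemma orthogonal_transformation_eq_on_span:
  assumes "linear f" "linear g" "\<And>x. x \<in> S \<Longrightarrow> f x = g x" "span S = UNIV" shows "f = g"
  using linear_eq_on_span[OF assms(1,2), of S] assms(3,4) by fastforce

section \<open>Realized polyhedra and their symmetries\<close>

locale realized_polyhedron =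
  fixes P :: "'a realized"
  assumes is_polyhedron: "is_polyhedron P"

sublocale realized_polyhedron \<subseteq> polyhedral_poset "incidence P"
  using is_polyhedron unfolding is_polyhedron_def nondegenerate_def
  by unfold_locales (auto simp: Let_def)

context realized_polyhedron
begin

abbreviation "r \<equiv> incidence P"
abbreviation "X \<equiv> points_of P"
abbreviation "V \<equiv> geom_vertices P"
abbreviation "Sym \<equiv> symmetry_group P"

lemma nondeg:
  "inj_on (pos P) (vertices r)" "inj_on (vertex_set r) (edges r)" "inj_on (vertex_set r) (faces r)"
  "f \<in> faces r \<Longrightarrow> aff_dim (X f) = 2"
  "f \<in> faces r \<Longrightarrow> g \<in> faces r \<Longrightarrow> e \<in> edges r \<Longrightarrow> f \<noteq> g \<Longrightarrow> (e, f) \<in> r \<Longrightarrow> (e, g) \<in> r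
     \<Longrightarrow> affine hull (X f) \<noteq> affine hull (X g)"
  using is_polyhedron unfolding is_polyhedron_def nondegenerate_def by (auto simp: Let_def)

lemma vertex_set_sub: "vertex_set r x \<subseteq> vertices r" by (auto simp: vertex_set_def)

lemma points_eq_iff: "X x = X y \<longleftrightarrow> vertex_set r x = vertex_set r y"
  unfolding points_of_def using inj_on_image_eq_iff[OF nondeg(1) vertex_set_sub vertex_set_sub] .

lemma edge_inj: "e \<in> edges r \<Longrightarrow> e' \<in> edges r \<Longrightarrow> X e = X e' \<Longrightarrow> e = e'"
  using nondeg(2) points_eq_iff by (auto simp: inj_on_def)
lemma face_inj: "e \<in> faces r \<Longrightarrow> e' \<in> faces r \<Longrightarrow> X e = X e' \<Longrightarrow> e = e'"
  using nondeg(3) points_eq_iff by (auto simp: inj_on_def)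

lemma points_mono: "(x, y) \<in> r \<Longrightarrow> X x \<subseteq> X y"
  unfolding points_of_def vertex_set_def using r_trans by auto

lemma vertex_in_points: "v \<in> vertices r \<Longrightarrow> pos P v \<in> X x \<longleftrightarrow> (v, x) \<in> r"
  unfolding points_of_def vertex_set_def using nondeg(1) by (auto simp: inj_on_def)

lemma points_sub: "X x \<subseteq> V" unfolding points_of_def vertex_set_def geom_vertices_def by auto

lemma edge_card: "e \<in> edges r \<Longrightarrow> card (X e) = 2"
  unfolding points_of_def using edge_vertices_card card_image inj_on_subset[OF nondeg(1) vertex_set_sub] by metis

lemma finite_V: "finite (V)"
  unfolding geom_vertices_def using fin finite_subset[of "vertices r"] vertices_iff by blast

lemma finite_points: "finite (X x)" using finite_V points_sub finite_subset by blast

lemma other_face: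
  assumes "e \<in> edges r" "f \<in> faces r" "(e, f) \<in> r"
  obtains g where "g \<in> faces r" "(e, g) \<in> r" "g \<noteq> f" "affine hull (X g) \<noteq> affine hull (X f)" "X g \<noteq> X f"
    "\<And>k. k \<in> faces r \<Longrightarrow> (e, k) \<in> r \<Longrightarrow> k = f \<or> k = g"
proof -
  have "f \<in> {f \<in> faces r. (e, f) \<in> r}" using assms by blast
  then obtain g where g: "{f \<in> faces r. (e, f) \<in> r} = {f, g}" "g \<noteq> f"
  proof -
    obtain x y where xy: "{f \<in> faces r. (e, f) \<in> r} = {x, y}" "x \<noteq> y"
      using edge_faces_card[OF assms(1)] by (metis (no_types, lifting) card_2_iff)
    moreover have "f = x \<or> f = y" using \<open>f \<in> {f \<in> faces r. (e, f) \<in> r}\<close> unfolding xy by simp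
    ultimately show thesis using that by (metis insert_commute)
  qed
  hence gg: "g \<in> faces r" "(e, g) \<in> r" by blast+
  show ?thesis
  proof
    show "g \<in> faces r" "(e, g) \<in> r" "g \<noteq> f" using g gg by auto
    show h: "affine hull (X g) \<noteq> affine hull (X f)" using nondeg(5)[OF gg(1) assms(2) assms(1) g(2) gg(2) assms(3)] .
    thus "X g \<noteq> X f" by metis
    show "\<And>k. k \<in> faces r \<Longrightarrow> (e, k) \<in> r \<Longrightarrow> k = f \<or> k = g" using g by blast
  qed
qed

lemma vertices_eq_Union_faces: "V = (\<Union>f\<in>faces r. X f)"
proof
  show "V \<subseteq> (\<Union>f\<in>faces r. X f)"
  proof
    fix y assume "y \<in> V"
    then obtain v where v: "v \<in> vertices r" "y = pos P v" by (auto simp: geom_vertices_def)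
    then obtain f where "f \<in> faces r" "(v, f) \<in> r" using ex_face_above vertices_iff by fastforce
    thus "y \<in> (\<Union>f\<in>faces r. X f)" using v vertex_in_points by blast
  qed
qed (use points_sub in blast)

lemma V_nonempty: "V \<noteq> {}"
proof -
  obtain f where "f \<in> faces r" using faces_nonempty by blast
  hence "X f \<noteq> {}" using nondeg(4) by fastforce
  thus ?thesis using points_sub by blast
qed

text \<open>The two faces at an edge lie in different planes, so the vertices are not coplanar.\<close>
lemma V_spans: "affine hull (V) = UNIV"
proof -
  obtain f where f: "f \<in> faces r" using faces_nonempty by blast
  obtain e where e: "e \<in> edges r" "(e, f) \<in> r" using ex_edge_below f by blast
  obtain g where g: "g \<in> faces r" "affine hull (X g) \<noteq> affine hull (X f)"
    using other_face[OF e(1) f e(2)] by metis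
  let ?V = "V"
  have "aff_dim ?V \<noteq> 2"
  proof
    assume *: "aff_dim ?V = 2"
    have "affine hull (X k) = affine hull ?V" if "k \<in> faces r" for k
      using aff_dim_eq_full_gen[OF points_sub[of k]] nondeg(4)[OF that] * by simp
    thus False using g f by blast
  qed
  moreover have "aff_dim ?V \<ge> 2" using aff_dim_subset[OF points_sub[of f]] nondeg(4)[OF f] by simp
  moreover have "aff_dim ?V \<le> 3" using aff_dim_le_DIM[of ?V] by simp
  ultimately show ?thesis using aff_dim_eq_full[of ?V] by simp
qed

definition gface :: "'a \<Rightarrow> (real^3) set set" where "gface f = X ` {e \<in> edges r. (e, f) \<in> r}"

lemma geom_faces_gface: "geom_faces P = gface ` faces r" unfolding geom_faces_def gface_def ..

lemma edge_in_gface: "e \<in> edges r \<Longrightarrow> X e \<in> gface f \<longleftrightarrow> (e, f) \<in> r"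
  unfolding gface_def using edge_inj by auto

lemma Union_gface: "f \<in> faces r \<Longrightarrow> \<Union>(gface f) = X f"
proof (intro equalityI subsetI)
  fix y assume f: "f \<in> faces r" and "y \<in> X f"
  then obtain v where v: "v \<in> vertices r" "(v, f) \<in> r" "y = pos P v" by (auto simp: points_of_def vertex_set_def)
  then obtain e where "e \<in> edges r" "(v, e) \<in> r" "(e, f) \<in> r" using ex_edge_above f by blast
  thus "y \<in> \<Union>(gface f)" using v vertex_in_points unfolding gface_def by blast
next
  fix y assume "y \<in> \<Union>(gface f)"
  thus "y \<in> X f" using points_mono unfolding gface_def by blast
qed

lemma Field_cases:
  assumes "x \<in> Field r"
  obtains "x = bottom" | "x \<in> vertices r" | "x \<in> edges r" | "x \<in> faces r" | "x = top"
proof -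
  have "rk x = 0 \<or> rk x = 1 \<or> rk x = 2 \<or> rk x = 3 \<or> rk x = 4" using rk_le[OF assms] by arith
  thus thesis using that rk_eq_0[OF assms] rk_eq_4[OF assms] assms
    vertices_iff[of x] edges_iff[of x] faces_iff[of x] by blast
qed

lemma points_bottom: "X bottom = {}"
proof -
  have "(v, bottom) \<notin> r" if "v \<in> vertices r" for v
    using that rk_mono[of v bottom] rk_bottom vertices_iff by auto
  thus ?thesis by (auto simp: points_of_def vertex_set_def)
qed

lemma points_vertex: "v \<in> vertices r \<Longrightarrow> X v = {pos P v}"
proof -
  assume v: "v \<in> vertices r"
  have "vertex_set r v = {v}"
    unfolding vertex_set_def using v r_refl rk_strict vertices_iff by fastforce
  thus ?thesis by (simp add: points_of_def)
qed

lemma points_top: "X top = V"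
proof -
  have "vertex_set r top = vertices r" using top vertices_iff by (auto simp: vertex_set_def)
  thus ?thesis by (simp add: points_of_def geom_vertices_def)
qed

lemma face_points_card: "f \<in> faces r \<Longrightarrow> card (X f) \<ge> 3"
  using aff_dim_le_card[OF finite_points, of f] nondeg(4)[of f] by simp

lemma card_V: "card (V) \<ge> 4"
proof -
  have "aff_dim (V) = 3" using V_spans aff_dim_eq_full[of "V"] by simp
  thus ?thesis using aff_dim_le_card[OF finite_V] by simp
qed

text \<open>
  Vertex sets determine elements of a given rank; this extends nondegeneracy to vertices and the
  improper elements.
\<close>
lemma points_inj:
  assumes xy: "x \<in> Field r" "y \<in> Field r" "rk x = rk y" "X x = X y" shows "x = y" using xy(1)
proof (cases rule: Field_cases)
  case 1 thus ?thesis using xy rk_eq_0[OF xy(2)] rk_bottom by simp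
next
  case 2
  hence "y \<in> vertices r" using xy vertices_iff by simp
  thus ?thesis using 2 xy(4) points_vertex nondeg(1) by (simp add: inj_on_def)
next
  case 3 thus ?thesis using xy edges_iff edge_inj by simp
next
  case 4 thus ?thesis using xy faces_iff face_inj by simp
next
  case 5 thus ?thesis using xy rk_eq_4[OF xy(2)] rk_top by simp
qed

text \<open>
  The order is recovered from geometric data. Inclusion of vertex sets alone does not suffice: a
  diagonal of a face may be an edge of the polyhedron.
\<close>
lemma order_iff:
  assumes xy: "x \<in> Field r" "y \<in> Field r"
  shows "(x, y) \<in> r \<longleftrightarrow> X x \<subseteq> X y \<and> rk x \<le> rk y \<and> (rk x = rk y \<longrightarrow> X x = X y)
    \<and> (x \<in> edges r \<longrightarrow> y \<in> faces r \<longrightarrow> X x \<in> gface y)" (is "_ \<longleftrightarrow> ?R")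
proof
  assume "(x, y) \<in> r"
  thus ?R using points_mono rk_mono rk_strict edge_in_gface by fastforce
next
  assume R: ?R
  show "(x, y) \<in> r"
  proof (cases "rk x = rk y")
    case True thus ?thesis using points_inj[OF xy] R r_refl xy by blast
  next
    case False
    hence lt: "rk x < rk y" using R by simp
    show ?thesis using xy(1)
    proof (cases rule: Field_cases)
      case 1 thus ?thesis using bottom xy by blast
    next
      case 2 thus ?thesis using R points_vertex vertex_in_points by auto
    next
      case 3 thus ?thesis using R lt rk_le[OF xy(2)] edge_in_gface top xy rk_eq_4[OF xy(2)] edges_iff faces_iff
        by (cases "rk y = 3") auto
    next
      case 4 thus ?thesis using lt rk_le[OF xy(2)] top xy rk_eq_4[OF xy(2)] faces_iff by auto
    next
      case 5 thus ?thesis using lt rk_le[OF xy(2)] rk_top by simp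
    qed
  qed
qed

text \<open>
  An isometry that carries the set of faces, given as sets of edges, into itself is a symmetry: the
  order is recovered from the vertex sets together with the edges of each face.
\<close>
lemma symmetry_if_preserves_faces:
  assumes h: "isometry h" and F: "\<And>f. f \<in> faces r \<Longrightarrow> (`) h ` gface f \<in> gface ` faces r"
  shows "h \<in> Sym"
proof -
  have inj: "inj h" using isometry_inj h .
  have face: "\<exists>g\<in>faces r. gface g = (`) h ` gface f \<and> X g = h ` X f" if f: "f \<in> faces r" for f
  proof -
    obtain g where g: "g \<in> faces r" "(`) h ` gface f = gface g" using F[OF f] by (auto simp del: image_image)
    have "X g = \<Union>((`) h ` gface f)" using Union_gface g by metis
    also have "\<dots> = h ` \<Union>(gface f)" by blast
    finally show ?thesis using g Union_gface[OF f] by metis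
  qed
  have edge: "\<exists>e'\<in>edges r. X e' = h ` X e" if e: "e \<in> edges r" for e
  proof -
    obtain f where f: "f \<in> faces r" "(e, f) \<in> r" using ex_face_above e edges_iff by force
    then obtain g where g: "g \<in> faces r" "gface g = (`) h ` gface f" using face by blast
    have "h ` X e \<in> gface g" using g e f edge_in_gface by blast
    thus ?thesis unfolding gface_def by auto
  qed
  have "h ` V \<subseteq> V"
  proof -
    have "h ` X f \<subseteq> V" if "f \<in> faces r" for f using face[OF that] points_sub by metis
    thus ?thesis unfolding vertices_eq_Union_faces by blast
  qed
  hence hV: "h ` V = V" using endo_inj_surj[OF finite_V] inj inj_on_subset by blast
  have vert: "\<exists>v'\<in>vertices r. X v' = h ` X v" if v: "v \<in> vertices r" for v
  proof -
    have "h (pos P v) \<in> V" using hV v unfolding geom_vertices_def by blast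
    then obtain v' where "v' \<in> vertices r" "h (pos P v) = pos P v'" unfolding geom_vertices_def by blast
    thus ?thesis using points_vertex v by auto
  qed
  have all: "\<exists>y\<in>Field r. X y = h ` X x \<and> rk y = rk x" if x: "x \<in> Field r" for x using x
  proof (cases rule: Field_cases)
    case 1 thus ?thesis using bottom points_bottom by auto
  next
    case 2 thus ?thesis using vert[OF 2] vertices_iff by metis
  next
    case 3 thus ?thesis using edge[OF 3] edges_iff by metis
  next
    case 4 thus ?thesis using face[OF 4] faces_iff by metis
  next
    case 5 thus ?thesis using top points_top hV by metis
  qed
  then obtain \<phi> where \<phi>: "\<And>x. x \<in> Field r \<Longrightarrow> \<phi> x \<in> Field r \<and> X (\<phi> x) = h ` X x \<and> rk (\<phi> x) = rk x"
    by metis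
  have inj\<phi>: "inj_on \<phi> (Field r)"
  proof (rule inj_onI)
    fix x y assume xy: "x \<in> Field r" "y \<in> Field r" "\<phi> x = \<phi> y"
    hence "h ` X x = h ` X y" using \<phi> by metis
    hence "X x = X y" using inj by (simp add: inj_image_eq_iff)
    thus "x = y" using points_inj xy \<phi> by metis
  qed
  have bij: "bij_betw \<phi> (Field r) (Field r)"
    unfolding bij_betw_def using inj\<phi> endo_inj_surj[OF fin _ inj\<phi>] \<phi> by blast
  have gf: "gface (\<phi> f) = (`) h ` gface f" if f: "f \<in> faces r" for f
  proof -
    obtain g where g: "g \<in> faces r" "gface g = (`) h ` gface f" "X g = h ` X f" using face f by blast
    have "g = \<phi> f" using g \<phi>[of f] f points_inj faces_iff by metis
    thus ?thesis using g by simp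
  qed
  have ord: "(\<phi> x, \<phi> y) \<in> r \<longleftrightarrow> (x, y) \<in> r" if xy: "x \<in> Field r" "y \<in> Field r" for x y
  proof -
    have 1: "X (\<phi> x) \<subseteq> X (\<phi> y) \<longleftrightarrow> X x \<subseteq> X y" "X (\<phi> x) = X (\<phi> y) \<longleftrightarrow> X x = X y"
      using \<phi> xy inj by (simp_all add: inj_image_subset_iff inj_image_eq_iff)
    have 2: "\<phi> x \<in> edges r \<longleftrightarrow> x \<in> edges r" "\<phi> y \<in> faces r \<longleftrightarrow> y \<in> faces r" "\<phi> x \<in> faces r \<longleftrightarrow> x \<in> faces r"
      using \<phi> xy edges_iff faces_iff by auto
    have 3: "X (\<phi> x) \<in> gface (\<phi> y) \<longleftrightarrow> X x \<in> gface y" if "y \<in> faces r"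
      unfolding gf[OF that] using \<phi> xy inj by (auto simp: inj_image_eq_iff)
    show ?thesis using order_iff[of "\<phi> x" "\<phi> y"] order_iff[OF xy] \<phi> xy 1 2 3 by auto
  qed
  have "pos P (\<phi> v) = h (pos P v)" if v: "v \<in> vertices r" for v
  proof -
    have "v \<in> Field r" using v vertices_iff by blast
    hence "\<phi> v \<in> vertices r" using \<phi> v vertices_iff by auto
    thus ?thesis using \<phi>[OF \<open>v \<in> Field r\<close>] points_vertex v by auto
  qed
  thus ?thesis unfolding symmetry_group_def poset_automorphism_def induced_by_def
    using bij ord h by blast
qed

lemma automorphism_image:
  assumes \<phi>: "poset_automorphism r \<phi>" and h: "induced_by P \<phi> h"
  shows "x \<in> vertices r \<Longrightarrow> \<phi> x \<in> vertices r" "x \<in> faces r \<Longrightarrow> \<phi> x \<in> faces r"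
    "x \<in> Field r \<Longrightarrow> X (\<phi> x) = h ` X x"
    "f \<in> faces r \<Longrightarrow> gface (\<phi> f) = (`) h ` gface f"
proof -
  have bij: "bij_betw \<phi> (Field r) (Field r)"
    and iff: "\<And>x y. x \<in> Field r \<Longrightarrow> y \<in> Field r \<Longrightarrow> (\<phi> x, \<phi> y) \<in> r \<longleftrightarrow> (x, y) \<in> r"
    using \<phi> unfolding poset_automorphism_def by auto
  have mem: "\<And>x. x \<in> Field r \<Longrightarrow> \<phi> x \<in> Field r" using bij bij_betwE by blast
  have rk: "\<And>x. x \<in> Field r \<Longrightarrow> rk (\<phi> x) = rk x"
    using poset_automorphism_rank[OF polyhedral_poset_axioms \<phi>] .
  have im: "elements_of_rank r k = \<phi> ` elements_of_rank r k" for k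
  proof (intro equalityI subsetI)
    fix y assume y: "y \<in> elements_of_rank r k"
    then obtain x where "x \<in> Field r" "y = \<phi> x"
      using bij unfolding elements_of_rank_iff bij_betw_def by blast
    thus "y \<in> \<phi> ` elements_of_rank r k" using y rk elements_of_rank_iff by auto
  qed (use rk mem elements_of_rank_iff in auto)
  show v: "x \<in> vertices r \<Longrightarrow> \<phi> x \<in> vertices r" for x using im by blast
  show f: "x \<in> faces r \<Longrightarrow> \<phi> x \<in> faces r" for x using im by blast
  have vs: "vertex_set r (\<phi> x) = \<phi> ` vertex_set r x" if x: "x \<in> Field r" for x
  proof (intro equalityI subsetI)
    fix y assume "y \<in> vertex_set r (\<phi> x)"
    hence y: "y \<in> vertices r" "(y, \<phi> x) \<in> r" by (auto simp: vertex_set_def)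
    then obtain z where "z \<in> vertices r" "y = \<phi> z" using im by blast
    thus "y \<in> \<phi> ` vertex_set r x" using y iff x vertices_iff by (auto simp: vertex_set_def)
  next
    fix y assume "y \<in> \<phi> ` vertex_set r x"
    thus "y \<in> vertex_set r (\<phi> x)" using iff x v vertices_iff by (auto simp: vertex_set_def)
  qed
  show X: "x \<in> Field r \<Longrightarrow> X (\<phi> x) = h ` X x" for x
    unfolding points_of_def image_image vs image_comp using h vertex_set_sub
    by (auto simp: induced_by_def image_image intro!: image_cong)
  show "gface (\<phi> f) = (`) h ` gface f" if ff: "f \<in> faces r" for f
  proof -
    have "{e \<in> edges r. (e, \<phi> f) \<in> r} = \<phi> ` {e \<in> edges r. (e, f) \<in> r}"
    proof (intro equalityI subsetI)
      fix y assume "y \<in> {e \<in> edges r. (e, \<phi> f) \<in> r}"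
      hence y: "y \<in> edges r" "(y, \<phi> f) \<in> r" by auto
      then obtain z where "z \<in> edges r" "y = \<phi> z" using im by blast
      thus "y \<in> \<phi> ` {e \<in> edges r. (e, f) \<in> r}" using y iff ff edges_iff faces_iff by auto
    next
      fix y assume "y \<in> \<phi> ` {e \<in> edges r. (e, f) \<in> r}"
      then obtain e where e: "e \<in> edges r" "(e, f) \<in> r" "y = \<phi> e" by blast
      hence "y \<in> edges r" using im by blast
      thus "y \<in> {e \<in> edges r. (e, \<phi> f) \<in> r}" using e iff ff edges_iff faces_iff by auto
    qed
    thus ?thesis unfolding gface_def using X edges_iff by (auto simp: image_image intro!: image_cong)
  qed
qed

lemma symmetry_group_isometry: "h \<in> Sym \<Longrightarrow> isometry h"
  unfolding symmetry_group_def induced_by_def by blast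

lemma symmetry_group_vertices: assumes "h \<in> Sym" shows "h ` V = V"
proof -
  obtain \<phi> where \<phi>: "poset_automorphism r \<phi>" "induced_by P \<phi> h" using assms by (auto simp: symmetry_group_def)
  have "h ` V \<subseteq> V" unfolding geom_vertices_def using \<phi>(2) automorphism_image(1)[OF \<phi>]
    by (auto simp: induced_by_def) (metis imageI)
  thus ?thesis
    using endo_inj_surj[OF finite_V] isometry_inj[OF symmetry_group_isometry[OF assms]] inj_on_subset by blast
qed

lemma symmetry_group_face:
  assumes "h \<in> Sym" "f \<in> faces r"
  obtains g where "g \<in> faces r" "X g = h ` X f" "gface g = (`) h ` gface f"
proof -
  obtain \<phi> where \<phi>: "poset_automorphism r \<phi>" "induced_by P \<phi> h" using assms by (auto simp: symmetry_group_def)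
  show ?thesis using automorphism_image(2,3,4)[OF \<phi>, of f] assms(2) that faces_iff by blast
qed

lemma symmetry_group_iff:
  "h \<in> Sym \<longleftrightarrow> isometry h \<and> (`) ((`) h) ` geom_faces P \<subseteq> geom_faces P"
proof
  assume h: "h \<in> Sym"
  thus "isometry h \<and> (`) ((`) h) ` geom_faces P \<subseteq> geom_faces P" unfolding geom_faces_gface
  proof (intro conjI subsetI)
    show "isometry h" using symmetry_group_isometry h .
    fix F assume "F \<in> (`) ((`) h) ` gface ` faces r"
    then obtain f where f: "f \<in> faces r" "F = (`) h ` gface f" by auto
    obtain g where "g \<in> faces r" "gface g = (`) h ` gface f" using symmetry_group_face[OF h f(1)] .
    thus "F \<in> gface ` faces r" using f by auto
  qed
next
  assume "isometry h \<and> (`) ((`) h) ` geom_faces P \<subseteq> geom_faces P"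
  thus "h \<in> Sym" unfolding geom_faces_gface by (intro symmetry_if_preserves_faces) auto
qed

lemma symmetry_group_comp: "g \<in> Sym \<Longrightarrow> h \<in> Sym \<Longrightarrow> g \<circ> h \<in> Sym" unfolding symmetry_group_iff
proof (intro conjI)
  assume A: "isometry g \<and> (`) ((`) g) ` geom_faces P \<subseteq> geom_faces P"
     "isometry h \<and> (`) ((`) h) ` geom_faces P \<subseteq> geom_faces P"
  show "isometry (g \<circ> h)" by (rule isometry_comp[OF conjunct1[OF A(1)] conjunct1[OF A(2)]])
  have "(`) ((`) (g \<circ> h)) ` geom_faces P = (`) ((`) g) ` (`) ((`) h) ` geom_faces P"
    by (simp add: image_comp image_image comp_def)
  also have "\<dots> \<subseteq> (`) ((`) g) ` geom_faces P" by (rule image_mono[OF conjunct2[OF A(2)]])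
  also have "\<dots> \<subseteq> geom_faces P" by (rule conjunct2[OF A(1)])
  finally show "(`) ((`) (g \<circ> h)) ` geom_faces P \<subseteq> geom_faces P" .
qed

lemma geom_faces_finite: "finite (geom_faces P)"
  unfolding geom_faces_gface using fin finite_subset[of "faces r"] faces_iff by blast

lemma symmetry_group_faces_eq:
  assumes "h \<in> Sym" shows "(`) ((`) h) ` geom_faces P = geom_faces P"
proof -
  have "inj h" using assms symmetry_group_isometry isometry_inj by blast
  hence "inj ((`) ((`) h))" by (simp add: inj_image_eq_iff inj_def)
  thus ?thesis using endo_inj_surj[OF geom_faces_finite] assms symmetry_group_iff inj_on_subset by blast
qed

lemma symmetry_group_inv: assumes h: "h \<in> Sym" shows "ginv h \<in> Sym" unfolding symmetry_group_iff
proof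
  have iso: "isometry h" using h symmetry_group_isometry by blast
  thus "isometry (ginv h)" by (rule isometry_inv)
  have "ginv h \<circ> h = id" using isometry_inj[OF iso] by simp
  hence "(`) ((`) (ginv h)) ` (`) ((`) h) ` geom_faces P = geom_faces P"
    by (simp add: image_comp image_image comp_def id_def fun_eq_iff)
  thus "(`) ((`) (ginv h)) ` geom_faces P \<subseteq> geom_faces P" using symmetry_group_faces_eq[OF h] by simp
qed

lemma symmetry_group_id: "id \<in> Sym" unfolding symmetry_group_iff by (simp add: isometry_id)

text \<open>
  An isometry is affine, hence determined by its values on the vertices, which span the space
  affinely.
\<close>
lemma symmetry_group_eqI:
  assumes "g \<in> Sym" "h \<in> Sym" "\<And>x. x \<in> V \<Longrightarrow> g x = h x"
  shows "g = h"
proof -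
  obtain L a where L: "orth L" "\<And>x. g x = L x + a"
    using isometry_affine symmetry_group_isometry assms by blast
  obtain M b where M: "orth M" "\<And>x. h x = M x + b"
    using isometry_affine symmetry_group_isometry assms by blast
  obtain v where v: "v \<in> V" using V_nonempty by blast
  have "affine hull V = (\<lambda>x. v + x) ` span ((\<lambda>x. - v + x) ` V)"
    by (rule affine_hull_span_gen) (simp add: v hull_inc)
  hence U: "span ((\<lambda>x. - v + x) ` V) = UNIV"
    unfolding V_spans by (metis surj_plus translation_assoc image_inv_f_f inj_image_eq_iff injI add_left_imp_eq)
  have lin: "linear L" "linear M" using L M orth_linear by blast+
  have "L = M"
  proof (rule orthogonal_transformation_eq_on_span[OF lin _ U])
    fix x assume "x \<in> (\<lambda>x. - v + x) ` V"
    then obtain y where y: "y \<in> V" "x = y - v" by auto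
    have "L x = g y - g v" "M x = h y - h v"
      unfolding L(2) M(2) y(2) linear_diff[OF lin(1)] linear_diff[OF lin(2)] by simp_all
    thus "L x = M x" using assms(3)[OF y(1)] assms(3)[OF v] by simp
  qed
  thus ?thesis using L(2) M(2) assms(3)[OF v] by auto
qed

lemma symmetry_group_finite: "finite (Sym)"
proof -
  let ?V = "V"
  let ?R = "\<lambda>h. restrict h ?V"
  have "inj_on ?R (Sym)" by (rule inj_onI) (metis symmetry_group_eqI restrict_apply')
  moreover have "?R ` Sym \<subseteq> ?V \<rightarrow>\<^sub>E ?V" using symmetry_group_vertices by fastforce
  moreover have "finite (?V \<rightarrow>\<^sub>E ?V)" using finite_V by (simp add: finite_PiE)
  ultimately show ?thesis using finite_imageD finite_subset by metis
qed

lemma transform_is_polyhedron: assumes s: "isometry s" shows "is_polyhedron (transform s P)"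
proof -
  have pts: "points_of (transform s P) x = s ` X x" for x
    by (simp add: points_of_def transform_def image_comp)
  have "inj s" using isometry_inj s .
  have 1: "inj_on (s \<circ> pos P) (vertices r)"
    using nondeg(1) comp_inj_on \<open>inj s\<close> inj_on_subset by (metis subset_UNIV)
  have 2: "affine hull (s ` X f) \<noteq> affine hull (s ` X g)" if "affine hull (X f) \<noteq> affine hull (X g)" for f g
    unfolding isometry_affine_hull[OF s] using that \<open>inj s\<close> by (simp add: inj_image_eq_iff)
  show ?thesis
    using is_polyhedron 1 2 unfolding is_polyhedron_def nondegenerate_def pts isometry_aff_dim[OF s]
    by (simp add: transform_def Let_def)
qed

lemma symmetry_transform:
  assumes s: "isometry s"
  shows "induced_by (transform s P) \<phi> h \<longleftrightarrow> induced_by P \<phi> (ginv s \<circ> h \<circ> s)"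
proof -
  have s': "ginv s \<circ> s = id" "s \<circ> ginv s = id" using isometry_inj[OF s] isometry_surj[OF s] by (simp_all add: surj_iff)
  have iso: "isometry (ginv s \<circ> h \<circ> s) \<longleftrightarrow> isometry h"
  proof
    assume "isometry (ginv s \<circ> h \<circ> s)"
    hence "isometry (s \<circ> (ginv s \<circ> h \<circ> s) \<circ> ginv s)" using s isometry_inv isometry_comp by blast
    moreover have "s \<circ> (ginv s \<circ> h \<circ> s) \<circ> ginv s = h" using s' by (auto simp: fun_eq_iff)
    ultimately show "isometry h" by simp
  qed (use s isometry_inv isometry_comp in blast)
  have "s (pos P (\<phi> v)) = h (s (pos P v)) \<longleftrightarrow> pos P (\<phi> v) = ginv s (h (s (pos P v)))" for v
    using s' by (metis comp_apply id_apply)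
  thus ?thesis unfolding induced_by_def iso by (simp add: transform_def)
qed

lemma symmetry_group_transform:
  assumes s: "isometry s"
  shows "symmetry_group (transform s P) = {g. \<exists>h\<in>Sym. s \<circ> h = g \<circ> s}"
proof -
  have s': "ginv s \<circ> s = id" "s \<circ> ginv s = id" using isometry_inj[OF s] isometry_surj[OF s] by (simp_all add: surj_iff)
  have "(\<exists>h\<in>Sym. s \<circ> h = g \<circ> s) \<longleftrightarrow> ginv s \<circ> g \<circ> s \<in> Sym" for g
  proof
    assume "\<exists>h\<in>Sym. s \<circ> h = g \<circ> s"
    then obtain h where "h \<in> Sym" "s \<circ> h = g \<circ> s" by blast
    moreover hence "ginv s \<circ> g \<circ> s = h" using s' by (metis comp_assoc id_comp)
    ultimately show "ginv s \<circ> g \<circ> s \<in> Sym" by simp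
  next
    assume "ginv s \<circ> g \<circ> s \<in> Sym"
    moreover have "s \<circ> (ginv s \<circ> g \<circ> s) = g \<circ> s" using s' by (metis comp_assoc id_comp)
    ultimately show "\<exists>h\<in>Sym. s \<circ> h = g \<circ> s" by blast
  qed
  thus ?thesis unfolding symmetry_group_def symmetry_transform[OF s] by (auto simp: transform_def)
qed

end

lemma transform_simps [simp]:
  "incidence (transform s P) = incidence P" "points_of (transform s P) x = s ` points_of P x"
  "geom_vertices (transform s P) = s ` geom_vertices P"
  "geom_edges (transform s P) = (`) s ` geom_edges P"
  "geom_faces (transform s P) = (`) ((`) s) ` geom_faces P"
proof -
  show a: "incidence (transform s P) = incidence P" by (simp add: transform_def)
  show b: "points_of (transform s P) x = s ` points_of P x" for x
    by (simp add: points_of_def transform_def image_comp)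
  show "geom_vertices (transform s P) = s ` geom_vertices P"
    by (simp add: geom_vertices_def transform_def image_comp)
  show "geom_edges (transform s P) = (`) s ` geom_edges P"
    unfolding geom_edges_def a b by (simp add: image_comp comp_def)
  show "geom_faces (transform s P) = (`) ((`) s) ` geom_faces P"
    unfolding geom_faces_def a b by (simp add: image_comp image_image comp_def)
qed

lemma transform_transform: "transform t (transform s P) = transform (t \<circ> s) P"
  by (simp add: transform_def comp_assoc)

lemma transform_id: "transform id P = P" by (cases P) (simp add: transform_def)

lemma noble_transform:
  assumes s: "isometry s" and P: "noble P" shows "noble (transform s P)"
proof -
  interpret realized_polyhedron P using P by unfold_locales (simp add: noble_def)
  have s': "ginv s \<circ> s = id" "s \<circ> ginv s = id" using isometry_inj[OF s] isometry_surj[OF s] by (simp_all add: surj_iff)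
  have "symmetry (transform s P) \<phi>" if "symmetry P \<phi>" for \<phi>
  proof -
    obtain h where h: "poset_automorphism r \<phi>" "induced_by P \<phi> h"
      using \<open>symmetry P \<phi>\<close> unfolding symmetry_def by blast
    have "ginv s \<circ> (s \<circ> h \<circ> ginv s) \<circ> s = h" using s' by (auto simp: fun_eq_iff)
    hence "induced_by (transform s P) \<phi> (s \<circ> h \<circ> ginv s)"
      unfolding symmetry_transform[OF s] using h by simp
    thus ?thesis using h by (auto simp: symmetry_def)
  qed
  thus ?thesis using P transform_is_polyhedron[OF s] unfolding noble_def by (simp; metis)
qed

locale noble_polyhedron = realized_polyhedron +
  assumes noble: "noble P"
begin

lemma vertex_transitive:
  assumes "x \<in> V" "y \<in> V" obtains h where "h \<in> Sym" "h x = y"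
proof -
  obtain v w where vw: "v \<in> vertices r" "w \<in> vertices r" "x = pos P v" "y = pos P w"
    using assms by (auto simp: geom_vertices_def)
  then obtain \<phi> where "symmetry P \<phi>" "\<phi> v = w" using noble unfolding noble_def by metis
  then obtain h where h: "poset_automorphism r \<phi>" "induced_by P \<phi> h" unfolding symmetry_def by blast
  hence "h x = y" using vw \<open>\<phi> v = w\<close> unfolding induced_by_def by metis
  moreover have "h \<in> Sym" using h unfolding symmetry_group_def by blast
  ultimately show ?thesis by (rule that[rotated])
qed

lemma face_transitive:
  assumes "f \<in> faces r" "g \<in> faces r"
  obtains h where "h \<in> Sym" "h ` X f = X g" "(`) h ` gface f = gface g"
proof -
  obtain \<phi> where "symmetry P \<phi>" "\<phi> f = g" using noble assms unfolding noble_def by metis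
  then obtain h where h: "poset_automorphism r \<phi>" "induced_by P \<phi> h" unfolding symmetry_def by blast
  thus ?thesis using that[of h] automorphism_image(3,4)[OF h, of f] assms \<open>\<phi> f = g\<close> faces_iff
    by (auto simp: symmetry_group_def)
qed

end

lemma noble_polyhedronI: "noble P \<Longrightarrow> noble_polyhedron P" by unfold_locales (auto simp: noble_def)

text \<open>The symmetries permute the vertices, so they fix the centroid.\<close>
lemma noble_centre:
  assumes "noble P"
  obtains s where "isometry s" "\<And>h. h \<in> symmetry_group (transform s P) \<Longrightarrow> orth h"
proof -
  interpret noble_polyhedron P by (rule noble_polyhedronI[OF assms])
  let ?V = "geom_vertices P"
  define c where "c = (1 / real (card ?V)) *\<^sub>R \<Sum>?V"
  show thesis
  proof
    show s: "isometry (\<lambda>x. x - c)" by (rule isometry_translation)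
    fix h assume h: "h \<in> symmetry_group (transform (\<lambda>x. x - c) P)"
    then obtain g where g: "g \<in> symmetry_group P" "(\<lambda>x. x - c) \<circ> g = h \<circ> (\<lambda>x. x - c)"
      unfolding symmetry_group_transform[OF s] by blast
    have "g c = c" unfolding c_def
      using isometry_sum[OF symmetry_group_isometry[OF g(1)] finite_V symmetry_group_vertices[OF g(1)] V_nonempty] .
    hence "h 0 = 0" using fun_cong[OF g(2), of c] by simp
    moreover have "isometry h" using h by (auto simp: symmetry_group_def induced_by_def)
    ultimately show "orth h" by (rule isometry_fixing_0[rotated])
  qed
qed

section \<open>Groups of orthogonal transformations\<close>

definition orth_group :: "space_map set \<Rightarrow> bool" where
  "orth_group G \<longleftrightarrow> (\<forall>g\<in>G. orth g) \<and> id \<in> G \<and>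
     (\<forall>g\<in>G. \<forall>h\<in>G. g \<circ> h \<in> G) \<and> (\<forall>g\<in>G. ginv g \<in> G)"

lemma orth_groupD:
  assumes "orth_group G"
  shows "g \<in> G \<Longrightarrow> orth g" "id \<in> G" "g \<in> G \<Longrightarrow> h \<in> G \<Longrightarrow> g \<circ> h \<in> G"
    "g \<in> G \<Longrightarrow> ginv g \<in> G" using assms by (auto simp: orth_group_def)

definition rotations :: "space_map set \<Rightarrow> space_map set" where
  "rotations G = {g \<in> G. det (matrix g) = 1}"

lemma det_matrix_comp:
  fixes g h :: space_map
  assumes "orth g" "orth h"
  shows "det (matrix (g \<circ> h)) = det (matrix g) * det (matrix h)"
  using assms matrix_compose[of h g] orth_linear det_mul
  by (metis linear_matrix_vector_mul_eq)

lemma det_matrix_id: "det (matrix (id :: real^3 \<Rightarrow> real^3)) = 1"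
  by (simp add: matrix_id_mat_1[unfolded id_def] id_def)

lemma orth_det_cases:
  fixes g :: space_map
  assumes "orth g" shows "det (matrix g) = 1 \<or> det (matrix g) = -1"
  using orthogonal_transformation_det[OF assms] by linarith

lemma orth_inv_simps:
  fixes g :: space_map
  assumes "orth g"
  shows "ginv g (g x) = x" "g (ginv g x) = x" "ginv g \<circ> g = id" "g \<circ> ginv g = id"
    "orth (ginv g)"
  using orth_inj[OF assms] orthogonal_transformation_surj[OF assms]
    orthogonal_transformation_inv[OF assms] by (simp_all add: surj_f_inv_f fun_eq_iff)

lemma det_matrix_inv:
  fixes g :: space_map
  assumes "orth g"
  shows "det (matrix (ginv g)) = det (matrix g)"
proof -
  have "det (matrix (ginv g)) * det (matrix g) = 1"
    using det_matrix_comp[OF orth_inv_simps(5)[OF assms] assms] orth_inv_simps(3)[OF assms] det_matrix_id by simp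
  thus ?thesis using orth_det_cases[OF assms] by auto
qed

lemma orth_group_rotations: assumes "orth_group G" shows "orth_group (rotations G)"
  using assms det_matrix_comp det_matrix_id det_matrix_inv unfolding orth_group_def rotations_def by auto

lemma orth_inner: "orth g \<Longrightarrow> g x \<bullet> g y = x \<bullet> y" by (simp add: orth_def)
lemma orth_norm: "orth g \<Longrightarrow> norm (g x) = norm x" by (rule orthogonal_transformation_norm)
lemma orth_minus: "orth g \<Longrightarrow> g (- x) = - g x"
  using linear_neg orth_linear by blast
lemma orth_scale: "orth g \<Longrightarrow> g (c *\<^sub>R x) = c *\<^sub>R g x" by (rule orthogonal_transformation_scaleR)
lemma orth_add: "orth g \<Longrightarrow> g (x + y) = g x + g y"
  using linear_add orth_linear by blast
lemma orth_diff: "orth g \<Longrightarrow> g (x - y) = g x - g y"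
  using linear_diff orth_linear by blast
lemma orth_eq_iff: "orth g \<Longrightarrow> g x = g y \<longleftrightarrow> x = y"
  using orth_inj by (auto simp: inj_def)

unbundle cross3_syntax

text \<open>
  A nonzero vector orthogonal to \<open>a\<close> and \<open>b\<close> is parallel to their cross
  product, which is not orthogonal to \<open>c\<close>.
\<close>
lemma zero_if_orthogonal_to_basis:
  fixes x :: "real^3"
  assumes "x \<bullet> a = 0" "x \<bullet> b = 0" "x \<bullet> c = 0" "(a \<times> b) \<bullet> c \<noteq> 0"
  shows "x = 0"
proof -
  have "x \<times> (a \<times> b) = 0" using Lagrange[of x a b] assms by simp
  hence "x = 0 \<or> a \<times> b = 0 \<or> (\<exists>k. a \<times> b = k *\<^sub>R x)"
    using cross_eq_0[of x "a \<times> b"] unfolding collinear_lemma by blast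
  moreover have "a \<times> b \<noteq> 0" using assms(4) by auto
  moreover have "a \<times> b \<noteq> k *\<^sub>R x" for k using assms(3,4) by auto
  ultimately show ?thesis by blast
qed

lemma inner_eq_basis:
  fixes x y :: "real^3"
  assumes "x \<bullet> a = y \<bullet> a" "x \<bullet> b = y \<bullet> b" "x \<bullet> c = y \<bullet> c" "(a \<times> b) \<bullet> c \<noteq> 0"
  shows "x = y"
  using zero_if_orthogonal_to_basis[of "x - y" a b c] assms by (simp add: inner_diff_left)

lemma unit_inner_eq_1:
  fixes p q :: "real^3"
  assumes "norm p = 1" "norm q = 1" "p \<bullet> q = 1" shows "p = q"
  using assms norm_eq_1 vector_eq[of p q] by (metis inner_commute)

lemma unit_ne_minus: "norm (p :: real^3) = 1 \<Longrightarrow> p \<noteq> - p"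
  by (auto simp: eq_neg_iff_add_eq_0 simp flip: scaleR_2)

lemma unit_cross_nonzero:
  fixes p q :: "real^3"
  assumes "norm p = 1" "norm q = 1" "q \<noteq> p" "q \<noteq> - p" shows "p \<times> q \<noteq> 0" "(p \<bullet> q)\<^sup>2 < 1"
proof -
  have "p \<bullet> q \<noteq> 1" "p \<bullet> q \<noteq> -1"
    using unit_inner_eq_1[of p q] unit_inner_eq_1[of p "-q"] assms by auto
  moreover have "\<bar>p \<bullet> q\<bar> \<le> 1" using Cauchy_Schwarz_ineq2[of p q] assms by simp
  ultimately have "\<bar>p \<bullet> q\<bar> < 1" by linarith
  thus "(p \<bullet> q)\<^sup>2 < 1" by (simp add: abs_square_less_1)
  hence "(norm (p \<times> q))\<^sup>2 > 0" using norm_cross[of p q] assms by simp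
  thus "p \<times> q \<noteq> 0" by auto
qed

text \<open>A rotation of space has an axis: \<open>det (A - 1) = det (1 - A)\<close> by orthogonality, so \<open>A - 1\<close> is singular.\<close>
lemma rotation_axis:
  fixes g :: space_map
  assumes g: "orth g" and det: "det (matrix g) = 1"
  obtains p where "norm p = 1" "g p = p"
proof -
  let ?A = "matrix g"
  have A: "orthogonal_matrix ?A" "\<And>x. ?A *v x = g x"
    using g orthogonal_transformation_matrix by force+
  have "?A - mat 1 = ?A ** (mat 1 - transpose ?A)"
  proof -
    have "?A ** (mat 1 - transpose ?A) = ?A ** mat 1 - ?A ** transpose ?A"
      by (simp add: matrix_matrix_mult_def vec_eq_iff sum_subtractf right_diff_distrib)
    thus ?thesis using A(1) by (simp add: orthogonal_matrix_def)
  qed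
  hence "det (?A - mat 1) = det (mat 1 - transpose ?A)" using det by (simp add: det_mul)
  also have "mat 1 - transpose ?A = transpose (mat 1 - ?A)"
    by (simp add: transpose_def mat_def vec_eq_iff)
  also have "det (transpose (mat 1 - ?A)) = det (mat 1 - ?A)" by simp
  also have "\<dots> = - det (?A - mat 1)" by (simp add: det_3 mat_def algebra_simps)
  finally have "det (?A - mat 1) = 0" by simp
  then obtain x where x: "x \<noteq> 0" "(?A - mat 1) *v x = 0"
    using det_eq_0_rank[of "?A - mat 1"] matrix_nonfull_linear_equations_eq[of "?A - mat 1"]
    by (metis less_irrefl)
  hence "g x = x" using A(2)[of x] by (simp add: matrix_vector_mult_diff_rdistrib)
  hence "g (x /\<^sub>R norm x) = x /\<^sub>R norm x" using orth_scale[OF g] by simp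
  thus thesis using that[of "x /\<^sub>R norm x"] x by simp
qed

lemma rotation_fixing_two:
  fixes g :: space_map
  assumes g: "orth g" and det: "det (matrix g) = 1"
    and pq: "g p = p" "g q = q" "p \<times> q \<noteq> 0"
  shows "g = id"
proof
  fix x
  have c: "g (p \<times> q) = p \<times> q" using cross_orthogonal_transformation[OF g, of p q] det pq by simp
  have "g x \<bullet> p = x \<bullet> p" "g x \<bullet> q = x \<bullet> q" "g x \<bullet> (p \<times> q) = x \<bullet> (p \<times> q)"
    using orth_inner[OF g, of x p] orth_inner[OF g, of x q] orth_inner[OF g, of x "p \<times> q"] pq c by simp_all
  thus "g x = id x" using inner_eq_basis[of "g x" p x q "p \<times> q"] pq(3) by simp
qed

lemma rotation_fixed_units:
  fixes g :: space_map
  assumes g: "orth g" and det: "det (matrix g) = 1" and "g \<noteq> id"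
    and "g p = p" "g q = q" "norm p = 1" "norm q = 1"
  shows "q = p \<or> q = - p"
  using rotation_fixing_two[OF g det, of p q] unit_cross_nonzero[of p q] assms by blast

text \<open>
  With the vectors as rows of \<open>A\<close> and \<open>B\<close>, the map sought has the transpose of \<open>A^-1 B\<close> as its
  matrix, and equality of the Gram matrices \<open>A A^T\<close> and \<open>B B^T\<close> makes it orthogonal.
\<close>
lemma orth_of_Gram:
  fixes a b c a' b' c' :: "real^3"
  assumes "(a \<times> b) \<bullet> c \<noteq> 0"
    and "a' \<bullet> a' = a \<bullet> a" "b' \<bullet> b' = b \<bullet> b" "c' \<bullet> c' = c \<bullet> c"
    and "a' \<bullet> b' = a \<bullet> b" "a' \<bullet> c' = a \<bullet> c" "b' \<bullet> c' = b \<bullet> c"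
  obtains s where "orth s" "s a = a'" "s b = b'" "s c = c'"
proof -
  define A :: "real^3^3" where "A = vector [a, b, c]"
  define B :: "real^3^3" where "B = vector [a', b', c']"
  have "det A = a \<bullet> (b \<times> c)" unfolding A_def by (simp add: dot_cross_det)
  hence "det A \<noteq> 0" using assms(1) by (simp add: cross3_simps)
  then obtain C where C: "A ** C = mat 1" "C ** A = mat 1"
    using invertible_det_nz[of A] unfolding invertible_def by blast
  have gram: "B ** transpose B = A ** transpose A"
    unfolding matrix_mult_transpose_dot_row A_def B_def vec_eq_iff forall_3
    using assms by (simp add: row_def vec_lambda_eta inner_commute)
  define S where "S = transpose (C ** B)"
  have "transpose S ** S = C ** (B ** transpose B) ** transpose C"
    unfolding S_def by (simp add: matrix_transpose_mul matrix_mul_assoc)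
  also have "\<dots> = (C ** A) ** transpose (C ** A)"
    unfolding gram by (simp add: matrix_transpose_mul matrix_mul_assoc)
  also have "\<dots> = mat 1" using C by simp
  finally have "orthogonal_matrix S" by (simp add: orthogonal_matrix)
  hence S: "orth (\<lambda>x. S *v x)" by (simp add: orthogonal_transformation_matrix)
  have "S *v (transpose A *v x) = transpose B *v x" for x
  proof -
    have "S ** transpose A = transpose B"
      unfolding S_def by (metis C(1) matrix_mul_lid matrix_mul_assoc matrix_transpose_mul)
    thus ?thesis by (simp add: matrix_vector_mul_assoc del: transpose_matrix_vector)
  qed
  from this[of "axis 1 1"] this[of "axis 2 1"] this[of "axis 3 1"]
  have "S *v a = a'" "S *v b = b'" "S *v c = c'"
    unfolding A_def B_def by (simp_all add: matrix_vector_mul_component transpose_def matrix_vector_mult_def axis_def if_distrib vec_lambda_eta cong: if_cong)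
  with S that show thesis by blast
qed

lemma four_orthogonal_vectors:
  fixes a b c d :: "real^3"
  assumes "a \<bullet> b = 0" "a \<bullet> c = 0" "a \<bullet> d = 0" "b \<bullet> c = 0" "b \<bullet> d = 0" "c \<bullet> d = 0"
    "a \<noteq> 0" "b \<noteq> 0" "c \<noteq> 0"
  shows "d = 0"
proof -
  have "(norm (a \<times> b))\<^sup>2 = (norm a)\<^sup>2 * (norm b)\<^sup>2" using norm_cross[of a b] assms by simp
  hence ab: "a \<times> b \<noteq> 0" using assms by auto
  have "c \<times> (a \<times> b) = 0" using Lagrange[of c a b] assms by (simp add: inner_commute)
  hence "(norm c)\<^sup>2 * (norm (a \<times> b))\<^sup>2 = (c \<bullet> (a \<times> b))\<^sup>2" using norm_cross[of c "a \<times> b"] by simp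
  hence "(a \<times> b) \<bullet> c \<noteq> 0" using ab assms by (auto simp: inner_commute)
  thus ?thesis using zero_if_orthogonal_to_basis[of d a b c] assms by (simp add: inner_commute)
qed

unbundle no cross3_syntax

section \<open>Counting the poles of a finite rotation group\<close>

text \<open>Lagrange's theorem for groups of maps.\<close>
lemma orth_group_pow_card:
  assumes G: "orth_group G" and fin: "finite G" and g: "g \<in> G"
  shows "(g ^^ card G) = id"
proof -
  let ?M = "\<lparr>carrier = G, mult = (\<circ>), one = id\<rparr>"
  interpret group ?M
  proof (rule groupI)
    fix x assume x: "x \<in> carrier ?M"
    hence "ginv x \<circ> x = id" "ginv x \<in> G" using G orth_inv_simps(3) by (auto simp: orth_group_def)
    thus "\<exists>y\<in>carrier ?M. y \<otimes>\<^bsub>?M\<^esub> x = \<one>\<^bsub>?M\<^esub>" by auto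
  qed (use G in \<open>auto simp: orth_group_def comp_assoc\<close>)
  have "g [^]\<^bsub>?M\<^esub> n = g ^^ n" for n :: nat by (induction n) (simp_all add: funpow_swap1 fun_eq_iff)
  thus ?thesis using pow_order_eq_1[of g] g fin by (simp add: order_def)
qed

definition stab :: "space_map set \<Rightarrow> real^3 \<Rightarrow> space_map set" where
  "stab G p = {g \<in> G. g p = p}"

definition orbit_of :: "space_map set \<Rightarrow> real^3 \<Rightarrow> (real^3) set" where
  "orbit_of G p = (\<lambda>g. g p) ` G"

lemma stab_group: "orth_group G \<Longrightarrow> orth_group (stab G p)"
  unfolding orth_group_def stab_def using orth_inv_simps(1) by (auto) (metis orth_inv_simps(1))

lemma orbit_refl: "orth_group G \<Longrightarrow> p \<in> orbit_of G p"
  unfolding orbit_of_def orth_group_def by (metis id_apply imageI)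

lemma orbit_eq:
  assumes G: "orth_group G" and q: "q \<in> orbit_of G p" shows "orbit_of G q = orbit_of G p"
proof -
  obtain g where g: "g \<in> G" "q = g p" using q by (auto simp: orbit_of_def)
  show ?thesis
  proof (intro equalityI subsetI)
    fix x assume "x \<in> orbit_of G q"
    then obtain h where "h \<in> G" "x = (h \<circ> g) p" using g by (auto simp: orbit_of_def)
    thus "x \<in> orbit_of G p" using orth_groupD(3)[OF G] g unfolding orbit_of_def by blast
  next
    fix x assume "x \<in> orbit_of G p"
    then obtain h where h: "h \<in> G" "x = h p" by (auto simp: orbit_of_def)
    hence "x = (h \<circ> ginv g) q" using g orth_inv_simps(1)[OF orth_groupD(1)[OF G]] by simp
    thus "x \<in> orbit_of G q" using orth_groupD(3,4)[OF G] g h unfolding orbit_of_def by blast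
  qed
qed

lemma orbit_stabilizer:
  assumes G: "orth_group G" and fin: "finite G"
  shows "card (orbit_of G p) * card (stab G p) = card G"
proof -
  have fib: "card {g. g \<in> G \<and> g p = q} = card (stab G p)" if q: "q \<in> orbit_of G p" for q
  proof -
    obtain h where h: "h \<in> G" "q = h p" using q by (auto simp: orbit_of_def)
    note ho = orth_inv_simps[OF orth_groupD(1)[OF G h(1)]]
    have "bij_betw (\<lambda>g. h \<circ> g) (stab G p) {g. g \<in> G \<and> g p = q}"
    proof (rule bij_betw_byWitness[where f' = "\<lambda>g. ginv h \<circ> g"])
      show "\<forall>g\<in>stab G p. ginv h \<circ> (h \<circ> g) = g"
        "\<forall>g\<in>{g. g \<in> G \<and> g p = q}. h \<circ> (ginv h \<circ> g) = g" using ho by (simp_all add: fun_eq_iff)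
      show "(\<lambda>g. h \<circ> g) ` stab G p \<subseteq> {g. g \<in> G \<and> g p = q}"
        using h orth_groupD(3)[OF G] by (auto simp: stab_def)
      show "(\<lambda>g. ginv h \<circ> g) ` {g. g \<in> G \<and> g p = q} \<subseteq> stab G p"
        using h ho(1) orth_groupD(3,4)[OF G] by (auto simp: stab_def)
    qed
    from bij_betw_same_card[OF this] show ?thesis by simp
  qed
  have "card G = (\<Sum>g\<in>G. 1)" by simp
  also have "\<dots> = (\<Sum>q\<in>orbit_of G p. \<Sum>g\<in>{g. g \<in> G \<and> g p = q}. 1)"
    unfolding orbit_of_def by (rule sum.image_gen[OF fin])
  also have "\<dots> = (\<Sum>q\<in>orbit_of G p. card (stab G p))" using fib by (intro sum.cong) auto
  finally show ?thesis by simp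
qed

locale rotation_group =
  fixes G :: "space_map set"
  assumes G: "orth_group G" and finite: "finite G" and det: "\<And>g. g \<in> G \<Longrightarrow> det (matrix g) = 1"
begin

definition poles :: "(real^3) set" where
  "poles = {p. norm p = 1 \<and> (\<exists>g\<in>G. g \<noteq> id \<and> g p = p)}"

lemma orth: "g \<in> G \<Longrightarrow> orth g" using orth_groupD(1)[OF G] .

lemma fixed_units:
  assumes "g \<in> G" "g \<noteq> id" "g p = p" "g q = q" "norm p = 1" "norm q = 1" shows "q = p \<or> q = - p"
  using rotation_fixed_units[OF orth det] assms by metis

lemma fixed_poles: assumes "g \<in> G" "g \<noteq> id" shows "\<exists>p. {q \<in> poles. g q = q} = {p, - p} \<and> p \<noteq> - p"
proof -
  obtain p where p: "norm p = 1" "g p = p" using rotation_axis[OF orth det] assms by metis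
  hence "g (- p) = - p" using orth_minus[OF orth[OF assms(1)], of p] by simp
  hence "{q \<in> poles. g q = q} = {p, - p}"
    using p assms fixed_units[OF assms(1,2) p(2)] unfolding poles_def by auto
  moreover have "p \<noteq> - p" using unit_ne_minus[OF p(1)] .
  ultimately show ?thesis by blast
qed

lemma pole_neg: "p \<in> poles \<Longrightarrow> - p \<in> poles"
proof -
  assume "p \<in> poles"
  then obtain g where g: "g \<in> G" "g \<noteq> id" "g p = p" "norm p = 1" by (auto simp: poles_def)
  hence "g (- p) = - p" using orth_minus[OF orth[OF g(1)], of p] by simp
  thus ?thesis using g by (auto simp: poles_def)
qed

lemma finite_poles: "finite poles"
proof -
  have "poles \<subseteq> (\<Union>g\<in>G - {id}. {q \<in> poles. g q = q})" unfolding poles_def by auto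
  have fp: "Finite_Set.finite {q \<in> poles. g q = q}" if g: "g \<in> G - {id}" for g
  proof -
    obtain p where "{q \<in> poles. g q = q} = {p, - p}" using fixed_poles[of g] g by blast
    thus ?thesis by simp
  qed
  have "Finite_Set.finite (\<Union>g\<in>G - {id}. {q \<in> poles. g q = q})" using finite fp by (intro finite_UN_I) simp_all
  thus ?thesis using finite_subset \<open>poles \<subseteq> _\<close> by blast
qed

text \<open>
  If \<open>p\<close> is fixed by \<open>g\<close>, then \<open>h p\<close> is fixed by the conjugate
  of \<open>g\<close> under \<open>h\<close>.
\<close>
lemma pole_image: assumes "p \<in> poles" "h \<in> G" shows "h p \<in> poles"
proof -
  obtain g where g: "g \<in> G" "g \<noteq> id" "g p = p" "norm p = 1" using assms by (auto simp: poles_def)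
  let ?g = "h \<circ> g \<circ> ginv h"
  have "?g \<in> G"
    by (rule orth_groupD(3)[OF G orth_groupD(3)[OF G assms(2) g(1)] orth_groupD(4)[OF G assms(2)]])
  moreover have "?g (h p) = h p" using g orth_inv_simps[OF orth[OF assms(2)]] by simp
  moreover have "?g \<noteq> id"
  proof
    assume e: "?g = id"
    have "g x = x" for x
      using fun_cong[OF e, of "h x"] orth_inv_simps(1)[OF orth[OF assms(2)]] orth_eq_iff[OF orth[OF assms(2)], of "g x" x] by simp
    thus False using g by auto
  qed
  ultimately show ?thesis using g orth_norm[OF orth[OF assms(2)]] by (auto simp: poles_def)
qed

lemma orbit_poles: "p \<in> poles \<Longrightarrow> orbit_of G p \<subseteq> poles" using pole_image by (auto simp: orbit_of_def)

definition orbits :: "(real^3) set set" where "orbits = orbit_of G ` poles"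

lemma orbit_mem: "O1 \<in> orbits \<Longrightarrow> p \<in> O1 \<Longrightarrow> orbit_of G p = O1 \<and> p \<in> poles"
  using orbit_eq[OF G] orbit_poles by (fastforce simp: orbits_def)

lemma stab_ge_2: assumes "p \<in> poles" shows "card (stab G p) \<ge> 2"
proof -
  obtain g where g: "g \<in> G" "g \<noteq> id" "g p = p" using assms by (auto simp: poles_def)
  hence "{id, g} \<subseteq> stab G p" using orth_groupD(2)[OF G] by (auto simp: stab_def)
  hence "card {id, g} \<le> card (stab G p)" using finite by (intro card_mono) (auto simp: stab_def)
  thus ?thesis using g by simp
qed

lemma orbit_card:
  assumes "O1 \<in> orbits" obtains n where "n \<ge> 2" "card O1 * n = card G" "card O1 \<ge> 1"
    "\<And>p. p \<in> O1 \<Longrightarrow> card (stab G p) = n"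
proof -
  obtain p0 where p0: "p0 \<in> poles" "O1 = orbit_of G p0" using assms by (auto simp: orbits_def)
  have c: "card O1 * card (stab G p) = card G" if "p \<in> O1" for p
    using orbit_stabilizer[OF G finite, of p] orbit_mem[OF assms that] by simp
  have "O1 \<noteq> {}" "Finite_Set.finite O1" using p0 orbit_refl[OF G] finite by (auto simp: orbit_of_def)
  hence "card O1 > 0" by (simp add: card_gt_0_iff)
  thus thesis using that[of "card (stab G p0)"] stab_ge_2[OF p0(1)] c[of p0] c p0 orbit_refl[OF G, of p0]
    by (metis One_nat_def Suc_leI mult_cancel1 not_gr0)
qed

text \<open>
  Each rotation other than the identity has two poles, and a pole with stabilizer of order \<open>n\<close>
  is a pole of \<open>n - 1\<close> such rotations; count these pairs in both ways.
\<close>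
lemma pole_count: "(\<Sum>O1\<in>orbits. card G - card O1) = 2 * (card G - 1)"
proof -
  have "(\<Sum>p\<in>poles. card (stab G p) - 1) = (\<Sum>p\<in>poles. card {g \<in> G - {id}. g p = p})"
  proof (rule sum.cong)
    fix p
    have "{g \<in> G - {id}. g p = p} = stab G p - {id}" by (auto simp: stab_def)
    thus "card (stab G p) - 1 = card {g \<in> G - {id}. g p = p}"
      using orth_groupD(2)[OF G] finite by (simp add: stab_def)
  qed simp
  also have "\<dots> = (\<Sum>g\<in>G - {id}. card {p \<in> poles. g p = p})"
    using sum_multicount_gen[of poles "G - {id}" "\<lambda>p g. g p = p" "\<lambda>g. card {p \<in> poles. g p = p}"]
      finite_poles finite by simp
  also have "\<dots> = (\<Sum>g\<in>G - {id}. 2)"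
  proof (rule sum.cong)
    fix g assume "g \<in> G - {id}"
    then obtain p where "{q \<in> poles. g q = q} = {p, - p}" "p \<noteq> - p" using fixed_poles[of g] by blast
    thus "card {q \<in> poles. g q = q} = 2" by simp
  qed simp
  also have "\<dots> = 2 * (card G - 1)" using orth_groupD(2)[OF G] finite by simp
  finally have 1: "(\<Sum>p\<in>poles. card (stab G p) - 1) = 2 * (card G - 1)" .
  have "(\<Sum>p\<in>poles. card (stab G p) - 1) = (\<Sum>O1\<in>orbits. \<Sum>p\<in>{p. p \<in> poles \<and> orbit_of G p = O1}. card (stab G p) - 1)"
    unfolding orbits_def by (rule sum.image_gen[OF finite_poles])
  also have "\<dots> = (\<Sum>O1\<in>orbits. card G - card O1)"
  proof (rule sum.cong)
    fix O1 assume O: "O1 \<in> orbits"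
    hence eq: "{p. p \<in> poles \<and> orbit_of G p = O1} = O1" using orbit_mem orbit_refl[OF G] by blast
    obtain n where n: "card O1 * n = card G" "\<And>p. p \<in> O1 \<Longrightarrow> card (stab G p) = n" by (metis orbit_card[OF O])
    hence "(\<Sum>p\<in>O1. card (stab G p) - 1) = card O1 * (n - 1)" by simp
    also have "\<dots> = card G - card O1" using n(1) by (simp add: diff_mult_distrib2)
    finally show "(\<Sum>p\<in>{p. p \<in> poles \<and> orbit_of G p = O1}. card (stab G p) - 1) = card G - card O1"
      unfolding eq .
  qed simp
  finally show ?thesis using 1 by simp
qed

lemma neg_orbit_card: "card (orbit_of G (- p)) = card (orbit_of G p)"
proof -
  have "g (- p) = - p \<longleftrightarrow> g p = p" if "g \<in> G" for g using orth_minus[OF orth[OF that], of p] by simp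
  hence "stab G (- p) = stab G p" by (auto simp: stab_def)
  hence "card (orbit_of G (- p)) * card (stab G p) = card (orbit_of G p) * card (stab G p)"
    using orbit_stabilizer[OF G finite] by metis
  moreover have "card (stab G p) > 0" using orth_groupD(2)[OF G] finite by (auto simp: stab_def card_gt_0_iff)
  ultimately show ?thesis by simp
qed

text \<open>
  Write \<open>N\<close> for the order of the group and \<open>N / n\<close> for the size of an orbit, so that \<open>n \<ge> 2\<close>. The
  count says that \<open>2 - 2 / N\<close> is the sum of \<open>1 - 1 / n\<close> over the orbits. Each term is at least
  \<open>1 / 2\<close> and less than \<open>1\<close>, so there are two or three orbits; in the latter case the
  orders are \<open>(2, 2, m)\<close>, \<open>(2, 3, 3)\<close>, \<open>(2, 3, 4)\<close> or \<open>(2, 3, 5)\<close>.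
\<close>
lemma orbit_sizes:
  assumes N: "card G \<ge> 2"
  obtains (two) O1 O2 where "orbits = {O1, O2}" "O1 \<noteq> O2" "card O1 = 1" "card O2 = 1"
  | (three) O1 O2 O3 where "orbits = {O1, O2, O3}" "distinct [O1, O2, O3]"
      "2 * card O1 = card G"
      "(card O2 = card O1 \<and> card O3 = 2) \<or>
       (card G = 12 \<and> card O2 = 4 \<and> card O3 = 4) \<or> (card G = 24 \<and> card O2 = 8 \<and> card O3 = 6) \<or>
       (card G = 60 \<and> card O2 = 20 \<and> card O3 = 12)"
proof -
  have ub: "2 * card O1 \<le> card G \<and> 1 \<le> card O1" if "O1 \<in> orbits" for O1
    using orbit_card[OF that] by (metis mult.commute mult_le_mono2)
  have lo: "card orbits * card G \<le> 2 * (\<Sum>O1\<in>orbits. card G - card O1)"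
  proof -
    have "(\<Sum>O1\<in>orbits. card G) \<le> (\<Sum>O1\<in>orbits. 2 * (card G - card O1))"
      by (rule sum_mono) (use ub in fastforce)
    thus ?thesis by (simp add: sum_distrib_left)
  qed
  have hi: "(\<Sum>O1\<in>orbits. card G - card O1) \<le> card orbits * (card G - 1)"
  proof -
    have "(\<Sum>O1\<in>orbits. card G - card O1) \<le> (\<Sum>O1\<in>orbits. card G - 1)"
      by (rule sum_mono) (use ub in fastforce)
    thus ?thesis by simp
  qed
  have "card orbits * card G < 4 * card G" using lo pole_count N by linarith
  hence "card orbits < 4" by simp
  moreover have "2 * (card G - 1) \<le> card orbits * (card G - 1)" using hi pole_count by simp
  hence "2 \<le> card orbits" using N by simp
  ultimately consider "card orbits = 2" | "card orbits = 3" by linarith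
  thus thesis
  proof cases
    case 1
    then obtain O1 O2 where O: "orbits = {O1, O2}" "O1 \<noteq> O2" by (auto simp: card_2_iff)
    have "(card G - card O1) + (card G - card O2) = 2 * (card G - 1)" using pole_count O by simp
    moreover have "card O1 \<le> card G" "card O2 \<le> card G" "card O1 \<ge> 1" "card O2 \<ge> 1"
      using ub[of O1] ub[of O2] O(1) by simp_all
    ultimately have "card O1 = 1 \<and> card O2 = 1" using N by linarith
    thus thesis using two O by blast
  next
    case 2
    then obtain A B C where O: "orbits = {A, B, C}" "A \<noteq> B" "B \<noteq> C" "A \<noteq> C" by (auto simp: card_3_iff)
    have main: thesis if O: "orbits = {O1, O2, O3}" "distinct [O1, O2, O3]"
      and le: "card O2 \<le> card O1" "card O3 \<le> card O2" for O1 O2 O3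
    proof -
      have s: "card O1 + card O2 + card O3 = card G + 2"
      proof -
        have "(card G - card O1) + (card G - card O2) + (card G - card O3) = 2 * (card G - 1)"
          using pole_count O by (simp add: add.assoc)
        moreover have "card O1 \<le> card G" "card O2 \<le> card G" "card O3 \<le> card G"
          using ub[of O1] ub[of O2] ub[of O3] O(1) by simp_all
        ultimately show ?thesis using N by linarith
      qed
      obtain n1 n2 n3 where n: "n1 \<ge> 2" "card O1 * n1 = card G" "n2 \<ge> 2" "card O2 * n2 = card G"
        "n3 \<ge> 2" "card O3 * n3 = card G" using orbit_card O(1) by (metis insertI1 insertI2)
      have "n1 = 2"
      proof (rule ccontr)
        assume "n1 \<noteq> 2" hence "3 * card O1 \<le> card G" using n mult_le_mono[of 3 n1 "card O1" "card O1"] by (simp add: mult.commute)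
        thus False using s le by linarith
      qed
      hence h1: "2 * card O1 = card G" using n by simp
      have c: "n2 < 4"
      proof (rule ccontr)
        assume "\<not> n2 < 4" hence "4 * card O2 \<le> card G" using n mult_le_mono[of 4 n2 "card O2" "card O2"] by (simp add: mult.commute)
        thus False using s le h1 by linarith
      qed
      have "(card O2 = card O1 \<and> card O3 = 2) \<or>
       (card G = 12 \<and> card O2 = 4 \<and> card O3 = 4) \<or> (card G = 24 \<and> card O2 = 8 \<and> card O3 = 6) \<or>
       (card G = 60 \<and> card O2 = 20 \<and> card O3 = 12)"
      proof (cases "n2 = 2")
        case True
        hence "card O2 = card O1 \<and> card O3 = 2" using s h1 n by auto
        thus ?thesis by blast
      next
        case False
        hence "n2 = 3" using c n by linarith
        hence h2: "3 * card O2 = card G" using n by simp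
        have n3: "n3 < 6"
        proof (rule ccontr)
          assume "\<not> n3 < 6" hence "6 * card O3 \<le> card G" using n mult_le_mono[of 6 n3 "card O3" "card O3"] by (simp add: mult.commute)
          thus False using s h1 h2 by linarith
        qed
        consider "n3 = 2" | "n3 = 3" | "n3 = 4" | "n3 = 5" using n3 n by linarith
        thus ?thesis by cases (use s h1 h2 n le N in \<open>auto; linarith\<close>)+
      qed
      thus thesis using three[OF O h1] by blast
    qed
    show thesis
      using main[of A B C] main[of A C B] main[of B A C] main[of B C A] main[of C A B] main[of C B A] O
      by (metis (no_types, opaque_lifting) distinct_length_2_or_more distinct_singleton insert_commute nle_le)
  qed
qed

end

section \<open>Axial and polyhedral point groups\<close>

definition axial :: "space_map set \<Rightarrow> real^3 \<Rightarrow> bool" where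
  "axial G p \<longleftrightarrow> norm p = 1 \<and> (\<forall>g\<in>G. g p = p \<or> g p = - p)"

locale point_group =
  fixes \<Gamma> :: "space_map set"
  assumes group: "orth_group \<Gamma>" and finite_group: "finite \<Gamma>"

sublocale point_group \<subseteq> rotation_group "rotations \<Gamma>"
  using orth_group_rotations[OF group] finite_group by unfold_locales (auto simp: rotations_def)

context point_group
begin

abbreviation "G \<equiv> rotations \<Gamma>"

lemma orth': "g \<in> \<Gamma> \<Longrightarrow> orth g" using orth_groupD(1)[OF group] .

lemma rotations_sub: "g \<in> G \<Longrightarrow> g \<in> \<Gamma>" by (simp add: rotations_def)

lemma conj_rotation: assumes "g \<in> G" "t \<in> \<Gamma>" shows "t \<circ> g \<circ> ginv t \<in> G" "ginv t \<circ> g \<circ> t \<in> G"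
proof -
  have i: "ginv t \<in> \<Gamma>" using orth_groupD(4)[OF group] assms by blast
  have g: "g \<in> \<Gamma>" "det (matrix g) = 1" using assms by (auto simp: rotations_def)
  have d: "det (matrix t) * det (matrix t) = 1" using orth_det_cases[OF orth'[OF assms(2)]] by auto
  note tt = orth'[OF assms(2)]
  have tg: "t \<circ> g \<in> \<Gamma>" "ginv t \<circ> g \<in> \<Gamma>" using orth_groupD(3)[OF group] assms g i by blast+
  show "t \<circ> g \<circ> ginv t \<in> G" "ginv t \<circ> g \<circ> t \<in> G" unfolding rotations_def
    using orth_groupD(3)[OF group tg(1) i] orth_groupD(3)[OF group tg(2) assms(2)] g d
    by (simp_all add: det_matrix_comp[OF orth'[OF tg(1)] orth'[OF i]] det_matrix_comp[OF orth'[OF tg(2)] tt]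
       det_matrix_comp[OF tt orth'[OF g(1)]] det_matrix_comp[OF orth'[OF i] orth'[OF g(1)]] det_matrix_inv[OF tt])
qed

lemma orbit_conj: assumes t: "t \<in> \<Gamma>" shows "orbit_of G (t p) = t ` orbit_of G p"
proof (intro equalityI subsetI)
  fix x assume "x \<in> orbit_of G (t p)"
  then obtain g where g: "g \<in> G" "x = g (t p)" by (auto simp: orbit_of_def)
  hence "x = t ((ginv t \<circ> g \<circ> t) p)" using orth_inv_simps(2)[OF orth'[OF t]] by simp
  thus "x \<in> t ` orbit_of G p" using conj_rotation(2)[OF g(1) t] unfolding orbit_of_def by blast
next
  fix x assume "x \<in> t ` orbit_of G p"
  then obtain g where g: "g \<in> G" "x = t (g p)" by (auto simp: orbit_of_def)
  hence "x = (t \<circ> g \<circ> ginv t) (t p)" using orth_inv_simps(1)[OF orth'[OF t]] by simp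
  thus "x \<in> orbit_of G (t p)" using conj_rotation(1)[OF g(1) t] unfolding orbit_of_def by blast
qed

lemma pole_image': assumes "p \<in> poles" and t: "t \<in> \<Gamma>" shows "t p \<in> poles"
proof -
  obtain g where g: "g \<in> G" "g \<noteq> id" "g p = p" "norm p = 1" using assms by (auto simp: poles_def)
  let ?g = "t \<circ> g \<circ> ginv t"
  note i = orth_inv_simps[OF orth'[OF t]]
  have "?g (t p) = t p" using g i by simp
  moreover have "?g \<noteq> id"
  proof
    assume e: "?g = id"
    have "g x = x" for x using fun_cong[OF e, of "t x"] i(1) orth_eq_iff[OF orth'[OF t], of "g x" x] by simp
    thus False using g by auto
  qed
  ultimately show ?thesis using g orth_norm[OF orth'[OF t]] conj_rotation(1)[OF g(1) t] by (auto simp: poles_def)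
qed

lemma orbit_image: assumes "O1 \<in> orbits" and t: "t \<in> \<Gamma>" shows "t ` O1 \<in> orbits" "card (t ` O1) = card O1"
proof -
  obtain p where p: "p \<in> poles" "O1 = orbit_of G p" using assms by (auto simp: orbits_def)
  thus "t ` O1 \<in> orbits" using orbit_conj[OF t, of p] pole_image'[OF p(1) t] by (auto simp: orbits_def)
  show "card (t ` O1) = card O1"
    using card_image orth_inj[OF orth'[OF t]] inj_on_subset by blast
qed

lemma orbits_Union: "\<Union>orbits = poles"
  using orbit_refl[OF G] orbit_poles by (fastforce simp: orbits_def)

lemma pole_norm: "p \<in> poles \<Longrightarrow> norm p = 1 \<and> p \<noteq> - p" using unit_ne_minus by (auto simp: poles_def)

lemma neg_orbit: assumes "O1 \<in> orbits" "p \<in> O1" "\<And>A. A \<in> orbits \<Longrightarrow> card A = card O1 \<Longrightarrow> A = O1" shows "- p \<in> O1"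
proof -
  have p: "orbit_of G p = O1" "p \<in> poles" using orbit_mem[OF assms(1,2)] by auto
  have "orbit_of G (- p) \<in> orbits" using pole_neg p by (auto simp: orbits_def)
  hence "orbit_of G (- p) = O1" using assms(3) neg_orbit_card p by metis
  thus ?thesis using orbit_refl[OF G, of "- p"] by simp
qed

text \<open>The rotations form a subgroup of index at most two.\<close>
lemma improper_product:
  assumes "g \<in> \<Gamma>" "g \<notin> G" "t \<in> \<Gamma>" "t \<notin> G" shows "t \<circ> g \<in> G"
proof -
  have "det (matrix g) = -1" "det (matrix t) = -1"
    using assms orth_det_cases[OF orth'] by (auto simp: rotations_def)
  hence "det (matrix (t \<circ> g)) = 1"
    unfolding det_matrix_comp[OF orth'[OF assms(3)] orth'[OF assms(1)]] by simp
  thus ?thesis using orth_groupD(3)[OF group assms(3,1)] unfolding rotations_def by simp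
qed

text \<open>If the rotation subgroup is trivial, at most one further element exists; it is an involution.\<close>
lemma axial_if_no_rotations: assumes "card G < 2" shows "\<exists>p. axial \<Gamma> p"
proof -
  have "G = {id}"
  proof -
    have "card G = 1" using assms orth_groupD(2)[OF G] finite
      by (metis One_nat_def card_0_eq empty_iff less_2_cases_iff)
    thus ?thesis using orth_groupD(2)[OF G] by (metis card_1_singletonE singletonD)
  qed
  show ?thesis
  proof (cases "\<Gamma> \<subseteq> G")
    case True
    thus ?thesis using \<open>G = {id}\<close> unfolding axial_def by (intro exI[of _ "axis 1 1"]) auto
  next
    case False
    then obtain t where t: "t \<in> \<Gamma>" "t \<notin> G" by blast
    have prod: "g \<circ> t = id" if "g \<in> \<Gamma>" "g \<notin> G" for g using improper_product[OF t that] \<open>G = {id}\<close> by blast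
    have tt: "t (t x) = x" for x using prod[OF t] by (metis comp_apply id_apply)
    have all: "g = id \<or> g = t" if "g \<in> \<Gamma>" for g
    proof (cases "g \<in> G")
      case False
      have "g x = t x" for x using prod[OF that False] tt by (metis comp_apply id_apply)
      thus ?thesis by auto
    qed (use \<open>G = {id}\<close> in auto)
    let ?x = "axis 1 1 :: real^3"
    have "\<exists>p. norm p = 1 \<and> (t p = p \<or> t p = - p)"
    proof (cases "?x + t ?x = 0")
      case True thus ?thesis by (intro exI[of _ ?x]) (auto simp: eq_neg_iff_add_eq_0 add.commute)
    next
      case False
      let ?u = "?x + t ?x"
      have "t ?u = ?u" using orth_add[OF orth'[OF t(1)], of ?x "t ?x"] tt by (simp add: add.commute)
      hence "t (?u /\<^sub>R norm ?u) = ?u /\<^sub>R norm ?u" using orth_scale[OF orth'[OF t(1)]] by simp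
      thus ?thesis using False by (intro exI[of _ "?u /\<^sub>R norm ?u"]) auto
    qed
    then obtain p where p: "norm p = 1" "t p = p \<or> t p = - p" by blast
    have "g p = p \<or> g p = - p" if "g \<in> \<Gamma>" for g using all[OF that] p(2) by auto
    thus ?thesis using p unfolding axial_def by blast
  qed
qed

text \<open>Every rotation is an involution, so they commute, and each permutes the two poles of every other one.\<close>
lemma four_group_orbits:
  assumes "card G = 4" "\<And>O1. O1 \<in> orbits \<Longrightarrow> card O1 = 2" "O1 \<in> orbits" "p \<in> O1"
  shows "O1 = {p, - p}"
proof -
  have st: "card (stab G p) = 2" if "p \<in> poles" for p
    using orbit_stabilizer[OF G finite, of p] assms(1,2) that by (auto simp: orbits_def)
  have sq: "g \<circ> g = id" if g: "g \<in> G" for g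
  proof (cases "g = id")
    case False
    then obtain p where p: "norm p = 1" "g p = p" using rotation_axis[OF orth[OF g] det[OF g]] by blast
    hence pp: "p \<in> poles" using g False by (auto simp: poles_def)
    have sub: "{id, g} \<subseteq> stab G p" using g p orth_groupD(2)[OF G] by (auto simp: stab_def)
    have "stab G p = {id, g}"
      using card_subset_eq[OF _ sub] st[OF pp] False finite by (auto simp: stab_def)
    moreover have "g \<circ> g \<in> stab G p" using g p orth_groupD(3)[OF G] by (auto simp: stab_def)
    moreover have "g \<circ> g \<noteq> g"
    proof
      assume "g \<circ> g = g"
      hence "g x = x" for x using orth_eq_iff[OF orth[OF g], of "g x" x] by (metis comp_apply)
      thus False using False by auto
    qed
    ultimately show ?thesis by blast
  qed simp
  have comm: "g (h x) = h (g x)" if "g \<in> G" "h \<in> G" for g h x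
  proof -
    have "(g \<circ> h) \<circ> (g \<circ> h) = id" using sq orth_groupD(3)[OF G that] by blast
    hence "g (h (g (h y))) = y" for y by (metis comp_apply id_apply)
    moreover have "g (g y) = y" "h (h y) = y" for y using sq that by (metis comp_apply id_apply)+
    ultimately show ?thesis by metis
  qed
  have p: "orbit_of G p = O1" "p \<in> poles" using orbit_mem assms by auto
  obtain g where g: "g \<in> G" "g \<noteq> id" "g p = p" "norm p = 1" using p by (auto simp: poles_def)
  have "h p = p \<or> h p = - p" if "h \<in> G" for h
    using fixed_units[OF g(1,2,3), of "h p"] comm[OF g(1) that, of p] g orth_norm[OF orth[OF that]] by simp
  hence "O1 \<subseteq> {p, - p}" using p by (auto simp: orbit_of_def)
  thus ?thesis using card_subset_eq[of "{p, - p}" O1] assms(2)[OF assms(3)] pole_norm[OF p(2)] by simp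
qed

text \<open>
  Two orbits of size one are the ends of an axis. With three orbits of sizes \<open>n, n, 2\<close> and
  \<open>n \<noteq> 2\<close>, the orbit of size two is distinguished by its size, hence consists of the ends of an
  invariant axis. For \<open>n = 2\<close> the rotations are the identity and three half-turns about
  perpendicular axes; an improper element has a square among them, so it cannot permute the
  three axes without fixing one. The remaining cases are the polyhedral ones, in which the orbit
  of the poles of highest order becomes a regular polyhedron.
\<close>
lemma axial_or_polyhedral:
  obtains (axial) p where "axial \<Gamma> p"
  | (tetrahedral) A X Y where "orbits = {A, X, Y}" "card A = 6" "card X = 4" "card Y = 4" "card G = 12"
  | (octahedral) X where "X \<in> orbits" "\<And>A. A \<in> orbits \<Longrightarrow> card A = card X \<Longrightarrow> A = X" "card X = 6" "card G = 24"
  | (icosahedral) X where "X \<in> orbits" "\<And>A. A \<in> orbits \<Longrightarrow> card A = card X \<Longrightarrow> A = X" "card X = 12" "card G = 60"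
proof (cases "card G < 2")
  case True thus thesis using axial_if_no_rotations axial by blast
next
  case False
  hence N: "card G \<ge> 2" by simp
  show thesis
  proof (cases rule: orbit_sizes[OF N])
    case (1 O1 O2)
    obtain p q where pq: "O1 = {p}" "O2 = {q}" using 1 by (metis card_1_singletonE)
    hence P: "poles = {p, q}" using 1 orbits_Union by auto
    hence "- p = q" using pole_neg[of p] pole_norm[of p] by auto
    hence "axial \<Gamma> p" using pole_image'[of p] P pole_norm[of p] unfolding axial_def by auto
    thus thesis by (rule axial)
  next
    case (2 O1 O2 O3)
    show thesis using 2(4)
    proof (elim disjE)
      assume c: "card O2 = card O1 \<and> card O3 = 2"
      show thesis
      proof (cases "card O1 = 2")
        case False
        have uniq: "A = O3" if "A \<in> orbits" "card A = card O3" for A using that c False 2(1) by auto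
        have O3: "O3 \<in> orbits" using 2(1) by simp
        obtain p where p: "p \<in> O3" using c by (metis card.empty ex_in_conv zero_neq_numeral)
        hence pole: "p \<in> poles" using orbit_mem O3 by blast
        have sub: "{p, - p} \<subseteq> O3" using p neg_orbit[OF O3 p uniq] by simp
        have f3: "Finite_Set.finite O3" using c by (metis card.infinite zero_neq_numeral)
        have O3eq: "{p, - p} = O3" using card_subset_eq[OF f3 sub] c pole_norm[OF pole] by simp
        have "t p \<in> O3" if "t \<in> \<Gamma>" for t
          using uniq[OF orbit_image(1)[OF O3 that]] orbit_image(2)[OF O3 that] p by blast
        hence "axial \<Gamma> p" using O3eq pole_norm[OF pole] unfolding axial_def by blast
        thus thesis by (rule axial)
      next
        case True
        have c4: "card G = 4" and all2: "\<And>O1. O1 \<in> orbits \<Longrightarrow> card O1 = 2" using True 2(1,3) c by auto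
        note four = four_group_orbits[OF c4 all2]
        obtain O4 where O4: "O4 \<in> orbits" "\<And>t. t \<in> \<Gamma> \<Longrightarrow> t ` O4 = O4"
        proof (cases "\<Gamma> \<subseteq> G")
          case True
          have "t ` O1 = O1" if "t \<in> \<Gamma>" for t
          proof -
            obtain p where p: "p \<in> O1" using all2[of O1] 2(1) by (metis card.empty ex_in_conv insertI1 zero_neq_numeral)
            hence op: "orbit_of G p = O1" using orbit_mem[of O1 p] 2(1) by blast
            have "t p \<in> O1" using op True that by (auto simp: orbit_of_def)
            hence "orbit_of G (t p) = O1" using orbit_mem[of O1 "t p"] 2(1) by blast
            thus ?thesis using orbit_conj[OF that, of p] op by simp
          qed
          thus thesis using that 2(1) by blast
        next
          case False
          then obtain t where t: "t \<in> \<Gamma>" "t \<notin> G" by blast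
          note prod = improper_product[OF _ _ t]
          have inG: "g ` A = A" if "g \<in> G" "A \<in> orbits" for g A
          proof -
            obtain p where p: "A = orbit_of G p" using \<open>A \<in> orbits\<close> by (auto simp: orbits_def)
            have "g p \<in> orbit_of G p" using that by (auto simp: orbit_of_def)
            thus ?thesis using orbit_conj[OF rotations_sub[OF that(1)], of p] orbit_eq[OF G] p by simp
          qed
          have tt: "t ` t ` A = A" if "A \<in> orbits" for A
            using inG[OF prod[OF t] that] by (simp add: image_comp)
          have inj: "A = B" if "t ` A = t ` B" for A B
            using that orth_inj[OF orth'[OF t(1)]] by (simp add: inj_image_eq_iff)
          have im: "t ` A \<in> {O1, O2, O3}" if "A \<in> {O1, O2, O3}" for A
          proof -
            have "A \<in> orbits" using that unfolding 2(1) .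
            from orbit_image(1)[OF this t(1)] show ?thesis unfolding 2(1) .
          qed
          have "\<exists>A\<in>orbits. t ` A = A"
          proof (rule ccontr)
            assume no: "\<not> (\<exists>A\<in>orbits. t ` A = A)"
            hence n: "t ` O1 \<noteq> O1" "t ` O2 \<noteq> O2" "t ` O3 \<noteq> O3" using 2(1) by auto
            have o: "t ` t ` O1 = O1" "t ` t ` O2 = O2" "t ` t ` O3 = O3" using tt 2(1) by auto
            have d: "O1 \<noteq> O2" "O2 \<noteq> O3" "O1 \<noteq> O3" using 2(2) by auto
            have i: "t ` O1 \<in> {O1, O2, O3}" "t ` O2 \<in> {O1, O2, O3}" "t ` O3 \<in> {O1, O2, O3}" using im by auto
            show False using n o d i by (metis insertE singletonD)
          qed
          then obtain A where A: "A \<in> orbits" "t ` A = A" by blast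
          have "g ` A = A" if "g \<in> \<Gamma>" for g
          proof (cases "g \<in> G")
            case False
            have "t ` g ` A = t ` A" using inG[OF prod[OF that False] A(1)] A(2) by (simp add: image_comp)
            thus ?thesis by (rule inj)
          qed (use inG A in blast)
          thus thesis using that A by blast
        qed
        obtain p where p: "p \<in> O4" using all2[OF O4(1)] by (metis card.empty ex_in_conv zero_neq_numeral)
        have "O4 = {p, - p}" by (rule four[OF _ O4(1) p])
        moreover have "t p \<in> O4" if "t \<in> \<Gamma>" for t using O4(2)[OF that] p by blast
        moreover have "norm p = 1" using pole_norm orbit_mem[OF O4(1) p] by blast
        ultimately have "axial \<Gamma> p" unfolding axial_def by blast
        thus thesis by (rule axial)
      qed
    next
      assume "card G = 12 \<and> card O2 = 4 \<and> card O3 = 4"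
      hence "card O1 = 6" "card O2 = 4" "card O3 = 4" "card G = 12" using 2(3) by linarith+
      thus thesis by (rule tetrahedral[OF 2(1)])
    next
      assume c: "card G = 24 \<and> card O2 = 8 \<and> card O3 = 6"
      have "card O1 \<noteq> card O3" "card O2 \<noteq> card O3" using 2(3) c by linarith+
      hence "A = O3" if "A \<in> orbits" "card A = card O3" for A using that unfolding 2(1) by auto
      thus thesis using c octahedral[of O3] unfolding 2(1) by blast
    next
      assume c: "card G = 60 \<and> card O2 = 20 \<and> card O3 = 12"
      have "card O1 \<noteq> card O3" "card O2 \<noteq> card O3" using 2(3) c by linarith+
      hence "A = O3" if "A \<in> orbits" "card A = card O3" for A using that unfolding 2(1) by auto
      thus thesis using c icosahedral[of O3] unfolding 2(1) by blast
    qed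
  qed
qed

end

section \<open>Coordinates for the polyhedral point groups\<close>

definition v3 :: "real \<Rightarrow> real \<Rightarrow> real \<Rightarrow> real^3" where "v3 x y z = vector [x, y, z]"

lemma v3_simps [simp]:
  "v3 x y z $ 1 = x" "v3 x y z $ 2 = y" "v3 x y z $ 3 = z"
  "v3 x y z \<bullet> v3 x' y' z' = x * x' + y * y' + z * z'"
  "- v3 x y z = v3 (- x) (- y) (- z)"
  "v3 x y z + v3 x' y' z' = v3 (x + x') (y + y') (z + z')"
  "v3 x y z - v3 x' y' z' = v3 (x - x') (y - y') (z - z')"
  "c *\<^sub>R v3 x y z = v3 (c * x) (c * y) (c * z)"
  "v3 x y z = v3 x' y' z' \<longleftrightarrow> x = x' \<and> y = y' \<and> z = z'"
  unfolding v3_def by (simp_all add: inner_vec_def sum_3 vec_eq_iff forall_3)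

lemma v3_eta: "v3 (x $ 1) (x $ 2) (x $ 3) = x" unfolding v3_def by (simp add: vec_eq_iff forall_3)

lemma triple_v3: "cross3 (v3 a b c) (v3 a' b' c') \<bullet> v3 x y z
   = (b * c' - c * b') * x + (c * a' - a * c') * y + (a * b' - b * a') * z"
  unfolding v3_def by (simp add: cross3_def inner_vec_def sum_3)

definition tetra_pts :: "(real^3) set" where
  "tetra_pts = {v3 1 1 1, v3 (-1) (-1) 1, v3 1 (-1) (-1), v3 (-1) 1 (-1)}"

definition octa_pts :: "(real^3) set" where
  "octa_pts = {v3 0 0 1, v3 0 0 (-1), v3 0 1 0, v3 0 (-1) 0, v3 1 0 0, v3 (-1) 0 0}"

definition icosa_half :: "(real^3) set" where
  "icosa_half = {v3 0 1 golden, v3 0 (-1) golden, v3 golden 0 1, v3 1 golden 0, v3 (-1) golden 0, v3 (-golden) 0 1}"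

definition icosa_pts :: "(real^3) set" where "icosa_pts = icosa_half \<union> uminus ` icosa_half"

lemma golden_sq: "golden * golden = golden + 1" unfolding golden_def by (simp add: field_simps)
lemma golden_gt_1: "golden > 1"
proof -
  have "sqrt 5 > sqrt 1" by (rule real_sqrt_less_mono) simp
  thus ?thesis unfolding golden_def by simp
qed
lemma golden_inverse: "1 / golden = golden - 1"
  using golden_sq golden_gt_1 by (simp add: field_simps)
lemma golden_sqrt5: "sqrt 5 * golden = golden + 2"
proof -
  have "sqrt 5 = 2 * golden - 1" by (simp add: golden_def field_simps)
  hence "sqrt 5 * golden = 2 * (golden * golden) - golden" by (simp only:) (simp add: left_diff_distrib)
  thus ?thesis unfolding golden_sq by simp
qed

text \<open>
  A group that preserves a configuration and is transitive on the pairs of points with the same inner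
  product as a base pair is determined by the configuration as far as its rotations are concerned, since
  a rotation fixing two independent vectors is the identity.
\<close>
definition pair_transitive :: "space_map set \<Rightarrow> (real^3) set \<Rightarrow> real^3 \<Rightarrow> real^3 \<Rightarrow> bool" where
  "pair_transitive G X p q \<longleftrightarrow> p \<in> X \<and> q \<in> X \<and> (\<forall>g\<in>G. g ` X = X) \<and>
     (\<forall>x\<in>X. \<forall>y\<in>X. x \<bullet> y = p \<bullet> q \<longrightarrow> (\<exists>g\<in>G. g p = x \<and> g q = y))"

definition conj_by :: "space_map \<Rightarrow> space_map set \<Rightarrow> space_map set" where
  "conj_by s G = (\<lambda>g. ginv s \<circ> g \<circ> s) ` G"

lemma conj_image:
  fixes s g :: space_map
  assumes s: "orth s" and g: "orth g"
    and X: "s ` X' = (\<lambda>x. c *\<^sub>R x) ` X"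
    and gX: "g ` X = Y" and Y: "s ` Y' = (\<lambda>x. c *\<^sub>R x) ` Y"
  shows "(ginv s \<circ> g \<circ> s) ` X' = Y'"
proof -
  have "(ginv s \<circ> g \<circ> s) ` X' = ginv s ` g ` s ` X'" by (simp add: image_comp)
  also have "g ` s ` X' = (\<lambda>x. c *\<^sub>R x) ` g ` X" unfolding X using orth_scale[OF g] by (auto simp: image_iff)
  also have "\<dots> = s ` Y'" using gX Y by simp
  also have "ginv s ` s ` Y' = Y'" using orth_inv_simps(3)[OF s] by (simp add: image_comp)
  finally show ?thesis .
qed

lemma pair_transitive_conj:
  assumes s: "orth s" and G: "orth_group G" and c: "c \<noteq> 0"
    and X: "s ` X' = (\<lambda>x. c *\<^sub>R x) ` X" and p: "s p' = c *\<^sub>R p" and q: "s q' = c *\<^sub>R q"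
    and pt: "pair_transitive G X p q"
  shows "pair_transitive (conj_by s G) X' p' q'"
proof -
  note i = orth_inv_simps[OF s]
  have memiff: "x' \<in> X' \<longleftrightarrow> (\<exists>x\<in>X. s x' = c *\<^sub>R x)" for x'
  proof -
    have "x' \<in> X' \<longleftrightarrow> s x' \<in> s ` X'" using orth_eq_iff[OF s] by (metis imageE imageI)
    thus ?thesis unfolding X by auto
  qed
  have inner: "x' \<bullet> y' = c * c * (x \<bullet> y)" if "s x' = c *\<^sub>R x" "s y' = c *\<^sub>R y" for x' y' x y
    using orth_inner[OF s, of x' y'] that by simp
  show ?thesis unfolding pair_transitive_def
  proof (intro conjI ballI impI)
    show "p' \<in> X'" "q' \<in> X'" using memiff p q pt unfolding pair_transitive_def by blast+
    fix g assume "g \<in> conj_by s G"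
    then obtain h where h: "h \<in> G" "g = ginv s \<circ> h \<circ> s" by (auto simp: conj_by_def)
    show "g ` X' = X'" unfolding h(2)
      using conj_image[OF s orth_groupD(1)[OF G h(1)] X _ X] pt h(1) unfolding pair_transitive_def by blast
  next
    fix x' y' assume xy: "x' \<in> X'" "y' \<in> X'" "x' \<bullet> y' = p' \<bullet> q'"
    obtain x y where x: "x \<in> X" "s x' = c *\<^sub>R x" and y: "y \<in> X" "s y' = c *\<^sub>R y" using memiff xy by blast
    have "x \<bullet> y = p \<bullet> q" using inner[OF x(2) y(2)] inner[OF p q] xy c by simp
    then obtain h where h: "h \<in> G" "h p = x" "h q = y" using pt x y unfolding pair_transitive_def by blast
    have ho: "orth h" using orth_groupD(1)[OF G h(1)] .
    have "(ginv s \<circ> h \<circ> s) p' = x'" "(ginv s \<circ> h \<circ> s) q' = y'"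
      using p q h x y orth_scale[OF ho] i(1) by (metis comp_apply)+
    thus "\<exists>g\<in>conj_by s G. g p' = x' \<and> g q' = y'" using h(1) unfolding conj_by_def by blast
  qed
qed

text \<open>
  Move \<open>x\<close> to the base point \<open>p\<close> first; the pairs at \<open>p\<close> are
  then treated by the stabilizer of \<open>p\<close>.
\<close>
lemma pair_transitive_from_base:
  assumes R: "orth_group R" and p: "p \<in> X" and q: "q \<in> X" and pres: "\<And>g. g \<in> R \<Longrightarrow> g ` X = X"
    and trX: "\<And>x. x \<in> X \<Longrightarrow> \<exists>g\<in>R. g p = x"
    and trq: "\<And>y. y \<in> X \<Longrightarrow> p \<bullet> y = p \<bullet> q \<Longrightarrow> \<exists>g\<in>R. g p = p \<and> g q = y"
  shows "pair_transitive R X p q" unfolding pair_transitive_def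
proof (intro conjI ballI impI)
  fix x y assume xy: "x \<in> X" "y \<in> X" "x \<bullet> y = p \<bullet> q"
  obtain g where g: "g \<in> R" "g p = x" using trX xy by blast
  note i = orth_inv_simps[OF orth_groupD(1)[OF R g(1)]]
  have ig: "ginv g \<in> R" using orth_groupD(4)[OF R g(1)] .
  have "p \<bullet> ginv g y = p \<bullet> q"
    using orth_inner[OF orth_groupD(1)[OF R g(1)], of p "ginv g y"] i g xy by simp
  moreover have "ginv g y \<in> X" using pres[OF ig] xy by blast
  ultimately obtain k where k: "k \<in> R" "k p = p" "k q = ginv g y" using trq by blast
  hence "(g \<circ> k) p = x" "(g \<circ> k) q = y" using g i by simp_all
  thus "\<exists>g\<in>R. g p = x \<and> g q = y" using orth_groupD(3)[OF R g(1) k(1)] by blast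
qed (use p q pres in auto)

context rotation_group
begin

lemma stab_orbit_card:
  assumes "norm p = 1" "norm q = 1" "q \<noteq> p" "q \<noteq> - p"
  shows "card (orbit_of (stab G p) q) = card (stab G p)"
proof -
  have S: "orth_group (stab G p)" "Finite_Set.finite (stab G p)" using stab_group[OF G] finite by (auto simp: stab_def)
  have "stab (stab G p) q = {id}"
    using fixed_units[of _ p q] assms orth_groupD(2)[OF S(1)] by (auto simp: stab_def)
  thus ?thesis using orbit_stabilizer[OF S, of q] by simp
qed

lemma orbit_closed:
  assumes "X \<in> orbits" "x \<in> X" "g \<in> G" shows "g x \<in> X"
  using orbit_mem[OF assms(1,2)] assms(3) by (auto simp: orbit_of_def)

lemma orbit_image_eq:
  assumes "X \<in> orbits" "g \<in> G" shows "g ` X = X"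
proof -
  have "Finite_Set.finite X" using finite_poles orbit_mem[OF assms(1)] finite_subset by (metis subsetI)
  thus ?thesis
    using endo_inj_surj[of X g] orbit_closed[OF assms(1) _ assms(2)] orth_inj[OF orth[OF assms(2)]] inj_on_subset by blast
qed

lemma orbit_transitive:
  assumes "X \<in> orbits" "x \<in> X" "y \<in> X" obtains g where "g \<in> G" "g x = y"
  using orbit_mem[OF assms(1,2)] assms(3) by (auto simp: orbit_of_def)

lemma pair_transitiveI:
  assumes X: "X \<in> orbits" and pq: "p \<in> X" "q \<in> X"
    and nb: "\<And>y. y \<in> X \<Longrightarrow> p \<bullet> y = p \<bullet> q \<Longrightarrow> y \<in> orbit_of (stab G p) q"
  shows "pair_transitive G X p q"
proof (rule pair_transitive_from_base[OF G pq orbit_image_eq[OF X]])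
  show "\<exists>g\<in>G. g p = x" if "x \<in> X" for x using orbit_transitive[OF X pq(1) that] by blast
  show "\<exists>g\<in>G. g p = p \<and> g q = y" if "y \<in> X" "p \<bullet> y = p \<bullet> q" for y
    using nb[OF that] by (auto simp: orbit_of_def stab_def)
qed

lemma stab_orbit_inner: "y \<in> orbit_of (stab G p) q \<Longrightarrow> p \<bullet> y = p \<bullet> q"
proof -
  assume "y \<in> orbit_of (stab G p) q"
  then obtain k where k: "k \<in> G" "k p = p" "y = k q" by (auto simp: orbit_of_def stab_def)
  thus ?thesis using orth_inner[OF orth[OF k(1)], of p q] by simp
qed

lemma stab_orbit_sub: "X \<in> orbits \<Longrightarrow> q \<in> X \<Longrightarrow> orbit_of (stab G p) q \<subseteq> X"
  using orbit_closed by (auto simp: orbit_of_def stab_def)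

lemma orbit_stab_card: "X \<in> orbits \<Longrightarrow> p \<in> X \<Longrightarrow> card X * card (stab G p) = card G"
  using orbit_mem orbit_stabilizer[OF G finite] by metis

end

text \<open>The sum is orthogonal to \<open>a - b\<close>, \<open>c - d\<close> and \<open>a + b - c - d\<close>, which are nonzero and mutually orthogonal.\<close>
lemma equal_inner_sum_zero:
  fixes a b c d :: "real^3"
  assumes n: "a \<bullet> a = 1" "b \<bullet> b = 1" "c \<bullet> c = 1" "d \<bullet> d = 1" and k: "k \<noteq> 1"
    and e: "a \<bullet> b = k" "a \<bullet> c = k" "a \<bullet> d = k" "b \<bullet> c = k" "b \<bullet> d = k" "c \<bullet> d = k"
  shows "a + b + c + d = 0"
proof -
  note s = n e e[unfolded inner_commute[of a] ] inner_commute[of b a] inner_commute[of c a] inner_commute[of d a]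
    inner_commute[of c b] inner_commute[of d b] inner_commute[of d c]
  have nz: "x \<noteq> 0" if "x \<bullet> x \<noteq> 0" for x :: "real^3" using that by auto
  show ?thesis
  proof (rule four_orthogonal_vectors[of "a - b" "c - d" "a + b - c - d"])
    show "a - b \<noteq> 0" by (rule nz) (use k in \<open>simp add: inner_diff_left inner_diff_right inner_commute n e\<close>)
    show "c - d \<noteq> 0" by (rule nz) (use k in \<open>simp add: inner_diff_left inner_diff_right inner_commute n e\<close>)
    have "(a + b - c - d) \<bullet> (a + b - c - d) = 4 - 4 * k"
      by (simp add: inner_diff_left inner_diff_right inner_add_left inner_add_right inner_commute n e)
    thus "a + b - c - d \<noteq> 0" by (intro nz) (use k in simp)
  qed (simp_all add: inner_diff_left inner_diff_right inner_add_left inner_add_right inner_commute n e)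
qed

context point_group
begin

text \<open>
  Four poles form an orbit on which the stabilizer of a pole \<open>p\<close>, of order three, permutes the other
  three. So all inner products of different poles agree, their sum vanishes, and the Gram matrix is
  that of a regular tetrahedron. A symmetry maps this orbit to itself or to the only other orbit of
  size four, which consists of the opposite poles.
\<close>
lemma tetrahedral_coordinates:
  assumes X: "orbits = {A, X, Y}" "card A = 6" "card X = 4" "card Y = 4" "card G = 12"
  obtains s where "orth s"
    "pair_transitive (conj_by s G) tetra_pts (v3 1 1 1) (v3 (-1) (-1) 1)"
    "\<And>g. g \<in> conj_by s \<Gamma> \<Longrightarrow> g ` tetra_pts = tetra_pts \<or> g ` tetra_pts = uminus ` tetra_pts"
proof -
  have Xo: "X \<in> orbits" using X by blast
  have unit: "norm x = 1" if "x \<in> X" for x using orbit_mem[OF Xo that] pole_norm by blast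
  have fX: "Finite_Set.finite X" using X(3) by (metis card.infinite zero_neq_numeral)
  obtain p where p: "p \<in> X" using X(3) by (metis card.empty ex_in_conv zero_neq_numeral)
  have st: "card (stab G p) = 3" using orbit_stab_card[OF Xo p] X by simp
  have "\<not> X \<subseteq> {p, - p}"
  proof
    assume "X \<subseteq> {p, - p}" hence "card X \<le> card {p, - p}" by (intro card_mono) auto
    moreover have "card {p, - p} \<le> 2" by (simp add: card_insert_if)
    ultimately show False using X by simp
  qed
  then obtain q where q: "q \<in> X" "q \<noteq> p" "q \<noteq> - p" by blast
  let ?O = "orbit_of (stab G p) q"
  have O3: "card ?O = 3" using stab_orbit_card[OF unit[OF p] unit[OF q(1)] q(2,3)] st by simp
  have "p \<bullet> q \<noteq> 1" using unit_inner_eq_1[OF unit[OF p] unit[OF q(1)]] q by auto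
  hence "p \<notin> ?O" using stab_orbit_inner[of p p q] unit[OF p] norm_eq_1[of p] by auto
  have fO: "Finite_Set.finite ?O" using stab_orbit_sub[OF Xo q(1)] fX finite_subset by blast
  have sub: "insert p ?O \<subseteq> X" using stab_orbit_sub[OF Xo q(1)] p by blast
  have Xeq: "insert p ?O = X" using card_subset_eq[OF fX sub] O3 \<open>p \<notin> ?O\<close> fO X by simp
  define k where "k = p \<bullet> q"
  have k1: "k \<noteq> 1" using \<open>p \<bullet> q \<noteq> 1\<close> k_def by simp
  have dot: "x \<bullet> y = k" if xy: "x \<in> X" "y \<in> X" "x \<noteq> y" for x y
  proof -
    obtain g where g: "g \<in> G" "g x = p" using orbit_transitive[OF Xo xy(1) p] .
    have "g y \<in> X" "g y \<noteq> p" using orbit_closed[OF Xo xy(2) g(1)] xy g orth_eq_iff[OF orth[OF g(1)], of x y] by auto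
    hence "p \<bullet> g y = k" using Xeq stab_orbit_inner k_def by blast
    thus ?thesis using orth_inner[OF orth[OF g(1)], of x y] g by simp
  qed
  obtain r t u where rtu: "?O = {r, t, u}" "r \<noteq> t" "t \<noteq> u" "r \<noteq> u" using O3 by (auto simp: card_3_iff)
  have X4: "X = {p, r, t, u}" using Xeq rtu by simp
  have d: "p \<noteq> r" "p \<noteq> t" "p \<noteq> u" using \<open>p \<notin> ?O\<close> rtu by auto
  have mem: "p \<in> X" "r \<in> X" "t \<in> X" "u \<in> X" using X4 by auto
  have sq: "x \<bullet> x = 1" if "x \<in> X" for x using unit[OF that] norm_eq_1 by blast
  note D = dot[OF mem(1,2) d(1)] dot[OF mem(1,3) d(2)] dot[OF mem(1,4) d(3)] dot[OF mem(2,3) rtu(2)]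
    dot[OF mem(2,4) rtu(4)] dot[OF mem(3,4) rtu(3)]
  have sum0: "p + r + t + u = 0"
    using equal_inner_sum_zero[OF sq[OF mem(1)] sq[OF mem(2)] sq[OF mem(3)] sq[OF mem(4)] k1 D] .
  have "p \<bullet> (p + r + t + u) = 0" unfolding sum0 by simp
  hence k: "k = - 1 / 3" using D sq[OF mem(1)] by (simp add: inner_add_right)
  have s3: "sqrt 3 * sqrt 3 = 3" by simp
  have gram: "(c *\<^sub>R x) \<bullet> (d *\<^sub>R y) = (c * d) * (x \<bullet> y)" for c d :: real and x y :: "real^3" by simp
  obtain s where s: "orth s" "s (v3 1 1 1) = sqrt 3 *\<^sub>R p"
    "s (v3 (-1) (-1) 1) = sqrt 3 *\<^sub>R r" "s (v3 1 (-1) (-1)) = sqrt 3 *\<^sub>R t"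
    by (rule orth_of_Gram[of "v3 1 1 1" "v3 (-1) (-1) 1" "v3 1 (-1) (-1)"
        "sqrt 3 *\<^sub>R p" "sqrt 3 *\<^sub>R r" "sqrt 3 *\<^sub>R t"])
      (simp_all add: triple_v3 gram s3 sq mem D k)
  have "v3 (-1) 1 (-1) = - (v3 1 1 1 + v3 (-1) (-1) 1 + v3 1 (-1) (-1))" by simp
  hence "s (v3 (-1) 1 (-1)) = - (sqrt 3 *\<^sub>R p + sqrt 3 *\<^sub>R r + sqrt 3 *\<^sub>R t)"
    using orth_add[OF s(1)] orth_minus[OF s(1)] s by metis
  also have "\<dots> = sqrt 3 *\<^sub>R (- (p + r + t))" by (simp add: scaleR_add_right scaleR_diff_right)
  also have "- (p + r + t) = u" using sum0 by (metis add_eq_0_iff minus_unique add.commute)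
  finally have su: "s (v3 (-1) 1 (-1)) = sqrt 3 *\<^sub>R u" .
  have SX: "s ` tetra_pts = (\<lambda>x. sqrt 3 *\<^sub>R x) ` X" unfolding tetra_pts_def X4 using s su by simp
  have "r \<in> ?O" using rtu by simp
  have Or: "orbit_of (stab G p) r = ?O" using orbit_eq[OF stab_group[OF G] \<open>r \<in> ?O\<close>] .
  have pt: "pair_transitive G X p r"
  proof (rule pair_transitiveI[OF Xo mem(1,2)])
    fix y assume "y \<in> X" "p \<bullet> y = p \<bullet> r"
    thus "y \<in> orbit_of (stab G p) r" unfolding Or using Xeq sq[OF p] D k by auto
  qed
  show thesis
  proof
    show "orth s" by fact
    show "pair_transitive (conj_by s G) tetra_pts (v3 1 1 1) (v3 (- 1) (- 1) 1)"
      using pair_transitive_conj[OF s(1) G _ SX s(2,3) pt] by simp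
    fix g assume "g \<in> conj_by s \<Gamma>"
    then obtain h where h: "h \<in> \<Gamma>" "g = ginv s \<circ> h \<circ> s" by (auto simp: conj_by_def)
    have neg: "uminus ` X = Y"
    proof -
      have o: "orbit_of G (- p) = uminus ` X"
      proof -
        have "orbit_of G (- p) = (\<lambda>g. - g p) ` G" unfolding orbit_of_def using orth_minus[OF orth] by (intro image_cong) auto
        thus ?thesis using orbit_mem[OF Xo p] by (auto simp: orbit_of_def image_image)
      qed
      have "- p \<in> poles" using orbit_mem[OF Xo p] pole_neg by blast
      hence "uminus ` X \<in> orbits" using o by (auto simp: orbits_def)
      hence "uminus ` X = A \<or> uminus ` X = X \<or> uminus ` X = Y" using X(1) by simp
      moreover have "card (uminus ` X) = 4" using X by (simp add: card_image)
      moreover have "uminus ` X \<noteq> X"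
      proof
        assume "uminus ` X = X"
        hence "- p \<in> X" using p by blast
        hence "p \<bullet> (- p) = k" using dot[OF p, of "- p"] unit_ne_minus[OF unit[OF p]] by blast
        thus False using k sq[OF p] by simp
      qed
      ultimately show ?thesis using X(2) by auto
    qed
    have "h ` X \<in> orbits" "card (h ` X) = 4" using orbit_image[OF Xo h(1)] X by auto
    hence "h ` X = X \<or> h ` X = uminus ` X" using X(1,2) neg by auto
    moreover have "s ` (uminus ` tetra_pts) = (\<lambda>x. sqrt 3 *\<^sub>R x) ` uminus ` X"
    proof -
      have "s ` (uminus ` tetra_pts) = uminus ` s ` tetra_pts" using orth_minus[OF s(1)] by (auto simp: image_image)
      thus ?thesis unfolding SX by (simp add: image_image)
    qed
    ultimately show "g ` tetra_pts = tetra_pts \<or> g ` tetra_pts = uminus ` tetra_pts"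
      unfolding h(2) using conj_image[OF s(1) orth'[OF h(1)] SX _ SX] conj_image[OF s(1) orth'[OF h(1)] SX] by blast
  qed
qed

text \<open>
  The orbit \<open>X\<close> of six poles is closed under negation. The stabilizer of \<open>p\<close>, of order four, permutes
  transitively the poles other than \<open>p\<close> and \<open>- p\<close>; these include with \<open>q\<close> also \<open>- q\<close>, so they are
  orthogonal to \<open>p\<close>.
\<close>
lemma octahedral_coordinates:
  assumes Xo: "X \<in> orbits" and uniq: "\<And>A. A \<in> orbits \<Longrightarrow> card A = card X \<Longrightarrow> A = X" and c: "card X = 6" "card G = 24"
  obtains s where "orth s" "pair_transitive (conj_by s G) octa_pts (v3 0 0 1) (v3 0 1 0)"
    "\<And>g. g \<in> conj_by s \<Gamma> \<Longrightarrow> g ` octa_pts = octa_pts"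
proof -
  have unit: "norm x = 1" if "x \<in> X" for x using orbit_mem[OF Xo that] pole_norm by blast
  have sq: "x \<bullet> x = 1" if "x \<in> X" for x using unit[OF that] norm_eq_1 by blast
  have neg: "- x \<in> X" if "x \<in> X" for x using neg_orbit[OF Xo that uniq] .
  have fX: "Finite_Set.finite X" using c by (metis card.infinite zero_neq_numeral)
  obtain p where p: "p \<in> X" using c by (metis card.empty ex_in_conv zero_neq_numeral)
  have st: "card (stab G p) = 4" using orbit_stab_card[OF Xo p] c by simp
  have pm: "p \<noteq> - p" using unit_ne_minus[OF unit[OF p]] .
  have c4: "card (X - {p, - p}) = 4" using c p neg[OF p] pm fX by (simp add: card_Diff_subset)
  then obtain q where q: "q \<in> X - {p, - p}" by (metis card.empty ex_in_conv zero_neq_numeral)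
  hence q': "q \<in> X" "q \<noteq> p" "q \<noteq> - p" by auto
  let ?O = "orbit_of (stab G p) q"
  have O4: "card ?O = 4" using stab_orbit_card[OF unit[OF p] unit[OF q'(1)] q'(2,3)] st by simp
  have "(p \<bullet> q)\<^sup>2 < 1" using unit_cross_nonzero(2)[OF unit[OF p] unit[OF q'(1)] q'(2,3)] .
  hence "p \<bullet> q \<noteq> 1" "p \<bullet> q \<noteq> -1" by auto
  hence "p \<notin> ?O" "- p \<notin> ?O" using stab_orbit_inner[of p p q] stab_orbit_inner[of "- p" p q] sq[OF p] by auto
  hence sub: "?O \<subseteq> X - {p, - p}" using stab_orbit_sub[OF Xo q'(1)] by blast
  have Oeq: "?O = X - {p, - p}" using card_subset_eq[OF _ sub] fX O4 c4 by simp
  have "- q \<in> ?O" unfolding Oeq using neg[OF q'(1)] q' by auto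
  hence pq: "p \<bullet> q = 0" using stab_orbit_inner[of "- q" p q] by simp
  have dot: "x \<bullet> y = 0" if xy: "x \<in> X" "y \<in> X" "y \<noteq> x" "y \<noteq> - x" for x y
  proof -
    obtain g where g: "g \<in> G" "g x = p" using orbit_transitive[OF Xo xy(1) p] .
    have "g y \<in> X - {p, - p}" using orbit_closed[OF Xo xy(2) g(1)] xy g
      orth_eq_iff[OF orth[OF g(1)], of y x] orth_eq_iff[OF orth[OF g(1)], of y "- x"] orth_minus[OF orth[OF g(1)], of x] by auto
    hence "p \<bullet> g y = 0" using Oeq stab_orbit_inner[of "g y" p q] pq by simp
    thus ?thesis using orth_inner[OF orth[OF g(1)], of x y] g by simp
  qed
  have qm: "q \<noteq> - q" using unit_ne_minus[OF unit[OF q'(1)]] .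
  have "card (X - {p, - p} - {q, - q}) = 2"
    using c4 q neg[OF q'(1)] q' qm fX by (subst card_Diff_subset) auto
  then obtain r where r: "r \<in> X - {p, - p} - {q, - q}" by (metis card.empty ex_in_conv zero_neq_numeral)
  have rX: "r \<in> X" using r by blast
  have rm: "r \<noteq> - r" using unit_ne_minus[OF unit[OF rX]] .
  have neq: "r \<noteq> p" "r \<noteq> - p" "r \<noteq> q" "r \<noteq> - q" "- r \<noteq> p" "- r \<noteq> q" using r by auto
  have sub6: "{p, - p, q, - q, r, - r} \<subseteq> X" using p q'(1) rX neg by blast
  have "- q \<noteq> p" using q' by auto
  hence "card {p, - p, q, - q, r, - r} = 6" using pm qm rm neq q' by (simp add: card_insert_if)
  hence X6: "{p, - p, q, - q, r, - r} = X" using card_subset_eq[OF fX sub6] c by simp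
  have dots: "p \<bullet> q = 0" "p \<bullet> r = 0" "q \<bullet> r = 0" using pq dot[OF p rX] dot[OF q'(1) rX] neq by auto
  obtain s where s: "orth s" "s (v3 0 0 1) = p" "s (v3 0 1 0) = q" "s (v3 1 0 0) = r"
    by (rule orth_of_Gram[of "v3 0 0 1" "v3 0 1 0" "v3 1 0 0" p q r])
      (simp_all add: triple_v3 sq p q' rX dots)
  have "s (v3 0 0 (-1)) = - p" "s (v3 0 (-1) 0) = - q" "s (v3 (-1) 0 0) = - r"
    using orth_minus[OF s(1), of "v3 0 0 1"] orth_minus[OF s(1), of "v3 0 1 0"] orth_minus[OF s(1), of "v3 1 0 0"] s by simp_all
  hence SX: "s ` octa_pts = (\<lambda>x. 1 *\<^sub>R x) ` X" unfolding octa_pts_def X6[symmetric] using s by simp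
  have pt: "pair_transitive G X p q"
  proof (rule pair_transitiveI[OF Xo p q'(1)])
    fix y assume "y \<in> X" "p \<bullet> y = p \<bullet> q"
    thus "y \<in> ?O" unfolding Oeq using sq[OF p] pq by auto
  qed
  show thesis
  proof
    show "orth s" by fact
    show "pair_transitive (conj_by s G) octa_pts (v3 0 0 1) (v3 0 1 0)"
      by (rule pair_transitive_conj[OF s(1) G _ SX _ _ pt]) (simp_all add: s)
    fix g assume "g \<in> conj_by s \<Gamma>"
    then obtain h where h: "h \<in> \<Gamma>" "g = ginv s \<circ> h \<circ> s" by (auto simp: conj_by_def)
    have "h ` X = X" using uniq orbit_image[OF Xo h(1)] by blast
    thus "g ` octa_pts = octa_pts" unfolding h(2) using conj_image[OF s(1) orth'[OF h(1)] SX _ SX] by blast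
  qed
qed

text \<open>
  The orbit \<open>X\<close> of twelve poles is closed under negation. The stabilizer of \<open>p\<close>, of order five, has two
  opposite orbits on the poles other than \<open>\<plusminus>p\<close>, so all inner products of poles that are neither
  equal nor opposite are \<open>\<plusminus>c\<close> for one number \<open>c\<close>. The sum of the five poles near \<open>p\<close> is
  \<open>5 * c\<close> times \<open>p\<close>; one of them has inner
  products \<open>c\<close> and \<open>- c\<close> with two others each, so multiplying by it gives \<open>5 * c^2 = 1\<close>. Choosing the
  generator of the stabilizer suitably fixes the signs, and thus the Gram matrix of the icosahedron.
\<close>
lemma icosahedral_coordinates:
  assumes Xo: "X \<in> orbits" and uniq: "\<And>A. A \<in> orbits \<Longrightarrow> card A = card X \<Longrightarrow> A = X" and c: "card X = 12" "card G = 60"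
  obtains s where "orth s"
    "pair_transitive (conj_by s G) icosa_pts (v3 0 1 golden) (v3 0 (-1) golden)"
    "\<And>g. g \<in> conj_by s \<Gamma> \<Longrightarrow> g ` icosa_pts = icosa_pts"
proof -
  have unit: "norm x = 1" if "x \<in> X" for x using orbit_mem[OF Xo that] pole_norm by blast
  have sq: "x \<bullet> x = 1" if "x \<in> X" for x using unit[OF that] norm_eq_1 by blast
  have neg: "- x \<in> X" if "x \<in> X" for x using neg_orbit[OF Xo that uniq] .
  have fX: "Finite_Set.finite X" using c by (metis card.infinite zero_neq_numeral)
  obtain p where p: "p \<in> X" using c by (metis card.empty ex_in_conv zero_neq_numeral)
  have st: "card (stab G p) = 5" using orbit_stab_card[OF Xo p] c by simp
  have S: "orth_group (stab G p)" "Finite_Set.finite (stab G p)" using stab_group[OF G] finite by (auto simp: stab_def)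
  have pm: "p \<noteq> - p" using unit_ne_minus[OF unit[OF p]] .
  have c10: "card (X - {p, - p}) = 10" using c p neg[OF p] pm fX by (simp add: card_Diff_subset)
  then obtain q0 where q0: "q0 \<in> X - {p, - p}" by (metis card.empty ex_in_conv zero_neq_numeral)
  define q where "q = (if p \<bullet> q0 \<ge> 0 then q0 else - q0)"
  have q: "q \<in> X" "q \<noteq> p" "q \<noteq> - p" "p \<bullet> q \<ge> 0" using q0 neg by (auto simp: q_def)
  define c where "c = p \<bullet> q"
  have pow5: "k (k (k (k (k x)))) = x" if "k \<in> stab G p" for k x
  proof -
    have "(k ^^ 5) = id" using orth_group_pow_card[OF S that] st by simp
    hence "(k ^^ 5) x = x" by simp
    thus ?thesis by (simp add: numeral_eq_Suc)
  qed
  have qm: "q \<noteq> - q" using unit_ne_minus[OF unit[OF q(1)]] .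
  have free: "k = id" if "k \<in> stab G p" "k x = x" "x \<in> X" "x \<noteq> p" "x \<noteq> - p" for k x
    using fixed_units[of k p x] that unit p by (auto simp: stab_def)
  let ?O = "orbit_of (stab G p) q"
  have O5: "card ?O = 5" using stab_orbit_card[OF unit[OF p] unit[OF q(1)] q(2,3)] st by simp
  have fO: "Finite_Set.finite ?O" using stab_orbit_sub[OF Xo q(1)] fX finite_subset by blast
  have oS: "orth k" if "k \<in> stab G p" for k using orth that by (simp add: stab_def)
  have nomq: "k q \<noteq> - q" if k: "k \<in> stab G p" for k
  proof
    assume e: "k q = - q"
    have "k (k q) = q" using e orth_minus[OF oS[OF k], of q] by simp
    hence "k (k (k (k (k q)))) = k q" by simp
    thus False using pow5[OF k, of q] e qm by simp
  qed
  have "(p \<bullet> q)\<^sup>2 < 1" using unit_cross_nonzero(2)[OF unit[OF p] unit[OF q(1)] q(2,3)] .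
  hence pq: "p \<bullet> q \<noteq> 1" "p \<bullet> q \<noteq> -1" by auto
  have Op: "p \<bullet> y = c" if "y \<in> ?O" for y using stab_orbit_inner[OF that] c_def by simp
  have disj: "?O \<inter> uminus ` ?O = {}"
  proof (rule ccontr)
    assume "?O \<inter> uminus ` ?O \<noteq> {}"
    then obtain k l where k: "k \<in> stab G p" "l \<in> stab G p" "k q = - l q" by (auto simp: orbit_of_def)
    note il = orth_inv_simps[OF oS[OF k(2)]]
    have "(ginv l \<circ> k) q = - q" using k(3) orth_minus[OF il(5), of "l q"] il(1) by simp
    moreover have "ginv l \<circ> k \<in> stab G p" using orth_groupD(3,4)[OF S(1)] k by blast
    ultimately show False using nomq by blast
  qed
  have ne: "y \<noteq> p" "y \<noteq> - p" if "y \<in> ?O" for y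
  proof -
    have "p \<bullet> p = 1" "p \<bullet> (- p) = -1" using sq[OF p] by simp_all
    thus "y \<noteq> p" "y \<noteq> - p" using Op[OF that] pq c_def by metis+
  qed
  have sub: "?O \<union> uminus ` ?O \<subseteq> X - {p, - p}"
  proof
    fix y assume "y \<in> ?O \<union> uminus ` ?O"
    then consider "y \<in> ?O" | "- y \<in> ?O" by force
    thus "y \<in> X - {p, - p}"
    proof cases
      case 1 thus ?thesis using ne stab_orbit_sub[OF Xo q(1)] by blast
    next
      case 2 hence "- y \<noteq> p" "- y \<noteq> - p" "- y \<in> X" using ne stab_orbit_sub[OF Xo q(1)] by blast+
      thus ?thesis using neg[of "- y"] by auto
    qed
  qed
  have "card (?O \<union> uminus ` ?O) = 10" using card_Un_disjoint[OF fO _ disj] fO O5 by (simp add: card_image)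
  hence Yeq: "?O \<union> uminus ` ?O = X - {p, - p}" using card_subset_eq[OF _ sub] fX c10 by simp
  have pdot: "\<bar>p \<bullet> y\<bar> = \<bar>c\<bar>" if "y \<in> X" "y \<noteq> p" "y \<noteq> - p" for y
  proof -
    have "y \<in> ?O \<or> - y \<in> ?O" using Yeq that by force
    thus ?thesis using Op[of y] Op[of "- y"] by auto
  qed
  have dot: "\<bar>x \<bullet> y\<bar> = \<bar>c\<bar>" if xy: "x \<in> X" "y \<in> X" "y \<noteq> x" "y \<noteq> - x" for x y
  proof -
    obtain g where g: "g \<in> G" "g x = p" using orbit_transitive[OF Xo xy(1) p] .
    have "g y \<in> X" "g y \<noteq> p" "g y \<noteq> - p" using orbit_closed[OF Xo xy(2) g(1)] xy g
      orth_eq_iff[OF orth[OF g(1)], of y x] orth_eq_iff[OF orth[OF g(1)], of y "- x"] orth_minus[OF orth[OF g(1)], of x] by auto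
    hence "\<bar>p \<bullet> g y\<bar> = \<bar>c\<bar>" by (rule pdot)
    thus ?thesis using orth_inner[OF orth[OF g(1)], of x y] g by simp
  qed
  obtain g0 where g0: "g0 \<in> stab G p" "g0 \<noteq> id"
  proof -
    have "stab G p \<noteq> {id}" using st by auto
    thus thesis using that orth_groupD(2)[OF S(1)] by blast
  qed
  \<comment> \<open>\<open>a\<close> and \<open>b\<close> are the inner products of neighbours and of non-neighbours in the pentagon through \<open>q\<close>.\<close>
  have pent: "1 + 2 * (q \<bullet> g q) + 2 * (q \<bullet> g (g q)) = 5 * c\<^sup>2 \<and> \<bar>q \<bullet> g q\<bar> = \<bar>c\<bar> \<and> \<bar>q \<bullet> g (g q)\<bar> = \<bar>c\<bar>
      \<and> q \<bullet> g q \<noteq> q \<bullet> g (g q)" if g: "g \<in> stab G p" "g \<noteq> id" for g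
  proof -
    note go = oS[OF g(1)]
    have gp: "g p = p" using g by (simp add: stab_def)
    have inG: "g \<in> G" using g by (simp add: stab_def)
    define a where "a = q \<bullet> g q"
    define b where "b = q \<bullet> g (g q)"
    note gi = orth_inner[OF go]
    have g5: "g (g (g (g (g x)))) = x" for x using pow5[OF g(1)] .
    have 4: "q \<bullet> g (g (g (g q))) = a" using gi[of q "g (g (g (g q)))"] g5 a_def by (simp add: inner_commute)
    have 3: "q \<bullet> g (g (g q)) = b" using gi[of q "g (g (g q))"] gi[of "g q" "g (g (g (g q)))"] g5 b_def by (simp add: inner_commute)
    let ?u = "q + g q + g (g q) + g (g (g q)) + g (g (g (g q)))"
    have gu: "g ?u = ?u" by (simp add: orth_add[OF go] g5)
    have up: "p \<bullet> ?u = 5 * c" using gi[of p "q"] gi[of p "g q"] gi[of p "g (g q)"] gi[of p "g (g (g q))"] gp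
      by (simp add: inner_add_right c_def)
    have "?u = (5 * c) *\<^sub>R p"
    proof (rule ccontr)
      assume n: "?u \<noteq> (5 * c) *\<^sub>R p"
      let ?w = "?u - (5 * c) *\<^sub>R p"
      have "g ?w = ?w" using gu orth_diff[OF go, of ?u "(5 * c) *\<^sub>R p"] orth_scale[OF go] gp by simp
      hence "g (?w /\<^sub>R norm ?w) = ?w /\<^sub>R norm ?w" using orth_scale[OF go] by metis
      moreover have "norm (?w /\<^sub>R norm ?w) = 1" using n by simp
      ultimately have "?w /\<^sub>R norm ?w = p \<or> ?w /\<^sub>R norm ?w = - p"
        using fixed_units[OF inG g(2) gp] unit[OF p] by blast
      moreover define z where "z = ?w /\<^sub>R norm ?w"
      moreover have "p \<bullet> z = 0" unfolding z_def using up sq[OF p] by (simp add: inner_diff_right)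
      ultimately show False using sq[OF p] by (metis inner_minus_right neg_equal_0_iff_equal zero_neq_one)
    qed
    hence "q \<bullet> ?u = 5 * c * c" by (simp add: c_def inner_commute)
    hence eq: "1 + 2 * a + 2 * b = 5 * c\<^sup>2" using sq[OF q(1)] 3 4
      by (simp add: inner_add_right a_def b_def power2_eq_square)
    have g2: "g \<circ> g \<in> stab G p" using orth_groupD(3)[OF S(1)] g by blast
    have X1: "g q \<in> X" "g (g q) \<in> X" using orbit_closed[OF Xo _ inG] q(1) by blast+
    have n1: "g q \<noteq> q" using free[OF g(1) _ q(1-3)] g by blast
    have n2: "g (g q) \<noteq> q"
    proof
      assume "g (g q) = q"
      hence "g (g (g (g (g q)))) = g q" by simp
      thus False using g5[of q] n1 by simp
    qed
    have A: "\<bar>a\<bar> = \<bar>c\<bar>" "\<bar>b\<bar> = \<bar>c\<bar>" unfolding a_def b_def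
      using dot[OF q(1) X1(1) n1 nomq[OF g(1)]] dot[OF q(1) X1(2) n2] nomq[OF g2] by simp_all
    have "a \<noteq> b"
    proof
      assume ab: "a = b"
      have a1: "a \<noteq> 1" using unit_inner_eq_1[OF unit[OF q(1)] unit[OF X1(1)]] n1 a_def by auto
      have X3: "g (g (g q)) \<in> X" "g (g (g (g q))) \<in> X" using orbit_closed[OF Xo _ inG] X1 by blast+
      have "q + g q + g (g q) + g (g (g q)) = 0"
        by (rule equal_inner_sum_zero[OF sq[OF q(1)] sq[OF X1(1)] sq[OF X1(2)] sq[OF X3(1)] a1])
          (use gi[of q "g q"] gi[of "g q" "g (g q)"] gi[of q "g (g q)"] 3 ab a_def b_def in simp_all)
      moreover have "g q + g (g q) + g (g (g q)) + g (g (g (g q))) = 0"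
        using calculation orth_add[OF go] linear_0[OF orth_linear[OF go]] by metis
      moreover have "g (g (g (g q))) - q = (g q + g (g q) + g (g (g q)) + g (g (g (g q)))) - (q + g q + g (g q) + g (g (g q)))"
        by simp
      ultimately have "g (g (g (g q))) = q" by simp
      hence "g q = q" using g5[of q] by simp
      thus False using n1 by simp
    qed
    thus ?thesis using eq A by (simp add: a_def b_def)
  qed
  have c5: "5 * c\<^sup>2 = 1" "c > 0"
  proof -
    note P = pent[OF g0]
    have "c \<noteq> 0" using P by auto
    thus "c > 0" using q(4) c_def by simp
    hence "q \<bullet> g0 q = - (q \<bullet> g0 (g0 q))" using P by (auto simp: abs_if split: if_splits)
    thus "5 * c\<^sup>2 = 1" using P by simp
  qed
  obtain g where g: "g \<in> stab G p" "g \<noteq> id" "q \<bullet> g q = c" "q \<bullet> g (g q) = - c"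
  proof (cases "q \<bullet> g0 q = c")
    case True
    hence "q \<bullet> g0 (g0 q) = - c" using pent[OF g0] c5 by (auto simp: abs_if split: if_splits)
    thus thesis using that g0 True by blast
  next
    case False
    hence 1: "q \<bullet> g0 q = - c" "q \<bullet> g0 (g0 q) = c" using pent[OF g0] c5 by (auto simp: abs_if split: if_splits)
    have "q \<bullet> g0 (g0 (g0 (g0 q))) = - c"
      using orth_inner[OF oS[OF g0(1)], of q "g0 (g0 (g0 (g0 q)))"] pow5[OF g0(1), of q] 1 by (simp add: inner_commute)
    moreover have "g0 \<circ> g0 \<in> stab G p" using orth_groupD(3)[OF S(1)] g0 by blast
    moreover have "g0 \<circ> g0 \<noteq> id"
    proof
      assume "g0 \<circ> g0 = id" hence "g0 (g0 q) = q" by (metis comp_apply id_apply)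
      thus False using 1(2) sq[OF q(1)] c5 by simp
    qed
    ultimately show thesis using that[of "g0 \<circ> g0"] 1 by simp
  qed
  note go = oS[OF g(1)] and gi = orth_inner[OF oS[OF g(1)]] and g5 = pow5[OF g(1)]
  have gp: "g p = p" and inG: "g \<in> G" using g by (auto simp: stab_def)
  define q1 q2 q3 q4 where "q1 = g q" and "q2 = g q1" and "q3 = g q2" and "q4 = g q3"
  note qd = q1_def q2_def q3_def q4_def
  have Xq: "q1 \<in> X" "q2 \<in> X" "q3 \<in> X" "q4 \<in> X" unfolding qd using orbit_closed[OF Xo _ inG] q(1) by blast+
  have gq4: "g q4 = q" using g5[of q] by (simp add: qd)
  have D: "p \<bullet> q = c" "p \<bullet> q1 = c" "p \<bullet> q2 = c" "p \<bullet> q3 = c" "p \<bullet> q4 = c"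
    using gi[of p q] gi[of p q1] gi[of p q2] gi[of p q3] gp by (simp_all add: c_def qd)
  have E: "q \<bullet> q1 = c" "q1 \<bullet> q2 = c" "q2 \<bullet> q3 = c" "q3 \<bullet> q4 = c" "q4 \<bullet> q = c"
    using gi[of q q1] gi[of q1 q2] gi[of q2 q3] gi[of q3 q4] g(3) gq4 by (simp_all add: qd)
  have F: "q \<bullet> q2 = - c" "q1 \<bullet> q3 = - c" "q2 \<bullet> q4 = - c" "q3 \<bullet> q = - c" "q4 \<bullet> q1 = - c"
    using gi[of q q2] gi[of q1 q3] gi[of q2 q4] gi[of q3 q] g(4) gq4 by (simp_all add: qd)
  define N where "N = sqrt (golden + 2)"
  have N2: "N * N = golden + 2" unfolding N_def using golden_gt_1 by simp
  have Nc: "N * N * c = golden"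
  proof -
    have "(sqrt 5 * c)\<^sup>2 = 1" using c5 by (simp add: power_mult_distrib)
    moreover have "sqrt 5 * c > 0" using c5 by simp
    ultimately have "sqrt 5 * c = 1" by (simp add: power2_eq_1_iff)
    moreover have "sqrt 5 * (N * N * c) = (golden + 2) * (sqrt 5 * c)" by (simp add: N2)
    ultimately have "sqrt 5 * (N * N * c) = sqrt 5 * golden" using golden_sqrt5 by simp
    thus ?thesis by simp
  qed
  have Nc': "(golden + 2) * c = golden" using Nc N2 by simp
  have gram: "(N *\<^sub>R x) \<bullet> (N *\<^sub>R y) = N * N * (x \<bullet> y)" for x y :: "real^3" by simp
  have gs: "golden * golden = golden + 1" by (rule golden_sq)
  have tr: "cross3 (v3 0 1 golden) (v3 0 (-1) golden) \<bullet> v3 golden 0 1 \<noteq> 0"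
    using golden_gt_1 gs by (simp add: triple_v3)
  obtain s where s: "orth s" "s (v3 0 1 golden) = N *\<^sub>R p"
    "s (v3 0 (-1) golden) = N *\<^sub>R q" "s (v3 golden 0 1) = N *\<^sub>R q1"
    by (rule orth_of_Gram[of "v3 0 1 golden" "v3 0 (-1) golden" "v3 golden 0 1"
        "N *\<^sub>R p" "N *\<^sub>R q" "N *\<^sub>R q1", OF tr])
      (simp_all only: gram sq p q Xq D E Nc mult_1_right N2, simp_all add: gs Nc')
  \<comment> \<open>The remaining points are determined by their inner products with three of them.\<close>
  have rest: "s x = N *\<^sub>R y" if "x \<bullet> v3 0 1 golden = N * N * (y \<bullet> p)" "x \<bullet> v3 0 (-1) golden = N * N * (y \<bullet> q)"
    "x \<bullet> v3 golden 0 1 = N * N * (y \<bullet> q1)" for x y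
  proof -
    note i = orth_inv_simps[OF s(1)]
    have "ginv s (N *\<^sub>R y) = x"
    proof (rule inner_eq_basis[OF _ _ _ tr])
      have *: "ginv s (N *\<^sub>R y) \<bullet> z = (N *\<^sub>R y) \<bullet> s z" for z
        using orth_inner[OF s(1), of "ginv s (N *\<^sub>R y)" z] i(2) by simp
      show "ginv s (N *\<^sub>R y) \<bullet> v3 0 1 golden = x \<bullet> v3 0 1 golden"
        "ginv s (N *\<^sub>R y) \<bullet> v3 0 (- 1) golden = x \<bullet> v3 0 (- 1) golden"
        "ginv s (N *\<^sub>R y) \<bullet> v3 golden 0 1 = x \<bullet> v3 golden 0 1" unfolding * s gram that by simp_all
    qed
    thus ?thesis using i(2) by metis
  qed
  have s2: "s (v3 1 golden 0) = N *\<^sub>R q2" "s (v3 (-1) golden 0) = N *\<^sub>R q3" "s (v3 (-golden) 0 1) = N *\<^sub>R q4"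
    using D E F Nc by (intro rest; simp add: inner_commute gs)+
  have half: "s ` icosa_half = (\<lambda>x. N *\<^sub>R x) ` {p, q, q1, q2, q3, q4}"
    unfolding icosa_half_def using s s2 by auto
  have Ogen: "?O = {q, q1, q2, q3, q4}"
  proof (rule sym, rule card_subset_eq[OF fO])
    have m: "g x \<in> ?O" if x: "x \<in> ?O" for x
    proof -
      obtain k where "k \<in> stab G p" "x = k q" using x by (auto simp: orbit_of_def)
      thus ?thesis using orth_groupD(3)[OF S(1) g(1), of k] unfolding orbit_of_def by (metis comp_apply imageI)
    qed
    have "q \<in> ?O" using orbit_refl[OF S(1)] .
    thus "{q, q1, q2, q3, q4} \<subseteq> ?O" unfolding qd using m by blast
    have dis: "x \<noteq> y" if "x \<in> X" "x \<bullet> y = c \<or> x \<bullet> y = - c" for x y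
    proof
      assume "x = y" hence "c\<^sup>2 = 1" using that sq[of x] by auto
      thus False using c5 by simp
    qed
    have "distinct [q, q1, q2, q3, q4]"
      using dis[OF q(1), of q1] dis[OF q(1), of q2] dis[OF Xq(1), of q2] dis[OF Xq(1), of q3] dis[OF Xq(2), of q3]
        dis[OF Xq(2), of q4] dis[OF Xq(3), of q4] dis[OF Xq(3), of q] dis[OF Xq(4), of q] dis[OF Xq(4), of q1] E F by auto
    thus "card {q, q1, q2, q3, q4} = card ?O" using O5 distinct_card[of "[q, q1, q2, q3, q4]"] by simp
  qed
  have X12: "X = insert p ?O \<union> uminus ` insert p ?O" using Yeq p neg[OF p] by blast
  have SX: "s ` icosa_pts = (\<lambda>x. N *\<^sub>R x) ` X"
  proof -
    have "s ` uminus ` icosa_half = uminus ` s ` icosa_half" using orth_minus[OF s(1)] by (auto simp: image_image)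
    hence "s ` icosa_pts = s ` icosa_half \<union> uminus ` s ` icosa_half" unfolding icosa_pts_def by (simp add: image_Un)
    also have "\<dots> = (\<lambda>x. N *\<^sub>R x) ` ({p, q, q1, q2, q3, q4} \<union> uminus ` {p, q, q1, q2, q3, q4})"
      unfolding half by (auto simp: image_image)
    finally show ?thesis unfolding X12 Ogen .
  qed
  have pt: "pair_transitive G X p q"
  proof (rule pair_transitiveI[OF Xo p q(1)])
    fix y assume y: "y \<in> X" "p \<bullet> y = p \<bullet> q"
    hence "y \<noteq> p" "y \<noteq> - p" using pq sq[OF p] by auto
    hence "y \<in> ?O \<or> - y \<in> ?O" using Yeq y by force
    moreover have "- y \<notin> ?O" using Op[of "- y"] y c5 c_def by auto
    ultimately show "y \<in> ?O" by blast
  qed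
  show thesis
  proof
    show "orth s" by fact
    show "pair_transitive (conj_by s G) icosa_pts (v3 0 1 golden) (v3 0 (-1) golden)"
      by (rule pair_transitive_conj[OF s(1) G _ SX s(2,3) pt]) (use N2 golden_gt_1 in auto)
    fix g assume "g \<in> conj_by s \<Gamma>"
    then obtain h where h: "h \<in> \<Gamma>" "g = ginv s \<circ> h \<circ> s" by (auto simp: conj_by_def)
    have "h ` X = X" using uniq orbit_image[OF Xo h(1)] by blast
    thus "g ` icosa_pts = icosa_pts" unfolding h(2) using conj_image[OF s(1) orth'[OF h(1)] SX _ SX] by blast
  qed
qed

end

section \<open>The nonprismatic groups\<close>

lemma bij_in_BijGroup: "bij h \<longleftrightarrow> h \<in> carrier (BijGroup UNIV)" by (simp add: BijGroup_def Bij_def)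

lemma BijGroup_simps:
  "\<one>\<^bsub>BijGroup UNIV\<^esub> = id"
  "bij g \<Longrightarrow> bij h \<Longrightarrow> g \<otimes>\<^bsub>BijGroup UNIV\<^esub> h = g \<circ> h"
  "bij h \<Longrightarrow> m_inv (BijGroup UNIV) h = ginv h"
proof -
  show "\<one>\<^bsub>BijGroup UNIV\<^esub> = id" by (simp add: BijGroup_def id_def restrict_UNIV)
  show "bij g \<Longrightarrow> bij h \<Longrightarrow> g \<otimes>\<^bsub>BijGroup UNIV\<^esub> h = g \<circ> h"
    by (simp add: BijGroup_def Bij_def compose_def fun_eq_iff)
  show "bij h \<Longrightarrow> m_inv (BijGroup UNIV) h = ginv h"
    using inv_BijGroup[of h UNIV] by (simp add: Bij_def restrict_UNIV)
qed

lemma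
  assumes "\<And>h. h \<in> S \<Longrightarrow> bij h"
  shows generated_by_id: "id \<in> generated_by S"
    and generated_by_incl: "h \<in> S \<Longrightarrow> h \<in> generated_by S"
    and generated_by_comp: "g \<in> generated_by S \<Longrightarrow> h \<in> generated_by S \<Longrightarrow> g \<circ> h \<in> generated_by S"
    and generated_by_inv: "g \<in> generated_by S \<Longrightarrow> ginv g \<in> generated_by S"
    and generated_by_induct: "g \<in> generated_by S \<Longrightarrow> P id \<Longrightarrow> (\<And>h. h \<in> S \<Longrightarrow> P h) \<Longrightarrow>
       (\<And>h. h \<in> S \<Longrightarrow> P (ginv h)) \<Longrightarrow> (\<And>f h. P f \<Longrightarrow> P h \<Longrightarrow> P (f \<circ> h)) \<Longrightarrow> P g"
proof -
  interpret B: Group.group "BijGroup UNIV" by (rule group_BijGroup)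
  have S: "S \<subseteq> carrier (BijGroup UNIV)" using assms bij_in_BijGroup by blast
  have bij: "bij g" if "g \<in> generated_by S" for g
    using B.generate_in_carrier[OF S] that bij_in_BijGroup unfolding generated_by_def by blast
  show "id \<in> generated_by S" unfolding generated_by_def BijGroup_simps(1)[symmetric] by (rule generate.one)
  show "h \<in> S \<Longrightarrow> h \<in> generated_by S" unfolding generated_by_def by (rule generate.incl)
  show "g \<in> generated_by S \<Longrightarrow> h \<in> generated_by S \<Longrightarrow> g \<circ> h \<in> generated_by S"
    using generate.eng[of g "BijGroup UNIV" S h] bij BijGroup_simps(2)[of g h] unfolding generated_by_def by simp
  show "g \<in> generated_by S \<Longrightarrow> ginv g \<in> generated_by S"
    using B.generate_m_inv_closed[OF S, of g] bij[of g] BijGroup_simps(3)[of g] unfolding generated_by_def by simp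
  assume g: "g \<in> generated_by S" and P: "P id" "\<And>h. h \<in> S \<Longrightarrow> P h" "\<And>h. h \<in> S \<Longrightarrow> P (ginv h)"
    "\<And>f h. P f \<Longrightarrow> P h \<Longrightarrow> P (f \<circ> h)"
  show "P g" using g unfolding generated_by_def
  proof (induction rule: generate.induct)
    case one show ?case unfolding BijGroup_simps(1) by (rule P(1))
  next
    case (incl h) thus ?case by (rule P(2))
  next
    case (inv h) thus ?case using P BijGroup_simps(3) assms by metis
  next
    case (eng h1 h2)
    hence "bij h1" "bij h2" using bij unfolding generated_by_def by auto
    thus ?case using eng P(4) BijGroup_simps(2) by metis
  qed
qed

lemma orth_group_generated_by:
  assumes "\<And>h. h \<in> S \<Longrightarrow> orth h" shows "orth_group (generated_by S)"
proof -
  have b: "bij h" if "h \<in> S" for h using orth_bij assms that by blast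
  have "orth g" if "g \<in> generated_by S" for g using b that
  proof (rule generated_by_induct)
    show "orth (id :: real^3 \<Rightarrow> real^3)" by (simp add: id_def)
    show "orth (f \<circ> h)" if "orth f" "orth h" for f h :: space_map
      using that orth_compose by blast
  qed (use assms orth_inv_simps(5) in auto)
  moreover have "id \<in> generated_by S" by (rule generated_by_id[OF b])
  moreover have "g \<circ> h \<in> generated_by S" if "g \<in> generated_by S" "h \<in> generated_by S" for g h
    by (rule generated_by_comp[OF b that])
  moreover have "ginv g \<in> generated_by S" if "g \<in> generated_by S" for g
    by (rule generated_by_inv[OF b that])
  ultimately show ?thesis unfolding orth_group_def by simp
qed

lemma generated_by_preserves:
  assumes S: "\<And>h. h \<in> S \<Longrightarrow> bij h" "\<And>h. h \<in> S \<Longrightarrow> h ` X = X" and g: "g \<in> generated_by S" shows "g ` X = X"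
  using S(1) g
proof (rule generated_by_induct)
  fix h assume h: "h \<in> S"
  have "ginv h ` h ` X = X" using S(1)[OF h] by (simp add: image_comp bij_is_inj)
  thus "ginv h ` X = X" using S(2)[OF h] by simp
next
  fix f h assume "f ` X = X" "h ` X = X" thus "(f \<circ> h) ` X = X" by (simp only: image_comp[symmetric])
qed (use S in auto)

lemma reflection_orth: assumes "n \<noteq> 0" shows "orth (reflection n)"
proof -
  have n: "n \<bullet> n \<noteq> 0" using assms by simp
  have "linear (reflection n)"
    by (rule linearI) (simp_all add: reflection_def inner_add_right scaleR_add_left distrib_left add_divide_distrib algebra_simps)
  moreover have "reflection n v \<bullet> reflection n w = v \<bullet> w" for v w unfolding reflection_def using n
    by (simp add: inner_diff_left inner_diff_right inner_commute[of v n] field_simps)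
  ultimately show ?thesis by (simp add: orth_def)
qed

lemma reflection_reflection: assumes "n \<noteq> 0" shows "reflection n (reflection n x) = x"
  unfolding reflection_def using assms by (simp add: inner_diff_right field_simps)

lemma reflection_preserves:
  assumes "n \<noteq> 0" "\<And>x. x \<in> X \<Longrightarrow> reflection n x \<in> X" shows "reflection n ` X = X"
  using assms reflection_reflection[OF assms(1)] by (auto simp: image_iff) metis

text \<open>
  The common argument for identifying a group with the stabilizer of a configuration: after
  composing with a group element, a transformation fixes the base pair, hence its plane.
\<close>
lemma config_base_pair:
  assumes R: "pair_transitive R X p q" and f: "orth f" "f ` X = X"
  obtains g where "g \<in> R" "g p = f p" "g q = f q"
proof -
  have "f p \<in> X" "f q \<in> X" using R f(2) unfolding pair_transitive_def by blast+
  thus thesis using R orth_inner[OF f(1), of p q] that unfolding pair_transitive_def by blast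
qed

lemma orth_rotation_eq:
  fixes f g :: space_map
  assumes "orth f" "orth g" "det (matrix f) = det (matrix g)"
    "g p = f p" "g q = f q" "cross3 p q \<noteq> 0"
  shows "f = g"
proof -
  note i = orth_inv_simps[OF assms(2)]
  have "det (matrix (ginv g \<circ> f)) = 1"
    using det_matrix_comp[OF i(5) assms(1)] det_matrix_inv[OF assms(2)] assms(3) orth_det_cases[OF assms(2)] by auto
  moreover have "orth (ginv g \<circ> f)" using assms i orth_compose by blast
  moreover have "(ginv g \<circ> f) p = p" "(ginv g \<circ> f) q = q" using assms(4,5) i(1) by (metis comp_apply)+
  ultimately have "ginv g \<circ> f = id" using rotation_fixing_two assms(6) by blast
  hence "f x = g x" for x using i(2) by (metis comp_apply id_apply)
  thus ?thesis by blast
qed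

lemma rotations_of_config:
  assumes G: "orth_group G" "\<And>g. g \<in> G \<Longrightarrow> det (matrix g) = 1" and pt: "pair_transitive G X p q" and pq: "cross3 p q \<noteq> 0"
  shows "G = {g. orth g \<and> g ` X = X \<and> det (matrix g) = 1}"
proof (intro equalityI subsetI)
  fix f assume "f \<in> {g. orth g \<and> g ` X = X \<and> det (matrix g) = 1}"
  hence f: "orth f" "f ` X = X" "det (matrix f) = 1" by auto
  obtain g where g: "g \<in> G" "g p = f p" "g q = f q" using config_base_pair[OF pt f(1,2)] .
  have "f = g" by (rule orth_rotation_eq[OF f(1) _ _ g(2,3) pq]) (use G g f orth_groupD(1) in auto)
  thus "f \<in> G" using g by simp
qed (use G orth_groupD(1) pt in \<open>auto simp: pair_transitive_def\<close>)

lemma group_of_config: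
  assumes R: "orth_group R" and pt: "pair_transitive R X p q" and pq: "cross3 p q \<noteq> 0"
    and \<rho>: "\<rho> \<in> R" "\<rho> p = p" "\<rho> q = q" "\<rho> \<noteq> id"
  shows "R = {g. orth g \<and> g ` X = X}"
proof (intro equalityI subsetI)
  fix f assume "f \<in> {g. orth g \<and> g ` X = X}"
  hence f: "orth f" "f ` X = X" by auto
  obtain g where g: "g \<in> R" "g p = f p" "g q = f q" using config_base_pair[OF pt f] .
  have go: "orth g" "orth \<rho>" using R g \<rho> orth_groupD(1) by blast+
  have d: "det (matrix \<rho>) = -1" using orth_det_cases[OF go(2)] rotation_fixing_two[OF go(2) _ \<rho>(2,3) pq] \<rho>(4) by blast
  show "f \<in> R"
  proof (cases "det (matrix f) = det (matrix g)")
    case True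
    hence "f = g" using orth_rotation_eq[OF f(1) go(1) _ g(2,3) pq] by blast
    thus ?thesis using g by simp
  next
    case False
    hence "det (matrix f) = det (matrix (g \<circ> \<rho>))"
      using orth_det_cases[OF f(1)] orth_det_cases[OF go(1)] d det_matrix_comp[OF go] by auto
    moreover have "(g \<circ> \<rho>) p = f p" "(g \<circ> \<rho>) q = f q" using g \<rho> by simp_all
    moreover have "orth (g \<circ> \<rho>)" using go orth_compose by blast
    ultimately have "f = g \<circ> \<rho>" using orth_rotation_eq[OF f(1) _ _ _ _ pq] by blast
    thus ?thesis using orth_groupD(3)[OF R g(1) \<rho>(1)] by simp
  qed
qed (use R orth_groupD(1) pt in \<open>auto simp: pair_transitive_def\<close>)

lemma mirror_rows:
  "mirrors_332 $ 1 = v3 (-1) 1 0" "mirrors_332 $ 2 = v3 1 1 0" "mirrors_332 $ 3 = v3 0 (-1) 1"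
  "mirrors_432 $ 1 = v3 1 0 0" "mirrors_432 $ 2 = v3 (-1) 1 0" "mirrors_432 $ 3 = v3 0 (-1) 1"
  "mirrors_532 $ 1 = v3 1 0 0" "mirrors_532 $ 2 = v3 0 1 0" "mirrors_532 $ 3 = v3 (- golden) (-1) (golden - 1)"
  unfolding mirrors_332_def mirrors_432_def mirrors_532_def golden_inverse by (simp_all add: v3_def)

lemma reflection_v3:
  "reflection (v3 (-1) 1 0) (v3 x y z) = v3 y x z" "reflection (v3 1 1 0) (v3 x y z) = v3 (-y) (-x) z"
  "reflection (v3 0 (-1) 1) (v3 x y z) = v3 x z y" "reflection (v3 1 0 0) (v3 x y z) = v3 (-x) y z"
  "reflection (v3 0 1 0) (v3 x y z) = v3 x (-y) z"
  "reflection (v3 (-golden) (-1) (golden - 1)) (v3 x y z) =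
     (let k = (golden * z - golden * x - y - z) / 2 in v3 (x + k * golden) (y + k) (z - k * (golden - 1)))"
proof -
  let ?n = "v3 (-golden) (-1) (golden - 1)"
  define k where "k = (golden * z - golden * x - y - z) / 2"
  have nn: "?n \<bullet> ?n = 4" using golden_sq by (simp add: algebra_simps)
  have kk: "2 * (?n \<bullet> v3 x y z) / 4 = k" unfolding k_def by (simp add: field_simps)
  have "reflection ?n (v3 x y z) = v3 x y z - k *\<^sub>R ?n" unfolding reflection_def nn kk ..
  also have "\<dots> = v3 (x + k * golden) (y + k) (z - k * (golden - 1))" by simp
  finally show "reflection ?n (v3 x y z) =
     (let k = (golden * z - golden * x - y - z) / 2 in v3 (x + k * golden) (y + k) (z - k * (golden - 1)))"
    unfolding Let_def k_def .
qed (simp_all add: reflection_def field_simps)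

lemma mirror_row_nonzero:
  "M \<in> coxeter_mirrors \<Longrightarrow> M $ i \<noteq> 0"
  using exhaust_3[of i] by (auto simp: mirror_rows v3_def vec_eq_iff forall_3)

lemma reflection_group_props:
  assumes M: "M \<in> coxeter_mirrors"
  shows "orth_group (reflection_group M)" "reflection (M $ i) \<in> reflection_group M"
    "(\<And>i x. x \<in> X \<Longrightarrow> reflection (M $ i) x \<in> X) \<Longrightarrow> g \<in> reflection_group M \<Longrightarrow> g ` X = X"
proof -
  have o: "orth h" if "h \<in> range (\<lambda>i. reflection (M $ i))" for h
    using that reflection_orth mirror_row_nonzero[OF M] by auto
  hence b: "bij h" if "h \<in> range (\<lambda>i. reflection (M $ i))" for h
    using that orth_bij by blast
  show "orth_group (reflection_group M)" unfolding reflection_group_def using orth_group_generated_by[OF o] .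
  show "reflection (M $ i) \<in> reflection_group M" unfolding reflection_group_def using generated_by_incl[OF b] by blast
  assume X: "\<And>i x. x \<in> X \<Longrightarrow> reflection (M $ i) x \<in> X" and g: "g \<in> reflection_group M"
  show "g ` X = X" by (rule generated_by_preserves[OF b _ g[unfolded reflection_group_def]])
       (use reflection_preserves[OF mirror_row_nonzero[OF M]] X in auto)
qed

lemma reach_step:
  assumes M: "M \<in> coxeter_mirrors"
    and g: "\<exists>g\<in>reflection_group M. g p = x" and y: "reflection (M $ i) x = y"
  shows "\<exists>g\<in>reflection_group M. g p = y"
  using g y orth_groupD(3)[OF reflection_group_props(1)[OF M] reflection_group_props(2)[OF M, of i]]
  by (metis comp_apply)

lemma reach_step_fixing:
  assumes M: "M \<in> coxeter_mirrors"
    and g: "\<exists>g\<in>reflection_group M. g p = p \<and> g q = x" and y: "reflection (M $ i) x = y" "reflection (M $ i) p = p"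
  shows "\<exists>g\<in>reflection_group M. g p = p \<and> g q = y"
  using g y orth_groupD(3)[OF reflection_group_props(1)[OF M] reflection_group_props(2)[OF M, of i]]
  by (metis comp_apply)

lemma reach_id:
  assumes M: "M \<in> coxeter_mirrors"
  shows "\<exists>g\<in>reflection_group M. g p = p" "\<exists>g\<in>reflection_group M. g p = p \<and> g q = q"
  using orth_groupD(2)[OF reflection_group_props(1)[OF M]] by (metis id_apply)+

text \<open>
  The points reached from the base point, and the images of \<open>q\<close> under maps fixing it, are
  found by applying the generators one after the other.
\<close>
lemma pair_transitive_332: "pair_transitive (reflection_group mirrors_332) tetra_pts (v3 1 1 1) (v3 (-1) (-1) 1)"
proof (rule pair_transitive_from_base)
  let ?R = "reflection_group mirrors_332"
  have M: "mirrors_332 \<in> coxeter_mirrors" by simp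
  note rs = reach_step[OF M] and rf = reach_step_fixing[OF M]
  show "orth_group ?R" using reflection_group_props(1)[OF M] .
  show "v3 1 1 1 \<in> tetra_pts" "v3 (-1) (-1) 1 \<in> tetra_pts" by (auto simp: tetra_pts_def)
  show "g ` tetra_pts = tetra_pts" if "g \<in> ?R" for g
  proof (rule reflection_group_props(3)[OF M _ that])
    fix i :: 3 and x assume "x \<in> tetra_pts"
    thus "reflection (mirrors_332 $ i) x \<in> tetra_pts"
      using exhaust_3[of i] by (auto simp: tetra_pts_def mirror_rows reflection_v3)
  qed
  have 1: "\<exists>g\<in>?R. g (v3 1 1 1) = v3 (-1) (-1) 1" by (rule rs[OF reach_id(1)[OF M], of 2]) (simp add: mirror_rows reflection_v3)
  have 2: "\<exists>g\<in>?R. g (v3 1 1 1) = v3 (-1) 1 (-1)" by (rule rs[OF 1, of 3]) (simp add: mirror_rows reflection_v3)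
  have 3: "\<exists>g\<in>?R. g (v3 1 1 1) = v3 1 (-1) (-1)" by (rule rs[OF 2, of 1]) (simp add: mirror_rows reflection_v3)
  show "\<exists>g\<in>?R. g (v3 1 1 1) = x" if "x \<in> tetra_pts" for x
    using that 1 2 3 reach_id(1)[OF M] unfolding tetra_pts_def by blast
  have 4: "\<exists>g\<in>?R. g (v3 1 1 1) = v3 1 1 1 \<and> g (v3 (-1) (-1) 1) = v3 (-1) 1 (-1)"
    by (rule rf[OF reach_id(2)[OF M], of 3]) (simp_all add: mirror_rows reflection_v3)
  have 5: "\<exists>g\<in>?R. g (v3 1 1 1) = v3 1 1 1 \<and> g (v3 (-1) (-1) 1) = v3 1 (-1) (-1)"
    by (rule rf[OF 4, of 1]) (simp_all add: mirror_rows reflection_v3)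
  show "\<exists>g\<in>?R. g (v3 1 1 1) = v3 1 1 1 \<and> g (v3 (-1) (-1) 1) = y"
    if "y \<in> tetra_pts" "v3 1 1 1 \<bullet> y = v3 1 1 1 \<bullet> v3 (-1) (-1) 1" for y
    using that 4 5 reach_id(2)[OF M] unfolding tetra_pts_def by auto
qed

lemma pair_transitive_432: "pair_transitive (reflection_group mirrors_432) octa_pts (v3 0 0 1) (v3 0 1 0)"
proof (rule pair_transitive_from_base)
  let ?R = "reflection_group mirrors_432"
  have M: "mirrors_432 \<in> coxeter_mirrors" by simp
  note rs = reach_step[OF M] and rf = reach_step_fixing[OF M]
  show "orth_group ?R" using reflection_group_props(1)[OF M] .
  show "v3 0 0 1 \<in> octa_pts" "v3 0 1 0 \<in> octa_pts" by (auto simp: octa_pts_def)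
  show "g ` octa_pts = octa_pts" if "g \<in> ?R" for g
  proof (rule reflection_group_props(3)[OF M _ that])
    fix i :: 3 and x assume "x \<in> octa_pts"
    thus "reflection (mirrors_432 $ i) x \<in> octa_pts"
      using exhaust_3[of i] by (auto simp: octa_pts_def mirror_rows reflection_v3)
  qed
  have 1: "\<exists>g\<in>?R. g (v3 0 0 1) = v3 0 1 0" by (rule rs[OF reach_id(1)[OF M], of 3]) (simp add: mirror_rows reflection_v3)
  have 2: "\<exists>g\<in>?R. g (v3 0 0 1) = v3 1 0 0" by (rule rs[OF 1, of 2]) (simp add: mirror_rows reflection_v3)
  have 3: "\<exists>g\<in>?R. g (v3 0 0 1) = v3 (-1) 0 0" by (rule rs[OF 2, of 1]) (simp add: mirror_rows reflection_v3)
  have 4: "\<exists>g\<in>?R. g (v3 0 0 1) = v3 0 (-1) 0" by (rule rs[OF 3, of 2]) (simp add: mirror_rows reflection_v3)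
  have 5: "\<exists>g\<in>?R. g (v3 0 0 1) = v3 0 0 (-1)" by (rule rs[OF 4, of 3]) (simp add: mirror_rows reflection_v3)
  show "\<exists>g\<in>?R. g (v3 0 0 1) = x" if "x \<in> octa_pts" for x
    using that 1 2 3 4 5 reach_id(1)[OF M] unfolding octa_pts_def by blast
  have 6: "\<exists>g\<in>?R. g (v3 0 0 1) = v3 0 0 1 \<and> g (v3 0 1 0) = v3 1 0 0"
    by (rule rf[OF reach_id(2)[OF M], of 2]) (simp_all add: mirror_rows reflection_v3)
  have 7: "\<exists>g\<in>?R. g (v3 0 0 1) = v3 0 0 1 \<and> g (v3 0 1 0) = v3 (-1) 0 0"
    by (rule rf[OF 6, of 1]) (simp_all add: mirror_rows reflection_v3)
  have 8: "\<exists>g\<in>?R. g (v3 0 0 1) = v3 0 0 1 \<and> g (v3 0 1 0) = v3 0 (-1) 0"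
    by (rule rf[OF 7, of 2]) (simp_all add: mirror_rows reflection_v3)
  show "\<exists>g\<in>?R. g (v3 0 0 1) = v3 0 0 1 \<and> g (v3 0 1 0) = y"
    if "y \<in> octa_pts" "v3 0 0 1 \<bullet> y = v3 0 0 1 \<bullet> v3 0 1 0" for y
    using that 6 7 8 reach_id(2)[OF M] unfolding octa_pts_def by auto
qed

lemma icosa_pts_alt: "icosa_pts = {v3 0 1 golden, v3 0 (-1) golden, v3 golden 0 1, v3 1 golden 0, v3 (-1) golden 0, v3 (-golden) 0 1,
   v3 0 (-1) (-golden), v3 0 1 (-golden), v3 (-golden) 0 (-1), v3 (-1) (-golden) 0, v3 1 (-golden) 0, v3 golden 0 (-1)}"
  unfolding icosa_pts_def icosa_half_def by auto

text \<open>
  The third mirror fixes two pairs of opposite vertices of the icosahedron and exchanges the others in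
  pairs.
\<close>
lemma reflection_icosa:
  "reflection (mirrors_532 $ 3) (v3 0 1 golden) = v3 0 1 golden"
  "reflection (mirrors_532 $ 3) (v3 0 (-1) golden) = v3 golden 0 1"
  "reflection (mirrors_532 $ 3) (v3 golden 0 1) = v3 0 (-1) golden"
  "reflection (mirrors_532 $ 3) (v3 1 golden 0) = v3 (-golden) 0 1"
  "reflection (mirrors_532 $ 3) (v3 (-golden) 0 1) = v3 1 golden 0"
  "reflection (mirrors_532 $ 3) (v3 (-1) golden 0) = v3 (-1) golden 0"
  "reflection (mirrors_532 $ 3) (v3 0 (-1) (-golden)) = v3 0 (-1) (-golden)"
  "reflection (mirrors_532 $ 3) (v3 0 1 (-golden)) = v3 (-golden) 0 (-1)"
  "reflection (mirrors_532 $ 3) (v3 (-golden) 0 (-1)) = v3 0 1 (-golden)"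
  "reflection (mirrors_532 $ 3) (v3 (-1) (-golden) 0) = v3 golden 0 (-1)"
  "reflection (mirrors_532 $ 3) (v3 golden 0 (-1)) = v3 (-1) (-golden) 0"
  "reflection (mirrors_532 $ 3) (v3 1 (-golden) 0) = v3 1 (-golden) 0"
  unfolding mirror_rows reflection_v3 Let_def using golden_sq by (simp_all add: field_simps)

lemma pair_transitive_532: "pair_transitive (reflection_group mirrors_532) icosa_pts (v3 0 1 golden) (v3 0 (-1) golden)"
proof (rule pair_transitive_from_base)
  let ?R = "reflection_group mirrors_532" and ?p = "v3 0 1 golden" and ?q = "v3 0 (-1) golden"
  have M: "mirrors_532 \<in> coxeter_mirrors" by simp
  note rs = reach_step[OF M] and rf = reach_step_fixing[OF M]
  note refl12 = mirror_rows(7,8) reflection_v3(4,5)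
  show "orth_group ?R" using reflection_group_props(1)[OF M] .
  show "?p \<in> icosa_pts" "?q \<in> icosa_pts" by (auto simp: icosa_pts_alt)
  show "g ` icosa_pts = icosa_pts" if "g \<in> ?R" for g
  proof (rule reflection_group_props(3)[OF M _ that])
    fix i :: 3 and x assume "x \<in> icosa_pts"
    thus "reflection (mirrors_532 $ i) x \<in> icosa_pts" using exhaust_3[of i] unfolding icosa_pts_alt
      by (elim disjE insertE emptyE; simp add: reflection_icosa refl12)
  qed
  have 1: "\<exists>g\<in>?R. g ?p = v3 0 (-1) golden" by (rule rs[OF reach_id(1)[OF M], of 2]) (simp add: refl12)
  have 2: "\<exists>g\<in>?R. g ?p = v3 golden 0 1" by (rule rs[OF 1, of 3]) (simp add: reflection_icosa)
  have 3: "\<exists>g\<in>?R. g ?p = v3 (-golden) 0 1" by (rule rs[OF 2, of 1]) (simp add: refl12)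
  have 4: "\<exists>g\<in>?R. g ?p = v3 1 golden 0" by (rule rs[OF 3, of 3]) (simp add: reflection_icosa)
  have 5: "\<exists>g\<in>?R. g ?p = v3 (-1) golden 0" by (rule rs[OF 4, of 1]) (simp add: refl12)
  have 6: "\<exists>g\<in>?R. g ?p = v3 1 (-golden) 0" by (rule rs[OF 4, of 2]) (simp add: refl12)
  have 7: "\<exists>g\<in>?R. g ?p = v3 (-1) (-golden) 0" by (rule rs[OF 5, of 2]) (simp add: refl12)
  have 8: "\<exists>g\<in>?R. g ?p = v3 golden 0 (-1)" by (rule rs[OF 7, of 3]) (simp add: reflection_icosa)
  have 9: "\<exists>g\<in>?R. g ?p = v3 (-golden) 0 (-1)" by (rule rs[OF 8, of 1]) (simp add: refl12)
  have 10: "\<exists>g\<in>?R. g ?p = v3 0 1 (-golden)" by (rule rs[OF 9, of 3]) (simp add: reflection_icosa)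
  have 11: "\<exists>g\<in>?R. g ?p = v3 0 (-1) (-golden)" by (rule rs[OF 10, of 2]) (simp add: refl12)
  show "\<exists>g\<in>?R. g ?p = x" if "x \<in> icosa_pts" for x
    using that 1 2 3 4 5 6 7 8 9 10 11 reach_id(1)[OF M] unfolding icosa_pts_alt by (elim insertE) simp_all
  have 12: "\<exists>g\<in>?R. g ?p = ?p \<and> g ?q = v3 golden 0 1"
    by (rule rf[OF reach_id(2)[OF M], of 3]) (simp_all add: reflection_icosa)
  have 13: "\<exists>g\<in>?R. g ?p = ?p \<and> g ?q = v3 (-golden) 0 1" by (rule rf[OF 12, of 1]) (simp_all add: refl12)
  have 14: "\<exists>g\<in>?R. g ?p = ?p \<and> g ?q = v3 1 golden 0" by (rule rf[OF 13, of 3]) (simp_all add: reflection_icosa)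
  have 15: "\<exists>g\<in>?R. g ?p = ?p \<and> g ?q = v3 (-1) golden 0" by (rule rf[OF 14, of 1]) (simp_all add: refl12)
  show "\<exists>g\<in>?R. g ?p = ?p \<and> g ?q = y" if y: "y \<in> icosa_pts" "?p \<bullet> y = ?p \<bullet> ?q" for y
  proof -
    have "y = ?q \<or> y = v3 golden 0 1 \<or> y = v3 (-golden) 0 1 \<or> y = v3 1 golden 0 \<or> y = v3 (-1) golden 0"
      using y golden_gt_1 golden_sq unfolding icosa_pts_alt by (elim insertE emptyE; simp)
    thus ?thesis using 12 13 14 15 reach_id(2)[OF M, of ?p ?q] by (elim disjE) simp_all
  qed
qed

lemma base_pairs_independent:
  "cross3 (v3 1 1 1) (v3 (-1) (-1) 1) \<noteq> 0" "cross3 (v3 0 0 1) (v3 0 1 0) \<noteq> 0"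
  "cross3 (v3 0 1 golden) (v3 0 (-1) golden) \<noteq> 0"
  using golden_gt_1 by (simp_all add: cross3_def v3_def vec_eq_iff forall_3)

lemma reflection_not_id: "n \<noteq> 0 \<Longrightarrow> reflection n \<noteq> id"
proof
  assume "n \<noteq> 0" "reflection n = id"
  hence "reflection n n = n" by simp
  hence "2 *\<^sub>R n = 0" using \<open>n \<noteq> 0\<close> by (simp add: reflection_def)
  thus False using \<open>n \<noteq> 0\<close> by simp
qed

lemma reflection_group_of_config:
  assumes M: "M \<in> coxeter_mirrors" and "pair_transitive (reflection_group M) X p q"
    "cross3 p q \<noteq> 0" "reflection (M $ 1) p = p" "reflection (M $ 1) q = q"
  shows "reflection_group M = {g. orth g \<and> g ` X = X}"
  using group_of_config[OF reflection_group_props(1)[OF M] assms(2,3) reflection_group_props(2)[OF M] assms(4,5)]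
    reflection_not_id[OF mirror_row_nonzero[OF M]] by blast

text \<open>
  The three reflection groups are the full symmetry groups of the regular tetrahedron, octahedron and
  icosahedron. The group acts transitively on pairs of adjacent vertices, and one of its reflections
  fixes such a pair.
\<close>
theorem reflection_groups:
  "reflection_group mirrors_332 = {g. orth g \<and> g ` tetra_pts = tetra_pts}"
  "reflection_group mirrors_432 = {g. orth g \<and> g ` octa_pts = octa_pts}"
  "reflection_group mirrors_532 = {g. orth g \<and> g ` icosa_pts = icosa_pts}"
  by (rule reflection_group_of_config[OF _ pair_transitive_332 base_pairs_independent(1)]
      reflection_group_of_config[OF _ pair_transitive_432 base_pairs_independent(2)]
      reflection_group_of_config[OF _ pair_transitive_532 base_pairs_independent(3)];
      simp add: mirror_rows reflection_v3)+

lemmas reflection_group_332 = reflection_groups(1) and reflection_group_432 = reflection_groups(2)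
  and reflection_group_532 = reflection_groups(3)

lemma rotation_subgroup_rotations: "rotation_subgroup M = rotations (reflection_group M)"
  by (simp add: rotation_subgroup_def rotations_def)

section \<open>Classification of the point groups without an invariant axis\<close>

lemma conj_by_props:
  assumes s: "orth s" and G: "orth_group G"
  shows "orth_group (conj_by s G)" "rotations (conj_by s G) = conj_by s (rotations G)"
proof -
  note i = orth_inv_simps[OF s]
  have inv: "ginv (ginv s \<circ> g \<circ> s) = ginv s \<circ> ginv g \<circ> s" if "g \<in> G" for g
  proof (rule ext)
    fix x
    note ig = orth_inv_simps[OF orth_groupD(1)[OF G that]]
    have "bij (ginv s \<circ> g \<circ> s)"
      using s i(5) orth_groupD(1)[OF G that] orth_bij by (intro bij_comp) auto
    moreover have "(ginv s \<circ> g \<circ> s) ((ginv s \<circ> ginv g \<circ> s) x) = x" using i ig by simp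
    ultimately show "ginv (ginv s \<circ> g \<circ> s) x = (ginv s \<circ> ginv g \<circ> s) x" by (metis bij_inv_eq_iff)
  qed
  show "orth_group (conj_by s G)" unfolding orth_group_def
  proof (intro conjI ballI)
    fix g assume "g \<in> conj_by s G"
    then obtain g' where g': "g' \<in> G" "g = ginv s \<circ> g' \<circ> s" by (auto simp: conj_by_def)
    show "orth g" unfolding g'(2)
      using s i(5) orth_groupD(1)[OF G g'(1)] orth_compose by blast
    show "ginv g \<in> conj_by s G" unfolding g'(2) inv[OF g'(1)]
      using orth_groupD(4)[OF G g'(1)] by (auto simp: conj_by_def)
    fix h assume "h \<in> conj_by s G"
    then obtain h' where h': "h' \<in> G" "h = ginv s \<circ> h' \<circ> s" by (auto simp: conj_by_def)
    have "g \<circ> h = ginv s \<circ> (g' \<circ> h') \<circ> s" unfolding g' h' using i(2) by (auto simp: fun_eq_iff)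
    thus "g \<circ> h \<in> conj_by s G" using orth_groupD(3)[OF G g'(1) h'(1)] by (auto simp: conj_by_def)
  next
    have "id = ginv s \<circ> id \<circ> s" using i(3) by simp
    thus "id \<in> conj_by s G" using orth_groupD(2)[OF G] unfolding conj_by_def by (rule image_eqI)
  qed
  have "det (matrix (ginv s \<circ> g \<circ> s)) = det (matrix g)" if "g \<in> G" for g
  proof -
    note go = orth_groupD(1)[OF G that]
    have "orth (ginv s \<circ> g)" using i(5) go orth_compose by blast
    thus ?thesis
      using det_matrix_comp[OF _ s] det_matrix_comp[OF i(5) go] det_matrix_inv[OF s] orth_det_cases[OF s] by auto
  qed
  thus "rotations (conj_by s G) = conj_by s (rotations G)"
    unfolding rotations_def conj_by_def by auto
qed

text \<open>
  Two improper elements differ by a rotation, so a single improper element common to both groups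
  forces them to agree.
\<close>
lemma group_from_rotations:
  assumes G: "orth_group G" and R: "orth_group R" and sub: "G \<subseteq> R" and rot: "rotations G = rotations R"
  shows "G = rotations R \<or> G = R"
proof (cases "G \<subseteq> rotations R")
  case True thus ?thesis using rot unfolding rotations_def by blast
next
  case False
  then obtain t where t: "t \<in> G" "t \<notin> rotations R" by blast
  have "f \<in> G" if f: "f \<in> R" for f
  proof (cases "f \<in> rotations R")
    case True thus ?thesis using rot unfolding rotations_def by blast
  next
    case False
    note to = orth_groupD(1)[OF G t(1)]
    note it = orth_inv_simps[OF to]
    have d: "det (matrix t) = -1" "det (matrix f) = -1"
      using orth_det_cases[OF to] orth_det_cases[OF orth_groupD(1)[OF R f]] t False f sub by (auto simp: rotations_def)
    have "det (matrix (ginv t \<circ> f)) = 1"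
      using det_matrix_comp[OF it(5) orth_groupD(1)[OF R f]] det_matrix_inv[OF to] d by simp
    moreover have "ginv t \<circ> f \<in> R" using orth_groupD(3,4)[OF R] t sub f by blast
    ultimately have "ginv t \<circ> f \<in> G" using rot unfolding rotations_def by blast
    hence "t \<circ> (ginv t \<circ> f) \<in> G" using orth_groupD(3)[OF G] t by blast
    moreover have "t \<circ> (ginv t \<circ> f) = f" using it by (auto simp: fun_eq_iff)
    ultimately show ?thesis by simp
  qed
  thus ?thesis using sub by blast
qed

lemma rotations_preserving:
  "rotations {g. orth g \<and> g ` X = X} = {g. orth g \<and> g ` X = X \<and> det (matrix g) = 1}"
  by (auto simp: rotations_def)

lemma orth_group_preserving: "orth_group {g. orth g \<and> g ` X = X}" unfolding orth_group_def
proof (intro conjI ballI)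
  fix g :: space_map assume g: "g \<in> {g. orth g \<and> g ` X = X}"
  thus "orth g" by blast
  have "(ginv g \<circ> g) ` X = X" using orth_inv_simps(3)[of g] g by simp
  hence "ginv g ` g ` X = X" by (simp only: image_comp)
  thus "ginv g \<in> {g. orth g \<and> g ` X = X}" using g orth_inv_simps(5) by auto
  fix h assume "h \<in> {g. orth g \<and> g ` X = X}"
  hence h: "orth h" "h ` X = X" by auto
  have "(g \<circ> h) ` X = X" unfolding image_comp[symmetric] using g h by simp
  thus "g \<circ> h \<in> {g. orth g \<and> g ` X = X}" using g h orth_compose by blast
qed (simp add: id_def)

lemma det_matrix_uminus:
  fixes g :: space_map
  assumes "orth g"
  shows "orth (\<lambda>x. - g x)" "det (matrix (\<lambda>x. - g x)) = - det (matrix g)"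
proof -
  have lin: "linear g" using assms orth_linear by blast
  show "orth (\<lambda>x. - g x)" using assms orthogonal_transformation_neg by blast
  have "matrix (\<lambda>x. - g x) = - matrix g" by (simp add: matrix_def vec_eq_iff)
  thus "det (matrix (\<lambda>x. - g x)) = - det (matrix g)" by (simp add: det_3)
qed

text \<open>
  The pyritohedral group consists of the orthogonal maps \<open>g\<close> taking the tetrahedron to itself or to
  its opposite, according to the sign of \<open>det g\<close>. In this form closure under products, inverses
  and conjugation is immediate, since the determinant is multiplicative.
\<close>
lemma rotation_subgroup_332:
  "rotation_subgroup mirrors_332 = {g. orth g \<and> g ` tetra_pts = tetra_pts \<and> det (matrix g) = 1}"
  unfolding rotation_subgroup_rotations reflection_group_332 rotations_preserving ..

lemma pyritohedral_iff:
  "g \<in> pyritohedral_group \<longleftrightarrow> orth g \<and> g ` tetra_pts = (*\<^sub>R) (det (matrix g)) ` tetra_pts"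
proof
  assume "g \<in> pyritohedral_group"
  then consider "g \<in> rotation_subgroup mirrors_332" | k where "k \<in> rotation_subgroup mirrors_332" "g = (\<lambda>x. - k x)"
    unfolding pyritohedral_group_def by blast
  thus "orth g \<and> g ` tetra_pts = (*\<^sub>R) (det (matrix g)) ` tetra_pts"
  proof cases
    case 1 thus ?thesis unfolding rotation_subgroup_332 by simp
  next
    case (2 k)
    hence k: "orth k" "k ` tetra_pts = tetra_pts" "det (matrix k) = 1" unfolding rotation_subgroup_332 by auto
    have "g ` tetra_pts = uminus ` k ` tetra_pts" unfolding 2(2) by (simp add: image_image)
    thus ?thesis using det_matrix_uminus[OF k(1)] k(2,3) 2(2) by simp
  qed
next
  assume g: "orth g \<and> g ` tetra_pts = (*\<^sub>R) (det (matrix g)) ` tetra_pts"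
  show "g \<in> pyritohedral_group"
  proof (cases "det (matrix g) = 1")
    case True thus ?thesis using g unfolding pyritohedral_group_def rotation_subgroup_332 by simp
  next
    case False
    hence d: "det (matrix g) = -1" using orth_det_cases g by blast
    have "(\<lambda>x. - g x) ` tetra_pts = uminus ` g ` tetra_pts" by (simp add: image_image)
    also have "\<dots> = tetra_pts" using g d by (simp add: image_image)
    finally have "(\<lambda>x. - g x) \<in> rotation_subgroup mirrors_332"
      using g d det_matrix_uminus[of g] unfolding rotation_subgroup_332 by simp
    hence "(\<lambda>x. - (- g x)) \<in> (\<lambda>g x. - g x) ` rotation_subgroup mirrors_332" by (rule imageI)
    thus ?thesis unfolding pyritohedral_group_def by simp
  qed
qed

lemma orth_image_scale:
  fixes g :: space_map
  shows "orth g \<Longrightarrow> g ` (*\<^sub>R) c ` X = (*\<^sub>R) c ` g ` X"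
  by (simp add: image_image orth_scale)

lemma orth_group_pyritohedral: "orth_group pyritohedral_group" unfolding orth_group_def
proof (intro conjI ballI)
  show "id \<in> pyritohedral_group" unfolding pyritohedral_iff det_matrix_id by (simp add: id_def)
  fix g assume "g \<in> pyritohedral_group"
  hence g: "orth g" "g ` tetra_pts = (*\<^sub>R) (det (matrix g)) ` tetra_pts" unfolding pyritohedral_iff by auto
  note ig = orth_inv_simps[OF g(1)]
  have dd: "det (matrix g) * det (matrix g) = 1" using orth_det_cases[OF g(1)] by auto
  show "orth g" by (rule g(1))
  have "tetra_pts = ginv g ` g ` tetra_pts" using ig(3) by (simp add: image_comp)
  also have "\<dots> = (*\<^sub>R) (det (matrix g)) ` ginv g ` tetra_pts" unfolding g(2) by (rule orth_image_scale[OF ig(5)])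
  finally have "(*\<^sub>R) (det (matrix g)) ` tetra_pts = (*\<^sub>R) (det (matrix g)) ` (*\<^sub>R) (det (matrix g)) ` ginv g ` tetra_pts" by simp
  also have "\<dots> = ginv g ` tetra_pts" by (simp add: image_image dd)
  finally show "ginv g \<in> pyritohedral_group"
    unfolding pyritohedral_iff using ig(5) det_matrix_inv[OF g(1)] by simp
  fix h assume "h \<in> pyritohedral_group"
  hence h: "orth h" "h ` tetra_pts = (*\<^sub>R) (det (matrix h)) ` tetra_pts" unfolding pyritohedral_iff by auto
  have "(g \<circ> h) ` tetra_pts = (*\<^sub>R) (det (matrix h)) ` (*\<^sub>R) (det (matrix g)) ` tetra_pts"
    unfolding image_comp[symmetric] h(2) orth_image_scale[OF g(1)] g(2) ..
  thus "g \<circ> h \<in> pyritohedral_group"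
    unfolding pyritohedral_iff using orth_compose[OF g(1) h(1)] det_matrix_comp[OF g(1) h(1)]
    by (simp add: image_image mult.commute)
qed

lemma rotations_pyritohedral: "rotations pyritohedral_group = rotation_subgroup mirrors_332"
  unfolding rotation_subgroup_332 by (auto simp: rotations_def pyritohedral_iff)

text \<open>
  In the coordinates found above the rotations of the conjugated group are all rotations preserving the
  configuration, so only the improper elements are left to be discussed. In the tetrahedral case
  they may exchange the tetrahedron with its opposite; this is the pyritohedral group, listed
  with the mirrors of the octahedral group.
\<close>
theorem (in point_group) axial_or_nonprismatic:
  obtains (axial) p where "axial \<Gamma> p"
  | (nonprismatic) s M N where "orth s" "(M, N) \<in> nonprismatic_groups" "conj_by s \<Gamma> = N"
proof (cases rule: axial_or_polyhedral)
  case (axial p) thus thesis by (rule that(1))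
next
  case (tetrahedral A X Y)
  obtain s where s: "orth s"
    "pair_transitive (conj_by s G) tetra_pts (v3 1 1 1) (v3 (-1) (-1) 1)"
    "\<And>g. g \<in> conj_by s \<Gamma> \<Longrightarrow> g ` tetra_pts = tetra_pts \<or> g ` tetra_pts = uminus ` tetra_pts"
    using tetrahedral_coordinates[OF tetrahedral] by metis
  let ?\<Gamma> = "conj_by s \<Gamma>" and ?R = "{g. orth g \<and> g ` tetra_pts = tetra_pts}"
  note c = conj_by_props[OF s(1) group]
  note cG = orth_group_rotations[OF c(1)]
  let ?T = "rotations ?R"
  have rot: "rotations ?\<Gamma> = ?T" unfolding rotations_preserving
    by (rule rotations_of_config[OF cG _ _ base_pairs_independent(1)]) (use s(2) c(2) in \<open>auto simp: rotations_def\<close>)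
  have T: "?T = rotation_subgroup mirrors_332" unfolding rotation_subgroup_rotations reflection_group_332 ..
  show thesis
  proof (cases "\<forall>g\<in>?\<Gamma>. g ` tetra_pts = tetra_pts")
    case True
    hence "?\<Gamma> \<subseteq> ?R" using orth_groupD(1)[OF c(1)] by blast
    from group_from_rotations[OF c(1) orth_group_preserving this rot] show thesis
    proof
      assume "?\<Gamma> = ?T" thus thesis
        using that(2)[of s mirrors_332 "rotation_subgroup mirrors_332"] s(1) T by (simp add: nonprismatic_groups_def)
    next
      assume "?\<Gamma> = ?R" thus thesis
        using that(2)[of s mirrors_332 "reflection_group mirrors_332"] s(1) reflection_group_332
        by (simp add: nonprismatic_groups_def)
    qed
  next
    case False
    then obtain t where t: "t \<in> ?\<Gamma>" "t ` tetra_pts \<noteq> tetra_pts" by blast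
    have rotT: "g ` tetra_pts = tetra_pts" if "g \<in> ?\<Gamma>" "det (matrix g) = 1" for g
      using rot that by (auto simp: rotations_def)
    have dt: "det (matrix t) = -1" using orth_det_cases[OF orth_groupD(1)[OF c(1) t(1)]] rotT t by blast
    have sub: "?\<Gamma> \<subseteq> pyritohedral_group"
    proof
      fix f assume f: "f \<in> ?\<Gamma>"
      note fo = orth_groupD(1)[OF c(1) f]
      show "f \<in> pyritohedral_group"
      proof (cases "det (matrix f) = 1")
        case True thus ?thesis unfolding pyritohedral_iff using fo rotT[OF f] by simp
      next
        case False
        hence d: "det (matrix f) = -1" using orth_det_cases[OF fo] by blast
        hence "(t \<circ> f) ` tetra_pts = tetra_pts"
          using orth_groupD(3)[OF c(1) t(1) f] det_matrix_comp[OF orth_groupD(1)[OF c(1) t(1)] fo] dt by (intro rotT) simp_all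
        hence "f ` tetra_pts \<noteq> tetra_pts" using t(2) unfolding image_comp[symmetric] by auto
        thus ?thesis unfolding pyritohedral_iff using fo d s(3)[OF f] by simp
      qed
    qed
    have "?\<Gamma> \<noteq> rotation_subgroup mirrors_332" using t unfolding rotation_subgroup_332 by blast
    hence "?\<Gamma> = pyritohedral_group"
      using group_from_rotations[OF c(1) orth_group_pyritohedral sub] rot T rotations_pyritohedral by simp
    thus thesis using that(2)[of s mirrors_432 pyritohedral_group] s(1) by (simp add: nonprismatic_groups_def)
  qed
next
  case (octahedral X)
  obtain s where s: "orth s" "pair_transitive (conj_by s G) octa_pts (v3 0 0 1) (v3 0 1 0)"
    "\<And>g. g \<in> conj_by s \<Gamma> \<Longrightarrow> g ` octa_pts = octa_pts"
    using octahedral_coordinates[OF octahedral] by metis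
  let ?\<Gamma> = "conj_by s \<Gamma>" and ?R = "{g. orth g \<and> g ` octa_pts = octa_pts}"
  note c = conj_by_props[OF s(1) group]
  have rot: "rotations ?\<Gamma> = rotations ?R" unfolding rotations_preserving
    by (rule rotations_of_config[OF orth_group_rotations[OF c(1)] _ _ base_pairs_independent(2)])
       (use s(2) c(2) in \<open>auto simp: rotations_def\<close>)
  have "?\<Gamma> \<subseteq> ?R" using orth_groupD(1)[OF c(1)] s(3) by blast
  from group_from_rotations[OF c(1) orth_group_preserving this rot] show thesis
  proof
    assume "?\<Gamma> = rotations ?R" thus thesis
      using that(2)[of s mirrors_432 "rotation_subgroup mirrors_432"] s(1)
      by (simp add: nonprismatic_groups_def rotation_subgroup_rotations reflection_group_432)
  next
    assume "?\<Gamma> = ?R" thus thesis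
      using that(2)[of s mirrors_432 "reflection_group mirrors_432"] s(1) reflection_group_432
      by (simp add: nonprismatic_groups_def)
  qed
next
  case (icosahedral X)
  obtain s where s: "orth s" "pair_transitive (conj_by s G) icosa_pts (v3 0 1 golden) (v3 0 (-1) golden)"
    "\<And>g. g \<in> conj_by s \<Gamma> \<Longrightarrow> g ` icosa_pts = icosa_pts"
    using icosahedral_coordinates[OF icosahedral] by metis
  let ?\<Gamma> = "conj_by s \<Gamma>" and ?R = "{g. orth g \<and> g ` icosa_pts = icosa_pts}"
  note c = conj_by_props[OF s(1) group]
  have rot: "rotations ?\<Gamma> = rotations ?R" unfolding rotations_preserving
    by (rule rotations_of_config[OF orth_group_rotations[OF c(1)] _ _ base_pairs_independent(3)])
       (use s(2) c(2) in \<open>auto simp: rotations_def\<close>)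
  have "?\<Gamma> \<subseteq> ?R" using orth_groupD(1)[OF c(1)] s(3) by blast
  from group_from_rotations[OF c(1) orth_group_preserving this rot] show thesis
  proof
    assume "?\<Gamma> = rotations ?R" thus thesis
      using that(2)[of s mirrors_532 "rotation_subgroup mirrors_532"] s(1)
      by (simp add: nonprismatic_groups_def rotation_subgroup_rotations reflection_group_532)
  next
    assume "?\<Gamma> = ?R" thus thesis
      using that(2)[of s mirrors_532 "reflection_group mirrors_532"] s(1) reflection_group_532
      by (simp add: nonprismatic_groups_def)
  qed
qed

section \<open>Properties of the nonprismatic groups\<close>

lemma nonprismatic_cases:
  assumes "(M, N) \<in> nonprismatic_groups"
  obtains "M \<in> coxeter_mirrors" "N = reflection_group M"
  | "M \<in> coxeter_mirrors" "N = rotation_subgroup M"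
  | "M = mirrors_432" "N = pyritohedral_group" using assms unfolding nonprismatic_groups_def by auto

lemma finite_orth_preserving:
  assumes "finite X" "a \<in> X" "b \<in> X" "c \<in> X" "cross3 a b \<bullet> c \<noteq> 0"
  shows "finite {g. orth g \<and> g ` X = X}"
proof -
  let ?S = "{g. orth g \<and> g ` X = X}"
  have "inj_on (\<lambda>g. (g a, g b, g c)) ?S"
  proof (rule inj_onI)
    fix f g :: space_map assume fg: "f \<in> ?S" "g \<in> ?S" "(f a, f b, f c) = (g a, g b, g c)"
    hence fo: "orth f" and go: "orth g" by auto
    note ig = orth_inv_simps[OF go]
    have "ginv g (f x) = x" for x
    proof (rule inner_eq_basis[OF _ _ _ assms(5)])
      have *: "ginv g (f x) \<bullet> y = x \<bullet> y" if "f y = g y" for y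
        using orth_inner[OF fo, of x y] orth_inner[OF go, of "ginv g (f x)" y] ig(2) that by simp
      show "ginv g (f x) \<bullet> a = x \<bullet> a" "ginv g (f x) \<bullet> b = x \<bullet> b" "ginv g (f x) \<bullet> c = x \<bullet> c"
        using * fg(3) by simp_all
    qed
    hence "f x = g x" for x using ig(2) by metis
    thus "f = g" by blast
  qed
  moreover have "(\<lambda>g. (g a, g b, g c)) ` ?S \<subseteq> X \<times> X \<times> X"
  proof
    fix y assume "y \<in> (\<lambda>g. (g a, g b, g c)) ` ?S"
    then obtain g where g: "g ` X = X" "y = (g a, g b, g c)" by blast
    thus "y \<in> X \<times> X \<times> X" using assms(2-4) by blast
  qed
  moreover have "finite (X \<times> X \<times> X)" using assms by simp
  ultimately show ?thesis by (meson finite_imageD finite_subset)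
qed

lemma finite_reflection_groups:
  assumes "M \<in> coxeter_mirrors" shows "finite (reflection_group M)"
proof -
  have 1: "finite (reflection_group mirrors_332)" unfolding reflection_group_332
    by (rule finite_orth_preserving[of _ "v3 1 1 1" "v3 (-1) (-1) 1" "v3 1 (-1) (-1)"])
       (auto simp: tetra_pts_def triple_v3)
  have 2: "finite (reflection_group mirrors_432)" unfolding reflection_group_432
    by (rule finite_orth_preserving[of _ "v3 0 0 1" "v3 0 1 0" "v3 1 0 0"])
       (auto simp: octa_pts_def triple_v3)
  have 3: "finite (reflection_group mirrors_532)" unfolding reflection_group_532
    by (rule finite_orth_preserving[of _ "v3 0 1 golden" "v3 0 (-1) golden" "v3 golden 0 1"])
       (use golden_gt_1 in \<open>simp_all add: icosa_pts_alt triple_v3\<close>)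
  show ?thesis using assms 1 2 3 by auto
qed

lemma nonprismatic_finite:
  assumes "(M, N) \<in> nonprismatic_groups" shows "finite N"
proof -
  have "finite (rotation_subgroup M)" if "M \<in> coxeter_mirrors" for M
    using finite_reflection_groups[OF that] unfolding rotation_subgroup_def by simp
  moreover from this have "finite pyritohedral_group" unfolding pyritohedral_group_def by simp
  ultimately show ?thesis using nonprismatic_cases[OF assms] finite_reflection_groups by metis
qed

lemma orth_group_nonprismatic:
  assumes "(M, N) \<in> nonprismatic_groups" shows "orth_group N"
proof (cases rule: nonprismatic_cases[OF assms])
  case 1 thus ?thesis using reflection_group_props(1) by blast
next
  case 2 thus ?thesis using reflection_group_props(1) orth_group_rotations rotation_subgroup_rotations by metis
next
  case 3 thus ?thesis using orth_group_pyritohedral by simp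
qed

text \<open>
  Only the pyritohedral group is neither the whole reflection group nor its subgroup of rotations. It
  is normal because the reflections of the octahedral group take the tetrahedron to itself or to its opposite.
\<close>
lemma nonprismatic_normal:
  assumes MN: "(M, N) \<in> nonprismatic_groups" and g: "g \<in> reflection_group M" and h: "h \<in> N"
  shows "ginv g \<circ> h \<circ> g \<in> N" "g \<circ> h \<circ> ginv g \<in> N"
proof -
  have M3: "M \<in> coxeter_mirrors" using MN by (auto simp: nonprismatic_groups_def)
  note R = reflection_group_props(1)[OF M3]
  have main: "ginv g \<circ> h \<circ> g \<in> N" if g: "g \<in> reflection_group M" for g
  proof (cases rule: nonprismatic_cases[OF MN])
    case 1 thus ?thesis using orth_groupD(3,4)[OF R] g h by blast
  next
    case 2
    hence "conj_by g (rotations (reflection_group M)) = rotations (conj_by g (reflection_group M))"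
      using conj_by_props(2)[OF orth_groupD(1)[OF R g] R] by simp
    moreover have "ginv g \<circ> h \<circ> g \<in> reflection_group M"
      using orth_groupD(3,4)[OF R] g h 2 unfolding rotation_subgroup_def by blast
    moreover have "ginv g \<circ> h \<circ> g \<in> conj_by g (rotations (reflection_group M))"
      using h 2 unfolding rotation_subgroup_rotations conj_by_def by blast
    ultimately show ?thesis using 2 unfolding rotation_subgroup_rotations rotations_def by blast
  next
    case 3
    have gt: "f ` tetra_pts = tetra_pts \<or> f ` tetra_pts = uminus ` tetra_pts" if f: "f \<in> reflection_group mirrors_432" for f
    proof -
      have o: "orth h" if "h \<in> range (\<lambda>i. reflection (mirrors_432 $ i))" for h
        using that reflection_orth mirror_row_nonzero[of mirrors_432] by auto
      hence b: "bij h" if "h \<in> range (\<lambda>i. reflection (mirrors_432 $ i))" for h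
        using that orth_bij by blast
      let ?P = "\<lambda>f. orth f \<and> (f ` tetra_pts = tetra_pts \<or> f ` tetra_pts = uminus ` tetra_pts)"
      have inc: "?P h" if "h \<in> range (\<lambda>i. reflection (mirrors_432 $ i))" for h
      proof -
        obtain i where i: "h = reflection (mirrors_432 $ i)" using \<open>h \<in> _\<close> by blast
        have "h ` tetra_pts = tetra_pts \<or> h ` tetra_pts = uminus ` tetra_pts"
          unfolding i tetra_pts_def using exhaust_3[of i] by (auto simp: mirror_rows reflection_v3)
        thus ?thesis using o that by blast
      qed
      have mm: "uminus ` uminus ` tetra_pts = tetra_pts" by (simp add: image_image)
      have fm: "f ` uminus ` tetra_pts = uminus ` f ` tetra_pts" if "orth f" for f
        using orth_minus[OF that] by (simp add: image_image)
      have "?P f" using b f[unfolded reflection_group_def]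
      proof (rule generated_by_induct[where P = ?P])
        fix h assume "h \<in> range (\<lambda>i. reflection (mirrors_432 $ i))"
        hence h: "?P h" by (rule inc)
        hence ho: "orth h" by blast
        have e: "ginv h ` h ` tetra_pts = tetra_pts" using orth_inv_simps(3)[OF ho] by (simp add: image_comp)
        have "ginv h ` tetra_pts = tetra_pts \<or> ginv h ` tetra_pts = uminus ` tetra_pts"
        proof (cases "h ` tetra_pts = tetra_pts")
          case True thus ?thesis using e by simp
        next
          case False
          hence "ginv h ` uminus ` tetra_pts = tetra_pts" using h e by metis
          hence "uminus ` ginv h ` tetra_pts = tetra_pts" using fm[OF orth_inv_simps(5)[OF ho]] by simp
          hence "uminus ` uminus ` ginv h ` tetra_pts = uminus ` tetra_pts" by (rule arg_cong)
          thus ?thesis by (simp add: image_image)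
        qed
        thus "?P (ginv h)" using orth_inv_simps(5)[OF ho] by blast
      next
        fix f h assume "?P f" "?P h"
        thus "?P (f \<circ> h)" using fm[of f] mm orth_compose[of f h]
          unfolding image_comp[symmetric] by metis
      qed (use inc in \<open>auto simp: id_def\<close>)
      thus ?thesis by blast
    qed
    have g': "g \<in> reflection_group mirrors_432" using g 3 by simp
    note go = orth_groupD(1)[OF R g]
    note ig = orth_inv_simps[OF go]
    obtain e where e: "g ` tetra_pts = (*\<^sub>R) e ` tetra_pts" "e * e = 1"
      using gt[OF g'] that[of 1] that[of "-1"] by auto
    have h3: "orth h" "h ` tetra_pts = (*\<^sub>R) (det (matrix h)) ` tetra_pts"
      using h unfolding 3 pyritohedral_iff by auto
    have o: "orth (ginv g \<circ> h)" using ig(5) h3(1) orth_compose by blast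
    have "(ginv g \<circ> h \<circ> g) ` tetra_pts = (*\<^sub>R) e ` (*\<^sub>R) (det (matrix h)) ` ginv g ` tetra_pts"
      unfolding image_comp[symmetric] e(1) orth_image_scale[OF h3(1)] h3(2) orth_image_scale[OF ig(5)] ..
    also have "ginv g ` tetra_pts = (*\<^sub>R) e ` ginv g ` g ` tetra_pts"
      unfolding e(1) orth_image_scale[OF ig(5)] by (simp add: image_image e(2))
    also have "ginv g ` g ` tetra_pts = tetra_pts" using ig(3) by (simp add: image_comp)
    also have "(*\<^sub>R) e ` (*\<^sub>R) (det (matrix h)) ` (*\<^sub>R) e ` tetra_pts = (*\<^sub>R) (e * e * det (matrix h)) ` tetra_pts"
      by (simp only: image_image scaleR_scaleR ac_simps)
    finally have "(ginv g \<circ> h \<circ> g) ` tetra_pts = (*\<^sub>R) (det (matrix h)) ` tetra_pts" by (simp only: e(2) mult_1)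
    moreover have "det (matrix (ginv g \<circ> h \<circ> g)) = det (matrix h)"
      using det_matrix_comp[OF o go] det_matrix_comp[OF ig(5) h3(1)] det_matrix_inv[OF go] orth_det_cases[OF go] by auto
    ultimately show ?thesis unfolding 3 pyritohedral_iff using orth_compose[OF o go] by simp
  qed
  show "ginv g \<circ> h \<circ> g \<in> N" using main g by blast
  have "ginv (ginv g) = g"
    using orth_groupD(1)[OF R g] orth_bij inv_inv_eq by blast
  thus "g \<circ> h \<circ> ginv g \<in> N" using main[OF orth_groupD(4)[OF R g]] by simp
qed

definition cyclic_shift :: space_map where "cyclic_shift x = v3 (x $ 2) (x $ 3) (x $ 1)"

text \<open>The cyclic permutation of the coordinates preserves all three configurations.\<close>
lemma nonprismatic_order_3:
  assumes "(M, N) \<in> nonprismatic_groups" obtains g where "g \<in> N" "g \<noteq> id" "\<And>x. g (g (g x)) = x"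
proof -
  have o: "orth cyclic_shift" unfolding orth_def
  proof
    show "linear cyclic_shift" by (rule linearI) (simp_all add: cyclic_shift_def)
    show "\<forall>v w. cyclic_shift v \<bullet> cyclic_shift w = v \<bullet> w"
      by (simp add: cyclic_shift_def inner_vec_def sum_3)
  qed
  have d: "det (matrix cyclic_shift) = 1" by (simp add: det_3 matrix_def cyclic_shift_def axis_def)
  have v: "cyclic_shift (v3 a b c) = v3 b c a" for a b c by (simp add: cyclic_shift_def)
  have "cyclic_shift ` tetra_pts = tetra_pts" "cyclic_shift ` octa_pts = octa_pts" "cyclic_shift ` icosa_pts = icosa_pts"
    unfolding tetra_pts_def octa_pts_def icosa_pts_alt by (auto simp: v)
  hence "cyclic_shift \<in> rotation_subgroup M" if "M \<in> coxeter_mirrors" for M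
    using that o d reflection_group_332 reflection_group_432 reflection_group_532 unfolding rotation_subgroup_def by auto
  hence "cyclic_shift \<in> N" using nonprismatic_cases[OF assms]
    unfolding rotation_subgroup_def pyritohedral_group_def by (smt (verit) UnI1 insertI1 mem_Collect_eq)
  moreover have "cyclic_shift \<noteq> id"
  proof
    assume "cyclic_shift = id" hence "cyclic_shift (v3 1 0 0) = v3 1 0 0" by simp
    thus False by (simp add: v)
  qed
  moreover have "cyclic_shift (cyclic_shift (cyclic_shift x)) = x" for x
    by (simp add: cyclic_shift_def v3_eta)
  ultimately show thesis by (rule that)
qed

lemma nonprismatic_det:
  assumes "(M, N) \<in> nonprismatic_groups" shows "cross3 (M $ 1) (M $ 2) \<bullet> M $ 3 \<noteq> 0"
  using assms golden_gt_1 unfolding nonprismatic_groups_def by (auto simp: mirror_rows triple_v3)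

section \<open>Placing a noble polyhedron\<close>

lemma orth_is_isometry: "orth f \<Longrightarrow> isometry f" by (rule orthogonal_transformation_is_isometry)

lemma symmetry_group_conj:
  assumes P: "noble P" and s: "orth s"
  shows "symmetry_group (transform (ginv s) P) = conj_by s (symmetry_group P)"
proof -
  interpret noble_polyhedron P by (rule noble_polyhedronI[OF P])
  note i = orth_inv_simps[OF s]
  have "(\<exists>h\<in>symmetry_group P. ginv s \<circ> h = g \<circ> ginv s) \<longleftrightarrow> g \<in> conj_by s (symmetry_group P)" for g
  proof -
    have "ginv s \<circ> h = g \<circ> ginv s \<longleftrightarrow> g = ginv s \<circ> h \<circ> s" for h
    proof
      assume "ginv s \<circ> h = g \<circ> ginv s"
      thus "g = ginv s \<circ> h \<circ> s" using i(3) by (metis comp_assoc comp_id)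
    next
      assume "g = ginv s \<circ> h \<circ> s"
      thus "ginv s \<circ> h = g \<circ> ginv s" using i(4) by (metis comp_assoc comp_id)
    qed
    thus ?thesis unfolding conj_by_def by auto
  qed
  thus ?thesis unfolding symmetry_group_transform[OF orth_is_isometry[OF i(5)]] by blast
qed

lemma symmetry_point_group:
  assumes P: "noble P" and o: "\<And>h. h \<in> symmetry_group P \<Longrightarrow> orth h"
  shows "point_group (symmetry_group P)"
proof -
  interpret noble_polyhedron P by (rule noble_polyhedronI[OF P])
  show ?thesis
    using o symmetry_group_id symmetry_group_comp symmetry_group_inv symmetry_group_finite
    by unfold_locales (auto simp: orth_group_def)
qed

theorem noble_axial_or_nonprismatic:
  assumes P: "noble P"
  obtains (axial) t where "isometry t" "\<And>h. h \<in> symmetry_group (transform t P) \<Longrightarrow> orth h"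
      "\<And>h. h \<in> symmetry_group (transform t P) \<Longrightarrow> h (v3 0 0 1) = v3 0 0 1 \<or> h (v3 0 0 1) = - v3 0 0 1"
  | (nonprismatic) t M N where "isometry t" "(M, N) \<in> nonprismatic_groups" "symmetry_group (transform t P) = N"
proof -
  obtain s0 where s0: "isometry s0" "\<And>h. h \<in> symmetry_group (transform s0 P) \<Longrightarrow> orth h"
    using noble_centre[OF P] by blast
  let ?P = "transform s0 P"
  have nP: "noble ?P" using noble_transform[OF s0(1) P] .
  interpret point_group "symmetry_group ?P" by (rule symmetry_point_group[OF nP s0(2)])
  show thesis
  proof (cases rule: axial_or_nonprismatic)
    case (axial p)
    have "norm (v3 0 0 1) = 1" unfolding norm_eq_1 by simp
    then obtain s where s: "orth s" "s (v3 0 0 1) = p"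
      using orthogonal_transformation_exists_1[of "v3 0 0 1" p] axial unfolding axial_def by blast
    note i = orth_inv_simps[OF s(1)]
    have t: "isometry (ginv s \<circ> s0)" using isometry_comp orth_is_isometry i(5) s0 by blast
    have sg: "symmetry_group (transform (ginv s \<circ> s0) P) = conj_by s (symmetry_group ?P)"
      using symmetry_group_conj[OF nP s(1)] by (simp add: transform_transform)
    show thesis
    proof (rule that(1)[OF t])
      fix h assume "h \<in> symmetry_group (transform (ginv s \<circ> s0) P)"
      hence h: "h \<in> conj_by s (symmetry_group ?P)" using sg by simp
      thus "orth h" using conj_by_props(1)[OF s(1) group] orth_groupD(1) by blast
      obtain k where k: "k \<in> symmetry_group ?P" "h = ginv s \<circ> k \<circ> s" using h by (auto simp: conj_by_def)
      have "h (v3 0 0 1) = ginv s (k p)" using k s by simp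
      moreover have "ginv s p = v3 0 0 1" using i(1) s(2) by metis
      moreover have "ginv s (- p) = - ginv s p" using orth_minus[OF i(5)] .
      moreover have "k p = p \<or> k p = - p" using axial k unfolding axial_def by blast
      ultimately show "h (v3 0 0 1) = v3 0 0 1 \<or> h (v3 0 0 1) = - v3 0 0 1" by metis
    qed
  next
    case (nonprismatic s M N)
    have "isometry (ginv s \<circ> s0)"
      using isometry_comp orth_is_isometry orth_inv_simps(5)[OF nonprismatic(1)] s0 by blast
    moreover have "symmetry_group (transform (ginv s \<circ> s0) P) = N"
      using symmetry_group_conj[OF nP nonprismatic(1)] nonprismatic(3) by (simp add: transform_transform)
    ultimately show thesis using that(2) nonprismatic(2) by blast
  qed
qed

section \<open>Orbit types\<close>

lemma infdist_plane:
  fixes n v :: "'a::euclidean_space"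
  assumes "n \<noteq> 0" shows "infdist v {x. n \<bullet> x = 0} = \<bar>n \<bullet> v\<bar> / norm n"
proof (rule antisym)
  have ne: "{x. n \<bullet> x = 0} \<noteq> {}" by (auto intro: exI[of _ 0])
  let ?a = "v - ((n \<bullet> v) / (n \<bullet> n)) *\<^sub>R n"
  have "n \<bullet> ?a = 0" using assms by (simp add: inner_diff_right)
  hence "infdist v {x. n \<bullet> x = 0} \<le> dist v ?a" by (intro infdist_le) simp
  also have "dist v ?a = \<bar>n \<bullet> v\<bar> / norm n"
    using assms by (simp add: dist_norm dot_square_norm power2_eq_square)
  finally show "infdist v {x. n \<bullet> x = 0} \<le> \<bar>n \<bullet> v\<bar> / norm n" .
  have "\<bar>n \<bullet> v\<bar> / norm n \<le> dist v a" if "a \<in> {x. n \<bullet> x = 0}" for a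
  proof -
    have "\<bar>n \<bullet> v\<bar> = \<bar>n \<bullet> (v - a)\<bar>" using that by (simp add: inner_diff_right)
    also have "\<dots> \<le> norm n * norm (v - a)" by (rule Cauchy_Schwarz_ineq2)
    finally show ?thesis using assms by (simp add: dist_norm field_simps)
  qed
  thus "\<bar>n \<bullet> v\<bar> / norm n \<le> infdist v {x. n \<bullet> x = 0}"
    unfolding infdist_notempty[OF ne] by (intro cINF_greatest ne) auto
qed

lemma independent_rows_solve:
  fixes M :: "real^3^3"
  assumes "cross3 (M $ 1) (M $ 2) \<bullet> M $ 3 \<noteq> 0"
  obtains v where "\<And>j. M $ j \<bullet> v = w j"
proof -
  have "M = vector [M $ 1, M $ 2, M $ 3]" by (simp add: vec_eq_iff forall_3)
  hence "det M = M $ 1 \<bullet> cross3 (M $ 2) (M $ 3)" using dot_cross_det by metis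
  also have "\<dots> = cross3 (M $ 1) (M $ 2) \<bullet> M $ 3" by (simp add: cross3_simps)
  finally have "det M \<noteq> 0" using assms by simp
  then obtain C where C: "M ** C = mat 1" using invertible_det_nz[of M] unfolding invertible_def by blast
  have "M *v (C *v (\<chi> j. w j)) = (\<chi> j. w j)" by (simp add: matrix_vector_mul_assoc C)
  hence "M $ j \<bullet> (C *v (\<chi> j. w j)) = w j" for j
    by (metis matrix_vector_mul_component vec_lambda_beta)
  thus thesis by (rule that)
qed

lemma rows_unique:
  fixes M :: "real^3^3"
  assumes "cross3 (M $ 1) (M $ 2) \<bullet> M $ 3 \<noteq> 0" "\<And>j. M $ j \<bullet> v = M $ j \<bullet> w" shows "v = w"
  by (rule inner_eq_basis[OF _ _ _ assms(1)]) (use assms(2) in \<open>simp_all add: inner_commute\<close>)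

text \<open>
  Lying on the other two mirrors and at distance one from the mirror with normal vector
  \<open>n\<close> means having inner products \<open>0\<close>, \<open>0\<close> and \<open>norm
  n\<close> with the three normal vectors.
\<close>
lemma basis_vec_inner:
  fixes M :: "real^3^3"
  assumes M: "cross3 (M $ 1) (M $ 2) \<bullet> M $ 3 \<noteq> 0"
  shows "M $ j \<bullet> basis_vec M i = (if j = i then norm (M $ i) else 0)"
proof -
  have nz: "M $ i \<noteq> 0" for i
    using M exhaust_3[of i] by (metis cross_zero_left cross_zero_right inner_zero_left inner_zero_right)
  obtain v where v: "\<And>j. M $ j \<bullet> v = (if j = i then norm (M $ i) else 0)"
    using independent_rows_solve[OF M, of "\<lambda>j. if j = i then norm (M $ i) else 0"] by blast
  let ?Q = "\<lambda>v. v \<in> fundamental_domain M \<and> (\<forall>j. j \<noteq> i \<longrightarrow> v \<in> mirror M j) \<and> infdist v (mirror M i) = 1"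
  have "basis_vec M i = v" unfolding basis_vec_def
  proof (rule the_equality)
    show "?Q v" unfolding fundamental_domain_def mirror_def infdist_plane[OF nz] using v nz by auto
    fix w assume w: "?Q w"
    have "0 \<le> M $ i \<bullet> w" using w by (simp add: fundamental_domain_def)
    moreover have "infdist w (mirror M i) = 1" using w by blast
    hence "\<bar>M $ i \<bullet> w\<bar> / norm (M $ i) = 1" unfolding mirror_def infdist_plane[OF nz] .
    ultimately have "M $ i \<bullet> w = norm (M $ i)" by (simp add: divide_eq_1_iff split: if_splits)
    moreover have "M $ j \<bullet> w = 0" if "j \<noteq> i" for j using w that by (simp add: mirror_def)
    ultimately show "w = v" using v by (intro rows_unique[OF M]) auto
  qed
  thus ?thesis using v by simp
qed

lemma generating_point_inner:
  fixes M :: "real^3^3"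
  assumes M: "cross3 (M $ 1) (M $ 2) \<bullet> M $ 3 \<noteq> 0"
  shows "M $ j \<bullet> generating_point M c = c $ j * norm (M $ j)"
  unfolding generating_point_def inner_sum_right inner_scaleR_right basis_vec_inner[OF M]
  by (simp add: if_distrib cong: if_cong)

text \<open>Divide by the last coefficient that is not zero.\<close>
lemma coefficient_family_scaling:
  fixes d :: "real^3"
  assumes "\<And>i. d $ i \<ge> 0" "d \<noteq> 0"
  obtains k C where "k > 0" "C \<in> coefficient_families" "k *\<^sub>R d \<in> C"
proof -
  have abc: "\<exists>C\<in>coefficient_families. vector [a, b, 1] \<in> C" if nn: "a \<ge> 0" "b \<ge> 0" for a b :: real
  proof -
    consider "a > 0" "b > 0" | "a = 0" "b > 0" | "a > 0" "b = 0" | "a = 0" "b = 0" using nn by fastforce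
    thus ?thesis
    proof cases
      case 1 hence "vector [a, b, 1] \<in> {vector [a, b, 1] |a b. 0 < a \<and> 0 < (b::real)}" by blast
      thus ?thesis by (rule bexI) (simp add: coefficient_families_def)
    next
      case 2 hence "vector [a, b, 1] \<in> {vector [0, a, 1] |a. 0 < (a::real)}" by blast
      thus ?thesis by (rule bexI) (simp add: coefficient_families_def)
    next
      case 3 hence "vector [a, b, 1] \<in> {vector [a, 0, 1] |a. 0 < (a::real)}" by blast
      thus ?thesis by (rule bexI) (simp add: coefficient_families_def)
    next
      case 4 hence "vector [a, b, 1] \<in> {vector [0, 0, 1 :: real]}" by simp
      thus ?thesis by (rule bexI) (simp add: coefficient_families_def)
    qed
  qed
  have ab: "\<exists>C\<in>coefficient_families. vector [a, 1, 0] \<in> C" if "a \<ge> 0" for a :: real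
  proof (cases "a = 0")
    case False hence "vector [a, 1, 0] \<in> {vector [a, 1, 0] |a. 0 < (a::real)}" using that by force
    thus ?thesis by (rule bexI) (simp add: coefficient_families_def)
  qed (simp add: coefficient_families_def)
  have a: "\<exists>C\<in>coefficient_families. vector [1, 0, 0] \<in> C" unfolding coefficient_families_def by auto
  have nn: "d $ 1 \<ge> 0" "d $ 2 \<ge> 0" "d $ 3 \<ge> 0" using assms by auto
  have "d $ 1 \<noteq> 0 \<or> d $ 2 \<noteq> 0 \<or> d $ 3 \<noteq> 0" using assms(2) by (simp add: vec_eq_iff forall_3)
  then consider "d $ 3 > 0" | "d $ 3 = 0" "d $ 2 > 0" | "d $ 3 = 0" "d $ 2 = 0" "d $ 1 > 0" using nn by fastforce
  thus thesis
  proof cases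
    case 1
    hence "(1 / d $ 3) *\<^sub>R d = vector [d $ 1 / d $ 3, d $ 2 / d $ 3, 1]" by (simp add: vec_eq_iff forall_3)
    thus thesis using abc[of "d $ 1 / d $ 3" "d $ 2 / d $ 3"] nn 1 that[of "1 / d $ 3"] by auto
  next
    case 2
    hence "(1 / d $ 2) *\<^sub>R d = vector [d $ 1 / d $ 2, 1, 0]" by (simp add: vec_eq_iff forall_3)
    thus thesis using ab[of "d $ 1 / d $ 2"] nn 2 that[of "1 / d $ 2"] by auto
  next
    case 3
    hence "(1 / d $ 1) *\<^sub>R d = vector [1, 0, 0]" by (simp add: vec_eq_iff forall_3)
    thus thesis using a 3 that[of "1 / d $ 1"] by auto
  qed
qed

text \<open>
  The image of a point that lies closest to an interior point of the fundamental domain lies in the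
  fundamental domain, because a reflection in a violated mirror would bring it closer.
\<close>
lemma fundamental_domain_meets_orbit:
  assumes MN: "(M, N) \<in> nonprismatic_groups"
  obtains g where "g \<in> reflection_group M" "g x \<in> fundamental_domain M"
proof -
  have M3: "M \<in> coxeter_mirrors" using MN by (auto simp: nonprismatic_groups_def)
  let ?R = "reflection_group M"
  note R = reflection_group_props(1)[OF M3]
  obtain y where y: "\<And>j. M $ j \<bullet> y = 1" using independent_rows_solve[OF nonprismatic_det[OF MN], of "\<lambda>_. 1"] by blast
  let ?D = "(\<lambda>g. g x \<bullet> y) ` ?R"
  have D: "finite ?D" "?D \<noteq> {}" using finite_reflection_groups[OF M3] orth_groupD(2)[OF R] by auto
  obtain g where g: "g \<in> ?R" "Max ?D = g x \<bullet> y" using Max_in[OF D] by blast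
  have g2: "h x \<bullet> y \<le> g x \<bullet> y" if "h \<in> ?R" for h using Max_ge[OF D(1), of "h x \<bullet> y"] that g(2) by auto
  have "0 \<le> M $ i \<bullet> g x" for i
  proof -
    let ?n = "M $ i"
    have nz: "?n \<bullet> ?n > 0" using mirror_row_nonzero[OF M3] by simp
    have "reflection ?n \<circ> g \<in> ?R" using orth_groupD(3)[OF R reflection_group_props(2)[OF M3] g(1)] .
    hence "reflection ?n (g x) \<bullet> y \<le> g x \<bullet> y" using g2 by fastforce
    moreover have "reflection ?n (g x) \<bullet> y = g x \<bullet> y - 2 * (?n \<bullet> g x) / (?n \<bullet> ?n)"
      unfolding reflection_def by (simp add: inner_diff_left y)
    ultimately have "0 \<le> 2 * (?n \<bullet> g x) / (?n \<bullet> ?n)" by linarith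
    thus ?thesis using nz by (simp add: zero_le_divide_iff)
  qed
  thus thesis using that g(1) by (simp add: fundamental_domain_def)
qed

definition in_normal_form :: "'a realized \<Rightarrow> space_map \<Rightarrow> real^3^3 \<Rightarrow> space_map set \<Rightarrow> (real^3) set \<Rightarrow> real^3 \<Rightarrow> bool" where
  "in_normal_form P s M N C c \<longleftrightarrow> similarity s \<and> (M, N) \<in> nonprismatic_groups \<and> C \<in> coefficient_families \<and> c \<in> C \<and>
     geom_vertices (transform s P) = vertex_orbit M N c"

text \<open>
  Since \<open>N\<close> is normal in the reflection group, the image of an orbit of \<open>N\<close> under an element \<open>g\<close> of the
  latter is again an orbit of \<open>N\<close>. So a vertex may be moved into the fundamental domain, and
  there it is a nonnegative combination of the basis vectors.
\<close>
theorem normal_form_exists: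
  assumes P: "noble P" and t: "isometry t" and MN: "(M, N) \<in> nonprismatic_groups" "symmetry_group (transform t P) = N"
  shows "\<exists>s C c. in_normal_form P s M N C c"
proof -
  let ?P = "transform t P"
  interpret noble_polyhedron ?P by (rule noble_polyhedronI[OF noble_transform[OF t P]])
  note N = orth_group_nonprismatic[OF MN(1)]
  note det = nonprismatic_det[OF MN(1)]
  have M3: "M \<in> coxeter_mirrors" using MN(1) by (auto simp: nonprismatic_groups_def)
  note R = reflection_group_props(1)[OF M3]
  let ?V = "geom_vertices ?P"
  obtain x where x: "x \<in> ?V" using V_nonempty by blast
  have V: "?V = (\<lambda>g. g x) ` N"
  proof (intro equalityI subsetI)
    fix y assume "y \<in> ?V" thus "y \<in> (\<lambda>g. g x) ` N" using vertex_transitive[OF x, of y] MN(2) by blast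
  next
    fix y assume "y \<in> (\<lambda>g. g x) ` N"
    then obtain g where "g \<in> symmetry_group ?P" "y = g x" using MN(2) by blast
    thus "y \<in> ?V" using symmetry_group_vertices[of g] x by blast
  qed
  have "x \<noteq> 0"
  proof
    assume "x = 0"
    hence "?V \<subseteq> {0}" unfolding V using orth_scale[OF orth_groupD(1)[OF N], of _ 0 0] by auto
    hence "card ?V \<le> 1" using card_mono[of "{0}" ?V] by simp
    thus False using card_V by simp
  qed
  obtain g where g: "g \<in> reflection_group M" "g x \<in> fundamental_domain M"
    using fundamental_domain_meets_orbit[OF MN(1)] .
  note go = orth_groupD(1)[OF R g(1)]
  note ig = orth_inv_simps[OF go]
  have nz: "M $ j \<noteq> 0" for j using mirror_row_nonzero[OF M3] .
  define d :: "real^3" where "d = (\<chi> j. (M $ j \<bullet> g x) / norm (M $ j))"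
  have d0: "d $ i \<ge> 0" for i using g(2) by (simp add: d_def fundamental_domain_def)
  have "d \<noteq> 0"
  proof
    assume "d = 0"
    hence "M $ j \<bullet> g x = M $ j \<bullet> 0" for j using nz[of j] by (auto simp: d_def vec_eq_iff)
    hence "g x = 0" by (rule rows_unique[OF det])
    thus False using \<open>x \<noteq> 0\<close> orth_norm[OF go, of x] by simp
  qed
  obtain k C where k: "k > 0" "C \<in> coefficient_families" "k *\<^sub>R d \<in> C"
    using coefficient_family_scaling[OF d0 \<open>d \<noteq> 0\<close>] by blast
  have gp: "generating_point M (k *\<^sub>R d) = k *\<^sub>R g x"
    by (rule rows_unique[OF det]) (simp add: generating_point_inner[OF det] d_def nz)
  let ?s = "\<lambda>y. k *\<^sub>R g (t y)"
  have "similarity ?s" unfolding similarity_def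
  proof (intro exI[of _ k] conjI allI k(1))
    fix a b
    have "dist (g (t a)) (g (t b)) = dist a b" using orth_is_isometry[OF go] t by (simp add: isometry_def)
    thus "dist (k *\<^sub>R g (t a)) (k *\<^sub>R g (t b)) = k * dist a b"
      using k(1) by (simp add: dist_norm flip: scaleR_diff_right)
  qed
  moreover have "geom_vertices (transform ?s P) = vertex_orbit M N (k *\<^sub>R d)"
  proof -
    have "geom_vertices (transform ?s P) = (\<lambda>y. k *\<^sub>R g y) ` ?V" by (simp add: image_image)
    also have "\<dots> = (\<lambda>h. k *\<^sub>R g (h x)) ` N" unfolding V by (simp add: image_image)
    also have "\<dots> = (\<lambda>h. h (k *\<^sub>R g x)) ` N"
    proof (intro equalityI subsetI)
      fix y assume "y \<in> (\<lambda>h. k *\<^sub>R g (h x)) ` N"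
      then obtain h where h: "h \<in> N" "y = k *\<^sub>R g (h x)" by blast
      let ?h = "g \<circ> h \<circ> ginv g"
      have hN: "?h \<in> N" using nonprismatic_normal(2)[OF MN(1) g(1) h(1)] .
      have "y = ?h (k *\<^sub>R g x)" using h ig(1) orth_scale[OF orth_groupD(1)[OF N hN]] by simp
      thus "y \<in> (\<lambda>h. h (k *\<^sub>R g x)) ` N" using hN by blast
    next
      fix y assume "y \<in> (\<lambda>h. h (k *\<^sub>R g x)) ` N"
      then obtain h where h: "h \<in> N" "y = h (k *\<^sub>R g x)" by blast
      let ?h = "ginv g \<circ> h \<circ> g"
      have hN: "?h \<in> N" using nonprismatic_normal(1)[OF MN(1) g(1) h(1)] .
      have "y = k *\<^sub>R g (?h x)" using h ig(2) orth_scale[OF orth_groupD(1)[OF N h(1)]] by simp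
      thus "y \<in> (\<lambda>h. k *\<^sub>R g (h x)) ` N" using hN by blast
    qed
    finally show ?thesis unfolding vertex_orbit_def gp .
  qed
  ultimately show ?thesis unfolding in_normal_form_def using MN(1) k by blast
qed

section \<open>Finitely many polyhedra up to canonical equivalence\<close>

text \<open>
  With \<open>p\<close> a vertex, sets of vertices correspond to certain subsets of the group acting
  transitively on them.
\<close>
definition pull_back :: "space_map set \<Rightarrow> real^3 \<Rightarrow> (real^3) set \<Rightarrow> space_map set" where
  "pull_back N p e = {g \<in> N. g p \<in> e}"

type_synonym code = "(real^3^3) \<times> space_map set \<times> (real^3) set \<times> space_map set \<times>
   space_map set set \<times> space_map set set set"

text \<open>
  A code records, without reference to the parameters of the generating point, which vertices coincide
  and which sets of vertices are edges and faces. The orbit type is part of it, since the canonical mapping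
  is defined only within one orbit type.
\<close>
definition has_code :: "'a realized \<Rightarrow> code \<Rightarrow> bool" where
  "has_code P k \<longleftrightarrow> (\<exists>s M N C c. in_normal_form P s M N C c \<and>
     k = (M, N, C, stab N (generating_point M c),
          pull_back N (generating_point M c) ` geom_edges (transform s P),
          (`) (pull_back N (generating_point M c)) ` geom_faces (transform s P)))"

lemma finite_codes: "finite {k. \<exists>P. has_code P k}"
proof -
  let ?K = "\<Union>(M, N)\<in>nonprismatic_groups. {M} \<times> {N} \<times> coefficient_families \<times> Pow N \<times> Pow (Pow N) \<times> Pow (Pow (Pow N))"
  have "finite nonprismatic_groups" unfolding nonprismatic_groups_def by simp
  moreover have "finite coefficient_families" unfolding coefficient_families_def by simp
  ultimately have "finite ?K" using nonprismatic_finite by (intro finite_UN_I) auto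
  moreover have "{k. \<exists>P. has_code P k} \<subseteq> ?K"
    unfolding has_code_def in_normal_form_def by (auto simp: pull_back_def stab_def)
  ultimately show ?thesis using finite_subset by blast
qed

text \<open>
  Two polyhedra with the same code have corresponding edges and faces under the canonical mapping;
  the latter is well defined since the generating points have the same stabilizer.
\<close>
lemma same_code_related:
  assumes P: "noble P" "has_code P k" and Q: "noble Q" "has_code Q k"
  shows "canonically_related P Q"
proof -
  obtain s M N C c where nP: "in_normal_form P s M N C c"
    and k: "k = (M, N, C, stab N (generating_point M c),
          pull_back N (generating_point M c) ` geom_edges (transform s P),
          (`) (pull_back N (generating_point M c)) ` geom_faces (transform s P))"
    using P(2) unfolding has_code_def by blast
  obtain t d where nQ: "in_normal_form Q t M N C d"
    and k': "stab N (generating_point M c) = stab N (generating_point M d)"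
      "pull_back N (generating_point M c) ` geom_edges (transform s P) = pull_back N (generating_point M d) ` geom_edges (transform t Q)"
      "(`) (pull_back N (generating_point M c)) ` geom_faces (transform s P) = (`) (pull_back N (generating_point M d)) ` geom_faces (transform t Q)"
    using Q(2) unfolding has_code_def k by auto
  let ?p = "generating_point M c" and ?q = "generating_point M d"
  let ?P = "transform s P" and ?Q = "transform t Q"
  have MN: "(M, N) \<in> nonprismatic_groups" and C: "C \<in> coefficient_families" "c \<in> C" "d \<in> C"
    and sim: "similarity s" "similarity t"
    and V: "geom_vertices ?P = vertex_orbit M N c" "geom_vertices ?Q = vertex_orbit M N d"
    using nP nQ unfolding in_normal_form_def by auto
  note N = orth_group_nonprismatic[OF MN]
  define f where "f y = (SOME g. g \<in> N \<and> g ?p = y) ?q" for y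
  have f: "f (g ?p) = g ?q" if g: "g \<in> N" for g
  proof -
    let ?h = "SOME h. h \<in> N \<and> h ?p = g ?p"
    have h: "?h \<in> N \<and> ?h ?p = g ?p" by (rule someI[of _ g]) (use g in simp)
    note ig = orth_inv_simps[OF orth_groupD(1)[OF N g]]
    have "ginv g \<circ> ?h \<in> N" using orth_groupD(3,4)[OF N] g h by blast
    moreover have "(ginv g \<circ> ?h) ?p = ?p" using h ig(1) by simp
    ultimately have "ginv g \<circ> ?h \<in> stab N ?q" using k'(1) unfolding stab_def by blast
    hence "ginv g (?h ?q) = ?q" by (simp add: stab_def)
    hence "g (ginv g (?h ?q)) = g ?q" by (rule arg_cong)
    thus ?thesis unfolding f_def ig(2) .
  qed
  have img: "f ` e = (\<lambda>g. g ?q) ` pull_back N ?p e" if "e \<subseteq> vertex_orbit M N c" for e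
  proof -
    have "e = (\<lambda>g. g ?p) ` pull_back N ?p e" using that unfolding vertex_orbit_def pull_back_def by auto
    hence "f ` e = f ` (\<lambda>g. g ?p) ` pull_back N ?p e" by simp
    thus ?thesis using f by (auto simp: image_image pull_back_def image_iff)
  qed
  have img': "e = (\<lambda>g. g ?q) ` pull_back N ?q e" if "e \<subseteq> vertex_orbit M N d" for e
    using that unfolding vertex_orbit_def pull_back_def by auto
  have eV: "e \<subseteq> geom_vertices A" if "e \<in> geom_edges A" for e and A :: "'a realized"
    using that unfolding geom_edges_def geom_vertices_def points_of_def vertex_set_def by auto
  have fE: "F \<subseteq> geom_edges A" if "F \<in> geom_faces A" for F and A :: "'a realized"
    using that unfolding geom_faces_def geom_edges_def by auto
  have E: "(`) f ` geom_edges ?P = geom_edges ?Q"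
  proof -
    have "(`) f ` geom_edges ?P = (\<lambda>K. (\<lambda>g. g ?q) ` K) ` pull_back N ?p ` geom_edges ?P"
      unfolding image_image[of "\<lambda>K. (\<lambda>g. g ?q) ` K"] using eV[of _ ?P] V(1) by (intro image_cong refl img) blast
    also have "\<dots> = (\<lambda>e. (\<lambda>g. g ?q) ` pull_back N ?q e) ` geom_edges ?Q" unfolding k'(2) by (simp add: image_image)
    also have "\<dots> = (\<lambda>e. e) ` geom_edges ?Q" using eV[of _ ?Q] V(2) by (intro image_cong refl img'[symmetric]) blast
    finally show ?thesis by simp
  qed
  have F: "(`) ((`) f) ` geom_faces ?P = geom_faces ?Q"
  proof -
    have "(`) ((`) f) ` geom_faces ?P = (\<lambda>KK. (\<lambda>K. (\<lambda>g. g ?q) ` K) ` KK) ` (`) (pull_back N ?p) ` geom_faces ?P"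
      unfolding image_image[of "\<lambda>KK. (\<lambda>K. (\<lambda>g. g ?q) ` K) ` KK"]
    proof (intro image_cong refl)
      fix A assume A: "A \<in> geom_faces ?P"
      show "(`) f ` A = (\<lambda>K. (\<lambda>g. g ?q) ` K) ` pull_back N ?p ` A"
        unfolding image_image[of "\<lambda>K. (\<lambda>g. g ?q) ` K"] using eV[of _ ?P] fE[OF A] V(1) by (intro image_cong refl img) blast
    qed
    also have "\<dots> = (\<lambda>A. (\<lambda>e. (\<lambda>g. g ?q) ` pull_back N ?q e) ` A) ` geom_faces ?Q" unfolding k'(3) by (simp add: image_image)
    also have "\<dots> = (\<lambda>A. A) ` geom_faces ?Q"
    proof (intro image_cong refl)
      fix A assume A: "A \<in> geom_faces ?Q"
      have "(\<lambda>e. (\<lambda>g. g ?q) ` pull_back N ?q e) ` A = (\<lambda>e. e) ` A"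
        using eV[of _ ?Q] fE[OF A] V(2) by (intro image_cong refl img'[symmetric]) blast
      thus "(\<lambda>e. (\<lambda>g. g ?q) ` pull_back N ?q e) ` A = A" by simp
    qed
    finally show ?thesis by simp
  qed
  have VV: "f ` geom_vertices ?P = geom_vertices ?Q" unfolding V vertex_orbit_def using f by (auto simp: image_image image_iff)
  let ?T = "vertex_orbit M N ` C"
  have T: "?T \<in> orbit_types" unfolding orbit_types_def using MN C(1) by blast
  have "canonical_mapping ?T (geom_vertices ?P) (geom_vertices ?Q) f"
    unfolding canonical_mapping_def using MN C V f by blast
  moreover have "geom_vertices ?P \<in> ?T" "geom_vertices ?Q \<in> ?T" unfolding V using C by blast+
  ultimately show ?thesis unfolding canonically_related_def Let_def using P(1) Q(1) sim T VV E F by blast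
qed

lemma finite_quotient_by_invariant:
  assumes R: "equiv UNIV R" and f: "finite {k. \<exists>x\<in>A. I x k}" "\<And>x. x \<in> A \<Longrightarrow> \<exists>k. I x k"
    and same: "\<And>x y k. x \<in> A \<Longrightarrow> y \<in> A \<Longrightarrow> I x k \<Longrightarrow> I y k \<Longrightarrow> (x, y) \<in> R"
  shows "finite (A // R)"
proof -
  have "A // R \<subseteq> (\<lambda>k. R `` {SOME x. x \<in> A \<and> I x k}) ` {k. \<exists>x\<in>A. I x k}"
  proof
    fix S assume "S \<in> A // R"
    then obtain x where x: "x \<in> A" "S = R `` {x}" by (auto elim: quotientE)
    obtain k where k: "I x k" using f(2) x by blast
    have y: "(SOME x. x \<in> A \<and> I x k) \<in> A \<and> I (SOME x. x \<in> A \<and> I x k) k" by (rule someI[of _ x]) (use x k in blast)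
    hence "(x, SOME x. x \<in> A \<and> I x k) \<in> R" using same x k by blast
    hence "S = R `` {SOME x. x \<in> A \<and> I x k}" using x equiv_class_eq[OF R] by blast
    thus "S \<in> (\<lambda>k. R `` {SOME x. x \<in> A \<and> I x k}) ` {k. \<exists>x\<in>A. I x k}" using x k by blast
  qed
  thus ?thesis using f(1) finite_subset by blast
qed

lemma equiv_canonical: "equiv UNIV (canonical_equivalence :: ('a realized \<times> 'a realized) set)"
  unfolding canonical_equivalence_def
  by (rule equivI) (auto simp: refl_on_def sym_def trans_def intro: equivclp_sym equivclp_trans)

theorem finite_nonprismatic_quotient:
  fixes A :: "'a realized set"
  assumes "\<And>P. P \<in> A \<Longrightarrow> noble P \<and> (\<exists>s M N C c. in_normal_form P s M N C c)"
  shows "finite (A // canonical_equivalence)"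
proof (rule finite_quotient_by_invariant[OF equiv_canonical, where I = has_code])
  show "finite {k. \<exists>P\<in>A. has_code P k}" using finite_codes by (rule finite_subset[rotated]) blast
  show "\<exists>k. has_code P k" if "P \<in> A" for P using assms[OF that] unfolding has_code_def by blast
  show "(P, Q) \<in> canonical_equivalence" if "P \<in> A" "Q \<in> A" "has_code P k" "has_code Q k" for P Q k
    using same_code_related assms that unfolding canonical_equivalence_def by (blast intro: r_into_equivclp)
qed

section \<open>Symmetries preserving an axis\<close>

definition cyl :: "real \<Rightarrow> real \<Rightarrow> real \<Rightarrow> real^3" where
  "cyl \<rho> z t = v3 (\<rho> * cos t) (\<rho> * sin t) z"

text \<open>
  For \<open>a, b \<in> {1, -1}\<close>: multiply the height by \<open>a\<close> and replace the angle \<open>t\<close> about the axis by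
  \<open>b * t + \<tau>\<close>.
\<close>
definition msym :: "real \<Rightarrow> real \<Rightarrow> real \<Rightarrow> real^3 \<Rightarrow> real^3" where
  "msym a b \<tau> v = v3 (cos \<tau> * v $ 1 - b * sin \<tau> * v $ 2) (sin \<tau> * v $ 1 + b * cos \<tau> * v $ 2) (a * v $ 3)"

abbreviation sgns :: "real set" where "sgns \<equiv> {1, -1}"
abbreviation "is_msym g \<equiv> \<exists>a\<in>sgns. \<exists>b\<in>sgns. \<exists>\<tau>. g = msym a b \<tau>"

lemma sgns_cos_sin: "b \<in> sgns \<Longrightarrow> cos (b * t) = cos t" "b \<in> sgns \<Longrightarrow> sin (b * t) = b * sin t" by auto

lemma msym_cyl: assumes "b \<in> sgns" shows "msym a b \<tau> (cyl \<rho> z t) = cyl \<rho> (a * z) (b * t + \<tau>)"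
  unfolding msym_def cyl_def v3_simps cos_add sin_add sgns_cos_sin[OF assms]
  by (simp add: algebra_simps)

lemma cyl_polar: obtains \<rho> t where "\<rho> \<ge> 0" "v = cyl \<rho> (v $ 3) t"
proof -
  let ?c = "Complex (v $ 1) (v $ 2)"
  have c: "?c = complex_of_real (norm ?c) * cis (Arg ?c)" using rcis_cmod_Arg[of ?c] by (simp add: rcis_def)
  have "v $ 1 = norm ?c * cos (Arg ?c)" using arg_cong[OF c, of Re] by simp
  moreover have "v $ 2 = norm ?c * sin (Arg ?c)" using arg_cong[OF c, of Im] by simp
  ultimately have "v = cyl (norm ?c) (v $ 3) (Arg ?c)" unfolding cyl_def using v3_eta[of v] by metis
  thus thesis using that[of "norm ?c"] by simp
qed

lemma msym_comp:
  assumes "b \<in> sgns" "b' \<in> sgns"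
  shows "msym a b \<tau> \<circ> msym a' b' \<tau>' = msym (a * a') (b * b') (b * \<tau>' + \<tau>)"
proof
  have bb: "b * b' \<in> sgns" using assms by auto
  fix v obtain \<rho> t where v: "v = cyl \<rho> (v $ 3) t" using cyl_polar by metis
  have "(msym a b \<tau> \<circ> msym a' b' \<tau>') (cyl \<rho> (v $ 3) t) = msym (a * a') (b * b') (b * \<tau>' + \<tau>) (cyl \<rho> (v $ 3) t)"
    unfolding comp_apply msym_cyl[OF assms(1)] msym_cyl[OF assms(2)] msym_cyl[OF bb] by (simp add: algebra_simps)
  thus "(msym a b \<tau> \<circ> msym a' b' \<tau>') v = msym (a * a') (b * b') (b * \<tau>' + \<tau>) v" using v by metis
qed

lemma msym_id: "msym 1 1 0 = id" by (rule ext) (simp add: msym_def v3_eta)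

lemma msym_orth: assumes "a \<in> sgns" "b \<in> sgns" shows "orth (msym a b \<tau>)"
  unfolding orth_def
proof
  show "linear (msym a b \<tau>)" by (rule linearI) (simp_all add: msym_def algebra_simps)
  have sq: "a * a = 1" "b * b = 1" using assms by auto
  have cs: "cos \<tau> * cos \<tau> + sin \<tau> * sin \<tau> = 1" using sin_cos_squared_add[of \<tau>] by (simp add: power2_eq_square)
  show "\<forall>v w. msym a b \<tau> v \<bullet> msym a b \<tau> w = v \<bullet> w"
  proof (intro allI)
    fix v w :: "real^3"
    have "msym a b \<tau> v \<bullet> msym a b \<tau> w = (cos \<tau> * cos \<tau> + sin \<tau> * sin \<tau>) * (v $ 1 * w $ 1)
        + (b * b) * (cos \<tau> * cos \<tau> + sin \<tau> * sin \<tau>) * (v $ 2 * w $ 2) + (a * a) * (v $ 3 * w $ 3)"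
      unfolding msym_def by (simp add: algebra_simps del: sin_cos_squared_add3)
    also have "\<dots> = v \<bullet> w" unfolding sq cs by (simp add: inner_vec_def sum_3)
    finally show "msym a b \<tau> v \<bullet> msym a b \<tau> w = v \<bullet> w" .
  qed
qed

lemma msym_inv:
  assumes "a \<in> sgns" "b \<in> sgns" shows "ginv (msym a b \<tau>) = msym a b (- b * \<tau>)"
proof
  fix x
  have sq: "a * a = 1" "b * b = 1" using assms by auto
  have "msym a b \<tau> \<circ> msym a b (- b * \<tau>) = id"
    unfolding msym_comp[OF assms(2,2)] sq msym_id[symmetric] by (simp add: mult.assoc[symmetric] sq)
  hence "msym a b \<tau> (msym a b (- b * \<tau>) x) = x" by (metis comp_apply id_apply)
  thus "ginv (msym a b \<tau>) x = msym a b (- b * \<tau>) x"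
    using orth_inv_simps(1)[OF msym_orth[OF assms]] by metis
qed

lemma msym_axis: "a \<in> sgns \<Longrightarrow> msym a b \<tau> (v3 0 0 1) = v3 0 0 1 \<or> msym a b \<tau> (v3 0 0 1) = - v3 0 0 1"
  by (auto simp: msym_def)

text \<open>
  The images of the first two unit vectors are horizontal and orthonormal, so they are \<open>(cos
  \<tau>, sin \<tau>)\<close> and \<open>\<plusminus>(- sin \<tau>, cos \<tau>)\<close>.
\<close>
lemma axial_is_msym:
  assumes h: "orth h" and ax: "h (v3 0 0 1) = v3 0 0 1 \<or> h (v3 0 0 1) = - v3 0 0 1"
  obtains a b \<tau> where "a \<in> sgns" "b \<in> sgns" "h = msym a b \<tau>"
proof -
  obtain a where a: "a \<in> sgns" "h (v3 0 0 1) = v3 0 0 a" using ax by auto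
  let ?u = "h (v3 1 0 0)" and ?w = "h (v3 0 1 0)"
  note i = orth_inner[OF h]
  have av: "v3 0 0 a \<bullet> v = a * v $ 3" for v :: "real^3" using v3_simps(4)[of 0 0 a "v $ 1" "v $ 2" "v $ 3"] v3_eta[of v] by simp
  have "a * ?u $ 3 = 0" "a * ?w $ 3 = 0"
    using i[of "v3 0 0 1" "v3 1 0 0"] i[of "v3 0 0 1" "v3 0 1 0"] a(2) av by simp_all
  hence z: "?u $ 3 = 0" "?w $ 3 = 0" using a(1) by auto
  have uv: "x \<bullet> y = x $ 1 * y $ 1 + x $ 2 * y $ 2 + x $ 3 * y $ 3" for x y :: "real^3" by (simp add: inner_vec_def sum_3)
  have u1: "?u $ 1 * ?u $ 1 + ?u $ 2 * ?u $ 2 = 1" using i[of "v3 1 0 0" "v3 1 0 0"] z uv[of ?u ?u] by simp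
  have w1: "?w $ 1 * ?w $ 1 + ?w $ 2 * ?w $ 2 = 1" using i[of "v3 0 1 0" "v3 0 1 0"] z uv[of ?w ?w] by simp
  have uw: "?u $ 1 * ?w $ 1 + ?u $ 2 * ?w $ 2 = 0" using i[of "v3 1 0 0" "v3 0 1 0"] z uv[of ?u ?w] by simp
  obtain \<tau> where t: "?u $ 1 = cos \<tau>" "?u $ 2 = sin \<tau>"
    using sincos_total_2pi[of "?u $ 1" "?u $ 2"] u1 by (metis power2_eq_square)
  define b where "b = cos \<tau> * ?w $ 2 - sin \<tau> * ?w $ 1"
  have cs: "cos \<tau> * cos \<tau> + sin \<tau> * sin \<tau> = 1" using sin_cos_squared_add[of \<tau>] by (simp add: power2_eq_square)
  have w2: "?w $ 1 = - b * sin \<tau>" "?w $ 2 = b * cos \<tau>"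
  proof -
    have "?w $ 1 = (cos \<tau> * cos \<tau> + sin \<tau> * sin \<tau>) * ?w $ 1" using cs by simp
    also have "\<dots> = cos \<tau> * (cos \<tau> * ?w $ 1 + sin \<tau> * ?w $ 2) - b * sin \<tau>" unfolding b_def by (simp add: algebra_simps del: sin_cos_squared_add3)
    finally show "?w $ 1 = - b * sin \<tau>" using uw t by simp
    have "?w $ 2 = (cos \<tau> * cos \<tau> + sin \<tau> * sin \<tau>) * ?w $ 2" using cs by simp
    also have "\<dots> = sin \<tau> * (cos \<tau> * ?w $ 1 + sin \<tau> * ?w $ 2) + b * cos \<tau>" unfolding b_def by (simp add: algebra_simps del: sin_cos_squared_add3)
    finally show "?w $ 2 = b * cos \<tau>" using uw t by simp
  qed
  have "b * b * (cos \<tau> * cos \<tau> + sin \<tau> * sin \<tau>) = 1"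
    using w1 unfolding w2 by (simp add: algebra_simps del: sin_cos_squared_add3)
  hence "b * b = 1" unfolding cs by simp
  hence b: "b \<in> sgns" using power2_eq_1_iff[of b] by (simp add: power2_eq_square)
  have "h v = msym a b \<tau> v" for v
  proof -
    have "v = v $ 1 *\<^sub>R v3 1 0 0 + v $ 2 *\<^sub>R v3 0 1 0 + v $ 3 *\<^sub>R v3 0 0 1" by (simp add: v3_eta)
    hence "h v = h (v $ 1 *\<^sub>R v3 1 0 0 + v $ 2 *\<^sub>R v3 0 1 0 + v $ 3 *\<^sub>R v3 0 0 1)" by (rule arg_cong)
    also have "\<dots> = v $ 1 *\<^sub>R ?u + v $ 2 *\<^sub>R ?w + v $ 3 *\<^sub>R v3 0 0 a" unfolding orth_add[OF h] orth_scale[OF h] a(2) ..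
    also have "?u = v3 (cos \<tau>) (sin \<tau>) 0" using v3_eta[of ?u] t z by simp
    also have "?w = v3 (- b * sin \<tau>) (b * cos \<tau>) 0" using v3_eta[of ?w] w2 z by simp
    finally show ?thesis unfolding msym_def by (simp add: algebra_simps)
  qed
  thus thesis using that a(1) b by blast
qed

text \<open>Angles are compared modulo full turns.\<close>
definition ang_eq :: "real \<Rightarrow> real \<Rightarrow> bool" where "ang_eq s t \<longleftrightarrow> (\<exists>k::int. s = t + 2 * pi * k)"

lemma ang_eq_refl [simp]: "ang_eq t t" unfolding ang_eq_def by (intro exI[of _ 0]) simp
lemma ang_eq_sym: "ang_eq s t \<Longrightarrow> ang_eq t s" unfolding ang_eq_def by (metis add_diff_cancel_right' diff_conv_add_uminus mult_minus_right of_int_minus)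
lemma ang_eq_trans: "ang_eq s t \<Longrightarrow> ang_eq t u \<Longrightarrow> ang_eq s u"
proof -
  assume "ang_eq s t" "ang_eq t u"
  then obtain k l :: int where "s = t + 2 * pi * k" "t = u + 2 * pi * l" unfolding ang_eq_def by blast
  hence "s = u + 2 * pi * (k + l)" by (simp add: algebra_simps)
  thus ?thesis unfolding ang_eq_def by blast
qed
lemma ang_eq_cong:
  assumes "ang_eq s t" "ang_eq s' t'" shows "ang_eq (s + s') (t + t')" "ang_eq (s - s') (t - t')"
proof -
  obtain k l :: int where "s = t + 2 * pi * k" "s' = t' + 2 * pi * l" using assms unfolding ang_eq_def by blast
  hence "s + s' = t + t' + 2 * pi * (k + l)" "s - s' = t - t' + 2 * pi * (k - l)" by (simp_all add: algebra_simps)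
  thus "ang_eq (s + s') (t + t')" "ang_eq (s - s') (t - t')" unfolding ang_eq_def by blast+
qed
lemma ang_eq_0: "ang_eq s t \<longleftrightarrow> ang_eq (s - t) 0" unfolding ang_eq_def by (auto simp: algebra_simps)
lemma ang_eq_small: assumes "ang_eq x 0" "\<bar>x\<bar> < 2 * pi" shows "x = 0"
proof -
  obtain k :: int where k: "x = 2 * pi * k" using assms unfolding ang_eq_def by auto
  hence "2 * pi * \<bar>real_of_int k\<bar> < 2 * pi * 1" using assms by (simp add: abs_mult)
  hence "\<bar>real_of_int k\<bar> < 1" using pi_gt_zero by (simp only: mult_less_cancel_left_pos zero_less_numeral mult_pos_pos)
  hence "k = 0" by linarith
  thus ?thesis using k by simp
qed

lemma ang_eq_iff_sin_cos: "ang_eq s t \<longleftrightarrow> sin s = sin t \<and> cos s = cos t"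
  unfolding ang_eq_def sin_cos_eq_iff by (simp add: mult.assoc)

lemma cyl_eq_iff: assumes "\<rho> > 0" shows "cyl \<rho> z s = cyl \<rho> z' t \<longleftrightarrow> z = z' \<and> ang_eq s t"
  unfolding cyl_def ang_eq_iff_sin_cos using assms by auto

lemma cos_eq_cases: assumes "cos s = cos t" shows "ang_eq s t \<or> ang_eq s (- t)"
proof -
  have "(sin s)\<^sup>2 = (sin t)\<^sup>2" using assms by (simp add: sin_squared_eq)
  hence "sin s = sin t \<or> sin s = - sin t" by (simp add: power2_eq_iff)
  thus ?thesis using assms unfolding ang_eq_iff_sin_cos by auto
qed

text \<open>Two chords of a circle, given by their middle direction and half-angle.\<close>
lemma chord_eq_cases:
  assumes \<alpha>: "0 < \<alpha>" "\<alpha> < pi" and \<beta>: "0 < \<beta>" "\<beta> < pi"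
    and e: "(ang_eq (m - \<alpha>) (m' - \<beta>) \<and> ang_eq (m + \<alpha>) (m' + \<beta>)) \<or> (ang_eq (m - \<alpha>) (m' + \<beta>) \<and> ang_eq (m + \<alpha>) (m' - \<beta>))"
  shows "(ang_eq m m' \<and> \<alpha> = \<beta>) \<or> (ang_eq m (m' + pi) \<and> \<alpha> = pi - \<beta>)" using e
proof
  assume a: "ang_eq (m - \<alpha>) (m' - \<beta>) \<and> ang_eq (m + \<alpha>) (m' + \<beta>)"
  hence "ang_eq ((m + \<alpha>) - (m - \<alpha>)) ((m' + \<beta>) - (m' - \<beta>))" using ang_eq_cong(2) by blast
  hence "ang_eq (2 * \<alpha> - 2 * \<beta>) 0" using ang_eq_0 by (simp add: algebra_simps)
  hence "2 * \<alpha> - 2 * \<beta> = 0" by (rule ang_eq_small) (use \<alpha> \<beta> in auto)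
  hence "\<alpha> = \<beta>" by simp
  moreover have "ang_eq m m'" using a ang_eq_0[of m m'] ang_eq_0[of "m + \<alpha>" "m' + \<beta>"] \<open>\<alpha> = \<beta>\<close> by simp
  ultimately show ?thesis by blast
next
  assume a: "ang_eq (m - \<alpha>) (m' + \<beta>) \<and> ang_eq (m + \<alpha>) (m' - \<beta>)"
  hence "ang_eq ((m + \<alpha>) - (m - \<alpha>)) ((m' - \<beta>) - (m' + \<beta>))" using ang_eq_cong(2) by blast
  hence "ang_eq ((m + \<alpha>) - (m - \<alpha>) - ((m' - \<beta>) - (m' + \<beta>))) 0" using ang_eq_0 by blast
  hence "ang_eq (2 * \<alpha> + 2 * \<beta>) 0" by (simp add: algebra_simps)
  moreover have "ang_eq (2 * pi) 0" unfolding ang_eq_def by (intro exI[of _ 1]) simp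
  ultimately have "ang_eq (2 * \<alpha> + 2 * \<beta> - 2 * pi) (0 - 0)" by (rule ang_eq_cong(2))
  hence "2 * \<alpha> + 2 * \<beta> - 2 * pi = 0" by (intro ang_eq_small) (use \<alpha> \<beta> in auto)
  hence ab: "\<alpha> = pi - \<beta>" by simp
  moreover have "ang_eq m (m' + pi)"
  proof -
    have "ang_eq (m - \<alpha>) (m' + \<beta>)" using a by blast
    hence "ang_eq ((m - \<alpha>) - (m' + \<beta>)) 0" using ang_eq_0 by blast
    moreover have "(m - \<alpha>) - (m' + \<beta>) = m - (m' + pi)" using ab by simp
    ultimately show ?thesis using ang_eq_0 by metis
  qed
  ultimately show ?thesis by blast
qed

section \<open>Noble polyhedra with an axis\<close>

locale axial_polyhedron = noble_polyhedron +
  assumes sym_orth: "\<And>h. h \<in> Sym \<Longrightarrow> orth h"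
    and sym_axis: "\<And>h. h \<in> Sym \<Longrightarrow> h (v3 0 0 1) = v3 0 0 1 \<or> h (v3 0 0 1) = - v3 0 0 1"
begin

lemma sym_msym:
  assumes "h \<in> Sym" obtains a b \<tau> where "a \<in> sgns" "b \<in> sgns" "h = msym a b \<tau>"
  using axial_is_msym[OF sym_orth[OF assms] sym_axis[OF assms]] by blast

lemma symmetry_group_msym_eq:
  assumes "\<And>a b \<tau>. a \<in> sgns \<Longrightarrow> b \<in> sgns \<Longrightarrow> msym a b \<tau> \<in> Sym \<longleftrightarrow> Q a b \<tau>"
  shows "Sym = {msym a b \<tau> |a b \<tau>. a \<in> sgns \<and> b \<in> sgns \<and> Q a b \<tau>}" (is "_ = ?R")
proof (intro equalityI subsetI)
  fix g assume g: "g \<in> Sym"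
  then obtain a b \<tau> where m: "a \<in> sgns" "b \<in> sgns" "g = msym a b \<tau>" using sym_msym by metis
  thus "g \<in> ?R" using assms[OF m(1,2), of \<tau>] g by blast
qed (use assms in auto)

lemma not_in_plane: assumes "n \<noteq> 0" shows "\<not> V \<subseteq> {x. n \<bullet> x = d}"
proof
  assume "V \<subseteq> {x. n \<bullet> x = d}"
  hence "affine hull (V) \<subseteq> {x. n \<bullet> x = d}" by (intro hull_minimal affine_hyperplane)
  hence a: "n \<bullet> x = d" for x using V_spans by blast
  from a[of 0] a[of n] show False using assms by simp
qed

text \<open>
  All vertices are images of one under maps that preserve the distance from the axis and, up to sign,
  the height. If the height or the radius were zero, the vertices would be coplanar.
\<close>
lemma vertices_on_circles:
  obtains \<rho> h where "\<rho> > 0" "h > 0" "\<And>x. x \<in> V \<Longrightarrow> \<exists>sg\<in>sgns. \<exists>t. x = cyl \<rho> (sg * h) t"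
proof -
  obtain x0 where x0: "x0 \<in> V" using V_nonempty by blast
  obtain \<rho> t0 where r: "\<rho> \<ge> 0" "x0 = cyl \<rho> (x0 $ 3) t0" using cyl_polar by metis
  let ?z = "x0 $ 3"
  have all: "\<exists>sg\<in>sgns. \<exists>t. x = cyl \<rho> (sg * ?z) t" if x: "x \<in> V" for x
  proof -
    obtain h where h: "h \<in> Sym" "h x0 = x" using vertex_transitive[OF x0 x] .
    obtain a b \<tau> where m: "a \<in> sgns" "b \<in> sgns" "h = msym a b \<tau>" using sym_msym[OF h(1)] .
    have "x = msym a b \<tau> (cyl \<rho> ?z t0)" using h(2) m(3) r(2) by metis
    thus ?thesis using m(1) unfolding msym_cyl[OF m(2)] by blast
  qed
  have z: "?z \<noteq> 0"
  proof
    assume "?z = 0"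
    hence "V \<subseteq> {x. v3 0 0 1 \<bullet> x = 0}" using all by (fastforce simp: cyl_def)
    thus False using not_in_plane[of "v3 0 0 1" 0] by (simp add: v3_def vec_eq_iff forall_3)
  qed
  have "\<rho> \<noteq> 0"
  proof
    assume "\<rho> = 0"
    hence "V \<subseteq> {x. v3 1 0 0 \<bullet> x = 0}" using all by (fastforce simp: cyl_def)
    thus False using not_in_plane[of "v3 1 0 0" 0] by (simp add: v3_def vec_eq_iff forall_3)
  qed
  show thesis
  proof
    show "\<rho> > 0" "\<bar>?z\<bar> > 0" using r(1) \<open>\<rho> \<noteq> 0\<close> z by auto
    fix x assume "x \<in> V"
    then obtain sg t where e: "sg \<in> sgns" "x = cyl \<rho> (sg * ?z) t" using all by blast
    show "\<exists>sg\<in>sgns. \<exists>t. x = cyl \<rho> (sg * \<bar>?z\<bar>) t"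
    proof (cases "?z > 0")
      case True thus ?thesis using e by auto
    next
      case False
      hence "x = cyl \<rho> ((- sg) * \<bar>?z\<bar>) t" using e by simp
      moreover have "- sg \<in> sgns" using e by auto
      ultimately show ?thesis by blast
    qed
  qed
qed

lemma gface_vertex_card:
  assumes f: "f \<in> faces r" and x: "x \<in> X f" shows "card {e \<in> gface f. x \<in> e} = 2"
proof -
  obtain v where v: "v \<in> vertices r" "(v, f) \<in> r" "x = pos P v" using x by (auto simp: points_of_def vertex_set_def)
  have "{e \<in> gface f. x \<in> e} = X ` {e \<in> edges r. (v, e) \<in> r \<and> (e, f) \<in> r}"
    unfolding gface_def using v vertex_in_points by auto
  moreover have "inj_on X {e \<in> edges r. (v, e) \<in> r \<and> (e, f) \<in> r}"
    using edge_inj by (auto simp: inj_on_def)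
  ultimately show ?thesis using vertex_face_edges_card[OF v(1) f v(2)] by (simp add: card_image)
qed

lemma gface_edge: assumes "f \<in> faces r" "A \<in> gface f" shows "A \<subseteq> X f" "card A = 2"
  using assms edge_card points_mono unfolding gface_def by auto

lemma gface_edge_pair:
  assumes "f \<in> faces r" "A \<in> gface f" "x \<in> A" obtains y where "y \<in> X f" "y \<noteq> x" "A = {x, y}"
proof -
  have c: "card A = 2" "A \<subseteq> X f" using gface_edge[OF assms(1,2)] by auto
  obtain u v where uv: "A = {u, v}" "u \<noteq> v" using c(1) unfolding card_2_iff by blast
  show thesis
  proof (cases "x = u")
    case True thus thesis using that[of v] uv c(2) by auto
  next
    case False hence "x = v" using assms(3) uv by simp
    thus thesis using that[of u] uv c(2) by auto
  qed
qed

lemma gface_other_face: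
  assumes f: "f \<in> faces r" and A: "A \<in> gface f"
  obtains g where "g \<in> faces r" "A \<in> gface g" "X g \<noteq> X f" "affine hull (X g) \<noteq> affine hull (X f)"
    "\<And>k. k \<in> faces r \<Longrightarrow> A \<in> gface k \<Longrightarrow> k = f \<or> k = g"
proof -
  obtain e where e: "e \<in> edges r" "(e, f) \<in> r" "A = X e" using A by (auto simp: gface_def)
  obtain g where g: "g \<in> faces r" "(e, g) \<in> r" "g \<noteq> f" "affine hull (X g) \<noteq> affine hull (X f)" "X g \<noteq> X f"
    "\<And>k. k \<in> faces r \<Longrightarrow> (e, k) \<in> r \<Longrightarrow> k = f \<or> k = g" using other_face[OF e(1) f e(2)] by metis
  show thesis by (rule that[of g]) (use g e edge_in_gface[OF e(1)] in auto)
qed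

lemma faces_connected_gface:
  assumes S: "f0 \<in> faces r" "Q f0"
    and cl: "\<And>f g A. f \<in> faces r \<Longrightarrow> Q f \<Longrightarrow> g \<in> faces r \<Longrightarrow> A \<in> gface f \<Longrightarrow> A \<in> gface g \<Longrightarrow> Q g"
    and f: "f \<in> faces r"
  shows "Q f"
proof -
  have "{f \<in> faces r. Q f} = faces r"
  proof (rule faces_connected[of _ f0])
    fix f g e assume "f \<in> {f \<in> faces r. Q f}" "g \<in> faces r" "e \<in> edges r" "(e, f) \<in> r" "(e, g) \<in> r"
    thus "g \<in> {f \<in> faces r. Q f}" using cl[of f g "X e"] edge_in_gface[of e] by simp
  qed (use S in auto)
  thus ?thesis using f by blast
qed

lemma same_plane:
  assumes "f \<in> faces r" "g \<in> faces r" "n \<noteq> 0" "X f \<subseteq> {x. n \<bullet> x = d}" "X g \<subseteq> {x. n \<bullet> x = d}"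
  shows "affine hull (X f) = affine hull (X g)"
proof -
  have "affine hull (X k) = affine hull {x. n \<bullet> x = d}" if k: "k \<in> faces r" "X k \<subseteq> {x. n \<bullet> x = d}" for k
  proof -
    have "aff_dim (X k) = aff_dim {x. n \<bullet> x = d}" using nondeg(4)[OF k(1)] assms(3) by simp
    thus ?thesis using aff_dim_eq_full_gen[OF k(2)] by blast
  qed
  thus ?thesis using assms by metis
qed

lemma face_plane:
  assumes f: "f \<in> faces r" obtains n d where "n \<noteq> 0" "X f \<subseteq> {x. n \<bullet> x = d}"
proof -
  have "aff_dim (X f) = DIM(real^3) - 1" using nondeg(4)[OF f] by simp
  then obtain n d where "n \<noteq> 0" "affine hull (X f) = {x. n \<bullet> x = d}" using aff_dim_eq_hyperplane by blast
  thus thesis using that hull_subset[of "X f" affine] by blast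
qed

text \<open>Faces orthogonal to the axis would all be, and adjacent ones would lie in one plane.\<close>
lemma no_horizontal_face:
  assumes f: "f \<in> faces r" shows "\<not> X f \<subseteq> {x. v3 0 0 1 \<bullet> x = d}"
proof
  assume fd: "X f \<subseteq> {x. v3 0 0 1 \<bullet> x = d}"
  have nz: "v3 0 0 1 \<noteq> 0" by (simp add: v3_def vec_eq_iff forall_3)
  obtain A where A: "A \<in> gface f" using ex_edge_below[OF f] by (auto simp: gface_def)
  obtain g where g: "g \<in> faces r" "A \<in> gface g" "affine hull (X g) \<noteq> affine hull (X f)"
    using gface_other_face[OF f A] by metis
  obtain h where h: "h \<in> Sym" "h ` X f = X g" using face_transitive[OF f g(1)] .
  have "\<exists>d'. X g \<subseteq> {x. v3 0 0 1 \<bullet> x = d'}"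
  proof -
    obtain a b \<tau> where m: "a \<in> sgns" "b \<in> sgns" "h = msym a b \<tau>" using sym_msym[OF h(1)] .
    have e: "v3 0 0 1 \<bullet> x = x $ 3" for x :: "real^3" using v3_simps(4)[of 0 0 1 "x $ 1" "x $ 2" "x $ 3"] v3_eta[of x] by simp
    have "v3 0 0 1 \<bullet> h x = a * d" if "x \<in> X f" for x using fd that unfolding e m(3) msym_def by auto
    thus ?thesis unfolding h(2)[symmetric] by blast
  qed
  then obtain d' where gd: "X g \<subseteq> {x. v3 0 0 1 \<bullet> x = d'}" by blast
  have "A \<subseteq> X f" "A \<subseteq> X g" "A \<noteq> {}" using gface_edge[OF f A] gface_edge[OF g(1,2)] by auto
  hence "d = d'" using fd gd by blast
  thus False using same_plane[OF g(1) f nz] fd gd g(3) by blast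
qed

end

locale circled_polyhedron = axial_polyhedron +
  fixes \<rho> h :: real
  assumes \<rho>: "\<rho> > 0" and h: "h > 0"
    and on_circles: "\<And>x. x \<in> V \<Longrightarrow> \<exists>sg\<in>sgns. \<exists>t. x = cyl \<rho> (sg * h) t"
begin

definition pt :: "real \<Rightarrow> real \<Rightarrow> real^3" where "pt sg t = cyl \<rho> (sg * h) t"

lemma pt_eq_iff: "pt sg s = pt sg' t \<longleftrightarrow> sg = sg' \<and> ang_eq s t"
  unfolding pt_def cyl_eq_iff[OF \<rho>] using h by auto

lemma msym_pt: "b \<in> sgns \<Longrightarrow> msym a b \<tau> (pt sg t) = pt (a * sg) (b * t + \<tau>)"
  unfolding pt_def by (simp add: msym_cyl mult.assoc)

lemma plane_pt: "v3 (cos \<mu>) (sin \<mu>) m \<bullet> pt sg t = \<rho> * cos (t - \<mu>) + m * sg * h"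
  unfolding pt_def cyl_def by (simp add: cos_diff algebra_simps)

text \<open>A face plane meets each of the two circles in a chord, and the chords are parallel.\<close>
lemma face_shape:
  assumes f: "f \<in> faces r"
  obtains \<mu> \<theta> where "\<And>sg. 0 \<le> \<theta> sg \<and> \<theta> sg \<le> pi" "X f \<subseteq> (\<Union>sg\<in>sgns. {pt sg (\<mu> - \<theta> sg), pt sg (\<mu> + \<theta> sg)})"
proof -
  obtain n d where n: "n \<noteq> 0" "X f \<subseteq> {x. n \<bullet> x = d}" using face_plane[OF f] .
  obtain \<nu> \<mu> where nu: "\<nu> \<ge> 0" "n = cyl \<nu> (n $ 3) \<mu>" using cyl_polar by metis
  have "\<nu> \<noteq> 0"
  proof
    assume 0: "\<nu> = 0"
    hence n3: "n = (n $ 3) *\<^sub>R v3 0 0 1" using nu(2) by (simp add: cyl_def)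
    hence "n $ 3 \<noteq> 0" using n(1) by (metis scaleR_zero_left)
    moreover have "n $ 3 * (v3 0 0 1 \<bullet> x) = d" if "x \<in> X f" for x
    proof -
      have "((n $ 3) *\<^sub>R v3 0 0 1) \<bullet> x = d" unfolding n3[symmetric] using n(2) that by blast
      thus ?thesis by (simp only: inner_scaleR_left)
    qed
    ultimately have "X f \<subseteq> {x. v3 0 0 1 \<bullet> x = d / n $ 3}" by (auto simp: field_simps)
    thus False using no_horizontal_face[OF f] by blast
  qed
  hence nup: "\<nu> > 0" using nu by simp
  define D where "D sg = (d - n $ 3 * sg * h) / (\<nu> * \<rho>)" for sg
  define \<theta> where "\<theta> sg = (if \<bar>D sg\<bar> \<le> 1 then arccos (D sg) else 0)" for sg
  show thesis
  proof
    show "0 \<le> \<theta> sg \<and> \<theta> sg \<le> pi" for sg unfolding \<theta>_def by (auto simp: arccos_lbound arccos_ubound abs_le_iff)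
    show "X f \<subseteq> (\<Union>sg\<in>sgns. {pt sg (\<mu> - \<theta> sg), pt sg (\<mu> + \<theta> sg)})"
    proof
      fix x assume x: "x \<in> X f"
      then obtain sg t where e: "sg \<in> sgns" "x = pt sg t" using on_circles points_sub unfolding pt_def by blast
      have "n \<bullet> x = \<nu> * \<rho> * cos (t - \<mu>) + n $ 3 * sg * h"
        unfolding e(2) pt_def using arg_cong[OF nu(2), of "\<lambda>n. n \<bullet> cyl \<rho> (sg * h) t"]
        by (simp add: cyl_def cos_diff algebra_simps)
      hence "cos (t - \<mu>) = D sg" unfolding D_def using n(2) x nup \<rho> by (auto simp: field_simps)
      hence "\<bar>D sg\<bar> \<le> 1" "cos (\<theta> sg) = cos (t - \<mu>)"
        unfolding \<theta>_def using abs_cos_le_one[of "t - \<mu>"] by (auto simp: cos_arccos_abs)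
      hence "ang_eq (t - \<mu>) (\<theta> sg) \<or> ang_eq (t - \<mu>) (- \<theta> sg)" using cos_eq_cases by metis
      hence "ang_eq t (\<mu> + \<theta> sg) \<or> ang_eq t (\<mu> - \<theta> sg)"
        unfolding ang_eq_0[of "t - \<mu>"] ang_eq_0[of t] by (auto simp: algebra_simps)
      hence "x \<in> {pt sg (\<mu> - \<theta> sg), pt sg (\<mu> + \<theta> sg)}" unfolding e(2) using pt_eq_iff by auto
      thus "x \<in> (\<Union>sg\<in>sgns. {pt sg (\<mu> - \<theta> sg), pt sg (\<mu> + \<theta> sg)})" using e(1) by blast
    qed
  qed
qed

text \<open>
  Each chord contributes at most two vertices and there are at least three, so at least one chord is
  used with both of its ends.
\<close>
lemma face_cases:
  assumes f: "f \<in> faces r"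
  obtains (triangle) sg \<mu> \<alpha> \<beta> where "sg \<in> sgns" "0 < \<alpha>" "\<alpha> < pi" "X f = {pt sg (\<mu> - \<alpha>), pt sg (\<mu> + \<alpha>), pt (- sg) (\<mu> + \<beta>)}"
  | (quad) sg \<mu> \<alpha> \<beta> where "sg \<in> sgns" "0 < \<alpha>" "\<alpha> < pi" "0 < \<beta>" "\<beta> < pi"
      "X f = {pt sg (\<mu> - \<alpha>), pt sg (\<mu> + \<alpha>), pt (- sg) (\<mu> - \<beta>), pt (- sg) (\<mu> + \<beta>)}"
proof -
  obtain \<mu> \<theta> where th: "\<And>sg. 0 \<le> \<theta> sg \<and> \<theta> sg \<le> pi"
    and sub: "X f \<subseteq> (\<Union>sg\<in>sgns. {pt sg (\<mu> - \<theta> sg), pt sg (\<mu> + \<theta> sg)})" by (rule face_shape[OF f]) (blast intro: that)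
  define L where "L sg = X f \<inter> {pt sg (\<mu> - \<theta> sg), pt sg (\<mu> + \<theta> sg)}" for sg
  have XL: "X f = L 1 \<union> L (-1)" using sub unfolding L_def by auto
  have cL: "card (L sg) \<le> 2" for sg
  proof -
    have "card (L sg) \<le> card {pt sg (\<mu> - \<theta> sg), pt sg (\<mu> + \<theta> sg)}" unfolding L_def by (intro card_mono) auto
    also have "\<dots> \<le> 2" by (simp add: card_insert_if)
    finally show ?thesis .
  qed
  have two: "L sg = {pt sg (\<mu> - \<theta> sg), pt sg (\<mu> + \<theta> sg)} \<and> 0 < \<theta> sg \<and> \<theta> sg < pi" if c: "card (L sg) = 2" for sg
  proof -
    have s: "L sg \<subseteq> {pt sg (\<mu> - \<theta> sg), pt sg (\<mu> + \<theta> sg)}" by (simp add: L_def)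
    have "pt sg (\<mu> - \<theta> sg) \<noteq> pt sg (\<mu> + \<theta> sg)"
    proof
      assume "pt sg (\<mu> - \<theta> sg) = pt sg (\<mu> + \<theta> sg)"
      hence "card (L sg) \<le> card {pt sg (\<mu> + \<theta> sg)}" using s by (intro card_mono) auto
      thus False using c by simp
    qed
    hence "card {pt sg (\<mu> - \<theta> sg), pt sg (\<mu> + \<theta> sg)} = 2" and na: "\<not> ang_eq (\<mu> - \<theta> sg) (\<mu> + \<theta> sg)"
      by (simp_all add: pt_eq_iff)
    hence "L sg = {pt sg (\<mu> - \<theta> sg), pt sg (\<mu> + \<theta> sg)}" using card_subset_eq[OF _ s] c by simp
    moreover have "\<theta> sg \<noteq> 0" using na by auto
    moreover have "\<theta> sg \<noteq> pi"
    proof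
      assume "\<theta> sg = pi"
      hence "\<mu> - \<theta> sg = \<mu> + \<theta> sg + 2 * pi * of_int (-1)" by simp
      thus False using na unfolding ang_eq_def by blast
    qed
    ultimately show ?thesis using th[of sg] by simp
  qed
  have "3 \<le> card (L 1) + card (L (-1))" using face_points_card[OF f] card_Un_le[of "L 1" "L (-1)"] XL by simp
  then consider "card (L 1) = 2" "card (L (-1)) = 2" | "card (L 1) = 2" "card (L (-1)) = 1"
    | "card (L 1) = 1" "card (L (-1)) = 2" using cL[of 1] cL[of "-1"] by linarith
  thus thesis
  proof cases
    case 1
    have "X f = {pt 1 (\<mu> - \<theta> 1), pt 1 (\<mu> + \<theta> 1), pt (- 1) (\<mu> - \<theta> (-1)), pt (- 1) (\<mu> + \<theta> (-1))}"
      using XL two[OF 1(1)] two[OF 1(2)] by auto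
    thus thesis using quad[of 1 "\<theta> 1" "\<theta> (-1)" \<mu>] two[OF 1(1)] two[OF 1(2)] by simp
  next
    case 2
    obtain x where x: "L (-1) = {x}" using 2(2) by (metis card_1_singletonE)
    hence "x \<in> L (-1)" by simp
    then obtain \<beta> where b: "x = pt (-1) (\<mu> + \<beta>)" unfolding L_def by (metis IntD2 add.commute diff_conv_add_uminus insertE singletonD)
    have "X f = {pt 1 (\<mu> - \<theta> 1), pt 1 (\<mu> + \<theta> 1), pt (- 1) (\<mu> + \<beta>)}"
      using XL two[OF 2(1)] x b by auto
    thus thesis using triangle[of 1 "\<theta> 1" \<mu> \<beta>] two[OF 2(1)] by simp
  next
    case 3
    obtain x where x: "L 1 = {x}" using 3(1) by (metis card_1_singletonE)
    hence "x \<in> L 1" by simp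
    then obtain \<beta> where b: "x = pt 1 (\<mu> + \<beta>)" unfolding L_def by (metis IntD2 add.commute diff_conv_add_uminus insertE singletonD)
    have "X f = {pt (-1) (\<mu> - \<theta> (-1)), pt (-1) (\<mu> + \<theta> (-1)), pt (- (-1)) (\<mu> + \<beta>)}"
      using XL two[OF 3(2)] x b by auto
    thus thesis using triangle[of "-1" "\<theta> (-1)" \<mu> \<beta>] two[OF 3(2)] by simp
  qed
qed

end

context axial_polyhedron
begin

lemma gface_neighbours:
  assumes f: "f \<in> faces r" and x: "x \<in> X f"
  shows "card {y \<in> X f. y \<noteq> x \<and> {x, y} \<in> gface f} = 2"
proof -
  have "(\<lambda>y. {x, y}) ` {y \<in> X f. y \<noteq> x \<and> {x, y} \<in> gface f} = {e \<in> gface f. x \<in> e}"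
  proof (intro equalityI subsetI)
    fix e assume "e \<in> {e \<in> gface f. x \<in> e}"
    hence e: "e \<in> gface f" "x \<in> e" by auto
    then obtain y where "y \<in> X f" "y \<noteq> x" "e = {x, y}" using gface_edge_pair[OF f e] by blast
    thus "e \<in> (\<lambda>y. {x, y}) ` {y \<in> X f. y \<noteq> x \<and> {x, y} \<in> gface f}" using e by blast
  qed auto
  moreover have "inj_on (\<lambda>y. {x, y}) {y \<in> X f. y \<noteq> x \<and> {x, y} \<in> gface f}"
    by (auto simp: inj_on_def doubleton_eq_iff)
  from card_image[OF this] have "card ((\<lambda>y. {x, y}) ` {y \<in> X f. y \<noteq> x \<and> {x, y} \<in> gface f})
    = card {y \<in> X f. y \<noteq> x \<and> {x, y} \<in> gface f}" .
  ultimately show ?thesis using gface_vertex_card[OF f x] by simp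
qed

lemma triangle_edges:
  assumes f: "f \<in> faces r" and X: "X f = {a, b, c}"
  shows "a \<noteq> b" "{a, b} \<in> gface f"
proof -
  have c3: "card {a, b, c} \<ge> 3" using face_points_card[OF f] X by simp
  hence d: "a \<noteq> b" "a \<noteq> c" "b \<noteq> c" by (auto simp: card_insert_if split: if_splits)
  thus "a \<noteq> b" by blast
  have "{y \<in> X f. y \<noteq> a \<and> {a, y} \<in> gface f} \<subseteq> {b, c}" using X by auto
  moreover have "card {b, c} = card {y \<in> X f. y \<noteq> a \<and> {a, y} \<in> gface f}"
    using gface_neighbours[OF f, of a] X d by simp
  ultimately have "{y \<in> X f. y \<noteq> a \<and> {a, y} \<in> gface f} = {b, c}" using card_subset_eq[of "{b, c}"] by simp
  thus "{a, b} \<in> gface f" by blast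
qed

lemma quad_two_of_three:
  assumes f: "f \<in> faces r" and X: "X f = {x, y, z, w}" and d: "distinct [x, y, z, w]"
  shows "({x, y} \<in> gface f \<and> {x, z} \<in> gface f \<and> {x, w} \<notin> gface f) \<or>
         ({x, y} \<in> gface f \<and> {x, z} \<notin> gface f \<and> {x, w} \<in> gface f) \<or>
         ({x, y} \<notin> gface f \<and> {x, z} \<in> gface f \<and> {x, w} \<in> gface f)"
proof -
  let ?P = "\<lambda>u. {x, u} \<in> gface f"
  have "{u \<in> X f. u \<noteq> x \<and> ?P u} = {u \<in> {y, z, w}. ?P u}" using d unfolding X by force
  hence "card {u \<in> {y, z, w}. ?P u} = 2" using gface_neighbours[OF f, of x] X by simp
  moreover have "card {u \<in> {y, z, w}. ?P u} = (\<Sum>u\<in>{y, z, w}. if ?P u then 1 else 0)"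
    by (simp add: sum.If_cases Int_def)
  ultimately have "(if ?P y then 1 else 0) + (if ?P z then 1 else 0) + (if ?P w then 1 else 0) = (2::nat)"
    using d by (simp add: add.assoc)
  thus ?thesis by (simp split: if_splits)
qed

text \<open>
  In a cycle through four points each point is joined to two of the others, so if one pair of opposite
  sides of the complete quadrangle is missing, the other two pairs are present.
\<close>
lemma quad_edges:
  assumes f: "f \<in> faces r" and X: "X f = {a, b, c, d}" and ds: "distinct [a, b, c, d]"
  shows "{a, b} \<in> gface f \<Longrightarrow> {c, d} \<in> gface f"
    "{a, b} \<notin> gface f \<Longrightarrow> gface f = {{a, c}, {a, d}, {b, c}, {b, d}}"
proof -
  note A = quad_two_of_three[OF f X ds]
  have B: "({b, a} \<in> gface f \<and> {b, c} \<in> gface f \<and> {b, d} \<notin> gface f) \<or>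
         ({b, a} \<in> gface f \<and> {b, c} \<notin> gface f \<and> {b, d} \<in> gface f) \<or>
         ({b, a} \<notin> gface f \<and> {b, c} \<in> gface f \<and> {b, d} \<in> gface f)"
    by (rule quad_two_of_three[OF f]) (use X ds in auto)
  have C: "({c, a} \<in> gface f \<and> {c, b} \<in> gface f \<and> {c, d} \<notin> gface f) \<or>
         ({c, a} \<in> gface f \<and> {c, b} \<notin> gface f \<and> {c, d} \<in> gface f) \<or>
         ({c, a} \<notin> gface f \<and> {c, b} \<in> gface f \<and> {c, d} \<in> gface f)"
    by (rule quad_two_of_three[OF f]) (use X ds in auto)
  have D: "({d, a} \<in> gface f \<and> {d, b} \<in> gface f \<and> {d, c} \<notin> gface f) \<or>
         ({d, a} \<in> gface f \<and> {d, b} \<notin> gface f \<and> {d, c} \<in> gface f) \<or>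
         ({d, a} \<notin> gface f \<and> {d, b} \<in> gface f \<and> {d, c} \<in> gface f)"
    by (rule quad_two_of_three[OF f]) (use X ds in auto)
  have comm: "{b, a} = {a, b}" "{c, a} = {a, c}" "{d, a} = {a, d}" "{c, b} = {b, c}" "{d, b} = {b, d}" "{d, c} = {c, d}"
    by auto
  show "{a, b} \<in> gface f \<Longrightarrow> {c, d} \<in> gface f" using A B C D unfolding comm by argo
  assume n: "{a, b} \<notin> gface f"
  hence m: "{a, c} \<in> gface f" "{a, d} \<in> gface f" "{b, c} \<in> gface f" "{b, d} \<in> gface f" "{c, d} \<notin> gface f"
    using A B C D unfolding comm by argo+
  show "gface f = {{a, c}, {a, d}, {b, c}, {b, d}}"
  proof (intro equalityI subsetI)
    fix e assume e: "e \<in> gface f"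
    obtain x where x: "x \<in> e" using gface_edge(2)[OF f e] by fastforce
    obtain y where y: "y \<in> X f" "y \<noteq> x" "e = {x, y}" using gface_edge_pair[OF f e x] by blast
    have "x \<in> X f" using gface_edge(1)[OF f e] x by blast
    hence "x \<in> {a, b, c, d}" "y \<in> {a, b, c, d}" using y(1) unfolding X by blast+
    moreover have "e \<noteq> {a, b}" "e \<noteq> {c, d}" using n m e by blast+
    ultimately show "e \<in> {{a, c}, {a, d}, {b, c}, {b, d}}" using y(2) unfolding y(3) by (elim insertE emptyE) (simp_all add: insert_commute)
  qed (use m in auto)
qed

lemma sym_face:
  assumes "f0 \<in> faces r" "f \<in> faces r"
  obtains a b \<tau> where "a \<in> sgns" "b \<in> sgns" "X f = msym a b \<tau> ` X f0" "gface f = (`) (msym a b \<tau>) ` gface f0"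
proof -
  obtain k where k: "k \<in> Sym" "k ` X f0 = X f" "(`) k ` gface f0 = gface f" using face_transitive[OF assms] .
  obtain a b \<tau> where m: "a \<in> sgns" "b \<in> sgns" "k = msym a b \<tau>" using sym_msym[OF k(1)] .
  show thesis by (rule that[OF m(1,2), of \<tau>]) (use k m(3) in simp_all)
qed

end

context circled_polyhedron
begin

definition chord :: "real \<Rightarrow> real \<Rightarrow> real \<Rightarrow> (real^3) set" where
  "chord sg \<mu> \<alpha> = {pt sg (\<mu> - \<alpha>), pt sg (\<mu> + \<alpha>)}"

lemma chord_cong: assumes "ang_eq \<mu> \<mu>'" shows "chord sg \<mu> \<alpha> = chord sg \<mu>' \<alpha>"
proof -
  have "pt sg (\<mu> - \<alpha>) = pt sg (\<mu>' - \<alpha>)" "pt sg (\<mu> + \<alpha>) = pt sg (\<mu>' + \<alpha>)"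
    unfolding pt_eq_iff using ang_eq_cong[OF assms ang_eq_refl] by blast+
  thus ?thesis unfolding chord_def by simp
qed

lemma ang_eq_2pi: "ang_eq (t + 2 * pi) t" unfolding ang_eq_def by (intro exI[of _ 1]) simp

lemma chord_flip: "chord sg (\<mu> + pi) (pi - \<alpha>) = chord sg \<mu> \<alpha>"
proof -
  have "pt sg (\<mu> + pi + (pi - \<alpha>)) = pt sg (\<mu> - \<alpha>)"
    using ang_eq_2pi[of "\<mu> - \<alpha>"] by (simp add: pt_eq_iff algebra_simps)
  moreover have "\<mu> + pi - (pi - \<alpha>) = \<mu> + \<alpha>" by simp
  ultimately show ?thesis unfolding chord_def by (simp only: insert_commute)
qed

lemma chord_msym: assumes "b \<in> sgns" shows "msym a b \<tau> ` chord sg \<mu> \<alpha> = chord (a * sg) (b * \<mu> + \<tau>) \<alpha>"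
proof (cases "b = 1")
  case True thus ?thesis unfolding chord_def using msym_pt[OF assms] by (simp add: algebra_simps)
next
  case False
  hence b: "b = -1" using assms by simp
  have "msym a b \<tau> ` chord sg \<mu> \<alpha> = {pt (a * sg) (b * (\<mu> - \<alpha>) + \<tau>), pt (a * sg) (b * (\<mu> + \<alpha>) + \<tau>)}"
    unfolding chord_def using msym_pt[OF assms] by simp
  also have "b * (\<mu> - \<alpha>) + \<tau> = b * \<mu> + \<tau> + \<alpha>" using b by simp
  also have "b * (\<mu> + \<alpha>) + \<tau> = b * \<mu> + \<tau> - \<alpha>" using b by simp
  finally show ?thesis unfolding chord_def by (simp only: insert_commute)
qed

lemma chord_ends_distinct: assumes "0 < \<alpha>" "\<alpha> < pi" shows "pt sg (\<mu> - \<alpha>) \<noteq> pt sg' (\<mu> + \<alpha>)"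
proof
  assume "pt sg (\<mu> - \<alpha>) = pt sg' (\<mu> + \<alpha>)"
  hence "ang_eq ((\<mu> + \<alpha>) - (\<mu> - \<alpha>)) 0" using pt_eq_iff ang_eq_sym ang_eq_0 by blast
  hence "ang_eq (2 * \<alpha>) 0" by simp
  hence "2 * \<alpha> = 0" by (rule ang_eq_small) (use assms in auto)
  thus False using assms by simp
qed

lemma chord_match:
  assumes \<alpha>: "0 < \<alpha>" "\<alpha> < pi" and \<beta>: "0 < \<beta>" "\<beta> < pi" and s: "chord sg m \<alpha> \<subseteq> chord sg' m' \<beta>"
  shows "sg = sg'" "(ang_eq m m' \<and> \<alpha> = \<beta>) \<or> (ang_eq m (m' + pi) \<and> \<alpha> = pi - \<beta>)"
proof -
  show "sg = sg'" using s unfolding chord_def by (auto simp: pt_eq_iff)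
  have n: "\<not> ang_eq (m - \<alpha>) (m + \<alpha>)" using chord_ends_distinct[OF \<alpha>, of sg m sg] pt_eq_iff by blast
  have "ang_eq (m - \<alpha>) (m' - \<beta>) \<or> ang_eq (m - \<alpha>) (m' + \<beta>)" "ang_eq (m + \<alpha>) (m' - \<beta>) \<or> ang_eq (m + \<alpha>) (m' + \<beta>)"
    using s unfolding chord_def by (auto simp: pt_eq_iff)
  moreover have "\<not> (ang_eq (m - \<alpha>) x \<and> ang_eq (m + \<alpha>) x)" for x using n ang_eq_sym ang_eq_trans by blast
  ultimately show "(ang_eq m m' \<and> \<alpha> = \<beta>) \<or> (ang_eq m (m' + pi) \<and> \<alpha> = pi - \<beta>)"
    by (intro chord_eq_cases[OF \<alpha> \<beta>]) blast
qed

lemma chord_level: "x \<in> chord sg \<mu> \<alpha> \<Longrightarrow> x $ 3 = sg * h" unfolding chord_def pt_def cyl_def by auto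

lemma chord_levels_disjoint: "sg \<in> sgns \<Longrightarrow> chord sg \<mu> \<alpha> \<inter> chord (- sg) \<mu>' \<alpha>' = {}"
  using chord_level[of _ sg \<mu> \<alpha>] chord_level[of _ "- sg" \<mu>' \<alpha>'] h by force

subsection \<open>Triangular faces\<close>

definition bar :: space_map where "bar = msym 1 1 pi"

lemma bar_simps: "bar (bar x) = x" "(bar x) $ 3 = x $ 3" "bar (pt sg t) = pt sg (t + pi)"
proof -
  show "bar (bar x) = x" unfolding bar_def msym_def by (simp add: v3_eta)
  show "(bar x) $ 3 = x $ 3" by (simp add: bar_def msym_def)
  show "bar (pt sg t) = pt sg (t + pi)" unfolding bar_def using msym_pt[of 1 1 pi sg t] by simp
qed

text \<open>
  In a triangle with two vertices on one circle, the edge between these lies in two congruent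
  faces; unless it is a diameter the two would lie in the same plane.
\<close>
lemma triangle_base_diameter:
  assumes f0: "f0 \<in> faces r" and e0: "sg0 \<in> sgns" and \<alpha>: "0 < \<alpha>" "\<alpha> < pi"
    and X0: "X f0 = chord sg0 \<mu>0 \<alpha> \<union> {pt (- sg0) (\<mu>0 + \<beta>)}"
  shows "\<alpha> = pi / 2" "\<And>f. f \<in> faces r \<Longrightarrow> \<exists>sg\<in>sgns. \<exists>\<mu> u. X f = chord sg \<mu> \<alpha> \<union> {pt (- sg) u}"
proof -
  have all: "\<exists>sg\<in>sgns. \<exists>\<mu>. \<exists>\<sigma>\<in>sgns. X f = chord sg \<mu> \<alpha> \<union> {pt (- sg) (\<mu> + \<sigma> * \<beta>)}" if f: "f \<in> faces r" for f
  proof -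
    obtain a b \<tau> where m: "a \<in> sgns" "b \<in> sgns" "X f = msym a b \<tau> ` X f0" using sym_face[OF f0 f] .
    have "X f = chord (a * sg0) (b * \<mu>0 + \<tau>) \<alpha> \<union> {pt (- (a * sg0)) ((b * \<mu>0 + \<tau>) + b * \<beta>)}"
      unfolding m(3) X0 image_Un chord_msym[OF m(2)] using msym_pt[OF m(2)] by (simp add: algebra_simps)
    moreover have "a * sg0 \<in> sgns" using m(1) e0 by auto
    ultimately show ?thesis using m(2) by blast
  qed
  thus "\<exists>sg\<in>sgns. \<exists>\<mu> u. X f = chord sg \<mu> \<alpha> \<union> {pt (- sg) u}" if "f \<in> faces r" for f using that by blast
  show "\<alpha> = pi / 2"
  proof (rule ccontr)
    assume n: "\<alpha> \<noteq> pi / 2"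
    have A: "chord sg0 \<mu>0 \<alpha> \<in> gface f0" unfolding chord_def
      by (rule triangle_edges(2)[OF f0]) (use X0 in \<open>auto simp: chord_def\<close>)
    obtain g where g: "g \<in> faces r" "chord sg0 \<mu>0 \<alpha> \<in> gface g" "X g \<noteq> X f0" "affine hull (X g) \<noteq> affine hull (X f0)"
      using gface_other_face[OF f0 A] by metis
    obtain sg \<mu> \<sigma> where s: "sg \<in> sgns" "\<sigma> \<in> sgns" "X g = chord sg \<mu> \<alpha> \<union> {pt (- sg) (\<mu> + \<sigma> * \<beta>)}" using all[OF g(1)] by blast
    have sub: "chord sg0 \<mu>0 \<alpha> \<subseteq> chord sg \<mu> \<alpha> \<union> {pt (- sg) (\<mu> + \<sigma> * \<beta>)}" using gface_edge(1)[OF g(1,2)] s(3) by simp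
    have e: "sg0 = sg"
    proof (rule ccontr)
      assume "sg0 \<noteq> sg"
      hence "sg0 = - sg" using e0 s(1) by auto
      hence "chord sg0 \<mu>0 \<alpha> \<subseteq> {pt (- sg) (\<mu> + \<sigma> * \<beta>)}" using sub chord_levels_disjoint[OF s(1)] by blast
      thus False using chord_ends_distinct[OF \<alpha>] unfolding chord_def by (metis insert_subset singletonD)
    qed
    hence "chord sg0 \<mu>0 \<alpha> \<subseteq> chord sg \<mu> \<alpha>" using sub s(1)
      unfolding chord_def by (auto simp: pt_eq_iff)
    hence mu: "ang_eq \<mu>0 \<mu>" using chord_match(2)[OF \<alpha> \<alpha>, of sg0 \<mu>0 sg \<mu>] n by auto
    have Xg: "X g = chord sg0 \<mu>0 \<alpha> \<union> {pt (- sg0) (\<mu>0 + \<sigma> * \<beta>)}"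
    proof -
      have "pt (- sg) (\<mu>0 + \<sigma> * \<beta>) = pt (- sg) (\<mu> + \<sigma> * \<beta>)" unfolding pt_eq_iff using ang_eq_cong(1)[OF mu ang_eq_refl] by blast
      thus ?thesis unfolding s(3) e chord_cong[OF mu] by simp
    qed
    define m where "m = \<rho> * (cos \<beta> - cos \<alpha>) / (2 * sg0 * h)"
    let ?n = "v3 (cos \<mu>0) (sin \<mu>0) m" and ?d = "\<rho> * cos \<alpha> + m * sg0 * h"
    have "?n \<bullet> ?n \<noteq> 0"
    proof -
      have "?n \<bullet> ?n = 1 + m * m" by simp
      thus ?thesis by (metis add_pos_nonneg less_irrefl zero_le_square zero_less_one)
    qed
    hence nz: "?n \<noteq> 0" by (metis inner_zero_left)
    have "sg0 \<noteq> 0" using e0 by auto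
    hence md: "\<rho> * cos \<beta> - m * sg0 * h = ?d" unfolding m_def using h by (simp add: field_simps)
    have c1: "chord sg0 \<mu>0 \<alpha> \<subseteq> {x. ?n \<bullet> x = ?d}" unfolding chord_def by (simp add: plane_pt del: v3_simps)
    have c2: "pt (- sg0) (\<mu>0 + \<sigma> * \<beta>) \<in> {x. ?n \<bullet> x = ?d}" if "\<sigma> \<in> sgns" for \<sigma>
    proof -
      have "cos (\<sigma> * \<beta>) = cos \<beta>" using that by auto
      thus ?thesis using md by (simp add: plane_pt del: v3_simps)
    qed
    have "X f0 \<subseteq> {x. ?n \<bullet> x = ?d}" using X0 c1 c2[of 1] by auto
    moreover have "X g \<subseteq> {x. ?n \<bullet> x = ?d}" using Xg c1 c2[OF s(2)] by auto
    ultimately show False using same_plane[OF g(1) f0 nz] g(4) by blast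
  qed
qed

definition tetrahedron_faces :: "real^3 \<Rightarrow> real^3 \<Rightarrow> (real^3) set set" where
  "tetrahedron_faces p w = {{p, bar p, w}, {p, bar p, bar w}, {w, bar w, p}, {w, bar w, bar p}}"

lemma tetrahedron_faces_eq:
  assumes "distinct [p, bar p, w, bar w]"
  shows "tetrahedron_faces p w = (\<lambda>x. {p, bar p, w, bar w} - {x}) ` {p, bar p, w, bar w}"
proof -
  have "{p, bar p, w} = {p, bar p, w, bar w} - {bar w}" "{p, bar p, bar w} = {p, bar p, w, bar w} - {w}"
      "{w, bar w, p} = {p, bar p, w, bar w} - {bar p}" "{w, bar w, bar p} = {p, bar p, w, bar w} - {p}"
    using assms by auto
  thus ?thesis unfolding tetrahedron_faces_def by (auto simp only: image_insert image_empty)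
qed

text \<open>
  The base of such a face is a diameter of its circle, so the face consists of \<open>p\<close>, its opposite \<open>bar p\<close>,
  and a point \<open>w\<close> of the other circle. The other face at the edge from \<open>p\<close> to \<open>w\<close> has the same
  shape, so it consists of \<open>w\<close>, \<open>bar w\<close> and \<open>p\<close>. Repeating this yields the four faces of a
  tetrahedron, and they already form a closed surface.
\<close>
lemma triangle_faces:
  assumes f0: "f0 \<in> faces r" and e0: "sg0 \<in> sgns" and \<alpha>: "0 < \<alpha>" "\<alpha> < pi"
    and X0: "X f0 = chord sg0 \<mu>0 \<alpha> \<union> {pt (- sg0) (\<mu>0 + \<beta>)}"
  obtains sg t u where "sg \<in> sgns" "X ` faces r = tetrahedron_faces (pt sg t) (pt (- sg) u)"
proof -
  have al: "\<alpha> = pi / 2" using triangle_base_diameter(1)[OF assms] .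
  have form: "\<exists>p w. X f = {p, bar p, w} \<and> p $ 3 \<noteq> w $ 3" if f: "f \<in> faces r" for f
  proof -
    obtain sg \<mu> u where s: "sg \<in> sgns" "X f = chord sg \<mu> \<alpha> \<union> {pt (- sg) u}" using triangle_base_diameter(2)[OF assms f] by blast
    have "bar (pt sg (\<mu> - \<alpha>)) = pt sg (\<mu> + \<alpha>)" unfolding bar_simps(3) al by (simp add: field_simps)
    hence "X f = {pt sg (\<mu> - \<alpha>), bar (pt sg (\<mu> - \<alpha>)), pt (- sg) u}" using s(2) unfolding chord_def by auto
    moreover have "pt sg (\<mu> - \<alpha>) $ 3 \<noteq> pt (- sg) u $ 3" using s(1) h by (auto simp: pt_def cyl_def)
    ultimately show ?thesis by blast
  qed
  \<comment> \<open>The faces through an edge joining the two circles.\<close>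
  have lateral: "X f = {x, bar x, y} \<or> X f = {y, bar y, x}" if f: "f \<in> faces r" and xy: "{x, y} \<subseteq> X f" "x $ 3 \<noteq> y $ 3" for f x y
  proof -
    obtain p w where pw: "X f = {p, bar p, w}" "p $ 3 \<noteq> w $ 3" using form[OF f] by blast
    have lev: "(bar p) $ 3 = p $ 3" by (rule bar_simps(2))
    have bb: "bar (bar p) = p" by (rule bar_simps(1))
    have "x \<in> {p, bar p, w}" "y \<in> {p, bar p, w}" using xy(1) pw(1) by auto
    then consider "x = p \<or> x = bar p" "y = w" | "x = w" "y = p \<or> y = bar p" using xy(2) lev by fastforce
    thus ?thesis
    proof cases
      case 1
      hence "{x, bar x, y} = {p, bar p, w}" using bb by (elim disjE) (simp_all add: insert_commute)
      thus ?thesis using pw(1) by simp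
    next
      case 2
      hence "{y, bar y, x} = {p, bar p, w}" using bb by (elim disjE) (simp_all add: insert_commute)
      thus ?thesis using pw(1) by simp
    qed
  qed
  have step: "\<exists>g\<in>faces r. X g = {w, bar w, p}" if f: "f \<in> faces r" "X f = {p, bar p, w}" "p $ 3 \<noteq> w $ 3" for f p w
  proof -
    have "{p, w} \<in> gface f" by (rule triangle_edges(2)[OF f(1)]) (use f(2) in auto)
    then obtain g where g: "g \<in> faces r" "{p, w} \<in> gface g" "X g \<noteq> X f" using gface_other_face[OF f(1)] by metis
    thus ?thesis using lateral[OF g(1) gface_edge(1)[OF g(1,2)] f(3)] f(2) by auto
  qed
  define p w where "p = pt sg0 (\<mu>0 - \<alpha>)" and "w = pt (- sg0) (\<mu>0 + \<beta>)"
  have "bar p = pt sg0 (\<mu>0 + \<alpha>)" unfolding p_def bar_simps(3) al by (simp add: field_simps)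
  hence F1: "X f0 = {p, bar p, w}" using X0 unfolding chord_def p_def w_def by auto
  have lev: "p $ 3 \<noteq> w $ 3" using e0 h by (auto simp: p_def w_def pt_def cyl_def)
  note lb = bar_simps(2)
  obtain f2 where f2: "f2 \<in> faces r" "X f2 = {w, bar w, p}" using step[OF f0 F1 lev] by blast
  have "X f0 = {bar p, bar (bar p), w}" using F1 bar_simps(1) by (auto simp: insert_commute)
  then obtain f3 where f3: "f3 \<in> faces r" "X f3 = {w, bar w, bar p}" using step[OF f0, of "bar p" w] lev lb by auto
  have "X f2 = {bar w, bar (bar w), p}" using f2 bar_simps(1) by (auto simp: insert_commute)
  then obtain f4 where f4: "f4 \<in> faces r" "X f4 = {p, bar p, bar w}" using step[OF f2(1), of "bar w" p] lev lb by auto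
  let ?T = "tetrahedron_faces p w"
  have sub: "?T \<subseteq> X ` faces r"
    using imageI[OF f0, of X] imageI[OF f2(1), of X] imageI[OF f3(1), of X] imageI[OF f4(1), of X]
    unfolding tetrahedron_faces_def F1 f2(2) f3(2) f4(2) by simp
  let ?V = "{p, bar p, w, bar w}"
  have d: "distinct [p, bar p, w, bar w]"
    using triangle_edges(1)[OF f0 F1] triangle_edges(1)[OF f2] lev lb[of p] lb[of w] by auto
  note T = tetrahedron_faces_eq[OF d]
  have V4: "card ?V = 4" using d by simp
  \<comment> \<open>Each pair of the four points lies in two of these faces, hence in no further face.\<close>
  have closed: "X g \<in> ?T" if f: "f \<in> faces r" "X f \<in> ?T" and g: "g \<in> faces r" and A: "A \<in> gface f" "A \<in> gface g" for f g A
  proof -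
    obtain z where z: "z \<in> ?V" "X f = ?V - {z}" using f(2) unfolding T by blast
    obtain x y where xy: "A = {x, y}" "x \<noteq> y" "x \<in> X f" "y \<in> X f"
      using gface_edge[OF f(1) A(1)] unfolding card_2_iff by blast
    have "card (X f - A) = 1" unfolding z(2) using z xy V4 by (simp add: card_Diff_subset)
    then obtain c where "X f - A = {c}" by (rule card_1_singletonE)
    hence c: "c \<in> X f" "c \<noteq> x" "c \<noteq> y" "?V - {c} = {x, y, z}" using xy z by auto
    hence "?V - {c} \<in> ?T" using z unfolding T by blast
    then obtain k where k: "k \<in> faces r" "X k = {x, y, z}" using sub c(4) by auto
    have "A \<in> gface k" unfolding xy(1) by (rule triangle_edges(2)[OF k])
    moreover have "k \<noteq> f" using c(1-3) z k(2) by auto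
    ultimately have "g = f \<or> g = k" using gface_other_face[OF f(1) A(1)] A(2) g k(1) by metis
    moreover have "X k \<in> ?T" unfolding k(2) c(4)[symmetric] by fact
    ultimately show ?thesis using f(2) by (elim disjE) (simp_all only:)
  qed
  have T0: "X f0 \<in> ?T" using F1 by (simp add: tetrahedron_faces_def)
  have "X f \<in> ?T" if "f \<in> faces r" for f
    by (rule faces_connected_gface[of f0 "\<lambda>f. X f \<in> ?T", OF f0 T0 _ that]) (rule closed)
  hence "X ` faces r = ?T" using sub by blast
  thus thesis using that e0 unfolding p_def w_def by blast
qed

subsection \<open>Quadrangular faces\<close>

definition quad_pts :: "real \<Rightarrow> real \<Rightarrow> real \<Rightarrow> real \<Rightarrow> (real^3) set" where
  "quad_pts \<alpha> \<gamma> sg \<mu> = chord sg \<mu> \<alpha> \<union> chord (- sg) \<mu> \<gamma>"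

definition quad_edge_set :: "real \<Rightarrow> real \<Rightarrow> real \<Rightarrow> real \<Rightarrow> (real^3) set set" where
  "quad_edge_set \<alpha> \<gamma> sg \<mu> = {{x, y} |x y. x \<in> chord sg \<mu> \<alpha> \<and> y \<in> chord (- sg) \<mu> \<gamma>}"

lemma quad_swap: "quad_pts \<alpha> \<gamma> sg \<mu> = quad_pts \<gamma> \<alpha> (- sg) \<mu>" "quad_edge_set \<alpha> \<gamma> sg \<mu> = quad_edge_set \<gamma> \<alpha> (- sg) \<mu>"
  unfolding quad_pts_def quad_edge_set_def by (auto simp: insert_commute)

lemma quad_flip: "quad_pts (pi - \<alpha>) (pi - \<gamma>) sg (\<mu> + pi) = quad_pts \<alpha> \<gamma> sg \<mu>"
  "quad_edge_set (pi - \<alpha>) (pi - \<gamma>) sg (\<mu> + pi) = quad_edge_set \<alpha> \<gamma> sg \<mu>"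
  unfolding quad_pts_def quad_edge_set_def chord_flip by auto

lemma quad_cong: assumes "ang_eq \<mu> \<mu>'"
  shows "quad_pts \<alpha> \<gamma> sg \<mu> = quad_pts \<alpha> \<gamma> sg \<mu>'" "quad_edge_set \<alpha> \<gamma> sg \<mu> = quad_edge_set \<alpha> \<gamma> sg \<mu>'"
  unfolding quad_pts_def quad_edge_set_def chord_cong[OF assms] by auto

lemma quad_msym: assumes "b \<in> sgns"
  shows "msym a b \<tau> ` quad_pts \<alpha> \<gamma> sg \<mu> = quad_pts \<alpha> \<gamma> (a * sg) (b * \<mu> + \<tau>)"
    "(`) (msym a b \<tau>) ` quad_edge_set \<alpha> \<gamma> sg \<mu> = quad_edge_set \<alpha> \<gamma> (a * sg) (b * \<mu> + \<tau>)"
proof -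
  note c = chord_msym[OF assms, of a \<tau>]
  show "msym a b \<tau> ` quad_pts \<alpha> \<gamma> sg \<mu> = quad_pts \<alpha> \<gamma> (a * sg) (b * \<mu> + \<tau>)"
    unfolding quad_pts_def image_Un c by simp
  have "chord (- (a * sg)) (b * \<mu> + \<tau>) \<gamma> = msym a b \<tau> ` chord (- sg) \<mu> \<gamma>" using c[of "- sg" \<mu> \<gamma>] by simp
  thus "(`) (msym a b \<tau>) ` quad_edge_set \<alpha> \<gamma> sg \<mu> = quad_edge_set \<alpha> \<gamma> (a * sg) (b * \<mu> + \<tau>)"
    unfolding quad_edge_set_def c[symmetric] by (auto simp: image_iff) (metis image_empty image_insert)+
qed

lemma quad_distinct:
  assumes "sg \<in> sgns" "0 < \<alpha>" "\<alpha> < pi" "0 < \<gamma>" "\<gamma> < pi"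
  shows "distinct [pt sg (\<mu> - \<alpha>), pt sg (\<mu> + \<alpha>), pt (- sg) (\<mu> - \<gamma>), pt (- sg) (\<mu> + \<gamma>)]"
  using chord_ends_distinct[OF assms(2,3)] chord_ends_distinct[OF assms(4,5)] assms(1) by (auto simp: pt_eq_iff)

text \<open>
  An edge of such a face within one of the circles must be a diameter, since both faces containing
  it are determined by its direction.
\<close>
lemma horizontal_edge_diameter:
  assumes f: "f \<in> faces r" and e: "sg \<in> sgns" and Xf: "X f = quad_pts \<alpha> \<gamma> sg \<mu>"
    and \<alpha>: "0 < \<alpha>" "\<alpha> < pi" and \<gamma>: "0 < \<gamma>" "\<gamma> < pi"
    and all: "\<And>g. g \<in> faces r \<Longrightarrow> \<exists>sg\<in>sgns. \<exists>\<mu>. X g = quad_pts \<alpha> \<gamma> sg \<mu>"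
    and A: "chord sg \<mu> \<alpha> \<in> gface f"
  obtains g where "g \<in> faces r" "X g \<noteq> X f" "\<alpha> = pi / 2" "X g = quad_pts \<alpha> \<gamma> sg (\<mu> - pi)"
proof -
  obtain g where g: "g \<in> faces r" "chord sg \<mu> \<alpha> \<in> gface g" "X g \<noteq> X f" using gface_other_face[OF f A] by metis
  obtain sg' \<mu>' where s: "sg' \<in> sgns" "X g = quad_pts \<alpha> \<gamma> sg' \<mu>'" using all[OF g(1)] by blast
  have sub: "chord sg \<mu> \<alpha> \<subseteq> chord sg' \<mu>' \<alpha> \<union> chord (- sg') \<mu>' \<gamma>" using gface_edge(1)[OF g(1,2)] s(2) unfolding quad_pts_def by simp
  have shift: "ang_eq \<mu>' (\<mu> - pi)" if "ang_eq \<mu> (\<mu>' + pi)"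
    using ang_eq_cong(2)[OF ang_eq_sym[OF that] ang_eq_refl[of pi]] by simp
  show thesis
  proof (cases "sg' = sg")
    case True
    hence "chord sg \<mu> \<alpha> \<subseteq> chord sg' \<mu>' \<alpha>" using sub chord_levels_disjoint[OF e] by blast
    from chord_match(2)[OF \<alpha> \<alpha> this] show thesis
    proof
      assume "ang_eq \<mu> \<mu>' \<and> \<alpha> = \<alpha>"
      hence "X g = X f" using quad_cong(1) s(2) Xf True by metis
      thus thesis using g by simp
    next
      assume a: "ang_eq \<mu> (\<mu>' + pi) \<and> \<alpha> = pi - \<alpha>"
      hence "X g = quad_pts \<alpha> \<gamma> sg (\<mu> - pi)" using quad_cong(1)[OF shift] s(2) True by simp
      moreover have "\<alpha> = pi / 2" using a by simp
      ultimately show thesis using that[of g] g by blast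
    qed
  next
    case False
    hence e': "sg' = - sg" using e s(1) by auto
    hence "chord sg \<mu> \<alpha> \<subseteq> chord (- sg) \<mu>' \<alpha> \<union> chord sg \<mu>' \<gamma>" using sub by simp
    hence "chord sg \<mu> \<alpha> \<subseteq> chord sg \<mu>' \<gamma>" using chord_levels_disjoint[OF e] by blast
    from chord_match(2)[OF \<alpha> \<gamma> this] have "X g = X f"
    proof
      assume a: "ang_eq \<mu> \<mu>' \<and> \<alpha> = \<gamma>"
      hence "X g = quad_pts \<alpha> \<gamma> (- sg) \<mu>" using quad_cong(1)[OF conjunct1[OF a]] s(2) e' by simp
      thus ?thesis using Xf quad_swap(1)[of \<alpha> \<gamma> sg \<mu>] a by simp
    next
      assume a: "ang_eq \<mu> (\<mu>' + pi) \<and> \<alpha> = pi - \<gamma>"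
      hence "X g = quad_pts \<alpha> \<gamma> (- sg) (\<mu> - pi)" using quad_cong(1)[OF shift] s(2) e' by simp
      also have "\<dots> = quad_pts (pi - \<alpha>) (pi - \<gamma>) (- sg) \<mu>" using quad_flip(1)[of \<alpha> \<gamma> "- sg" "\<mu> - pi"] by simp
      also have "\<dots> = quad_pts \<gamma> \<alpha> (- sg) \<mu>" using a by simp
      finally show ?thesis using Xf quad_swap(1)[of \<alpha> \<gamma> sg \<mu>] by simp
    qed
    thus thesis using g by simp
  qed
qed

text \<open>
  If both horizontal sides of a face were edges, both would be diameters, and the face on the other
  side of one of them would have the same vertices.
\<close>
lemma quad_faces_lateral:
  assumes f0: "f0 \<in> faces r" and e0: "sg0 \<in> sgns" and X0: "X f0 = quad_pts \<alpha> \<gamma> sg0 \<mu>0"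
    and \<alpha>: "0 < \<alpha>" "\<alpha> < pi" and \<gamma>: "0 < \<gamma>" "\<gamma> < pi" and f: "f \<in> faces r"
  shows "\<exists>sg\<in>sgns. \<exists>\<mu>. X f = quad_pts \<alpha> \<gamma> sg \<mu> \<and> gface f = quad_edge_set \<alpha> \<gamma> sg \<mu>"
proof -
  have quad4: "quad_pts \<alpha> \<gamma> sg \<mu> = {pt sg (\<mu> - \<alpha>), pt sg (\<mu> + \<alpha>), pt (- sg) (\<mu> - \<gamma>), pt (- sg) (\<mu> + \<gamma>)}" for sg \<mu>
    unfolding quad_pts_def chord_def by auto
  have edges4: "quad_edge_set \<alpha> \<gamma> sg \<mu> = {{pt sg (\<mu> - \<alpha>), pt (- sg) (\<mu> - \<gamma>)}, {pt sg (\<mu> - \<alpha>), pt (- sg) (\<mu> + \<gamma>)},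
     {pt sg (\<mu> + \<alpha>), pt (- sg) (\<mu> - \<gamma>)}, {pt sg (\<mu> + \<alpha>), pt (- sg) (\<mu> + \<gamma>)}}" for sg \<mu>
    unfolding quad_edge_set_def chord_def by auto
  have all: "\<exists>sg\<in>sgns. \<exists>\<mu>. X g = quad_pts \<alpha> \<gamma> sg \<mu>" if g: "g \<in> faces r" for g
  proof -
    obtain a b \<tau> where m: "a \<in> sgns" "b \<in> sgns" "X g = msym a b \<tau> ` X f0" using sym_face[OF f0 g] .
    hence "X g = quad_pts \<alpha> \<gamma> (a * sg0) (b * \<mu>0 + \<tau>)" unfolding X0 quad_msym(1)[OF m(2)] by simp
    moreover have "a * sg0 \<in> sgns" using m(1) e0 by auto
    ultimately show ?thesis by blast
  qed
  have X0': "X f0 = quad_pts \<gamma> \<alpha> (- sg0) \<mu>0" using X0 quad_swap(1) by simp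
  have e0': "- sg0 \<in> sgns" using e0 by auto
  have all': "\<exists>sg\<in>sgns. \<exists>\<mu>. X g = quad_pts \<gamma> \<alpha> sg \<mu>" if g: "g \<in> faces r" for g
  proof -
    obtain sg \<mu> where "sg \<in> sgns" "X g = quad_pts \<alpha> \<gamma> sg \<mu>" using all[OF g] by blast
    moreover from this have "- sg \<in> sgns" by auto
    ultimately show ?thesis using quad_swap(1) by metis
  qed
  have "chord sg0 \<mu>0 \<alpha> \<notin> gface f0"
  proof
    assume A: "chord sg0 \<mu>0 \<alpha> \<in> gface f0"
    have B: "chord (- sg0) \<mu>0 \<gamma> \<in> gface f0" unfolding chord_def
      by (rule quad_edges(1)[OF f0 X0[unfolded quad4] quad_distinct[OF e0 \<alpha> \<gamma>]]) (use A in \<open>simp add: chord_def\<close>)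
    obtain g where g: "X g \<noteq> X f0" "\<alpha> = pi / 2" "X g = quad_pts \<alpha> \<gamma> sg0 (\<mu>0 - pi)"
      using horizontal_edge_diameter[OF f0 e0 X0 \<alpha> \<gamma> all A] by metis
    have "\<gamma> = pi / 2" using horizontal_edge_diameter[OF f0 e0' X0' \<gamma> \<alpha> all' B] by metis
    hence "pi - \<alpha> = \<alpha>" "pi - \<gamma> = \<gamma>" "\<mu>0 - pi + pi = \<mu>0" using g(2) by simp_all
    hence "quad_pts \<alpha> \<gamma> sg0 (\<mu>0 - pi) = quad_pts \<alpha> \<gamma> sg0 \<mu>0" using quad_flip(1)[of \<alpha> \<gamma> sg0 "\<mu>0 - pi"] by metis
    thus False using g X0 by simp
  qed
  hence "gface f0 = quad_edge_set \<alpha> \<gamma> sg0 \<mu>0"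
    unfolding edges4 using quad_edges(2)[OF f0 X0[unfolded quad4] quad_distinct[OF e0 \<alpha> \<gamma>]] by (simp add: chord_def)
  moreover obtain a b \<tau> where m: "a \<in> sgns" "b \<in> sgns" "X f = msym a b \<tau> ` X f0" "gface f = (`) (msym a b \<tau>) ` gface f0"
    using sym_face[OF f0 f] .
  ultimately have "X f = quad_pts \<alpha> \<gamma> (a * sg0) (b * \<mu>0 + \<tau>)" "gface f = quad_edge_set \<alpha> \<gamma> (a * sg0) (b * \<mu>0 + \<tau>)"
    unfolding m(3,4) X0 quad_msym[OF m(2), symmetric] by simp_all
  moreover have "a * sg0 \<in> sgns" using m(1) e0 by auto
  ultimately show ?thesis by blast
qed

text \<open>
  The normalization \<open>\<gamma> \<le> \<alpha>\<close> and \<open>\<alpha> + \<gamma> \<le>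
  pi\<close> is achieved by exchanging the circles and by describing a chord from its opposite
  direction.
\<close>
theorem faces_tetrahedral_or_lateral:
  obtains (tetrahedron) sg t u where "sg \<in> sgns" "X ` faces r = tetrahedron_faces (pt sg t) (pt (- sg) u)"
  | (lateral) \<alpha> \<gamma> where "0 < \<gamma>" "\<gamma> \<le> \<alpha>" "\<alpha> < pi" "\<alpha> + \<gamma> \<le> pi"
     "\<And>f. f \<in> faces r \<Longrightarrow> \<exists>sg\<in>sgns. \<exists>\<mu>. X f = quad_pts \<alpha> \<gamma> sg \<mu> \<and> gface f = quad_edge_set \<alpha> \<gamma> sg \<mu>"
proof -
  obtain f0 where f0: "f0 \<in> faces r" using faces_nonempty by blast
  show thesis
  proof (cases rule: face_cases[OF f0])
    case (1 sg \<mu> \<alpha> \<beta>)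
    hence "X f0 = chord sg \<mu> \<alpha> \<union> {pt (- sg) (\<mu> + \<beta>)}" unfolding chord_def by auto
    from triangle_faces[OF f0 1(1,2,3) this] show thesis using tetrahedron by metis
  next
    case (2 sg \<mu> \<alpha> \<beta>)
    have X0: "X f0 = quad_pts \<alpha> \<beta> sg \<mu>" using 2(6) unfolding quad_pts_def chord_def by auto
    have lat: "thesis" if e: "sg \<in> sgns" and X0: "X f0 = quad_pts \<alpha> \<beta> sg \<mu>" and a: "0 < \<alpha>" "\<alpha> < pi" "0 < \<beta>" "\<beta> < pi" "\<alpha> + \<beta> \<le> pi" for sg \<alpha> \<beta> \<mu>
    proof (cases "\<beta> \<le> \<alpha>")
      case True thus thesis using lateral[of \<beta> \<alpha>] a quad_faces_lateral[OF f0 e X0 a(1-4)] by blast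
    next
      case False
      have e': "- sg \<in> sgns" using e by auto
      have X0': "X f0 = quad_pts \<beta> \<alpha> (- sg) \<mu>" using X0 quad_swap(1) by simp
      show thesis using lateral[of \<alpha> \<beta>] a False quad_faces_lateral[OF f0 e' X0' a(3,4,1,2)] by force
    qed
    show thesis
    proof (cases "\<alpha> + \<beta> \<le> pi")
      case True thus thesis using lat[OF 2(1) X0] 2 by blast
    next
      case False
      have "X f0 = quad_pts (pi - \<alpha>) (pi - \<beta>) sg (\<mu> + pi)" using X0 quad_flip(1) by simp
      from lat[OF 2(1) this] show thesis using 2 False by simp
    qed
  qed
qed

end

section \<open>Finite groups of angles\<close>

lemma ang_eq_iff_cis: "ang_eq s t \<longleftrightarrow> cis s = cis t"
  unfolding ang_eq_iff_sin_cos by (auto simp: complex_eq_iff)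

text \<open>
  A finite multiplicative group of \<open>n\<close> complex numbers consists of \<open>n\<close>-th roots of unity, since
  multiplication by an element permutes the group and so does not change the product of all elements.
\<close>
lemma angle_group_cyclic:
  assumes 0: "0 \<in> H" and add: "\<And>x y. x \<in> H \<Longrightarrow> y \<in> H \<Longrightarrow> x + y \<in> H" and neg: "\<And>x. x \<in> H \<Longrightarrow> - x \<in> H"
    and turn: "2 * pi \<in> H" and fin: "finite (cis ` H)"
  obtains n :: nat where "n > 0" "H = {2 * pi * real_of_int k / real n |k. True}"
proof -
  let ?U = "cis ` H"
  define n where "n = card ?U"
  have n: "n > 0" unfolding n_def using fin 0 by (auto simp: card_gt_0_iff)
  have sub: "?U \<subseteq> {z. z ^ n = 1}"
  proof
    fix z assume "z \<in> ?U"
    then obtain x where x: "x \<in> H" "z = cis x" by blast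
    have im: "(\<lambda>u. z * u) ` ?U \<subseteq> ?U" using x add by (auto simp: cis_mult)
    have inj: "inj_on (\<lambda>u. z * u) ?U" using x by (auto simp: inj_on_def)
    have "\<Prod>?U = (\<Prod>u\<in>(\<lambda>u. z * u) ` ?U. u)" using endo_inj_surj[OF fin im inj] by simp
    also have "\<dots> = (\<Prod>u\<in>?U. z * u)" using inj by (simp add: prod.reindex)
    also have "\<dots> = z ^ n * \<Prod>?U" by (simp add: prod.distrib n_def)
    finally have "z ^ n * \<Prod>?U = \<Prod>?U" by simp
    moreover have "\<Prod>?U \<noteq> 0" using fin by auto
    ultimately show "z \<in> {z. z ^ n = 1}" by simp
  qed
  have U: "?U = {z. z ^ n = 1}"
  proof (rule card_subset_eq[OF _ sub])
    have "card {z::complex. z ^ n = 1} = n" using card_roots_unity_eq[OF n] .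
    thus "finite {z::complex. z ^ n = 1}" using n card_ge_0_finite by metis
    show "card ?U = card {z::complex. z ^ n = 1}" using card_roots_unity_eq[OF n] n_def by simp
  qed
  have turns_nat: "2 * pi * real k \<in> H" for k :: nat
  proof (induction k)
    case (Suc k)
    have "2 * pi * real (Suc k) = 2 * pi * real k + 2 * pi" by (simp add: algebra_simps)
    thus ?case using add[OF Suc.IH turn] by simp
  qed (use 0 in simp)
  have turns: "2 * pi * real_of_int k \<in> H" for k
  proof (cases "k \<ge> 0")
    case True thus ?thesis using turns_nat[of "nat k"] by simp
  next
    case False thus ?thesis using neg[OF turns_nat[of "nat (- k)"]] by simp
  qed
  have mem: "x \<in> H \<longleftrightarrow> cis x \<in> ?U" for x
  proof
    assume "cis x \<in> ?U"
    then obtain y where "y \<in> H" "ang_eq x y" unfolding ang_eq_iff_cis by auto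
    thus "x \<in> H" unfolding ang_eq_def using add turns by auto
  qed simp
  have "x \<in> H \<longleftrightarrow> (\<exists>k. x = 2 * pi * real_of_int k / real n)" for x
  proof -
    have "x \<in> H \<longleftrightarrow> cis x ^ n = 1" using mem[of x] U by simp
    also have "\<dots> \<longleftrightarrow> cis (real n * x) = cis 0" unfolding Complex.DeMoivre by simp
    also have "\<dots> \<longleftrightarrow> (\<exists>k::int. real n * x = 2 * pi * k)" unfolding ang_eq_iff_cis[symmetric] ang_eq_def by simp
    also have "\<dots> \<longleftrightarrow> (\<exists>k. x = 2 * pi * real_of_int k / real n)" using n by (simp add: field_simps)
    finally show ?thesis .
  qed
  hence "H = {2 * pi * real_of_int k / real n |k. True}" by blast
  thus thesis using that n by blast
qed

lemma finite_image_transfer: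
  assumes "finite (f ` A)" "\<And>x y. x \<in> A \<Longrightarrow> y \<in> A \<Longrightarrow> f x = f y \<Longrightarrow> g x = g y" shows "finite (g ` A)"
proof -
  have "g ` A \<subseteq> (\<lambda>p. g (SOME x. x \<in> A \<and> f x = p)) ` f ` A"
  proof
    fix y assume "y \<in> g ` A"
    then obtain x where x: "x \<in> A" "y = g x" by blast
    let ?s = "SOME z. z \<in> A \<and> f z = f x"
    have "?s \<in> A \<and> f ?s = f x" by (rule someI[of _ x]) (use x in simp)
    hence "y = g ?s" using assms(2)[of x ?s] x by simp
    thus "y \<in> (\<lambda>p. g (SOME x. x \<in> A \<and> f x = p)) ` f ` A" using x by blast
  qed
  thus ?thesis using assms(1) finite_subset by blast
qed

section \<open>Polyhedra whose faces are crossed quadrilaterals\<close>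

locale quad_polyhedron = circled_polyhedron +
  fixes \<alpha> \<gamma> :: real
  assumes weak: "0 < \<gamma>" "\<gamma> \<le> \<alpha>" "\<alpha> < pi" "\<alpha> + \<gamma> \<le> pi"
    and faces: "\<And>f. f \<in> faces r \<Longrightarrow> \<exists>sg\<in>sgns. \<exists>\<mu>. X f = quad_pts \<alpha> \<gamma> sg \<mu> \<and> gface f = quad_edge_set \<alpha> \<gamma> sg \<mu>"
begin

abbreviation "Qp \<equiv> quad_pts \<alpha> \<gamma>"
abbreviation "Qe \<equiv> quad_edge_set \<alpha> \<gamma>"

lemma sub_face_plane: "f \<in> faces r \<Longrightarrow> g \<in> faces r \<Longrightarrow> X f \<subseteq> X g \<Longrightarrow> affine hull (X g) = affine hull (X f)"
  using aff_dim_eq_full_gen[of "X f" "X g"] nondeg(4) by simp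

text \<open>If \<open>\<gamma> = \<alpha>\<close> the faces are parallel to the axis, and the two faces at an edge coincide.\<close>
lemma \<gamma>_less: "\<gamma> < \<alpha>"
proof (rule ccontr)
  assume "\<not> \<gamma> < \<alpha>"
  hence eq: "\<gamma> = \<alpha>" using weak by simp
  obtain f where f: "f \<in> faces r" using faces_nonempty by blast
  obtain sg \<mu> where e: "sg \<in> sgns" "X f = Qp sg \<mu>" "gface f = Qe sg \<mu>" using faces[OF f] by blast
  have A: "{pt sg (\<mu> - \<alpha>), pt (- sg) (\<mu> + \<alpha>)} \<in> gface f" unfolding e(3) quad_edge_set_def chord_def eq by blast
  obtain g where g: "g \<in> faces r" "{pt sg (\<mu> - \<alpha>), pt (- sg) (\<mu> + \<alpha>)} \<in> gface g" "affine hull (X g) \<noteq> affine hull (X f)"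
    using gface_other_face[OF f A] by metis
  obtain sg' \<mu>' where e': "sg' \<in> sgns" "X g = Qp sg' \<mu>'" using faces[OF g(1)] by blast
  have Xg: "X g = chord sg \<mu>' \<alpha> \<union> chord (- sg) \<mu>' \<alpha>" using e'(1) e(1) unfolding e'(2) quad_pts_def eq by auto
  have "pt sg (\<mu> - \<alpha>) \<in> X g" "pt (- sg) (\<mu> + \<alpha>) \<in> X g" using gface_edge(1)[OF g(1,2)] by auto
  hence "ang_eq (\<mu> - \<alpha>) (\<mu>' - \<alpha>) \<or> ang_eq (\<mu> - \<alpha>) (\<mu>' + \<alpha>)" "ang_eq (\<mu> + \<alpha>) (\<mu>' - \<alpha>) \<or> ang_eq (\<mu> + \<alpha>) (\<mu>' + \<alpha>)"
    using e(1) unfolding Xg chord_def by (auto simp: pt_eq_iff)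
  hence "X f \<subseteq> X g" unfolding Xg e(2) quad_pts_def eq chord_def by (auto simp: pt_eq_iff)
  thus False using sub_face_plane[OF f g(1)] g(3) by blast
qed

text \<open>If \<open>\<alpha> + \<gamma> = pi\<close> the faces pass through the centre and are symmetric about it.\<close>
lemma sum_less: "\<alpha> + \<gamma> < pi"
proof (rule ccontr)
  assume "\<not> \<alpha> + \<gamma> < pi"
  hence eq: "\<gamma> = pi - \<alpha>" using weak by simp
  let ?n = "msym (-1) 1 pi"
  have npt: "?n (pt sg t) = pt (- sg) (t + pi)" for sg t using msym_pt[of 1 "-1" pi sg t] by simp
  have nn: "?n (?n x) = x" for x by (simp add: msym_def v3_eta)
  have low: "chord sg \<mu> \<gamma> = ?n ` chord (- sg) \<mu> \<alpha>" for sg \<mu>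
    unfolding eq chord_msym[of 1, simplified] using chord_flip[of sg \<mu> "pi - \<alpha>"] by simp
  have sym: "?n ` Qp sg \<mu> = Qp sg \<mu>" for sg \<mu>
    unfolding quad_pts_def low using nn by (auto simp: image_Un image_image)
  obtain f where f: "f \<in> faces r" using faces_nonempty by blast
  obtain sg \<mu> where e: "sg \<in> sgns" "X f = Qp sg \<mu>" "gface f = Qe sg \<mu>" using faces[OF f] by blast
  let ?x = "pt sg (\<mu> - \<alpha>)" and ?y = "pt sg (\<mu> + \<alpha>)"
  have lowe: "chord (- sg) \<mu> \<gamma> = {?n ?x, ?n ?y}" unfolding low by (simp add: chord_def)
  have A: "{?x, ?n ?y} \<in> gface f" unfolding e(3) quad_edge_set_def lowe by (auto simp: chord_def)
  obtain g where g: "g \<in> faces r" "{?x, ?n ?y} \<in> gface g" "affine hull (X g) \<noteq> affine hull (X f)"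
    using gface_other_face[OF f A] by metis
  obtain sg' \<mu>' where e': "sg' \<in> sgns" "X g = Qp sg' \<mu>'" using faces[OF g(1)] by blast
  have cl: "?n z \<in> X g" if "z \<in> X g" for z using that sym[of sg' \<mu>'] unfolding e'(2) by blast
  have m: "?x \<in> X g" "?n ?y \<in> X g" using gface_edge(1)[OF g(1,2)] by auto
  hence "?n ?x \<in> X g" "?y \<in> X g" using cl[OF m(1)] cl[OF m(2)] nn by auto
  hence "X f \<subseteq> X g" using m unfolding e(2) quad_pts_def lowe by (auto simp: chord_def)
  thus False using sub_face_plane[OF f g(1)] g(3) by blast
qed

lemma \<alpha>_bounds: "0 < \<alpha>" "\<alpha> < pi" and \<gamma>_bounds: "0 < \<gamma>" "\<gamma> < pi" using weak \<gamma>_less by auto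

lemma Qp_level: "sg \<in> sgns \<Longrightarrow> chord sg \<mu>1 \<beta> \<subseteq> Qp sg \<mu> \<Longrightarrow> chord sg \<mu>1 \<beta> \<subseteq> chord sg \<mu> \<alpha>"
  "sg \<in> sgns \<Longrightarrow> chord (- sg) \<mu>1 \<beta> \<subseteq> Qp sg \<mu> \<Longrightarrow> chord (- sg) \<mu>1 \<beta> \<subseteq> chord (- sg) \<mu> \<gamma>"
  unfolding quad_pts_def using chord_levels_disjoint[of sg \<mu>1 \<beta> \<mu> \<gamma>] chord_levels_disjoint[of sg \<mu> \<alpha> \<mu>1 \<beta>] by blast+

text \<open>
  A chord determines its direction up to a half-turn, which replaces the half-angle by its supplement;
  the strict inequalities exclude this.
\<close>
lemma Qp_inj:
  assumes e: "sg \<in> sgns" "sg' \<in> sgns" and eq: "Qp sg \<mu> = Qp sg' \<mu>'" shows "sg = sg' \<and> ang_eq \<mu> \<mu>'"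
proof (cases "sg' = sg")
  case True
  have "chord sg \<mu> \<alpha> \<subseteq> chord sg \<mu>' \<alpha>" "chord (- sg) \<mu> \<gamma> \<subseteq> chord (- sg) \<mu>' \<gamma>"
    using Qp_level(1)[OF e(1), of \<mu> \<alpha> \<mu>'] Qp_level(2)[OF e(1), of \<mu> \<gamma> \<mu>'] eq True unfolding quad_pts_def by blast+
  from chord_match(2)[OF \<alpha>_bounds \<alpha>_bounds this(1)] chord_match(2)[OF \<gamma>_bounds \<gamma>_bounds this(2)]
  show ?thesis using True \<gamma>_less by (elim disjE conjE) auto
next
  case False
  hence e': "sg' = - sg" using e by auto
  have "chord sg \<mu> \<alpha> \<subseteq> Qp (- sg) \<mu>'" using eq e' unfolding quad_pts_def by blast
  hence "chord (- (- sg)) \<mu> \<alpha> \<subseteq> chord (- (- sg)) \<mu>' \<gamma>" using Qp_level(2)[of "- sg" \<mu> \<alpha> \<mu>'] e by fastforce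
  hence "chord sg \<mu> \<alpha> \<subseteq> chord sg \<mu>' \<gamma>" by simp
  from chord_match(2)[OF \<alpha>_bounds \<gamma>_bounds this] show ?thesis using \<gamma>_less sum_less by auto
qed

lemma Qe_iff: "A \<in> Qe sg \<mu> \<longleftrightarrow> (\<exists>s\<in>sgns. \<exists>s'\<in>sgns. A = {pt sg (\<mu> + s * \<alpha>), pt (- sg) (\<mu> + s' * \<gamma>)})"
  unfolding quad_edge_set_def chord_def by auto

text \<open>
  If the two faces at an edge had their longer chords on the same circle, \<open>2 * \<alpha>\<close> and \<open>2 * \<gamma>\<close> would
  agree modulo full turns and up to sign. Hence the end of the edge on the longer chord of one
  face is on the shorter chord of the other, and this determines the direction of the latter.
\<close>
lemma neighbour:
  assumes f: "f \<in> faces r" and e: "sg \<in> sgns" and Xf: "X f = Qp sg \<mu>" and g: "g \<in> faces r" "X g \<noteq> X f"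
    and s: "s \<in> sgns" "s' \<in> sgns" and A: "{pt sg (\<mu> + s * \<alpha>), pt (- sg) (\<mu> + s' * \<gamma>)} \<in> gface g"
  shows "X g = Qp (- sg) (\<mu> + s * \<alpha> + s' * \<gamma>) \<and> gface g = Qe (- sg) (\<mu> + s * \<alpha> + s' * \<gamma>)"
proof -
  obtain sg' \<mu>' where e': "sg' \<in> sgns" "X g = Qp sg' \<mu>'" "gface g = Qe sg' \<mu>'" using faces[OF g(1)] by blast
  have in_chord: "\<exists>u\<in>sgns. ang_eq t (\<mu>' + u * \<beta>)" if "pt sg t \<in> chord sg \<mu>' \<beta>" for t sg \<beta>
    using that unfolding chord_def by (auto simp: pt_eq_iff)
  have sub: "pt sg (\<mu> + s * \<alpha>) \<in> Qp sg' \<mu>'" "pt (- sg) (\<mu> + s' * \<gamma>) \<in> Qp sg' \<mu>'"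
    using gface_edge(1)[OF g(1) A] e'(2) by auto
  have lev: "pt \<delta> t \<in> chord \<delta>' m b \<Longrightarrow> \<delta> = \<delta>'" for \<delta> \<delta>' t m b unfolding chord_def by (auto simp: pt_eq_iff)
  have ne: "sg \<noteq> - sg" using e by auto
  have ab: "\<alpha> > 0" "\<gamma> > 0" using \<alpha>_bounds \<gamma>_bounds by auto
  have small: "x = 0" if "ang_eq x 0" "\<bar>x\<bar> < 2 * pi" for x using ang_eq_small that .
  show ?thesis
  proof (cases "sg' = sg")
    case True
    have "pt sg (\<mu> + s * \<alpha>) \<notin> chord (- sg) \<mu>' \<gamma>" "pt (- sg) (\<mu> + s' * \<gamma>) \<notin> chord sg \<mu>' \<alpha>"
      using lev ne by metis+
    hence "pt sg (\<mu> + s * \<alpha>) \<in> chord sg \<mu>' \<alpha>" "pt (- sg) (\<mu> + s' * \<gamma>) \<in> chord (- sg) \<mu>' \<gamma>"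
      using sub unfolding True quad_pts_def by blast+
    then obtain u v where uv: "u \<in> sgns" "v \<in> sgns" "ang_eq (\<mu> + s * \<alpha>) (\<mu>' + u * \<alpha>)" "ang_eq (\<mu> + s' * \<gamma>) (\<mu>' + v * \<gamma>)"
      using in_chord by metis
    have notmu: "\<not> ang_eq \<mu> \<mu>'" using quad_cong(1) g(2) Xf e'(2) True by metis
    have "u \<noteq> s"
    proof
      assume "u = s" hence "ang_eq \<mu> \<mu>'" using uv(3) ang_eq_0[of \<mu>] ang_eq_0[of "\<mu> + s * \<alpha>"] by simp
      thus False using notmu by simp
    qed
    hence u: "u = - s" using uv s by auto
    have "v \<noteq> s'"
    proof
      assume "v = s'" hence "ang_eq \<mu> \<mu>'" using uv(4) ang_eq_0[of \<mu>] ang_eq_0[of "\<mu> + s' * \<gamma>"] by simp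
      thus False using notmu by simp
    qed
    hence v: "v = - s'" using uv s by auto
    have "ang_eq ((\<mu> + s * \<alpha> - (\<mu> + s' * \<gamma>)) - ((\<mu>' + u * \<alpha>) - (\<mu>' + v * \<gamma>))) 0"
      using ang_eq_cong(2)[OF uv(3,4)] ang_eq_0 by blast
    hence "ang_eq (2 * s * \<alpha> - 2 * s' * \<gamma>) 0" unfolding u v by (simp add: algebra_simps)
    hence "2 * s * \<alpha> - 2 * s' * \<gamma> = 0" by (rule small) (use s ab sum_less in auto)
    thus ?thesis using s \<gamma>_less ab by auto
  next
    case False
    hence ee: "sg' = - sg" using e e'(1) by auto
    have "pt sg (\<mu> + s * \<alpha>) \<notin> chord (- sg) \<mu>' \<alpha>" "pt (- sg) (\<mu> + s' * \<gamma>) \<notin> chord sg \<mu>' \<gamma>"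
      using lev ne by metis+
    hence "pt sg (\<mu> + s * \<alpha>) \<in> chord sg \<mu>' \<gamma>" "pt (- sg) (\<mu> + s' * \<gamma>) \<in> chord (- sg) \<mu>' \<alpha>"
      using sub unfolding ee quad_pts_def by simp_all
    then obtain u v where uv: "u \<in> sgns" "v \<in> sgns" "ang_eq (\<mu> + s * \<alpha>) (\<mu>' + u * \<gamma>)" "ang_eq (\<mu> + s' * \<gamma>) (\<mu>' + v * \<alpha>)"
      using in_chord by metis
    have "ang_eq ((\<mu> + s * \<alpha> - (\<mu> + s' * \<gamma>)) - ((\<mu>' + u * \<gamma>) - (\<mu>' + v * \<alpha>))) 0"
      using ang_eq_cong(2)[OF uv(3,4)] ang_eq_0 by blast
    hence "ang_eq ((s + v) * \<alpha> - (s' + u) * \<gamma>) 0" by (simp add: algebra_simps)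
    hence z: "(s + v) * \<alpha> - (s' + u) * \<gamma> = 0" by (rule small) (use s uv ab sum_less \<gamma>_less in auto)
    have "u = - s'" using z s uv ab \<gamma>_less sum_less by auto
    hence "ang_eq (\<mu>') (\<mu> + s * \<alpha> + s' * \<gamma>)"
    proof -
      have "ang_eq (\<mu>' + u * \<gamma> + s' * \<gamma>) (\<mu> + s * \<alpha> + s' * \<gamma>)" using ang_eq_cong(1)[OF ang_eq_sym[OF uv(3)] ang_eq_refl] .
      thus ?thesis using \<open>u = - s'\<close> by simp
    qed
    thus ?thesis using quad_cong e'(2,3) ee by metis
  qed
qed

text \<open>
  There is a face with its chord of half-angle \<open>\<alpha>\<close> on the circle
  \<open>sg\<close> and in direction \<open>\<mu>\<close>.
\<close>
definition is_face :: "real \<Rightarrow> real \<Rightarrow> bool" where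
  "is_face sg \<mu> \<longleftrightarrow> sg \<in> sgns \<and> (\<exists>f\<in>faces r. X f = Qp sg \<mu> \<and> gface f = Qe sg \<mu>)"

lemma is_face_cong: "ang_eq \<mu> \<mu>' \<Longrightarrow> is_face sg \<mu> \<longleftrightarrow> is_face sg \<mu>'"
  unfolding is_face_def using quad_cong by metis

lemma is_face_step: assumes "is_face sg \<mu>" "s \<in> sgns" "s' \<in> sgns" shows "is_face (- sg) (\<mu> + s * \<alpha> + s' * \<gamma>)"
proof -
  obtain f where f: "sg \<in> sgns" "f \<in> faces r" "X f = Qp sg \<mu>" "gface f = Qe sg \<mu>" using assms(1) unfolding is_face_def by blast
  have A: "{pt sg (\<mu> + s * \<alpha>), pt (- sg) (\<mu> + s' * \<gamma>)} \<in> gface f" unfolding f(4) Qe_iff using assms by blast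
  obtain g where g: "g \<in> faces r" "{pt sg (\<mu> + s * \<alpha>), pt (- sg) (\<mu> + s' * \<gamma>)} \<in> gface g" "X g \<noteq> X f"
    using gface_other_face[OF f(2) A] by metis
  have "- sg \<in> sgns" using f(1) by auto
  thus ?thesis using neighbour[OF f(2,1,3) g(1,3) assms(2,3) g(2)] g(1) unfolding is_face_def by blast
qed

text \<open>The angles through which faces can be turned by crossing an even number of edges.\<close>
definition H :: "real set" where "H = {2 * \<alpha> * real_of_int i + 2 * \<gamma> * real_of_int j + 2 * pi * real_of_int k |i j k. True}"

lemma H_I: "2 * \<alpha> * real_of_int i + 2 * \<gamma> * real_of_int j + 2 * pi * real_of_int k \<in> H" unfolding H_def by blast

lemma H_add: "x \<in> H \<Longrightarrow> y \<in> H \<Longrightarrow> x + y \<in> H"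
proof -
  assume "x \<in> H" "y \<in> H"
  then obtain i j k i' j' k' where "x = 2 * \<alpha> * real_of_int i + 2 * \<gamma> * real_of_int j + 2 * pi * real_of_int k"
     "y = 2 * \<alpha> * real_of_int i' + 2 * \<gamma> * real_of_int j' + 2 * pi * real_of_int k'" unfolding H_def by blast
  thus ?thesis using H_I[of "i + i'" "j + j'" "k + k'"] by (simp add: algebra_simps)
qed

lemma H_neg: "x \<in> H \<Longrightarrow> - x \<in> H"
proof -
  assume "x \<in> H"
  then obtain i j k where "x = 2 * \<alpha> * real_of_int i + 2 * \<gamma> * real_of_int j + 2 * pi * real_of_int k" unfolding H_def by blast
  thus ?thesis using H_I[of "- i" "- j" "- k"] by (simp add: algebra_simps)
qed

lemma H_diff: "x \<in> H \<Longrightarrow> y \<in> H \<Longrightarrow> x - y \<in> H" using H_add[OF _ H_neg] by fastforce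

lemma H_gens: "0 \<in> H" "2 * \<alpha> \<in> H" "2 * \<gamma> \<in> H" "2 * pi \<in> H"
  using H_I[of 0 0 0] H_I[of 1 0 0] H_I[of 0 1 0] H_I[of 0 0 1] by simp_all

lemma H_ang_eq: "ang_eq x y \<Longrightarrow> x \<in> H \<longleftrightarrow> y \<in> H"
proof -
  assume "ang_eq x y"
  then obtain k :: int where "x = y + 2 * pi * k" unfolding ang_eq_def by blast
  moreover have "2 * pi * real_of_int k \<in> H" using H_I[of 0 0 k] by simp
  ultimately show ?thesis using H_add[of y] H_diff[of x "2 * pi * real_of_int k"] by auto
qed

definition \<kappa> :: real where "\<kappa> = \<alpha> + \<gamma>"

text \<open>
  The angle between faces that have their longer chords on the same circle or on different circles,
  modulo \<open>H\<close>.
\<close>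
definition offset :: "real \<Rightarrow> real" where "offset a = (if a = 1 then 0 else \<kappa>)"

lemma offset_mult: assumes "a \<in> sgns" "a' \<in> sgns" "b \<in> sgns" shows "offset (a * a') - b * offset a' - offset a \<in> H"
proof -
  have k: "\<kappa> + \<kappa> \<in> H" using H_add[OF H_gens(2,3)] by (simp add: \<kappa>_def algebra_simps)
  show ?thesis using assms k H_neg[OF k] H_gens(1) unfolding offset_def by auto
qed

lemma step_offset: assumes "s \<in> sgns" "s' \<in> sgns" shows "s * \<alpha> + s' * \<gamma> - \<kappa> \<in> H" "s * \<alpha> + s' * \<gamma> + \<kappa> \<in> H"
proof -
  have m: "- (2 * \<alpha>) \<in> H" "- (2 * \<gamma>) \<in> H" "2 * \<alpha> + 2 * \<gamma> \<in> H" "- (2 * \<alpha>) - 2 * \<gamma> \<in> H"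
    using H_neg H_gens H_add H_diff by blast+
  show "s * \<alpha> + s' * \<gamma> - \<kappa> \<in> H" "s * \<alpha> + s' * \<gamma> + \<kappa> \<in> H"
    using assms m H_gens unfolding \<kappa>_def by (auto simp: algebra_simps)
qed

lemma is_face_double: assumes "is_face sg \<mu>" shows "is_face sg (\<mu> + 2 * \<alpha>)" "is_face sg (\<mu> - 2 * \<alpha>)" "is_face sg (\<mu> + 2 * \<gamma>)" "is_face sg (\<mu> - 2 * \<gamma>)"
  using is_face_step[OF is_face_step[OF assms, of 1 1], of 1 "-1"] is_face_step[OF is_face_step[OF assms, of "-1" "-1"], of "-1" 1]
    is_face_step[OF is_face_step[OF assms, of 1 1], of "-1" 1] is_face_step[OF is_face_step[OF assms, of "-1" "-1"], of 1 "-1"]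
  by (simp_all add: algebra_simps)

lemma int_multiple_closed:
  fixes Q :: "real \<Rightarrow> bool"
  assumes "\<And>\<mu>. Q \<mu> \<Longrightarrow> Q (\<mu> + c)" "\<And>\<mu>. Q \<mu> \<Longrightarrow> Q (\<mu> - c)" "Q \<mu>" shows "Q (\<mu> + c * real_of_int i)"
proof (induction i rule: int_induct[where k = 0])
  case base thus ?case using assms(3) by simp
next
  case (step1 i) thus ?case using assms(1)[OF step1.IH] by (simp add: algebra_simps)
next
  case (step2 i) thus ?case using assms(2)[OF step2.IH] by (simp add: algebra_simps)
qed

lemma is_face_add_H: assumes "is_face sg \<mu>" "x \<in> H" shows "is_face sg (\<mu> + x)"
proof -
  obtain i j k where x: "x = 2 * \<alpha> * real_of_int i + 2 * \<gamma> * real_of_int j + 2 * pi * real_of_int k" using assms(2) unfolding H_def by blast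
  have "is_face sg (\<mu> + 2 * \<alpha> * real_of_int i)" using int_multiple_closed[of "is_face sg" "2 * \<alpha>"] is_face_double assms(1) by blast
  hence "is_face sg (\<mu> + 2 * \<alpha> * real_of_int i + 2 * \<gamma> * real_of_int j)"
    using int_multiple_closed[of "is_face sg" "2 * \<gamma>"] is_face_double by blast
  moreover have "ang_eq (\<mu> + x) (\<mu> + 2 * \<alpha> * real_of_int i + 2 * \<gamma> * real_of_int j)" unfolding x ang_eq_def by auto
  ultimately show ?thesis using is_face_cong by blast
qed

text \<open>Crossing an edge changes the circle and adds \<open>\<kappa>\<close> modulo \<open>H\<close>; all faces are reached in this way.\<close>
lemma is_face_iff:
  assumes base: "is_face sg0 \<mu>0"
  shows "is_face sg \<mu> \<longleftrightarrow> sg \<in> sgns \<and> \<mu> - \<mu>0 - offset (sg * sg0) \<in> H"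
proof
  assume R: "sg \<in> sgns \<and> \<mu> - \<mu>0 - offset (sg * sg0) \<in> H"
  have e0: "sg0 \<in> sgns" using base unfolding is_face_def by blast
  show "is_face sg \<mu>"
  proof (cases "sg = sg0")
    case True
    hence "\<mu> - \<mu>0 \<in> H" using R e0 unfolding offset_def by auto
    thus ?thesis using is_face_add_H[OF base, of "\<mu> - \<mu>0"] True by simp
  next
    case False
    hence "sg = - sg0" using R e0 by auto
    moreover from this have "\<mu> - \<mu>0 - \<kappa> \<in> H" using R e0 unfolding offset_def by auto
    moreover have "is_face (- sg0) (\<mu>0 + \<kappa>)" using is_face_step[OF base, of 1 1] by (simp add: \<kappa>_def algebra_simps)
    ultimately show ?thesis using is_face_add_H[of "- sg0" "\<mu>0 + \<kappa>" "\<mu> - \<mu>0 - \<kappa>"] by simp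
  qed
next
  assume "is_face sg \<mu>"
  then obtain f where f: "sg \<in> sgns" "f \<in> faces r" "X f = Qp sg \<mu>" unfolding is_face_def by blast
  obtain f0 where f0: "sg0 \<in> sgns" "f0 \<in> faces r" "X f0 = Qp sg0 \<mu>0" "gface f0 = Qe sg0 \<mu>0" using base unfolding is_face_def by blast
  let ?Q = "\<lambda>f. \<exists>sg\<in>sgns. \<exists>\<mu>. X f = Qp sg \<mu> \<and> gface f = Qe sg \<mu> \<and> \<mu> - \<mu>0 - offset (sg * sg0) \<in> H"
  have "?Q f"
  proof (rule faces_connected_gface[of f0 ?Q, OF f0(2) _ _ f(2)])
    have "sg0 * sg0 = 1" using f0(1) by auto
    hence "\<mu>0 - \<mu>0 - offset (sg0 * sg0) \<in> H" using H_gens(1) by (simp add: offset_def)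
    thus "?Q f0" using f0 by blast
  next
    fix f g A assume f: "f \<in> faces r" "?Q f" and g: "g \<in> faces r" and A: "A \<in> gface f" "A \<in> gface g"
    obtain sg \<mu> where e: "sg \<in> sgns" "X f = Qp sg \<mu>" "gface f = Qe sg \<mu>" "\<mu> - \<mu>0 - offset (sg * sg0) \<in> H" using f(2) by blast
    show "?Q g"
    proof (cases "X g = X f")
      case True thus ?thesis using face_inj[OF g f(1)] f(2) by simp
    next
      case False
      obtain s s' where s: "s \<in> sgns" "s' \<in> sgns" "A = {pt sg (\<mu> + s * \<alpha>), pt (- sg) (\<mu> + s' * \<gamma>)}"
        using A(1) unfolding e(3) Qe_iff by blast
      let ?m = "\<mu> + s * \<alpha> + s' * \<gamma>"
      have n: "X g = Qp (- sg) ?m" "gface g = Qe (- sg) ?m" using neighbour[OF f(1) e(1,2) g False s(1,2)] A(2) s(3) by auto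
      have "?m - \<mu>0 - offset (- sg * sg0) \<in> H"
      proof (cases "sg * sg0 = 1")
        case True
        hence "\<mu> - \<mu>0 \<in> H" using e(4) by (simp add: offset_def)
        from H_add[OF this step_offset(1)[OF s(1,2)]] show ?thesis using True by (simp add: offset_def algebra_simps)
      next
        case False
        hence m1: "- sg * sg0 = 1" using e(1) f0(1) by auto
        have "\<mu> - \<mu>0 - \<kappa> \<in> H" using e(4) False by (simp add: offset_def)
        from H_add[OF this step_offset(2)[OF s(1,2)]] show ?thesis unfolding m1 by (simp add: offset_def algebra_simps)
      qed
      moreover have "- sg \<in> sgns" using e(1) by auto
      ultimately show ?thesis using n by blast
    qed
  qed
  then obtain sg' \<mu>' where e': "sg' \<in> sgns" "X f = Qp sg' \<mu>'" "\<mu>' - \<mu>0 - offset (sg' * sg0) \<in> H" by blast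
  have "sg = sg' \<and> ang_eq \<mu> \<mu>'" by (rule Qp_inj[OF f(1) e'(1)]) (use f(3) e'(2) in simp)
  moreover from this have "ang_eq (\<mu> - \<mu>0 - offset (sg * sg0)) (\<mu>' - \<mu>0 - offset (sg' * sg0))"
    using ang_eq_cong(2)[OF ang_eq_cong(2)[OF _ ang_eq_refl] ang_eq_refl] by blast
  ultimately show "sg \<in> sgns \<and> \<mu> - \<mu>0 - offset (sg * sg0) \<in> H" using H_ang_eq e' by blast
qed

lemma geom_faces_is_face: "geom_faces P = {Qe sg \<mu> |sg \<mu>. is_face sg \<mu>}"
proof (intro equalityI subsetI)
  fix F assume "F \<in> geom_faces P"
  then obtain f where "f \<in> faces r" "F = gface f" unfolding geom_faces_gface by blast
  thus "F \<in> {Qe sg \<mu> |sg \<mu>. is_face sg \<mu>}" using faces[of f] unfolding is_face_def by blast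
next
  fix F assume "F \<in> {Qe sg \<mu> |sg \<mu>. is_face sg \<mu>}"
  thus "F \<in> geom_faces P" unfolding is_face_def geom_faces_gface by blast
qed

text \<open>
  Turning a face through the angles in \<open>H\<close> yields vertices on one circle, of which there
  are finitely many.
\<close>
lemma H_cyclic: obtains n :: nat where "n > 0" "H = {2 * pi * real_of_int k / real n |k. True}"
proof -
  obtain f where "f \<in> faces r" using faces_nonempty by blast
  then obtain sg0 \<mu>0 where b: "is_face sg0 \<mu>0" using faces unfolding is_face_def by blast
  have "(\<lambda>x. pt sg0 (\<mu>0 + x - \<alpha>)) ` H \<subseteq> V"
  proof
    fix y assume "y \<in> (\<lambda>x. pt sg0 (\<mu>0 + x - \<alpha>)) ` H"
    then obtain x where x: "x \<in> H" "y = pt sg0 (\<mu>0 + x - \<alpha>)" by blast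
    obtain f where "X f = Qp sg0 (\<mu>0 + x)" using is_face_add_H[OF b x(1)] unfolding is_face_def by blast
    hence "y \<in> X f" using x(2) by (simp add: quad_pts_def chord_def)
    thus "y \<in> V" using points_sub by blast
  qed
  hence fin: "finite ((\<lambda>x. pt sg0 (\<mu>0 + x - \<alpha>)) ` H)" using finite_V finite_subset by blast
  have "finite (cis ` H)"
  proof (rule finite_image_transfer[OF fin])
    fix x y assume "pt sg0 (\<mu>0 + x - \<alpha>) = pt sg0 (\<mu>0 + y - \<alpha>)"
    hence "ang_eq x y" using pt_eq_iff ang_eq_0[of x y] ang_eq_0[of "\<mu>0 + x - \<alpha>"] by simp
    thus "cis x = cis y" using ang_eq_iff_cis by blast
  qed
  thus thesis using angle_group_cyclic[OF H_gens(1) H_add H_neg H_gens(4)] that by blast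
qed

text \<open>The condition on \<open>\<mu>0\<close> makes the reversal of angles preserve the set of faces, so both signs are unrestricted.\<close>
lemma symmetry_group_quad:
  assumes b: "is_face sg0 \<mu>0" and m: "2 * \<mu>0 \<in> H"
  shows "Sym = {msym a b \<tau> |a b \<tau>. a \<in> sgns \<and> b \<in> sgns \<and> \<tau> - offset a \<in> H}"
proof (rule symmetry_group_msym_eq)
  fix a c \<tau> :: real
  assume g: "a \<in> sgns" "c \<in> sgns"
  let ?g = "msym a c \<tau>"
  have bm: "c * \<mu>0 - \<mu>0 \<in> H" using g(2) H_gens(1) H_neg[OF m] by auto
  have e0: "sg0 \<in> sgns" using b unfolding is_face_def by blast
  show "?g \<in> Sym \<longleftrightarrow> \<tau> - offset a \<in> H"
  proof
    assume gS: "?g \<in> Sym"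
    obtain f where f: "f \<in> faces r" "X f = Qp sg0 \<mu>0" "gface f = Qe sg0 \<mu>0" using b unfolding is_face_def by blast
    obtain k where k: "k \<in> faces r" "X k = ?g ` X f" "gface k = (`) ?g ` gface f"
      using symmetry_group_face[OF gS f(1)] by blast
    have "is_face (a * sg0) (c * \<mu>0 + \<tau>)"
      unfolding is_face_def using k f quad_msym[OF g(2)] g(1) e0 by auto
    hence "c * \<mu>0 + \<tau> - \<mu>0 - offset (a * sg0 * sg0) \<in> H" using is_face_iff[OF b] by blast
    moreover have "a * sg0 * sg0 = a" using e0 by auto
    ultimately have "c * \<mu>0 + \<tau> - \<mu>0 - offset a \<in> H" by metis
    from H_diff[OF this bm] show "\<tau> - offset a \<in> H" by (simp add: algebra_simps)
  next
    assume t: "\<tau> - offset a \<in> H"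
    have "is_face (a * sg) (c * \<mu> + \<tau>)" if "is_face sg \<mu>" for sg \<mu>
    proof -
      have e: "sg \<in> sgns" "\<mu> - \<mu>0 - offset (sg * sg0) \<in> H" using is_face_iff[OF b] that by blast+
      have ee: "sg * sg0 \<in> sgns" using e e0 by auto
      have 1: "c * (\<mu> - \<mu>0 - offset (sg * sg0)) \<in> H" using g(2) e(2) H_neg[OF e(2)] by auto
      have "c * (\<mu> - \<mu>0 - offset (sg * sg0)) + (c * \<mu>0 - \<mu>0) + (\<tau> - offset a)
         - (offset (a * (sg * sg0)) - c * offset (sg * sg0) - offset a) \<in> H"
        using H_diff[OF H_add[OF H_add[OF 1 bm] t] offset_mult[OF g(1) ee g(2)]] .
      hence "(c * \<mu> + \<tau>) - \<mu>0 - offset (a * sg * sg0) \<in> H" by (simp add: algebra_simps)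
      moreover have "a * sg \<in> sgns" using g(1) e(1) by auto
      ultimately show ?thesis using is_face_iff[OF b] by blast
    qed
    hence "(`) ((`) ?g) ` geom_faces P \<subseteq> geom_faces P"
      unfolding geom_faces_is_face using quad_msym(2)[OF g(2)] by fastforce
    thus "?g \<in> Sym" unfolding symmetry_group_iff using orth_is_isometry[OF msym_orth[OF g]] by blast
  qed
qed

end

section \<open>The prismatic groups\<close>

lemma rot_z_msym: "rot_z t = msym 1 1 t" by (rule ext) (simp add: rot_z_def msym_def v3_def)
lemma axial_mirror_msym: "axial_mirror = msym 1 (-1) 0"
  by (rule ext) (simp add: axial_mirror_def msym_def v3_def)
lemma perp_mirror_msym: "perp_mirror = msym (-1) 1 0"
  by (rule ext) (simp add: perp_mirror_def msym_def v3_def)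
lemma perp_half_turn_msym: "perp_half_turn = msym (-1) (-1) 0"
  by (rule ext) (simp add: perp_half_turn_def msym_def v3_def)
lemma perp_rot_msym: "perp_mirror \<circ> rot_z t = msym (-1) 1 t"
  unfolding perp_mirror_msym rot_z_msym by (simp add: msym_comp)

lemmas generators_msym = rot_z_msym axial_mirror_msym perp_mirror_msym perp_half_turn_msym

lemma msym_bij: "a \<in> sgns \<Longrightarrow> b \<in> sgns \<Longrightarrow> bij (msym a b \<tau>)"
  using orth_bij msym_orth by blast

text \<open>The rules for \<open>Q\<close> mirror composition and inversion of these maps.\<close>
lemma generated_msym_subset:
  assumes S: "\<And>g. g \<in> S \<Longrightarrow> \<exists>a\<in>sgns. \<exists>b\<in>sgns. \<exists>\<tau>. g = msym a b \<tau> \<and> Q a b \<tau>"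
    and Q: "Q 1 1 0" "\<And>a b \<tau> a' b' \<tau>'. a \<in> sgns \<Longrightarrow> b \<in> sgns \<Longrightarrow> a' \<in> sgns \<Longrightarrow> b' \<in> sgns \<Longrightarrow> Q a b \<tau> \<Longrightarrow> Q a' b' \<tau>' \<Longrightarrow> Q (a * a') (b * b') (b * \<tau>' + \<tau>)"
      "\<And>a b \<tau>. a \<in> sgns \<Longrightarrow> b \<in> sgns \<Longrightarrow> Q a b \<tau> \<Longrightarrow> Q a b (- b * \<tau>)"
    and g: "g \<in> generated_by S"
  shows "\<exists>a\<in>sgns. \<exists>b\<in>sgns. \<exists>\<tau>. g = msym a b \<tau> \<and> Q a b \<tau>"
proof -
  have bij: "bij h" if "h \<in> S" for h using S[OF that] msym_bij by auto
  let ?P = "\<lambda>g. \<exists>a\<in>sgns. \<exists>b\<in>sgns. \<exists>\<tau>. g = msym a b \<tau> \<and> Q a b \<tau>"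
  show ?thesis using bij g
  proof (rule generated_by_induct[where P = ?P])
    show "?P id" by (rule bexI[of _ 1], rule bexI[of _ 1], rule exI[of _ 0]) (use msym_id Q(1) in auto)
    show "?P h" if "h \<in> S" for h using S[OF that] .
    show "?P (ginv h)" if h: "h \<in> S" for h
    proof -
      obtain a b \<tau> where m: "a \<in> sgns" "b \<in> sgns" "h = msym a b \<tau>" "Q a b \<tau>" using S[OF h] by blast
      show ?thesis unfolding m(3) msym_inv[OF m(1,2)] using m(1,2) Q(3)[OF m(1,2,4)] by blast
    qed
    fix f h assume "?P f" "?P h"
    then obtain a b \<tau> a' b' \<tau>' where m: "a \<in> sgns" "b \<in> sgns" "f = msym a b \<tau>" "Q a b \<tau>"
      "a' \<in> sgns" "b' \<in> sgns" "h = msym a' b' \<tau>'" "Q a' b' \<tau>'" by blast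
    have "a * a' \<in> sgns" "b * b' \<in> sgns" using m by auto
    thus "?P (f \<circ> h)" unfolding m(3,7) msym_comp[OF m(2,6)] using Q(2)[OF m(1,2,5,6,4,8)] by blast
  qed
qed

definition turns :: "nat \<Rightarrow> real set" where "turns n = {2 * pi * real_of_int k / real n |k. True}"

lemma turns_0 [simp]: "0 \<in> turns n" unfolding turns_def by (auto intro: exI[of _ 0])
lemma turns_1: "2 * pi / real n \<in> turns n" unfolding turns_def by (auto intro: exI[of _ 1])
lemma turns_add: "x \<in> turns n \<Longrightarrow> y \<in> turns n \<Longrightarrow> x + y \<in> turns n"
proof -
  assume "x \<in> turns n" "y \<in> turns n"
  then obtain k l :: int where "x = 2 * pi * real_of_int k / real n" "y = 2 * pi * real_of_int l / real n" unfolding turns_def by blast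
  hence "x + y = 2 * pi * real_of_int (k + l) / real n" by (simp add: add_divide_distrib distrib_left)
  thus ?thesis unfolding turns_def by blast
qed
lemma turns_neg: "x \<in> turns n \<Longrightarrow> - x \<in> turns n"
proof -
  assume "x \<in> turns n"
  then obtain k :: int where "x = 2 * pi * real_of_int k / real n" unfolding turns_def by blast
  hence "- x = 2 * pi * real_of_int (- k) / real n" by simp
  thus ?thesis unfolding turns_def by blast
qed
lemma turns_diff: "x \<in> turns n \<Longrightarrow> y \<in> turns n \<Longrightarrow> x - y \<in> turns n" using turns_add[OF _ turns_neg] by fastforce
lemma turns_sgn: "b \<in> sgns \<Longrightarrow> x \<in> turns n \<Longrightarrow> b * x \<in> turns n" using turns_neg by auto

lemma rotations_generated:
  assumes bij: "\<And>h. h \<in> S \<Longrightarrow> bij h" and r: "rot_z (2 * pi / real n) \<in> S" and t: "\<tau> \<in> turns n"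
  shows "msym 1 1 \<tau> \<in> generated_by S"
proof -
  have nat: "msym 1 1 (2 * pi * real k / real n) \<in> generated_by S" for k :: nat
  proof (induction k)
    case 0
    have "2 * pi * real 0 / real n = 0" by simp
    thus ?case using generated_by_id[OF bij] by (simp only: msym_id)
  next
    case (Suc k)
    have "msym 1 1 (2 * pi * real (Suc k) / real n) = msym 1 1 (2 * pi / real n) \<circ> msym 1 1 (2 * pi * real k / real n)"
      by (simp add: msym_comp algebra_simps add_divide_distrib)
    thus ?case using generated_by_comp[OF bij generated_by_incl[OF bij r] Suc.IH] unfolding rot_z_msym by (simp only:)
  qed
  obtain k :: int where k: "\<tau> = 2 * pi * real_of_int k / real n" using t unfolding turns_def by blast
  show ?thesis
  proof (cases "k \<ge> 0")
    case True thus ?thesis using nat[of "nat k"] k by simp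
  next
    case False
    hence "ginv (msym 1 1 (2 * pi * real (nat (- k)) / real n)) = msym 1 1 \<tau>"
      unfolding k by (simp add: msym_inv)
    thus ?thesis using generated_by_inv[OF bij nat[of "nat (- k)"]] by simp
  qed
qed

lemma msym_factor:
  assumes "a \<in> sgns" "b \<in> sgns" shows "msym a b \<tau> = msym 1 1 (\<tau> - b * x) \<circ> (msym 1 b 0 \<circ> msym a 1 x)"
proof -
  have "msym 1 b 0 \<circ> msym a 1 x = msym a b (b * x)" using msym_comp[OF assms(2), of 1 1 0 a x] by simp
  thus ?thesis using msym_comp[OF _ assms(2), of 1 1 "\<tau> - b * x" a "b * x"] by simp
qed

lemma grp_star_22n_eq: "grp_star_22n n = {msym a b \<tau> |a b \<tau>. a \<in> sgns \<and> b \<in> sgns \<and> \<tau> \<in> turns n}" (is "_ = ?R")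
proof (intro equalityI subsetI)
  fix g assume "g \<in> grp_star_22n n"
  hence "\<exists>a\<in>sgns. \<exists>b\<in>sgns. \<exists>\<tau>. g = msym a b \<tau> \<and> \<tau> \<in> turns n" unfolding grp_star_22n_def
  proof (rule generated_msym_subset[rotated 4])
    fix g assume "g \<in> {rot_z (2 * pi / real n), axial_mirror, perp_mirror}"
    thus "\<exists>a\<in>sgns. \<exists>b\<in>sgns. \<exists>\<tau>. g = msym a b \<tau> \<and> \<tau> \<in> turns n"
      unfolding generators_msym using turns_1 turns_0 by blast
  qed (use turns_add turns_sgn turns_neg in auto)
  thus "g \<in> ?R" by blast
next
  fix g assume "g \<in> ?R"
  then obtain a b \<tau> where g: "g = msym a b \<tau>" "a \<in> sgns" "b \<in> sgns" "\<tau> \<in> turns n" by blast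
  let ?S = "{rot_z (2 * pi / real n), axial_mirror, perp_mirror}"
  have bij: "bij h" if "h \<in> ?S" for h using that msym_bij unfolding generators_msym by auto
  note gen = generated_by_id[of ?S, OF bij] generated_by_incl[of ?S, OF bij] generated_by_comp[of ?S, OF bij]
  have incl: "h \<in> generated_by ?S" if "h \<in> ?S" for h using that by (intro gen(2)) auto
  have "msym 1 1 \<tau> \<in> generated_by ?S" by (rule rotations_generated[OF bij _ g(4)]) auto
  moreover have "msym 1 b 0 \<in> generated_by ?S" using g(3) gen(1) incl[of axial_mirror] msym_id unfolding generators_msym by auto
  moreover have "msym a 1 0 \<in> generated_by ?S" using g(2) gen(1) incl[of perp_mirror] msym_id unfolding generators_msym by auto
  ultimately have "msym 1 1 \<tau> \<circ> (msym 1 b 0 \<circ> msym a 1 0) \<in> generated_by ?S" by (intro gen(3))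
  thus "g \<in> grp_star_22n n" unfolding grp_star_22n_def g(1) using msym_factor[OF g(2,3), of \<tau> 0] by simp
qed

text \<open>
  The generator \<open>perp_mirror \<circ> rot_z (pi / real n)\<close> accounts for the shift by half
  a step in the maps that exchange the two sides.
\<close>
lemma grp_2_star_n_eq:
  "grp_2_star_n n = {msym a b \<tau> |a b \<tau>. a \<in> sgns \<and> b \<in> sgns \<and> \<tau> - (if a = 1 then 0 else pi / real n) \<in> turns n}" (is "_ = ?R")
proof (intro equalityI subsetI)
  let ?o = "\<lambda>a::real. if a = 1 then 0 else pi / real n"
  have two: "pi / real n + pi / real n \<in> turns n" using turns_1[of n] by simp
  have oo: "?o (a * a') - b * ?o a' - ?o a \<in> turns n" if "a \<in> sgns" "a' \<in> sgns" "b \<in> sgns" for a a' b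
    using that two turns_neg[OF two] by auto
  {
    fix g assume "g \<in> grp_2_star_n n"
    hence "\<exists>a\<in>sgns. \<exists>b\<in>sgns. \<exists>\<tau>. g = msym a b \<tau> \<and> \<tau> - ?o a \<in> turns n" unfolding grp_2_star_n_def
    proof (rule generated_msym_subset[rotated 4])
      fix g assume g: "g \<in> {rot_z (2 * pi / real n), axial_mirror, perp_mirror \<circ> rot_z (pi / real n)}"
      have "2 * pi / real n - ?o 1 \<in> turns n" "0 - ?o 1 \<in> turns n" "pi / real n - ?o (-1) \<in> turns n" using turns_1 by simp_all
      with g show "\<exists>a\<in>sgns. \<exists>b\<in>sgns. \<exists>\<tau>. g = msym a b \<tau> \<and> \<tau> - ?o a \<in> turns n"
        unfolding perp_rot_msym unfolding rot_z_msym axial_mirror_msym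
        by (elim insertE emptyE; simp only:; blast)
    next
      fix a b \<tau> a' b' \<tau>' :: real
      assume s: "a \<in> sgns" "b \<in> sgns" "a' \<in> sgns" "b' \<in> sgns" and t: "\<tau> - ?o a \<in> turns n" "\<tau>' - ?o a' \<in> turns n"
      have "b * (\<tau>' - ?o a') + (\<tau> - ?o a) - (?o (a * a') - b * ?o a' - ?o a) \<in> turns n"
        using turns_diff[OF turns_add[OF turns_sgn[OF s(2) t(2)] t(1)] oo[OF s(1,3,2)]] .
      thus "b * \<tau>' + \<tau> - ?o (a * a') \<in> turns n" by (simp add: algebra_simps)
    next
      fix a b \<tau> :: real
      assume s: "a \<in> sgns" "b \<in> sgns" and t: "\<tau> - ?o a \<in> turns n"
      have aa: "?o (a * a) = 0" using s(1) by auto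
      have "- (b * (\<tau> - ?o a)) + (?o (a * a) - b * ?o a - ?o a) \<in> turns n"
        using turns_add[OF turns_neg[OF turns_sgn[OF s(2) t]] oo[OF s(1,1,2)]] .
      thus "- b * \<tau> - ?o a \<in> turns n" unfolding aa by (simp add: algebra_simps)
    qed simp
    thus "g \<in> ?R" by blast
  }
  fix g assume "g \<in> ?R"
  then obtain a b \<tau> where g: "g = msym a b \<tau>" "a \<in> sgns" "b \<in> sgns" "\<tau> - ?o a \<in> turns n" by blast
  let ?S = "{rot_z (2 * pi / real n), axial_mirror, perp_mirror \<circ> rot_z (pi / real n)}"
  have bij: "bij h" if "h \<in> ?S" for h using that msym_bij unfolding perp_rot_msym unfolding rot_z_msym axial_mirror_msym by auto
  note gen = generated_by_id[of ?S, OF bij] generated_by_incl[of ?S, OF bij] generated_by_comp[of ?S, OF bij]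
  have incl: "h \<in> generated_by ?S" if "h \<in> ?S" for h using that by (intro gen(2)) auto
  have "?o a - b * ?o a \<in> turns n" using oo[of 1 a b] g by auto
  hence "\<tau> - b * ?o a \<in> turns n" using turns_add[OF g(4)] by fastforce
  hence "msym 1 1 (\<tau> - b * ?o a) \<in> generated_by ?S" by (intro rotations_generated[OF bij]) auto
  moreover have "msym 1 b 0 \<in> generated_by ?S" using g(3) gen(1) incl[of axial_mirror] msym_id unfolding generators_msym by auto
  moreover have "msym a 1 (?o a) \<in> generated_by ?S"
    using g(2) gen(1) incl[of "perp_mirror \<circ> rot_z (pi / real n)"] msym_id unfolding perp_rot_msym by auto
  ultimately have "msym 1 1 (\<tau> - b * ?o a) \<circ> (msym 1 b 0 \<circ> msym a 1 (?o a)) \<in> generated_by ?S" by (intro gen(3))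
  thus "g \<in> grp_2_star_n n" unfolding grp_2_star_n_def g(1) using msym_factor[OF g(2,3), of \<tau> "?o a"] by simp
qed

lemma grp_22n_eq: "grp_22n n = {msym a a \<tau> |a \<tau>. a \<in> sgns \<and> \<tau> \<in> turns n}" (is "_ = ?R")
proof (intro equalityI subsetI)
  fix g assume "g \<in> grp_22n n"
  hence "\<exists>a\<in>sgns. \<exists>b\<in>sgns. \<exists>\<tau>. g = msym a b \<tau> \<and> (a = b \<and> \<tau> \<in> turns n)" unfolding grp_22n_def
  proof (rule generated_msym_subset[rotated 4])
    fix g assume "g \<in> {rot_z (2 * pi / real n), perp_half_turn}"
    thus "\<exists>a\<in>sgns. \<exists>b\<in>sgns. \<exists>\<tau>. g = msym a b \<tau> \<and> (a = b \<and> \<tau> \<in> turns n)"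
      unfolding generators_msym using turns_1 turns_0 by (elim insertE emptyE; simp only:; blast)
  qed (use turns_add turns_sgn turns_neg in auto)
  then obtain a b \<tau> where "a \<in> sgns" "g = msym a b \<tau>" "a = b" "\<tau> \<in> turns n" by blast
  thus "g \<in> ?R" by blast
next
  fix g assume "g \<in> ?R"
  then obtain a \<tau> where g: "g = msym a a \<tau>" "a \<in> sgns" "\<tau> \<in> turns n" by blast
  let ?S = "{rot_z (2 * pi / real n), perp_half_turn}"
  have bij: "bij h" if "h \<in> ?S" for h using that msym_bij unfolding generators_msym by auto
  note gen = generated_by_id[of ?S, OF bij] generated_by_incl[of ?S, OF bij] generated_by_comp[of ?S, OF bij]
  have incl: "h \<in> generated_by ?S" if "h \<in> ?S" for h using that by (intro gen(2)) auto
  have "msym 1 1 \<tau> \<in> generated_by ?S" by (rule rotations_generated[OF bij _ g(3)]) auto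
  moreover have "msym a a 0 \<in> generated_by ?S" using g(2) gen(1) incl[of perp_half_turn] msym_id unfolding generators_msym by auto
  ultimately have "msym 1 1 \<tau> \<circ> msym a a 0 \<in> generated_by ?S" by (intro gen(3))
  moreover have "msym 1 1 \<tau> \<circ> msym a a 0 = msym a a \<tau>" using msym_comp[of 1 a 1 \<tau> a 0] g(2) by simp
  ultimately show "g \<in> grp_22n n" unfolding grp_22n_def g(1) by simp
qed

lemma prismatic_groups_axial:
  assumes "G \<in> prismatic_groups n" "g \<in> G"
  shows "is_msym g"
proof -
  let ?P = "\<lambda>g. is_msym g"
  have P: "?P (msym a b \<tau>)" if "a \<in> sgns" "b \<in> sgns" for a b \<tau> using that by blast
  have gens: "?P (rot_z t)" "?P axial_mirror" "?P perp_mirror" "?P perp_half_turn" "?P (perp_mirror \<circ> rot_z t)" for t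
    unfolding perp_rot_msym unfolding generators_msym by (intro P; simp)+
  have sub: "?P g" if S: "\<And>g. g \<in> S \<Longrightarrow> ?P g" and g: "g \<in> generated_by S" for S
  proof -
    have "\<exists>a\<in>sgns. \<exists>b\<in>sgns. \<exists>\<tau>. g = msym a b \<tau> \<and> True"
      by (rule generated_msym_subset[where Q = "\<lambda>_ _ _. True", OF _ _ _ _ g]) (use S in auto)
    thus ?thesis by blast
  qed
  show ?thesis using assms(1)
    unfolding grp_nn_def grp_star_nn_def grp_n_star_def grp_n_cross_def grp_22n_def grp_star_22n_def grp_2_star_n_def
    by (elim insertE emptyE) (rule sub[rotated], use assms(2) in blast, elim insertE emptyE; simp only: gens)+
qed

section \<open>Moving polyhedra about the axis\<close>

lemma prismaticI:
  assumes "noble P" "isometry s" "symmetry_group (transform s P) = G" "n \<ge> 1"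
    "G \<in> prismatic_groups n"
  shows "prismatic P"
proof -
  interpret noble_polyhedron P by (rule noble_polyhedronI[OF assms(1)])
  have G: "G = {g. \<exists>h\<in>symmetry_group P. s \<circ> h = g \<circ> s}" using symmetry_group_transform[OF assms(2)] assms(3) by simp
  note b = isometry_bij[OF assms(2)]
  have "symmetry_group P = {h. \<exists>g\<in>G. s \<circ> h = g \<circ> s}"
  proof (intro equalityI subsetI)
    fix h assume h: "h \<in> symmetry_group P"
    have "s \<circ> h = (s \<circ> h \<circ> ginv s) \<circ> s" using b by (simp add: fun_eq_iff bij_is_inj)
    thus "h \<in> {h. \<exists>g\<in>G. s \<circ> h = g \<circ> s}" unfolding G using h by blast
  next
    fix h assume "h \<in> {h. \<exists>g\<in>G. s \<circ> h = g \<circ> s}"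
    then obtain g k where "s \<circ> h = g \<circ> s" "k \<in> symmetry_group P" "s \<circ> k = g \<circ> s" unfolding G by blast
    hence "s (h x) = s (k x)" for x by (metis comp_apply)
    hence "h = k" using bij_is_inj[OF b] by (auto simp: inj_def)
    thus "h \<in> symmetry_group P" using \<open>k \<in> symmetry_group P\<close> by simp
  qed
  thus ?thesis unfolding prismatic_def using assms(2,4,5) by blast
qed

lemma transform_inverse: assumes "isometry s" shows "transform (ginv s) (transform s P) = P"
  using isometry_inj[OF assms] by (simp add: transform_transform transform_id)

lemma prismatic_transform: assumes P: "noble P" and s: "isometry s" and p: "prismatic (transform s P)" shows "prismatic P"
proof -
  obtain n G q where q: "n \<ge> 1" "G \<in> prismatic_groups n"
    "isometry q" "symmetry_group (transform s P) = {h. \<exists>g\<in>G. q \<circ> h = g \<circ> q}" using p unfolding prismatic_def by blast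
  interpret T: noble_polyhedron "transform s P" by (rule noble_polyhedronI[OF noble_transform[OF s P]])
  have "symmetry_group (transform (q \<circ> s) P) = {k. \<exists>h\<in>symmetry_group (transform s P). q \<circ> h = k \<circ> q}"
    unfolding transform_transform[symmetric] by (rule T.symmetry_group_transform[OF q(3)])
  also have "\<dots> = G"
  proof (intro equalityI subsetI)
    fix k assume "k \<in> {k. \<exists>h\<in>symmetry_group (transform s P). q \<circ> h = k \<circ> q}"
    then obtain h g where hg: "q \<circ> h = k \<circ> q" "g \<in> G" "q \<circ> h = g \<circ> q" unfolding q(4) by blast
    hence "k (q x) = g (q x)" for x by (metis comp_apply)
    hence "k y = g y" for y using isometry_surj[OF q(3)] by (metis surjD)
    hence "k = g" by blast
    thus "k \<in> G" using hg by simp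
  next
    fix g assume g: "g \<in> G"
    have "q \<circ> (ginv q \<circ> g \<circ> q) = g \<circ> q" using isometry_surj[OF q(3)] by (simp add: fun_eq_iff surj_f_inv_f)
    thus "g \<in> {k. \<exists>h\<in>symmetry_group (transform s P). q \<circ> h = k \<circ> q}" unfolding q(4) using g by blast
  qed
  finally show ?thesis using prismaticI[OF P isometry_comp[OF q(3) s] _ q(1,2)] by blast
qed

lemma stephanoid_transform: assumes P: "noble P" "prismatic P" and s: "isometry s" and st: "stephanoid (transform s P)" shows "stephanoid P"
proof -
  obtain n p q \<rho> h k where k: "\<rho> > 0" "h > 0" "isometry k"
    "PC_params n p q \<and> geom_faces (transform s P) = (`) ((`) k) ` PC n p q \<rho> h \<or>
     AC_params n p q \<and> geom_faces (transform s P) = (`) ((`) k) ` AC n p q \<rho> h"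
    using st unfolding stephanoid_def by (elim conjE exE) (rule that; assumption)
  let ?i = "ginv s"
  have g: "geom_faces P = (`) ((`) (?i \<circ> k)) ` F" if "geom_faces (transform s P) = (`) ((`) k) ` F" for F
  proof -
    have "geom_faces P = (`) ((`) ?i) ` geom_faces (transform s P)"
      using transform_simps(5)[of ?i "transform s P"] unfolding transform_inverse[OF s] .
    thus ?thesis unfolding that by (simp only: image_image comp_def)
  qed
  have "isometry (?i \<circ> k)" by (intro isometry_comp isometry_inv s k(3))
  thus ?thesis unfolding stephanoid_def using P k(1,2,4) g by metis
qed

lemma prismatic_axial:
  assumes P: "noble P" "prismatic P"
  obtains s where "isometry s" "\<And>g. g \<in> symmetry_group (transform s P) \<Longrightarrow> is_msym g"
proof -
  interpret noble_polyhedron P by (rule noble_polyhedronI[OF P(1)])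
  obtain n G s where s: "G \<in> prismatic_groups n"
    "isometry s" "symmetry_group P = {h. \<exists>g\<in>G. s \<circ> h = g \<circ> s}" using P(2) unfolding prismatic_def by blast
  note b = isometry_bij[OF s(2)]
  have "g \<in> G" if gT: "g \<in> symmetry_group (transform s P)" for g
  proof -
    obtain h where h: "h \<in> symmetry_group P" "s \<circ> h = g \<circ> s" using gT unfolding symmetry_group_transform[OF s(2)] by blast
    then obtain k where k: "k \<in> G" "s \<circ> h = k \<circ> s" using s(3) by blast
    hence "g (s x) = k (s x)" for x using h(2) by (metis comp_apply)
    hence "g y = k y" for y using bij_is_surj[OF b] by (metis surjD)
    hence "g = k" by blast
    thus ?thesis using k by simp
  qed
  thus thesis using that[OF s(2)] prismatic_groups_axial[OF s(1)] by blast
qed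

lemma axial_polyhedronI:
  assumes "noble P" "\<And>g. g \<in> symmetry_group P \<Longrightarrow> is_msym g"
  shows "axial_polyhedron P"
proof -
  interpret noble_polyhedron P by (rule noble_polyhedronI[OF assms(1)])
  show ?thesis
  proof
    fix h assume "h \<in> symmetry_group P"
    then obtain a b \<tau> where m: "a \<in> sgns" "b \<in> sgns" "h = msym a b \<tau>" using assms(2) by blast
    show "orth h" unfolding m(3) using msym_orth m by blast
    show "h (v3 0 0 1) = v3 0 0 1 \<or> h (v3 0 0 1) = - v3 0 0 1" unfolding m(3) by (rule msym_axis[OF m(1)])
  qed
qed

lemma axial_transform:
  assumes "axial_polyhedron P" "a \<in> sgns" "b \<in> sgns" shows "axial_polyhedron (transform (msym a b \<tau>) P)"
proof -
  interpret axial_polyhedron P by (rule assms(1))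
  have s: "isometry (msym a b \<tau>)" using orth_is_isometry msym_orth assms by blast
  show ?thesis
  proof (rule axial_polyhedronI[OF noble_transform[OF s noble]])
    fix g assume "g \<in> symmetry_group (transform (msym a b \<tau>) P)"
    then obtain h where h: "h \<in> symmetry_group P" "msym a b \<tau> \<circ> h = g \<circ> msym a b \<tau>"
      unfolding symmetry_group_transform[OF s] by blast
    obtain c d \<sigma> where m: "c \<in> sgns" "d \<in> sgns" "h = msym c d \<sigma>" using sym_msym[OF h(1)] .
    note i = orth_inv_simps[OF msym_orth[OF assms(2,3), of \<tau>]]
    have "g = (msym a b \<tau> \<circ> h) \<circ> ginv (msym a b \<tau>)" unfolding h(2) using i(4) by (simp add: comp_assoc)
    also have "\<dots> = (msym a b \<tau> \<circ> msym c d \<sigma>) \<circ> msym a b (- b * \<tau>)" unfolding m(3) msym_inv[OF assms(2,3)] ..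
    also have "\<dots> = msym (a * c * a) (b * d * b) (b * d * (- b * \<tau>) + (b * \<sigma> + \<tau>))"
      using assms m by (simp only: msym_comp) (subst msym_comp, auto)
    finally have "g = msym (a * c * a) (b * d * b) (b * d * (- b * \<tau>) + (b * \<sigma> + \<tau>))" .
    moreover have "a * c * a \<in> sgns" "b * d * b \<in> sgns" using assms m by auto
    ultimately show "is_msym g" by blast
  qed
qed

lemma circled_transform:
  assumes P: "circled_polyhedron P \<rho> h" and ab: "a \<in> sgns" "b \<in> sgns" shows "circled_polyhedron (transform (msym a b \<tau>) P) \<rho> h"
proof -
  interpret circled_polyhedron P \<rho> h by (rule P)
  interpret T: axial_polyhedron "transform (msym a b \<tau>) P" by (rule axial_transform[OF axial_polyhedron_axioms ab])
  show ?thesis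
  proof
    show "\<rho> > 0" "h > 0" by (rule \<rho> h)+
    fix x assume "x \<in> geom_vertices (transform (msym a b \<tau>) P)"
    then obtain y where y: "y \<in> geom_vertices P" "x = msym a b \<tau> y" by auto
    obtain sg t where e: "sg \<in> sgns" "y = cyl \<rho> (sg * h) t" using on_circles[OF y(1)] by blast
    have "x = cyl \<rho> ((a * sg) * h) (b * t + \<tau>)" unfolding y(2) e(2) msym_cyl[OF ab(2)] by (simp add: mult.assoc)
    moreover have "a * sg \<in> sgns" using e ab by auto
    ultimately show "\<exists>sg\<in>sgns. \<exists>t. x = cyl \<rho> (sg * h) t" by blast
  qed
qed

lemma gface_transform:
  assumes "realized_polyhedron P" "realized_polyhedron (transform s P)"
  shows "realized_polyhedron.gface (transform s P) f = (`) s ` realized_polyhedron.gface P f"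
  unfolding realized_polyhedron.gface_def[OF assms(1)] realized_polyhedron.gface_def[OF assms(2)]
  by (simp add: image_image)

lemma quad_transform:
  assumes P: "quad_polyhedron P \<rho> h \<alpha> \<gamma>" and ab: "a \<in> sgns" "b \<in> sgns"
  shows "quad_polyhedron (transform (msym a b \<tau>) P) \<rho> h \<alpha> \<gamma>"
    "quad_polyhedron.is_face P \<rho> h \<alpha> \<gamma> sg \<mu> \<Longrightarrow>
       quad_polyhedron.is_face (transform (msym a b \<tau>) P) \<rho> h \<alpha> \<gamma> (a * sg) (b * \<mu> + \<tau>)"
proof -
  interpret quad_polyhedron P \<rho> h \<alpha> \<gamma> by (rule P)
  let ?T = "transform (msym a b \<tau>) P"
  interpret T: circled_polyhedron ?T \<rho> h by (rule circled_transform[OF circled_polyhedron_axioms ab])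
  have gf: "T.gface f = (`) (msym a b \<tau>) ` gface f" for f
    by (rule gface_transform[OF realized_polyhedron_axioms T.realized_polyhedron_axioms])
  have tr: "points_of ?T f = Qp (a * sg) (b * \<mu> + \<tau>) \<and> T.gface f = Qe (a * sg) (b * \<mu> + \<tau>)"
    if "X f = Qp sg \<mu>" "gface f = Qe sg \<mu>" for f sg \<mu>
    unfolding gf that(2) using that(1) quad_msym[OF ab(2)] by simp
  show Q: "quad_polyhedron ?T \<rho> h \<alpha> \<gamma>"
  proof
    show "0 < \<gamma>" "\<gamma> \<le> \<alpha>" "\<alpha> < pi" "\<alpha> + \<gamma> \<le> pi" by (rule weak)+
    fix f assume "f \<in> faces (incidence ?T)"
    hence "f \<in> faces r" by simp
    then obtain sg \<mu> where e: "sg \<in> sgns" "X f = Qp sg \<mu>" "gface f = Qe sg \<mu>" using faces by blast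
    have "a * sg \<in> sgns" using e(1) ab by auto
    thus "\<exists>sg\<in>sgns. \<exists>\<mu>. points_of ?T f = Qp sg \<mu> \<and> T.gface f = Qe sg \<mu>" using tr[OF e(2,3)] by blast
  qed
  interpret T: quad_polyhedron ?T \<rho> h \<alpha> \<gamma> by (rule Q)
  assume "is_face sg \<mu>"
  then obtain f where f: "sg \<in> sgns" "f \<in> faces r" "X f = Qp sg \<mu>" "gface f = Qe sg \<mu>" unfolding is_face_def by blast
  have "a * sg \<in> sgns" using f(1) ab by auto
  thus "T.is_face (a * sg) (b * \<mu> + \<tau>)" unfolding T.is_face_def using tr[OF f(3,4)] f(2) by auto
qed

section \<open>Stephanoids\<close>

lemma polygon4: "polygon [x, y, z, w] = {{x, y}, {y, z}, {z, w}, {w, x}}"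
proof -
  have "polygon [x, y, z, w] = (\<lambda>i. {[x, y, z, w] ! i, [x, y, z, w] ! ((i + 1) mod length [x, y, z, w])}) ` {i. i < length [x, y, z, w]}"
    unfolding polygon_def by blast
  also have "{i. i < length [x, y, z, w]} = {0, 1, 2, 3}" by auto
  finally show ?thesis by simp
qed

context quad_polyhedron
begin

text \<open>
  As \<open>2 * \<alpha>\<close> and \<open>2 * \<gamma>\<close> belong to the cyclic group
  \<open>H\<close>, the half-angles are multiples of \<open>pi / n\<close>.
\<close>
lemma angle_parameters:
  obtains n p c :: nat where "n > 0" "H = turns n" "\<alpha> = pi * real p / real n" "\<gamma> = pi * real c / real n" "0 < c" "c < p" "p + c < n"
proof -
  obtain n :: nat where n: "n > 0" "H = {2 * pi * real_of_int k / real n |k. True}" using H_cyclic by blast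
  obtain p0 c0 :: int where pc: "2 * \<alpha> = 2 * pi * real_of_int p0 / real n" "2 * \<gamma> = 2 * pi * real_of_int c0 / real n"
    using H_gens(2,3) unfolding n(2) by blast
  have a: "\<alpha> = pi * real_of_int p0 / real n" and g: "\<gamma> = pi * real_of_int c0 / real n" using pc by simp_all
  have np: "pi / real n > 0" using n(1) by simp
  have a': "\<alpha> = (pi / real n) * real_of_int p0" and g': "\<gamma> = (pi / real n) * real_of_int c0"
    and p': "pi = (pi / real n) * real n" using a g n(1) by simp_all
  have "0 < real_of_int c0" using weak(1) g' np by (metis zero_less_mult_pos)
  moreover have "real_of_int c0 < real_of_int p0" using \<gamma>_less a' g' np by (metis mult_less_cancel_left_pos)
  moreover have "real_of_int (p0 + c0) < real n"
  proof -
    have "(pi / real n) * real_of_int (p0 + c0) < (pi / real n) * real n" using sum_less a' g' p' by (simp add: distrib_left)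
    thus ?thesis using np by (metis mult_less_cancel_left_pos)
  qed
  ultimately have c: "0 < c0" "c0 < p0" "p0 + c0 < int n" by linarith+
  show thesis by (rule that[of n "nat p0" "nat c0"]) (use n c a g in \<open>auto simp: turns_def\<close>)
qed

lemma polygon_orbit_of_face:
  assumes "is_face sg \<mu>" shows "geom_faces P = polygon_orbit (Sym) (Qe sg \<mu>)"
proof -
  obtain f where f: "f \<in> faces r" "gface f = Qe sg \<mu>" using assms unfolding is_face_def by blast
  show ?thesis unfolding geom_faces_gface polygon_orbit_def f(2)[symmetric]
  proof (intro equalityI subsetI)
    fix F assume "F \<in> gface ` faces r"
    then obtain g where "g \<in> faces r" "F = gface g" by blast
    moreover obtain k where "k \<in> Sym" "(`) k ` gface f = gface g" using face_transitive[OF f(1) \<open>g \<in> faces r\<close>] by metis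
    ultimately show "F \<in> (\<lambda>g. (`) g ` gface f) ` Sym" by (intro image_eqI[of _ _ k]) simp_all
  next
    fix F assume "F \<in> (\<lambda>g. (`) g ` gface f) ` Sym"
    then obtain g where g: "g \<in> Sym" "F = (`) g ` gface f" by blast
    obtain k where "k \<in> faces r" "gface k = F" using symmetry_group_face[OF g(1) f(1)] g(2) by metis
    thus "F \<in> gface ` faces r" by (intro image_eqI[of _ _ k]) simp_all
  qed
qed

lemma Qe_explicit: "Qe sg \<mu> = {{pt sg (\<mu> - \<alpha>), pt (- sg) (\<mu> - \<gamma>)}, {pt (- sg) (\<mu> - \<gamma>), pt sg (\<mu> + \<alpha>)},
     {pt sg (\<mu> + \<alpha>), pt (- sg) (\<mu> + \<gamma>)}, {pt (- sg) (\<mu> + \<gamma>), pt sg (\<mu> - \<alpha>)}}"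
proof -
  have "{{x, y} |x y. x \<in> {a, b} \<and> y \<in> {c, d}} = {{a, c}, {c, b}, {b, d}, {d, a}}" for a b c d :: "real^3"
  proof -
    have "{{x, y} |x y. x \<in> {a, b} \<and> y \<in> {c, d}} = (\<lambda>(x, y). {x, y}) ` ({a, b} \<times> {c, d})" by (auto simp only: image_iff)
    also have "\<dots> = {{a, c}, {a, d}, {b, c}, {b, d}}" by simp
    also have "\<dots> = {{a, c}, {c, b}, {b, d}, {d, a}}" by (simp only: insert_commute[of _ _ "{}"] insert_commute)
    finally show ?thesis .
  qed
  thus ?thesis unfolding quad_edge_set_def chord_def .
qed

text \<open>
  Two faces on different circles differ by \<open>\<kappa> = \<alpha> + \<gamma>\<close>, here a multiple of the step \<open>2 * pi / n\<close>, so
  the vertices form a prism. With \<open>c = p - 2 * q\<close> the four vertices of the standard face have the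
  indices \<open>1\<close>, \<open>1 + q\<close>, \<open>1 + p\<close> and \<open>1 + p - q\<close>; its direction is that of the mean
  index, whence the angle \<open>2 * pi / n + \<alpha>\<close>.
\<close>
lemma prism_case:
  assumes n: "n > 0" "H = turns n" and ac: "\<alpha> = pi * real p / real n" "\<gamma> = pi * real c / real n" "0 < c" "c < p" "p + c < n"
    and q: "p - c = 2 * q" and base: "is_face 1 (2 * pi / real n + \<alpha>)"
  shows "Sym = grp_star_22n n" "PC_params n p q" "geom_faces P = PC n p q \<rho> h"
proof -
  let ?m = "2 * pi / real n + \<alpha>"
  have m2: "2 * ?m \<in> H" using H_add[OF H_add[OF turns_1[of n, folded n(2)] turns_1[of n, folded n(2)]] H_gens(2)] by (simp add: algebra_simps)
  have pq: "p = 2 * q + c" using q ac by linarith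
  have kap: "\<kappa> \<in> H"
  proof -
    have "\<kappa> = 2 * pi * real_of_int (int (q + c)) / real n" unfolding \<kappa>_def unfolding ac pq by (simp add: algebra_simps flip: add_divide_distrib)
    thus ?thesis unfolding n(2) turns_def by blast
  qed
  have "\<tau> - offset a \<in> H \<longleftrightarrow> \<tau> \<in> turns n" for \<tau> a
    using kap H_diff[of \<tau> \<kappa>] H_add[of "\<tau> - \<kappa>" \<kappa>] unfolding offset_def n(2)[symmetric] by auto
  thus G: "Sym = grp_star_22n n" unfolding symmetry_group_quad[OF base m2] grp_star_22n_eq by simp
  show "PC_params n p q" unfolding PC_params_def using n ac pq by auto
  have "prism_a n \<rho> h 1 = pt 1 (?m - \<alpha>)" unfolding prism_a_def pt_def cyl_def v3_def by simp
  moreover have "prism_b n \<rho> h (1 + q) = pt (- 1) (?m - \<gamma>)"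
  proof -
    have "2 * pi * real (1 + q) / real n = ?m - \<gamma>" unfolding ac pq by (simp add: algebra_simps flip: add_divide_distrib)
    thus ?thesis unfolding prism_b_def prism_a_def pt_def cyl_def v3_def perp_mirror_def by simp
  qed
  moreover have "prism_a n \<rho> h (1 + p) = pt 1 (?m + \<alpha>)"
  proof -
    have "2 * pi * real (1 + p) / real n = ?m + \<alpha>" unfolding ac by (simp add: algebra_simps flip: add_divide_distrib)
    thus ?thesis unfolding prism_a_def pt_def cyl_def v3_def by simp
  qed
  moreover have "prism_b n \<rho> h (1 + p - q) = pt (- 1) (?m + \<gamma>)"
  proof -
    have "1 + p - q = 1 + q + c" using pq by simp
    hence "2 * pi * real (1 + p - q) / real n = ?m + \<gamma>" unfolding ac pq by (simp add: algebra_simps flip: add_divide_distrib)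
    thus ?thesis unfolding prism_b_def prism_a_def pt_def cyl_def v3_def perp_mirror_def by simp
  qed
  ultimately have "polygon [prism_a n \<rho> h 1, prism_b n \<rho> h (1 + q), prism_a n \<rho> h (1 + p), prism_b n \<rho> h (1 + p - q)] = Qe 1 ?m"
    unfolding polygon4 Qe_explicit by simp
  thus "geom_faces P = PC n p q \<rho> h" unfolding PC_def polygon_orbit_of_face[OF base] G by simp
qed

text \<open>
  Here \<open>\<kappa>\<close> is an odd multiple of half the step, so the vertices form an antiprism. The standard face starts
  at the vertex of index \<open>1\<close>, which lies on the lower circle at angle \<open>pi / n\<close>.
\<close>
lemma antiprism_case:
  assumes n: "n > 0" "H = turns n" and ac: "\<alpha> = pi * real p / real n" "\<gamma> = pi * real c / real n" "0 < c" "c < p" "p + c < n"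
    and q: "q = p - c" "odd q" and base: "is_face (-1) (pi / real n + \<alpha>)"
  shows "Sym = grp_2_star_n n" "AC_params n p q" "geom_faces P = AC n p q \<rho> h"
proof -
  let ?m = "pi / real n + \<alpha>"
  have m2: "2 * ?m \<in> H" using H_add[OF turns_1[of n, folded n(2)] H_gens(2)] by (simp add: algebra_simps)
  have pq: "p = q + c" using q ac by linarith
  obtain l where l: "q = 2 * l + 1" using q(2) oddE by blast
  have kap: "\<kappa> - pi / real n \<in> H"
  proof -
    have "\<kappa> - pi / real n = 2 * pi * real_of_int (int (l + c)) / real n" unfolding \<kappa>_def unfolding ac pq l by (simp add: algebra_simps flip: add_divide_distrib diff_divide_distrib)
    thus ?thesis unfolding n(2) turns_def by blast
  qed
  have "\<tau> - offset a \<in> H \<longleftrightarrow> \<tau> - (if a = 1 then 0 else pi / real n) \<in> turns n" for \<tau> a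
    using kap H_diff[of "\<tau> - pi / real n" "\<kappa> - pi / real n"] H_add[of "\<tau> - \<kappa>" "\<kappa> - pi / real n"]
    unfolding offset_def n(2)[symmetric] by auto
  thus G: "Sym = grp_2_star_n n" unfolding symmetry_group_quad[OF base m2] grp_2_star_n_eq by simp
  show "AC_params n p q" unfolding AC_params_def using n ac pq q(2) by auto
  have "antiprism_a n \<rho> h 1 = pt (-1) (?m - \<alpha>)"
    unfolding antiprism_a_def pt_def cyl_def v3_def by simp
  moreover have "antiprism_a n \<rho> h (1 + q) = pt 1 (?m - \<gamma>)"
  proof -
    have "pi * real (1 + q) / real n = ?m - \<gamma>" unfolding ac pq by (simp add: algebra_simps flip: add_divide_distrib)
    moreover have "(-1::real) ^ (1 + q) = 1" using q(2) by simp
    ultimately show ?thesis unfolding antiprism_a_def pt_def cyl_def v3_def by simp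
  qed
  moreover have "antiprism_a n \<rho> h (1 + 2 * p) = pt (-1) (?m + \<alpha>)"
  proof -
    have "pi * real (1 + 2 * p) / real n = ?m + \<alpha>" unfolding ac by (simp add: algebra_simps flip: add_divide_distrib)
    moreover have "(-1::real) ^ (1 + 2 * p) = -1" by simp
    ultimately show ?thesis unfolding antiprism_a_def pt_def cyl_def v3_def by (simp only: mult_minus_left mult_1)
  qed
  moreover have "antiprism_a n \<rho> h (1 + 2 * p - q) = pt 1 (?m + \<gamma>)"
  proof -
    have e: "1 + 2 * p - q = 1 + q + 2 * c" using pq by simp
    hence "pi * real (1 + 2 * p - q) / real n = ?m + \<gamma>" unfolding e ac pq by (simp add: algebra_simps flip: add_divide_distrib)
    moreover have "(-1::real) ^ (1 + 2 * p - q) = 1" unfolding e using q(2) by simp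
    ultimately show ?thesis unfolding antiprism_a_def pt_def cyl_def v3_def by simp
  qed
  ultimately have "polygon [antiprism_a n \<rho> h 1, antiprism_a n \<rho> h (1 + q), antiprism_a n \<rho> h (1 + 2 * p), antiprism_a n \<rho> h (1 + 2 * p - q)] = Qe (-1) ?m"
    unfolding polygon4 Qe_explicit by simp
  thus "geom_faces P = AC n p q \<rho> h" unfolding AC_def polygon_orbit_of_face[OF base] G by simp
qed

end

lemma stephanoidI:
  assumes P: "noble P" "prismatic P" and r: "\<rho> > 0" "h > 0"
    and F: "(PC_params n p q \<and> geom_faces P = PC n p q \<rho> h) \<or> (AC_params n p q \<and> geom_faces P = AC n p q \<rho> h)"
  shows "stephanoid P"
proof -
  have "(`) ((`) id) ` F = F" for F :: "(real^3) set set set" by simp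
  thus ?thesis unfolding stephanoid_def using P r F isometry_id by metis
qed

text \<open>
  Place a face in the standard position for the parity of \<open>p - c\<close>; as all faces have one
  shape, some isometry preserving the two circles does this.
\<close>
theorem quad_stephanoid:
  assumes "quad_polyhedron P \<rho> h \<alpha> \<gamma>" shows "stephanoid P \<and> prismatic P"
proof -
  interpret quad_polyhedron P \<rho> h \<alpha> \<gamma> by (rule assms)
  obtain n p c :: nat where n: "n > 0" "H = turns n" and ac: "\<alpha> = pi * real p / real n" "\<gamma> = pi * real c / real n" "0 < c" "c < p" "p + c < n"
    using angle_parameters by metis
  obtain f where "f \<in> faces r" using faces_nonempty by blast
  then obtain sg0 \<mu>0 where b: "is_face sg0 \<mu>0" using faces unfolding is_face_def by blast
  have e0: "sg0 \<in> sgns" using b unfolding is_face_def by blast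
  have move: "\<exists>s. isometry s \<and> quad_polyhedron (transform s P) \<rho> h \<alpha> \<gamma> \<and> quad_polyhedron.is_face (transform s P) \<rho> h \<alpha> \<gamma> sg \<mu>"
    if e: "sg \<in> sgns" for sg \<mu>
  proof -
    have a: "sg * sg0 \<in> sgns" using e e0 by auto
    have "sg * sg0 * sg0 = sg" "1 * \<mu>0 + (\<mu> - \<mu>0) = \<mu>" using e0 by auto
    hence "quad_polyhedron.is_face (transform (msym (sg * sg0) 1 (\<mu> - \<mu>0)) P) \<rho> h \<alpha> \<gamma> sg \<mu>"
      using quad_transform(2)[OF assms a, of 1 sg0 \<mu>0 "\<mu> - \<mu>0"] b by (simp only:) simp
    moreover have "isometry (msym (sg * sg0) 1 (\<mu> - \<mu>0))" using orth_is_isometry msym_orth[OF a, of 1] by blast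
    ultimately show ?thesis using quad_transform(1)[OF assms a, of 1 "\<mu> - \<mu>0"] by blast
  qed
  show ?thesis
  proof (cases "even (p - c)")
    case True
    then obtain q where q: "p - c = 2 * q" by blast
    obtain s where s: "isometry s" "quad_polyhedron (transform s P) \<rho> h \<alpha> \<gamma>"
      "quad_polyhedron.is_face (transform s P) \<rho> h \<alpha> \<gamma> 1 (2 * pi / real n + \<alpha>)" using move[of 1] by blast
    interpret T: quad_polyhedron "transform s P" \<rho> h \<alpha> \<gamma> by (rule s(2))
    have "T.H = turns n" using n(2) T.H_def H_def by simp
    note pr = T.prism_case[OF n(1) this ac q s(3)]
    have p: "prismatic P" by (rule prismaticI[where n = n, OF noble s(1) pr(1)]) (use n in auto)
    have "prismatic (transform s P)"
      by (rule prismaticI[where n = n and G = "grp_star_22n n", OF T.noble isometry_id]) (use n pr(1) in \<open>simp_all add: transform_id\<close>)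
    thus ?thesis using stephanoidI[OF T.noble _ \<rho> h] pr(2,3) p stephanoid_transform[OF noble p s(1)] by blast
  next
    case False
    obtain s where s: "isometry s" "quad_polyhedron (transform s P) \<rho> h \<alpha> \<gamma>"
      "quad_polyhedron.is_face (transform s P) \<rho> h \<alpha> \<gamma> (-1) (pi / real n + \<alpha>)" using move[of "-1"] by blast
    interpret T: quad_polyhedron "transform s P" \<rho> h \<alpha> \<gamma> by (rule s(2))
    have "T.H = turns n" using n(2) T.H_def H_def by simp
    note pr = T.antiprism_case[OF n(1) this ac HOL.refl False s(3)]
    have p: "prismatic P" by (rule prismaticI[where n = n, OF noble s(1) pr(1)]) (use n in auto)
    have "prismatic (transform s P)"
      by (rule prismaticI[where n = n and G = "grp_2_star_n n", OF T.noble isometry_id]) (use n pr(1) in \<open>simp_all add: transform_id\<close>)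
    thus ?thesis using stephanoidI[OF T.noble _ \<rho> h] pr(2,3) p stephanoid_transform[OF noble p s(1)] by blast
  qed
qed

section \<open>Disphenoids\<close>

lemma turns_2_iff: "x \<in> turns 2 \<longleftrightarrow> sin x = 0"
  unfolding turns_def sin_zero_iff_int2 by (auto simp: mult.commute)

lemma ang_eq_mod_pi: "ang_eq x t \<or> ang_eq x (t + pi) \<longleftrightarrow> x - t \<in> turns 2"
proof
  assume "ang_eq x t \<or> ang_eq x (t + pi)"
  hence "sin (x - t) = 0" unfolding ang_eq_iff_sin_cos by (auto simp: sin_diff)
  thus "x - t \<in> turns 2" unfolding turns_2_iff .
next
  assume "x - t \<in> turns 2"
  then obtain k :: int where k: "x - t = pi * real_of_int k" unfolding turns_def by auto
  show "ang_eq x t \<or> ang_eq x (t + pi)"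
  proof (cases "even k")
    case True
    then obtain l where "k = 2 * l" by blast
    hence "x = t + 2 * pi * real_of_int l" using k by (simp add: algebra_simps)
    thus ?thesis unfolding ang_eq_def by blast
  next
    case False
    then obtain l where "k = 2 * l + 1" using oddE by blast
    hence "x = t + pi + 2 * pi * real_of_int l" using k by (simp add: algebra_simps)
    thus ?thesis unfolding ang_eq_def by blast
  qed
qed

locale tetrahedral_polyhedron = circled_polyhedron +
  fixes sg t u :: real
  assumes sg: "sg \<in> sgns" and tetrahedron: "X ` faces r = tetrahedron_faces (pt sg t) (pt (- sg) u)"
begin

definition p where "p = pt sg t"
definition w where "w = pt (- sg) u"
definition offs :: "real \<Rightarrow> real" where "offs e = (if e = sg then t else u)"

lemma V_eq: "V = {p, bar p, w, bar w}"
  unfolding vertices_eq_Union_faces tetrahedron tetrahedron_faces_def p_def[symmetric] w_def[symmetric] by auto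

lemma V_distinct: "distinct [p, bar p, w, bar w]"
proof -
  have "\<not> ang_eq x (x + pi)" for x unfolding ang_eq_iff_sin_cos by (auto dest: sin_zero_norm_cos_one)
  thus ?thesis using sg by (auto simp: p_def w_def bar_simps pt_eq_iff)
qed

lemma faces_eq: "X ` faces r = (\<lambda>x. V - {x}) ` V"
  unfolding tetrahedron p_def[symmetric] w_def[symmetric] V_eq by (rule tetrahedron_faces_eq[OF V_distinct])

lemma cards: "card (V) = 4" "card (vertices r) = 4" "card (faces r) = 4" "f \<in> faces r \<Longrightarrow> card (X f) = 3"
proof -
  show 4: "card (V) = 4" unfolding V_eq using V_distinct by simp
  thus "card (vertices r) = 4" unfolding geom_vertices_def using card_image[OF nondeg(1)] by simp
  have "inj_on X (faces r)" using face_inj by (auto simp: inj_on_def)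
  hence "card (faces r) = card ((\<lambda>x. V - {x}) ` V)" using card_image faces_eq by metis
  also have "\<dots> = 4" unfolding 4[symmetric] by (rule card_image) (auto simp: inj_on_def)
  finally show "card (faces r) = 4" .
  assume "f \<in> faces r"
  then obtain x where "x \<in> V" "X f = V - {x}" using faces_eq by blast
  thus "card (X f) = 3" using 4 finite_V by simp
qed

lemma gface_eq: assumes f: "f \<in> faces r" shows "gface f = {A. A \<subseteq> X f \<and> card A = 2}"
proof (intro equalityI subsetI)
  fix A assume "A \<in> gface f" thus "A \<in> {A. A \<subseteq> X f \<and> card A = 2}" using gface_edge[OF f] by blast
next
  fix A assume A: "A \<in> {A. A \<subseteq> X f \<and> card A = 2}"
  then obtain a b where ab: "A = {a, b}" "a \<noteq> b" unfolding card_2_iff by blast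
  have "finite (X f)" using cards(4)[OF f] card.infinite by fastforce
  moreover have "A \<subseteq> X f" "card A = 2" using A by auto
  ultimately have "card (X f - A) = 1" using cards(4)[OF f] card_Diff_subset[of A "X f"] finite_subset[of A "X f"] by simp
  then obtain c where "X f - A = {c}" by (rule card_1_singletonE)
  hence "X f = {a, b, c}" using A ab by blast
  thus "A \<in> gface f" unfolding ab(1) by (rule triangle_edges(2)[OF f])
qed

text \<open>All three-point sets of vertices are faces, so every isometry permuting the vertices is a symmetry.\<close>
lemma vertex_isometry_symmetry:
  assumes g: "isometry g" "g ` V \<subseteq> V" shows "g \<in> Sym" unfolding symmetry_group_iff
proof (intro conjI subsetI)
  show "isometry g" by (rule g(1))
  have inj: "inj g" by (rule isometry_inj[OF g(1)])
  have gV: "g ` V = V" using endo_inj_surj[OF finite_V g(2)] inj_on_subset[OF inj] by blast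
  fix F assume "F \<in> (`) ((`) g) ` geom_faces P"
  then obtain f where f: "f \<in> faces r" "F = (`) g ` gface f" unfolding geom_faces_gface by auto
  obtain x where x: "x \<in> V" "X f = V - {x}" using f(1) faces_eq by blast
  have "g ` X f = V - {g x}" unfolding x(2) image_set_diff[OF inj] gV by simp
  moreover have "g x \<in> V" using x(1) gV by blast
  ultimately have "g ` X f \<in> X ` faces r" unfolding faces_eq by blast
  then obtain k where k: "k \<in> faces r" "X k = g ` X f" by auto
  have "(`) g ` {A. A \<subseteq> X f \<and> card A = 2} = {A. A \<subseteq> g ` X f \<and> card A = 2}"
  proof (intro equalityI subsetI)
    fix B assume "B \<in> (`) g ` {A. A \<subseteq> X f \<and> card A = 2}"
    thus "B \<in> {A. A \<subseteq> g ` X f \<and> card A = 2}" using card_image[OF inj_on_subset[OF inj subset_UNIV]] by auto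
  next
    fix B assume B: "B \<in> {A. A \<subseteq> g ` X f \<and> card A = 2}"
    then obtain A where A: "A \<subseteq> X f" "B = g ` A" by (auto simp: subset_image_iff)
    hence "card A = 2" using B card_image[OF inj_on_subset[OF inj subset_UNIV], of A] by simp
    thus "B \<in> (`) g ` {A. A \<subseteq> X f \<and> card A = 2}" using A by blast
  qed
  hence "F = gface k" unfolding f(2) gface_eq[OF f(1)] gface_eq[OF k(1)] k(2) .
  thus "F \<in> geom_faces P" unfolding geom_faces_gface using k(1) by blast
qed

lemma pt_inner: "pt e x \<bullet> pt e' y = \<rho>\<^sup>2 * cos (x - y) + e * e' * h\<^sup>2"
  unfolding pt_def cyl_def by (simp add: cos_diff algebra_simps power2_eq_square)

lemma not_parallel: "u - t \<notin> turns 2"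
proof
  assume "u - t \<in> turns 2"
  hence s: "sin (u - t) = 0" unfolding turns_2_iff .
  let ?n = "v3 (cos (t + pi / 2)) (sin (t + pi / 2)) 0"
  have n: "?n \<bullet> pt e x = \<rho> * sin (x - t)" for e x
    unfolding plane_pt using cos_diff[of "x - t" "pi / 2"] by (simp add: algebra_simps)
  have s': "sin (u + pi - t) = 0" using s sin_periodic_pi[of "u - t"] by (simp add: algebra_simps)
  have "?n \<bullet> p = 0" "?n \<bullet> bar p = 0" "?n \<bullet> w = 0" "?n \<bullet> bar w = 0"
    unfolding p_def w_def bar_simps n using s s' by simp_all
  hence "V \<subseteq> {x. ?n \<bullet> x = 0}" unfolding V_eq by blast
  moreover have "?n \<noteq> 0" using sin_zero_norm_cos_one[of "t + pi / 2"] by (auto simp: v3_def vec_eq_iff forall_3)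
  ultimately show False using not_in_plane by blast
qed

lemma pt_in_V: assumes "e \<in> sgns" shows "pt e x \<in> V \<longleftrightarrow> x - offs e \<in> turns 2"
proof -
  have "pt e x \<in> V \<longleftrightarrow> (e = sg \<and> (ang_eq x t \<or> ang_eq x (t + pi))) \<or> (e = - sg \<and> (ang_eq x u \<or> ang_eq x (u + pi)))"
    unfolding V_eq p_def w_def bar_simps by (auto simp: pt_eq_iff)
  also have "\<dots> \<longleftrightarrow> x - offs e \<in> turns 2" unfolding ang_eq_mod_pi offs_def using assms sg by auto
  finally show ?thesis .
qed

text \<open>
  The map is a symmetry if it maps the two base vertices into the vertex set, since it commutes with
  the half-turn \<open>bar\<close>.
\<close>
lemma symmetry_iff:
  assumes ab: "a \<in> sgns" "b \<in> sgns"
  shows "msym a b \<tau> \<in> Sym \<longleftrightarrow> b * t + \<tau> - offs (a * sg) \<in> turns 2 \<and> b * u + \<tau> - offs (- a * sg) \<in> turns 2"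
proof -
  have e: "a * sg \<in> sgns" "- a * sg \<in> sgns" using ab sg by auto
  have b: "b * pi \<in> turns 2" using turns_sgn[OF ab(2) turns_1[of 2]] by simp
  have add: "x + b * pi \<in> turns 2 \<longleftrightarrow> x \<in> turns 2" for x using turns_add[OF _ b, of x] turns_diff[OF _ b, of "x + b * pi"] by auto
  have im: "msym a b \<tau> p = pt (a * sg) (b * t + \<tau>)" "msym a b \<tau> (bar p) = pt (a * sg) (b * (t + pi) + \<tau>)"
     "msym a b \<tau> w = pt (- a * sg) (b * u + \<tau>)" "msym a b \<tau> (bar w) = pt (- a * sg) (b * (u + pi) + \<tau>)"
    unfolding p_def w_def bar_simps msym_pt[OF ab(2)] by simp_all
  have "msym a b \<tau> \<in> Sym \<longleftrightarrow> msym a b \<tau> ` V \<subseteq> V"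
    using symmetry_group_vertices vertex_isometry_symmetry[OF orth_is_isometry[OF msym_orth[OF ab]]] by blast
  also have "\<dots> \<longleftrightarrow> b * t + \<tau> - offs (a * sg) \<in> turns 2 \<and> b * t + \<tau> - offs (a * sg) + b * pi \<in> turns 2 \<and>
     b * u + \<tau> - offs (- a * sg) \<in> turns 2 \<and> b * u + \<tau> - offs (- a * sg) + b * pi \<in> turns 2"
    unfolding V_eq image_insert image_empty insert_subset im unfolding V_eq[symmetric] pt_in_V[OF e(1)] pt_in_V[OF e(2)]
    by (simp add: algebra_simps)
  also have "\<dots> \<longleftrightarrow> b * t + \<tau> - offs (a * sg) \<in> turns 2 \<and> b * u + \<tau> - offs (- a * sg) \<in> turns 2" unfolding add by blast
  finally show ?thesis .
qed

lemma offs_simps: "offs (1 * sg) = t" "offs (- 1 * sg) = u" "offs (- (-1) * sg) = t"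
  unfolding offs_def using sg by auto

text \<open>
  In a regular tetrahedron the rotary reflection that permutes the vertices cyclically would be a
  symmetry, but it does not preserve the axis.
\<close>
lemma not_equilateral: assumes f: "f \<in> faces r" shows "\<not> equilateral (X f)"
proof
  assume "equilateral (X f)"
  then obtain d where d: "\<forall>x\<in>X f. \<forall>y\<in>X f. x \<noteq> y \<longrightarrow> dist x y = d" unfolding equilateral_def ..
  obtain x where x: "x \<in> V" "X f = V - {x}" using f faces_eq by blast
  have sq: "(dist (pt e a) (pt e' b))\<^sup>2 = 2 * \<rho>\<^sup>2 + 2 * h\<^sup>2 - 2 * (\<rho>\<^sup>2 * cos (a - b) + e * e' * h\<^sup>2)" if "e \<in> sgns" "e' \<in> sgns" for e e' a b
  proof -
    have "e * e = 1" "e' * e' = 1" using that by auto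
    thus ?thesis unfolding dist_norm power2_norm_eq_inner inner_diff_left inner_diff_right
      using pt_inner[of e a e' b] pt_inner[of e' b e a] pt_inner[of e a e a] pt_inner[of e' b e' b] by (simp add: inner_commute)
  qed
  have ee: "sg * sg = 1" "- sg \<in> sgns" using sg by auto
  let ?c = "\<rho>\<^sup>2 * cos (t - u)"
  note s = sq[OF sg sg] sq[OF sg ee(2)] sq[OF ee(2) sg] sq[OF ee(2) ee(2)]
  have c: "cos (u - t) = cos (t - u)" using cos_minus[of "t - u"] by simp
  have cp: "cos (a + pi - b) = - cos (a - b)" "cos (a - (b + pi)) = - cos (a - b)"
     "cos (pi + a - b) = - cos (a - b)" "cos (a - (pi + b)) = - cos (a - b)" for a b :: real
    using cos_periodic_pi[of "a - b"] cos_minus[of "a - b - pi"] by (simp_all add: algebra_simps cos_diff)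
  have D: "(dist p (bar p))\<^sup>2 = 4 * \<rho>\<^sup>2" "(dist w (bar w))\<^sup>2 = 4 * \<rho>\<^sup>2"
    "(dist p w)\<^sup>2 = 2 * \<rho>\<^sup>2 + 4 * h\<^sup>2 - 2 * ?c" "(dist (bar p) (bar w))\<^sup>2 = 2 * \<rho>\<^sup>2 + 4 * h\<^sup>2 - 2 * ?c"
    "(dist p (bar w))\<^sup>2 = 2 * \<rho>\<^sup>2 + 4 * h\<^sup>2 + 2 * ?c" "(dist (bar p) w)\<^sup>2 = 2 * \<rho>\<^sup>2 + 4 * h\<^sup>2 + 2 * ?c"
    unfolding p_def w_def bar_simps s using ee(1) by (simp_all add: cp c algebra_simps)
  have dd: "(dist a b)\<^sup>2 = d\<^sup>2" if "a \<in> V - {x}" "b \<in> V - {x}" "a \<noteq> b" for a b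
    using d[rule_format, of a b] that unfolding x(2) by simp
  have "x = p \<or> x = bar p \<or> x = w \<or> x = bar w" using x(1) V_eq by blast
  hence "4 * \<rho>\<^sup>2 = d\<^sup>2 \<and> 2 * \<rho>\<^sup>2 + 4 * h\<^sup>2 - 2 * ?c = d\<^sup>2 \<and> 2 * \<rho>\<^sup>2 + 4 * h\<^sup>2 + 2 * ?c = d\<^sup>2"
  proof (elim disjE)
    assume "x = p"
    thus ?thesis using dd[of w "bar w"] dd[of "bar p" w] dd[of "bar p" "bar w"] V_distinct D unfolding V_eq by auto
  next
    assume "x = bar p"
    thus ?thesis using dd[of w "bar w"] dd[of p w] dd[of p "bar w"] V_distinct D unfolding V_eq by auto
  next
    assume "x = w"
    thus ?thesis using dd[of p "bar p"] dd[of p "bar w"] dd[of "bar p" "bar w"] V_distinct D unfolding V_eq by auto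
  next
    assume "x = bar w"
    thus ?thesis using dd[of p "bar p"] dd[of p w] dd[of "bar p" w] V_distinct D unfolding V_eq by auto
  qed
  hence c0: "?c = 0" and rh: "\<rho>\<^sup>2 = 2 * h\<^sup>2" by linarith+
  have inner: "p \<bullet> p = 3 * h\<^sup>2" "bar p \<bullet> bar p = 3 * h\<^sup>2" "w \<bullet> w = 3 * h\<^sup>2" "bar w \<bullet> bar w = 3 * h\<^sup>2"
    "p \<bullet> bar p = - h\<^sup>2" "p \<bullet> w = - h\<^sup>2" "p \<bullet> bar w = - h\<^sup>2" "bar p \<bullet> w = - h\<^sup>2" "w \<bullet> bar w = - h\<^sup>2"
    unfolding p_def w_def bar_simps pt_inner using ee(1) c0 by (simp_all add: cp c rh)
  have sum: "bar w = - (p + bar p + w)"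
    unfolding p_def w_def bar_simps unfolding pt_def cyl_def by simp
  have "(cross3 p (bar p)) \<bullet> w \<noteq> 0"
  proof
    have "(cross3 p (bar p)) \<bullet> w = 2 * (sg * h) * (\<rho> * \<rho>) * (sin t * cos u - cos t * sin u)"
      unfolding p_def w_def bar_simps unfolding pt_def cyl_def triple_v3 by (simp add: algebra_simps)
    also have "\<dots> = 2 * (sg * h) * (\<rho> * \<rho>) * (- sin (u - t))" by (simp add: sin_diff)
    finally have e: "(cross3 p (bar p)) \<bullet> w = 2 * (sg * h) * (\<rho> * \<rho>) * (- sin (u - t))" .
    assume "(cross3 p (bar p)) \<bullet> w = 0"
    thus False using e \<rho> h sg not_parallel turns_2_iff by auto
  qed
  then obtain g where g: "orth g" "g p = p" "g (bar p) = w" "g w = bar w"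
    by (rule orth_of_Gram[of p "bar p" w p w "bar w"]) (simp_all only: inner)
  have "g (bar w) = - (g p + g (bar p) + g w)" unfolding sum using orth_minus[OF g(1)] orth_add[OF g(1)] by metis
  also have "\<dots> = bar p" unfolding g(2-4) sum by simp
  finally have "g ` V \<subseteq> V" unfolding V_eq using g(2-4) by simp
  hence "g \<in> Sym" using vertex_isometry_symmetry[OF orth_is_isometry[OF g(1)]] by blast
  then obtain a b \<tau> where m: "a \<in> sgns" "b \<in> sgns" "g = msym a b \<tau>" using sym_msym by metis
  have z: "msym a b \<tau> y $ 3 = a * y $ 3" for y unfolding msym_def by simp
  have h3: "p $ 3 = sg * h" "bar p $ 3 = sg * h" "w $ 3 = - sg * h" unfolding p_def w_def bar_simps unfolding pt_def cyl_def by simp_all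
  have "a * (sg * h) = sg * h" "a * (sg * h) = - sg * h" using z[of p] z[of "bar p"] g(2,3) h3 unfolding m(3) by simp_all
  thus False using h ee(1) by auto
qed

lemma disphenoid: "disphenoid P"
proof -
  have "\<exists>h. isometry h \<and> h ` X f = X g" if f: "f \<in> faces r" and g: "g \<in> faces r" for f g
  proof -
    obtain k where "k \<in> Sym" "k ` X f = X g" using face_transitive[OF f g] by metis
    thus ?thesis using symmetry_group_isometry by blast
  qed
  thus ?thesis unfolding disphenoid_def Let_def using noble cards not_equilateral by blast
qed

text \<open>The two horizontal edges are perpendicular to each other.\<close>
lemma symmetry_group_tetragonal:
  assumes "t = 0" "2 * u \<in> turns 2" shows "Sym = grp_2_star_n 2"
proof -
  have nu: "u \<notin> turns 2" using not_parallel assms(1) by simp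
  have "u - pi / 2 \<in> turns 2"
  proof -
    have "sin (2 * u) = 0" "sin u \<noteq> 0" using assms(2) nu turns_2_iff by auto
    hence "cos u = 0" by (simp add: sin_double)
    thus ?thesis unfolding turns_2_iff by (simp add: sin_diff)
  qed
  hence uu: "x - u \<in> turns 2 \<longleftrightarrow> x - pi / 2 \<in> turns 2" for x
    using turns_add[of "x - u" 2 "u - pi / 2"] turns_diff[of "x - pi / 2" 2 "u - pi / 2"] by auto
  have bu: "b * u + x - u \<in> turns 2 \<longleftrightarrow> x \<in> turns 2" if b: "b \<in> sgns" for b x
  proof -
    have "b * u - u \<in> turns 2" using b turns_neg[OF assms(2)] by auto
    thus ?thesis using turns_add[of x 2 "b * u - u"] turns_diff[of "b * u + x - u" 2 "b * u - u"] by (auto simp: algebra_simps)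
  qed
  have bu': "b * u + x \<in> turns 2 \<longleftrightarrow> x - u \<in> turns 2" if b: "b \<in> sgns" for b x
  proof -
    have "b * u + u \<in> turns 2" using b assms(2) by auto
    thus ?thesis using turns_add[of "x - u" 2 "b * u + u"] turns_diff[of "b * u + x" 2 "b * u + u"] by (auto simp: algebra_simps)
  qed
  have key: "msym a b \<tau> \<in> Sym \<longleftrightarrow> \<tau> - (if a = 1 then 0 else pi / real 2) \<in> turns 2"
    if ab: "a \<in> sgns" "b \<in> sgns" for a b \<tau>
  proof (cases "a = 1")
    case True
    thus ?thesis unfolding symmetry_iff[OF ab] unfolding True offs_simps unfolding assms(1) using bu[OF ab(2), of \<tau>] by auto
  next
    case False
    hence a: "a = -1" using ab by simp
    show ?thesis unfolding symmetry_iff[OF ab] unfolding a offs_simps unfolding assms(1) using bu'[OF ab(2), of \<tau>] uu[of \<tau>] by auto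
  qed
  show ?thesis unfolding grp_2_star_n_eq by (rule symmetry_group_msym_eq) (rule key)
qed

lemma symmetry_group_rhombic:
  assumes "u = - t" "4 * t \<notin> turns 2" shows "Sym = grp_22n 2"
proof -
  have no: "\<not> (x + 2 * t \<in> turns 2 \<and> x - 2 * t \<in> turns 2)" "\<not> (x - 2 * t \<in> turns 2 \<and> x + 2 * t \<in> turns 2)" for x
    using assms(2) turns_diff[of "x + 2 * t" 2 "x - 2 * t"] by (auto simp: algebra_simps)
  have key: "msym a b \<tau> \<in> Sym \<longleftrightarrow> a = b \<and> \<tau> \<in> turns 2" if ab: "a \<in> sgns" "b \<in> sgns" for a b \<tau>
  proof -
    consider "a = 1" "b = 1" | "a = 1" "b = -1" | "a = -1" "b = 1" | "a = -1" "b = -1" using ab by auto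
    thus ?thesis unfolding symmetry_iff[OF ab]
      by cases (simp_all only: offs_simps, use no[of \<tau>] in \<open>simp_all add: assms(1) algebra_simps\<close>)
  qed
  have "Sym = {msym a b \<tau> |a b \<tau>. a \<in> sgns \<and> b \<in> sgns \<and> (a = b \<and> \<tau> \<in> turns 2)}"
    by (rule symmetry_group_msym_eq) (rule key)
  thus ?thesis unfolding grp_22n_eq by auto
qed

end

lemma tetrahedral_turn:
  assumes "tetrahedral_polyhedron P \<rho> h sg t u"
  shows "tetrahedral_polyhedron (transform (msym 1 1 \<sigma>) P) \<rho> h sg (t + \<sigma>) (u + \<sigma>)"
proof -
  interpret tetrahedral_polyhedron P \<rho> h sg t u by (rule assms)
  interpret T: circled_polyhedron "transform (msym 1 1 \<sigma>) P" \<rho> h by (rule circled_transform[OF circled_polyhedron_axioms]) simp_all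
  have m: "msym 1 1 \<sigma> (pt e x) = pt e (x + \<sigma>)" for e x using msym_pt[of 1 1 \<sigma> e x] by simp
  show ?thesis
  proof
    show "sg \<in> sgns" by (rule sg)
    have "points_of (transform (msym 1 1 \<sigma>) P) ` faces r = (`) (msym 1 1 \<sigma>) ` X ` faces r" by (simp add: image_image)
    also have "\<dots> = tetrahedron_faces (pt sg (t + \<sigma>)) (pt (- sg) (u + \<sigma>))"
      unfolding tetrahedron tetrahedron_faces_def bar_simps image_insert image_empty m by (simp only: add.assoc add.commute[of pi \<sigma>])
    finally show "points_of (transform (msym 1 1 \<sigma>) P) ` faces (incidence (transform (msym 1 1 \<sigma>) P))
       = tetrahedron_faces (pt sg (t + \<sigma>)) (pt (- sg) (u + \<sigma>))" by simp
  qed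
qed

text \<open>
  Turn one horizontal edge, or a bisector of the two, into the direction of the first coordinate axis.
\<close>
lemma tetrahedral_prismatic: assumes "tetrahedral_polyhedron P \<rho> h sg t u" shows "prismatic P"
proof -
  interpret tetrahedral_polyhedron P \<rho> h sg t u by (rule assms)
  have iso: "isometry (msym 1 1 \<sigma>)" for \<sigma> using orth_is_isometry[OF msym_orth[of 1 1 \<sigma>]] by simp
  show ?thesis
  proof (cases "2 * (u - t) \<in> turns 2")
    case True
    have "symmetry_group (transform (msym 1 1 (- t)) P) = grp_2_star_n 2"
      by (rule tetrahedral_polyhedron.symmetry_group_tetragonal[OF tetrahedral_turn[OF assms]]) (use True in simp_all)
    thus ?thesis by (rule prismaticI[where n = 2, OF noble iso]) simp_all
  next
    case False
    have "symmetry_group (transform (msym 1 1 (- ((t + u) / 2))) P) = grp_22n 2"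
    proof (rule tetrahedral_polyhedron.symmetry_group_rhombic[OF tetrahedral_turn[OF assms]])
      show "u + - ((t + u) / 2) = - (t + - ((t + u) / 2))" by (simp add: field_simps)
      have "4 * (t + - ((t + u) / 2)) = - (2 * (u - t))" by (simp add: field_simps)
      thus "4 * (t + - ((t + u) / 2)) \<notin> turns 2"
        using False turns_neg[of "- (2 * (u - t))" 2] by (simp only: minus_minus) blast
    qed
    thus ?thesis by (rule prismaticI[where n = 2, OF noble iso]) simp_all
  qed
qed

section \<open>The classification\<close>

lemma axial_classification:
  assumes "axial_polyhedron P" shows "prismatic P \<and> (stephanoid P \<or> disphenoid P)"
proof -
  interpret axial_polyhedron P by (rule assms)
  obtain \<rho> h where c: "\<rho> > 0" "h > 0" "\<And>x. x \<in> geom_vertices P \<Longrightarrow> \<exists>sg\<in>sgns. \<exists>t. x = cyl \<rho> (sg * h) t"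
    using vertices_on_circles by metis
  interpret circled_polyhedron P \<rho> h by unfold_locales (use c in auto)
  show ?thesis
  proof (cases rule: faces_tetrahedral_or_lateral)
    case (tetrahedron sg t u)
    hence T: "tetrahedral_polyhedron P \<rho> h sg t u" by unfold_locales
    show ?thesis using tetrahedral_prismatic[OF T] tetrahedral_polyhedron.disphenoid[OF T] by blast
  next
    case (lateral \<alpha> \<gamma>)
    hence "quad_polyhedron P \<rho> h \<alpha> \<gamma>" by unfold_locales
    thus ?thesis using quad_stephanoid by blast
  qed
qed

lemma equilateral_image: assumes "isometry s" "equilateral A" shows "equilateral (s ` A)"
proof -
  obtain d where d: "\<forall>x\<in>A. \<forall>y\<in>A. x \<noteq> y \<longrightarrow> dist x y = d" using assms(2) unfolding equilateral_def ..
  have "\<forall>x\<in>s ` A. \<forall>y\<in>s ` A. x \<noteq> y \<longrightarrow> dist x y = d"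
    using d assms(1) unfolding isometry_def by fastforce
  thus ?thesis unfolding equilateral_def ..
qed

lemma disphenoid_transform: assumes s: "isometry s" and d: "disphenoid P" shows "disphenoid (transform s P)"
proof -
  have inv: "ginv s ` s ` A = A" for A using isometry_inj[OF s] by (simp add: image_image)
  have card: "card (s ` A) = card A" for A using isometry_inj[OF s] by (meson card_image inj_on_subset subset_UNIV)
  have eq: "\<not> equilateral (s ` A)" if "\<not> equilateral A" for A
    using equilateral_image[OF isometry_inv[OF s], of "s ` A"] inv that by auto
  have ex: "\<exists>h. isometry h \<and> h ` s ` A = s ` B" if AB: "\<exists>h. isometry h \<and> h ` A = B" for A B
  proof -
    obtain h where h: "isometry h" "h ` A = B" using AB by blast
    have "(s \<circ> h \<circ> ginv s) ` s ` A = s ` B" unfolding h(2)[symmetric] using inv[of A] by (simp only: image_comp[symmetric])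
    moreover have "isometry (s \<circ> h \<circ> ginv s)" by (intro isometry_comp isometry_inv s h(1))
    ultimately show ?thesis by (intro exI conjI)
  qed
  have "noble P" using d unfolding disphenoid_def Let_def by (rule conjunct1)
  show ?thesis unfolding disphenoid_def Let_def transform_simps card
  proof (intro conjI ballI)
    show "noble (transform s P)" by (rule noble_transform[OF s \<open>noble P\<close>])
    show "card (vertices (incidence P)) = 4" "card (faces (incidence P)) = 4" using d unfolding disphenoid_def Let_def by iprover+
    fix f assume f: "f \<in> faces (incidence P)"
    show "card (points_of P f) = 3" using d f unfolding disphenoid_def Let_def by simp
    have "\<not> equilateral (points_of P f)" using d f unfolding disphenoid_def Let_def by simp
    thus "\<not> equilateral (s ` points_of P f)" by (rule eq)
    fix g assume g: "g \<in> faces (incidence P)"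
    have "\<exists>h. isometry h \<and> h ` points_of P f = points_of P g" using d f g unfolding disphenoid_def Let_def by blast
    thus "\<exists>h. isometry h \<and> h ` s ` points_of P f = s ` points_of P g" by (rule ex)
  qed
qed

text \<open>
  A rotation of order three that permutes the vertices of a tetrahedron turns one of its faces.
\<close>
lemma disphenoid_no_order_3:
  assumes d: "disphenoid P" and g: "g \<in> symmetry_group P" "\<And>x. g (g (g x)) = x" shows "g = id"
proof (rule ccontr)
  interpret noble_polyhedron P using d by (intro noble_polyhedronI) (simp add: disphenoid_def Let_def)
  let ?V = "geom_vertices P"
  have V4: "card ?V = 4" and F4: "card (faces r) = 4" and f3: "\<And>f. f \<in> faces r \<Longrightarrow> card (X f) = 3"
    and ne: "\<And>f. f \<in> faces r \<Longrightarrow> \<not> equilateral (X f)"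
    using d card_image[OF nondeg(1)] unfolding disphenoid_def Let_def geom_vertices_def by auto
  have "X ` faces r = {A. A \<subseteq> ?V \<and> card A = 3}"
  proof (rule card_subset_eq)
    show "finite {A. A \<subseteq> ?V \<and> card A = 3}" using finite_V by simp
    show "X ` faces r \<subseteq> {A. A \<subseteq> ?V \<and> card A = 3}" using f3 points_sub by auto
    have "card (X ` faces r) = card (faces r)" by (rule card_image) (use face_inj in \<open>auto simp: inj_on_def\<close>)
    thus "card (X ` faces r) = card {A. A \<subseteq> ?V \<and> card A = 3}"
      unfolding n_subsets[OF finite_V] V4 F4 by (simp add: numeral_eq_Suc)
  qed
  note all = this
  assume "g \<noteq> id"
  then obtain x where x: "x \<in> ?V" "g x \<noteq> x" using symmetry_group_eqI[OF g(1) symmetry_group_id] by auto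
  have iso: "isometry g" using symmetry_group_isometry g(1) by blast
  have in_V: "g x \<in> ?V" "g (g x) \<in> ?V" using symmetry_group_vertices[OF g(1)] x(1) by blast+
  have n: "g (g x) \<noteq> g x" "g (g x) \<noteq> x"
    using x(2) g(2)[of x] isometry_inj[OF iso] by (auto simp: inj_eq)
  have "card {x, g x, g (g x)} = 3" using n x(2) by (auto simp: card_insert_if)
  hence "{x, g x, g (g x)} \<in> X ` faces r" unfolding all using x(1) in_V by blast
  then obtain f where f: "f \<in> faces r" "X f = {x, g x, g (g x)}" by auto
  have "dist (g x) (g (g x)) = dist x (g x)" "dist (g (g x)) x = dist (g x) (g (g x))"
    using iso g(2)[of x] unfolding isometry_def by metis+
  hence "\<forall>a\<in>X f. \<forall>b\<in>X f. a \<noteq> b \<longrightarrow> dist a b = dist x (g x)" unfolding f(2) by (auto simp: dist_commute)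
  thus False using ne[OF f(1)] unfolding equilateral_def by blast
qed

lemma axial_placement:
  assumes P: "noble P" and s: "isometry s" and ax: "axial_polyhedron (transform s P)"
  shows "prismatic P \<and> (stephanoid P \<or> disphenoid P)"
proof -
  have c: "prismatic (transform s P)" "stephanoid (transform s P) \<or> disphenoid (transform s P)"
    using axial_classification[OF ax] by auto
  have p: "prismatic P" by (rule prismatic_transform[OF P s c(1)])
  have "disphenoid P" if "disphenoid (transform s P)"
    using disphenoid_transform[OF isometry_inv[OF s] that] unfolding transform_inverse[OF s] .
  thus ?thesis using c(2) p stephanoid_transform[OF P p s] by blast
qed

lemma noble_cases:
  assumes P: "noble (P :: 'a realized)"
  obtains (axial) "prismatic P" "stephanoid P \<or> disphenoid P"
  | (nonprismatic) t M N where "isometry t" "(M, N) \<in> nonprismatic_groups" "symmetry_group (transform t P) = N"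
  using P
proof (cases rule: noble_axial_or_nonprismatic)
  case (axial t)
  interpret noble_polyhedron "transform t P" by (rule noble_polyhedronI[OF noble_transform[OF axial(1) P]])
  have "axial_polyhedron (transform t P)" by unfold_locales (use axial(2,3) in auto)
  thus thesis using that(1) axial_placement[OF P axial(1)] by blast
next
  case (nonprismatic t M N) thus thesis using that(2) by blast
qed

lemma prismatic_classified: assumes P: "noble P" "prismatic P" shows "stephanoid P \<or> disphenoid P"
proof -
  obtain s where s: "isometry s" "\<And>g. g \<in> symmetry_group (transform s P) \<Longrightarrow> is_msym g"
    by (metis prismatic_axial[OF P])
  have "axial_polyhedron (transform s P)" by (rule axial_polyhedronI[OF noble_transform[OF s(1) P(1)] s(2)])
  thus ?thesis using axial_placement[OF P(1) s(1)] by blast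
qed

lemma disphenoid_prismatic: assumes d: "disphenoid P" shows "prismatic P"
proof -
  have P: "noble P" using d by (simp add: disphenoid_def Let_def)
  show ?thesis using P
  proof (cases rule: noble_cases)
    case (nonprismatic t M N)
    obtain g where "g \<in> N" "g \<noteq> id" "\<And>x. g (g (g x)) = x" using nonprismatic_order_3[OF nonprismatic(2)] by metis
    thus ?thesis using disphenoid_no_order_3[OF disphenoid_transform[OF nonprismatic(1) d]] nonprismatic(3) by blast
  qed
qed

theorem theorem1p1:
  shows "(\<forall>P :: 'a realized. noble P \<longrightarrow> (prismatic P \<longleftrightarrow> stephanoid P \<or> disphenoid P)) \<and>
         finite ({P :: 'a realized. noble P \<and> \<not> stephanoid P \<and> \<not> disphenoid P} //
                 canonical_equivalence)"
proof
  show "\<forall>P :: 'a realized. noble P \<longrightarrow> (prismatic P \<longleftrightarrow> stephanoid P \<or> disphenoid P)"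
    using prismatic_classified disphenoid_prismatic stephanoid_def by blast
  show "finite ({P :: 'a realized. noble P \<and> \<not> stephanoid P \<and> \<not> disphenoid P} // canonical_equivalence)"
  proof (rule finite_nonprismatic_quotient)
    fix P :: "'a realized" assume "P \<in> {P. noble P \<and> \<not> stephanoid P \<and> \<not> disphenoid P}"
    hence P: "noble P" "\<not> stephanoid P" "\<not> disphenoid P" by auto
    show "noble P \<and> (\<exists>s M N C c. in_normal_form P s M N C c)" using P(1)
    proof (cases rule: noble_cases)
      case axial thus ?thesis using P by blast
    next
      case (nonprismatic t M N)
      thus ?thesis using normal_form_exists[OF P(1)] P(1) by blast
    qed
  qed
qed

end
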